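(* Let $K$ be a field, $A=KQ/I$ a finite-dimensional $K$-algebra given by a finite quiver $Q$ and an admissible ideal $I$, and let $k$ be a vertex of $Q$ without loops. Let $T^-_k$ be the complex and $T^{\mathrm{BB}}_k$ the module defined in the context. (a) If the BB-tilting module is defined at $k$, then $T^-_k$ is a tilting complex and $T^{\mathrm{BB}}_k\simeq T^-_k$ in $\mathcal{D}^b(A)$. (b) Conversely, if $T^-_k$ is isomorphic in $\mathcal{D}^b(A)$ to a tilting module, then the BB-tilting module is defined at $k$ and $T^-_k\simeq T^{\mathrm{BB}}_k$ in $\mathcal{D}^b(A)$.
   Context: For an arrow $\alpha$ of $Q$, $s(\alpha)$ and $t(\alpha)$ denote its start and end vertices; paths compose left to right, i.e. $\alpha\beta$ is defined if $t(\alpha)=s(\beta)$. Modules are finite-dimensional right $A$-modules, and $\mathcal{D}^b(A)$ is the bounded derived category of $\operatorname{mod} A$. For a vertex $i$, $S_i$ is the simple module at $i$ and $P_i$ its projective cover, spanned by the (non-zero) paths starting at $i$. An arrow $\alpha$ induces a map $P_{t(\alpha)}\xrightarrow{\alpha}P_{s(\alpha)}$ (left multiplication by $\alpha$). $\tau$ is the Auslander-Reiten translation in $\operatorname{mod}A$. $L_k$ is the two-term complex $P_k\xrightarrow{f}\bigoplus_{\alpha:\,t(\alpha)=k}P_{s(\alpha)}$ with $P_k$ in degree $-1$, where $f$ is induced by all arrows $\alpha$ ending at $k$; and $T^-_k=L_k\oplus\bigoplus_{i\neq k}P_i$. The BB-tilting module is said to be defined at $k$ if $T^{\mathrm{BB}}_k=\tau^{-1}S_k\oplus\bigoplus_{i\neq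 k}P_i$ is a tilting module of projective dimension at most $1$. A tilting complex is a bounded complex $T$ of finitely generated projective modules with $\operatorname{Hom}_{\mathcal{D}^b(A)}(T,T[r])=0$ for all $r\neq 0$ whose direct summands generate the category $\operatorname{per}A$ of perfect complexes as a triangulated category. A tilting module is a module which, viewed as a complex concentrated in degree $0$, is isomorphic in $\mathcal{D}^b(A)$ to a tilting complex. *)

theory Defs
  imports "Graph_Theory.Arc_Walk" "HOL-Algebra.Module" "HOL-Algebra.QuotRing"
    "HOL-Algebra.Ideal_Product"
begin

section \<open>Bound quiver algebras\<close>

text \<open>
  A \<open>K\<close>-algebra is a record of type \<^typ>\<open>('k, 'a) module\<close>: the ring fields are those of the algebra and
  \<^const>\<open>smult\<close> is the multiplication by scalars from the field type \<^typ>\<open>'k\<close>.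

  A quiver is a multi-digraph; \<^const>\<open>tail\<close> and \<^const>\<open>head\<close> are the start and end of an arrow.
  The path \<open>\<alpha>\<^sub>1\<dots>\<alpha>\<^sub>n\<close> starting at \<open>u\<close> is the pair \<open>(u, [\<alpha>\<^sub>1, \<dots>, \<alpha>\<^sub>n])\<close>, and \<open>(u, [])\<close> is the trivial path
  at \<open>u\<close>; paths compose left to right.
\<close>

type_synonym ('v, 'e) qpath = "'v \<times> 'e list"

definition qpaths :: "('v, 'e) pre_digraph \<Rightarrow> ('v, 'e) qpath set" where
  "qpaths Q = {(u, p). \<exists>v. pre_digraph.awalk Q u p v}"

definition path_algebra :: "('v, 'e) pre_digraph \<Rightarrow> ('k::field, ('v, 'e) qpath \<Rightarrow> 'k) module" where
  "path_algebra Q =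
    \<lparr>carrier = {x. finite {w. x w \<noteq> 0} \<and> {w. x w \<noteq> 0} \<subseteq> qpaths Q},
     mult = (\<lambda>x y (u, p). \<Sum>i\<le>length p.
       x (u, take i p) * y (pre_digraph.awlast Q u (take i p), drop i p)),
     one = (\<lambda>(u, p). if u \<in> verts Q \<and> p = [] then 1 else 0),
     zero = (\<lambda>_. 0),
     add = (\<lambda>x y w. x w + y w),
     smult = (\<lambda>c x w. c * x w)\<rparr>"

definition path_elt :: "('v, 'e) qpath \<Rightarrow> ('v, 'e) qpath \<Rightarrow> 'k::field" where
  "path_elt w = (\<lambda>w'. if w' = w then 1 else 0)"

definition arrow_ideal :: "('v, 'e) pre_digraph \<Rightarrow> (('v, 'e) qpath \<Rightarrow> 'k::field) set" where
  "arrow_ideal Q =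
    genideal (path_algebra Q) ((\<lambda>\<alpha>. path_elt (tail Q \<alpha>, [\<alpha>])) ` arcs Q)"

definition admissible :: "('v, 'e) pre_digraph \<Rightarrow> (('v, 'e) qpath \<Rightarrow> 'k::field) set \<Rightarrow> bool" where
  "admissible Q I \<longleftrightarrow> ideal I (path_algebra Q) \<and>
    (\<exists>m\<ge>2. arrow_ideal Q [^]\<^bsub>ideals_set (path_algebra Q)\<^esub> (m::nat) \<subseteq> I) \<and>
    I \<subseteq> arrow_ideal Q [^]\<^bsub>ideals_set (path_algebra Q)\<^esub> (2::nat)"

definition quot_algebra :: "('k, 'a) module \<Rightarrow> 'a set \<Rightarrow> ('k, 'a set) module" where
  "quot_algebra R I =
    ring.extend (R Quot I) (module.fields (\<lambda>c C. I <+>\<^bsub>R\<^esub> (smult R c ` C)))"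

definition bq_algebra ::
  "('v, 'e) pre_digraph \<Rightarrow> (('v, 'e) qpath \<Rightarrow> 'k::field) set \<Rightarrow>
    ('k, (('v, 'e) qpath \<Rightarrow> 'k) set) module" where
  "bq_algebra Q I = quot_algebra (path_algebra Q) I"

definition bq_path ::
  "('v, 'e) pre_digraph \<Rightarrow> (('v, 'e) qpath \<Rightarrow> 'k::field) set \<Rightarrow> ('v, 'e) qpath \<Rightarrow>
    (('v, 'e) qpath \<Rightarrow> 'k) set" where
  "bq_path Q I w = I +>\<^bsub>path_algebra Q\<^esub> path_elt w"

definition opp :: "('k, 'a) module \<Rightarrow> ('k, 'a) module" where
  "opp A = A\<lparr>mult := (\<lambda>x y. y \<otimes>\<^bsub>A\<^esub> x)\<rparr>"

lemma opp_opp [simp]: "opp (opp A) = A"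
  by (simp add: opp_def)


section \<open>Right modules\<close>

text \<open>
  Right \<open>A\<close>-modules are records of type \<^typ>\<open>('a, 'm) module\<close>, where \<^term>\<open>a \<odot>\<^bsub>M\<^esub> x\<close> stands for
  \<open>x \<cdot> a\<close>. The fields \<^const>\<open>mult\<close> and \<^const>\<open>one\<close> are irrelevant for modules.
\<close>

definition right_module :: "('k, 'a) module \<Rightarrow> ('a, 'm) module \<Rightarrow> bool" where
  "right_module A M \<longleftrightarrow> abelian_group M \<and>
    (\<forall>a\<in>carrier A. \<forall>x\<in>carrier M. a \<odot>\<^bsub>M\<^esub> x \<in> carrier M) \<and>
    (\<forall>a\<in>carrier A. \<forall>x\<in>carrier M. \<forall>y\<in>carrier M.
      a \<odot>\<^bsub>M\<^esub> (x \<oplus>\<^bsub>M\<^esub> y) = a \<odot>\<^bsub>M\<^esub> x \<oplus>\<^bsub>M\<^esub> a \<odot>\<^bsub>M\<^esub> y) \<and>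
    (\<forall>a\<in>carrier A. \<forall>b\<in>carrier A. \<forall>x\<in>carrier M.
      (a \<oplus>\<^bsub>A\<^esub> b) \<odot>\<^bsub>M\<^esub> x = a \<odot>\<^bsub>M\<^esub> x \<oplus>\<^bsub>M\<^esub> b \<odot>\<^bsub>M\<^esub> x) \<and>
    (\<forall>a\<in>carrier A. \<forall>b\<in>carrier A. \<forall>x\<in>carrier M.
      (a \<otimes>\<^bsub>A\<^esub> b) \<odot>\<^bsub>M\<^esub> x = b \<odot>\<^bsub>M\<^esub> (a \<odot>\<^bsub>M\<^esub> x)) \<and>
    (\<forall>x\<in>carrier M. \<one>\<^bsub>A\<^esub> \<odot>\<^bsub>M\<^esub> x = x)"

text \<open>The ground field acts on a module through the scalar multiples of \<open>1\<close>.\<close>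

definition scal :: "('k, 'a) module \<Rightarrow> ('a, 'm) module \<Rightarrow> 'k \<Rightarrow> 'm \<Rightarrow> 'm" where
  "scal A M c x = (c \<odot>\<^bsub>A\<^esub> \<one>\<^bsub>A\<^esub>) \<odot>\<^bsub>M\<^esub> x"

definition fd_module :: "('k, 'a) module \<Rightarrow> ('a, 'm) module \<Rightarrow> bool" where
  "fd_module A M \<longleftrightarrow> right_module A M \<and>
    (\<exists>B. finite B \<and> B \<subseteq> carrier M \<and>
      (\<forall>x\<in>carrier M. \<exists>c. x = (\<Oplus>\<^bsub>M\<^esub>b\<in>B. scal A M (c b) b)))"

definition rmod_hom ::
  "('k, 'a) module \<Rightarrow> ('a, 'm) module \<Rightarrow> ('a, 'n) module \<Rightarrow> ('m \<Rightarrow> 'n) set" where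
  "rmod_hom A M N = {f. f \<in> carrier M \<rightarrow> carrier N \<and>
    (\<forall>x\<in>carrier M. \<forall>y\<in>carrier M. f (x \<oplus>\<^bsub>M\<^esub> y) = f x \<oplus>\<^bsub>N\<^esub> f y) \<and>
    (\<forall>a\<in>carrier A. \<forall>x\<in>carrier M. f (a \<odot>\<^bsub>M\<^esub> x) = a \<odot>\<^bsub>N\<^esub> f x)}"

definition rmod_iso :: "('k, 'a) module \<Rightarrow> ('a, 'm) module \<Rightarrow> ('a, 'n) module \<Rightarrow> bool" where
  "rmod_iso A M N \<longleftrightarrow> (\<exists>f\<in>rmod_hom A M N. bij_betw f (carrier M) (carrier N))"

definition submod :: "('k, 'a) module \<Rightarrow> 'm set \<Rightarrow> ('a, 'm) module \<Rightarrow> bool" where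
  "submod A L M \<longleftrightarrow> L \<subseteq> carrier M \<and> right_module A (M\<lparr>carrier := L\<rparr>)"

definition quot_module :: "('a, 'm) module \<Rightarrow> 'm set \<Rightarrow> ('a, 'm set) module" where
  "quot_module M L =
    \<lparr>carrier = a_rcosets\<^bsub>M\<^esub> L, mult = undefined, one = undefined, zero = L, add = set_add M,
     smult = (\<lambda>a C. L <+>\<^bsub>M\<^esub> (smult M a ` C))\<rparr>"

definition fg_projective :: "('k, 'a) module \<Rightarrow> ('a, 'm) module \<Rightarrow> bool" where
  "fg_projective A P \<longleftrightarrow> fd_module A P \<and>
    (\<forall>(M :: ('a, 'm) module) (N :: ('a, 'm) module) g h.
      fd_module A M \<and> fd_module A N \<and>
      g \<in> rmod_hom A M N \<and> g ` carrier M = carrier N \<and> h \<in> rmod_hom A P N \<longrightarrow>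
      (\<exists>l\<in>rmod_hom A P M. \<forall>x\<in>carrier P. g (l x) = h x))"

definition superfluous :: "('k, 'a) module \<Rightarrow> 'm set \<Rightarrow> ('a, 'm) module \<Rightarrow> bool" where
  "superfluous A N M \<longleftrightarrow> submod A N M \<and>
    (\<forall>L. submod A L M \<and> L <+>\<^bsub>M\<^esub> N = carrier M \<longrightarrow> L = carrier M)"

definition projective_cover ::
  "('k, 'a) module \<Rightarrow> ('a, 'm) module \<Rightarrow> ('m \<Rightarrow> 'n) \<Rightarrow> ('a, 'n) module \<Rightarrow> bool" where
  "projective_cover A P p M \<longleftrightarrow> fg_projective A P \<and>
    p \<in> rmod_hom A P M \<and> p ` carrier P = carrier M \<and> superfluous A (a_kernel P M p) P"


section \<open>The inverse Auslander--Reiten translation\<close>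

text \<open>
  \<open>D M = Hom\<^sub>K(M, K)\<close> and \<open>Hom\<^sub>A(M, A)\<close> are left \<open>A\<close>-modules, i.e. right modules over \<^term>\<open>opp A\<close>.
\<close>

definition kdual :: "('k::field, 'a) module \<Rightarrow> ('a, 'm) module \<Rightarrow> ('a, 'm \<Rightarrow> 'k) module" where
  "kdual A M =
    \<lparr>carrier = {\<phi> \<in> extensional (carrier M).
       (\<forall>x\<in>carrier M. \<forall>y\<in>carrier M. \<phi> (x \<oplus>\<^bsub>M\<^esub> y) = \<phi> x + \<phi> y) \<and>
       (\<forall>c. \<forall>x\<in>carrier M. \<phi> (scal A M c x) = c * \<phi> x)},
     mult = undefined, one = undefined,
     zero = (\<lambda>x\<in>carrier M. 0),
     add = (\<lambda>\<phi> \<psi>. \<lambda>x\<in>carrier M. \<phi> x + \<psi> x),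
     smult = (\<lambda>a \<phi>. \<lambda>x\<in>carrier M. \<phi> (a \<odot>\<^bsub>M\<^esub> x))\<rparr>"

definition regular :: "('k, 'a) module \<Rightarrow> ('a, 'a) module" where
  "regular A =
    \<lparr>carrier = carrier A, mult = undefined, one = undefined, zero = \<zero>\<^bsub>A\<^esub>, add = add A,
     smult = (\<lambda>a x. x \<otimes>\<^bsub>A\<^esub> a)\<rparr>"

definition adual :: "('k, 'a) module \<Rightarrow> ('a, 'm) module \<Rightarrow> ('a, 'm \<Rightarrow> 'a) module" where
  "adual A M =
    \<lparr>carrier = rmod_hom A M (regular A) \<inter> extensional (carrier M),
     mult = undefined, one = undefined,
     zero = (\<lambda>x\<in>carrier M. \<zero>\<^bsub>A\<^esub>),
     add = (\<lambda>f g. \<lambda>x\<in>carrier M. f x \<oplus>\<^bsub>A\<^esub> g x),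
     smult = (\<lambda>a f. \<lambda>x\<in>carrier M. a \<otimes>\<^bsub>A\<^esub> f x)\<rparr>"

text \<open>\<open>P\<^sub>1 \<rightarrow> P\<^sub>0 \<rightarrow> M \<rightarrow> 0\<close> is a minimal projective presentation.\<close>

definition min_presentation ::
  "('k, 'a) module \<Rightarrow> ('a, 'm) module \<Rightarrow> ('m \<Rightarrow> 'm) \<Rightarrow> ('a, 'm) module \<Rightarrow> ('m \<Rightarrow> 'n) \<Rightarrow>
    ('a, 'n) module \<Rightarrow> bool" where
  "min_presentation A P1 p1 P0 p0 M \<longleftrightarrow>
    projective_cover A P0 p0 M \<and>
    projective_cover A P1 p1 (P0\<lparr>carrier := a_kernel P0 M p0\<rparr>)"

text \<open>\<open>Tr M\<close> is the cokernel of \<open>Hom\<^sub>A(P\<^sub>0, A) \<rightarrow> Hom\<^sub>A(P\<^sub>1, A)\<close>.\<close>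

definition is_transpose ::
  "('k, 'a) module \<Rightarrow> ('a, 'n) module \<Rightarrow> ('a, 'm) module \<Rightarrow> bool" where
  "is_transpose A M N \<longleftrightarrow> fd_module (opp A) N \<and>
    (\<exists>(P1 :: ('a, 'm) module) p1 (P0 :: ('a, 'm) module) p0.
      min_presentation A P1 p1 P0 p0 M \<and>
      rmod_iso (opp A) N
        (quot_module (adual A P1)
          ((\<lambda>f. \<lambda>x\<in>carrier P1. f (p1 x)) ` carrier (adual A P0))))"

text \<open>\<open>\<tau>\<^sup>-\<^sup>1 = Tr D\<close>, determined up to isomorphism.\<close>

definition tau_inv :: "('k::field, 'a) module \<Rightarrow> ('a, 'n) module \<Rightarrow> ('a, 'm) module" where
  "tau_inv A M = (SOME N. is_transpose (opp A) (kdual A M) N)"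


section \<open>A carrier type closed under finite direct sums\<close>

text \<open>
  The type \<^term>\<open>elt\<close> contains the elements of the algebra and is closed under forming pairs and
  families. Every finite-dimensional module over an algebra on \<^typ>\<open>'a\<close> is therefore
  isomorphic to one with carrier in this type, so the modules with such carriers form (an
  equivalent copy of) the category \<open>mod A\<close>.
\<close>

datatype ('a, 'i) elt =
    Elem (the_elem_of: 'a)
  | Two (first: "('a, 'i) elt") (second: "('a, 'i) elt")
  | Fam (component: "'i \<Rightarrow> ('a, 'i) elt")

type_synonym ('a, 'i) emodule = "('a, ('a, 'i) elt) module"

definition dsum2 :: "('a, 'i) emodule \<Rightarrow> ('a, 'i) emodule \<Rightarrow> ('a, 'i) emodule" where
  "dsum2 M N =
    \<lparr>carrier = {Two x y | x y. x \<in> carrier M \<and> y \<in> carrier N},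
     mult = undefined, one = undefined, zero = Two \<zero>\<^bsub>M\<^esub> \<zero>\<^bsub>N\<^esub>,
     add = (\<lambda>z w. Two (first z \<oplus>\<^bsub>M\<^esub> first w) (second z \<oplus>\<^bsub>N\<^esub> second w)),
     smult = (\<lambda>a z. Two (a \<odot>\<^bsub>M\<^esub> first z) (a \<odot>\<^bsub>N\<^esub> second z))\<rparr>"

definition dsum :: "'i set \<Rightarrow> ('i \<Rightarrow> ('a, 'i) emodule) \<Rightarrow> ('a, 'i) emodule" where
  "dsum J M =
    \<lparr>carrier = Fam ` (\<Pi>\<^sub>E j\<in>J. carrier (M j)),
     mult = undefined, one = undefined, zero = Fam (\<lambda>j\<in>J. \<zero>\<^bsub>M j\<^esub>),
     add = (\<lambda>z w. Fam (\<lambda>j\<in>J. component z j \<oplus>\<^bsub>M j\<^esub> component w j)),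
     smult = (\<lambda>a z. Fam (\<lambda>j\<in>J. a \<odot>\<^bsub>M j\<^esub> component z j))\<rparr>"


section \<open>Complexes and the bounded derived category\<close>

text \<open>Complexes are cohomological: \<open>dif X n\<close> maps \<open>obj X n\<close> to \<open>obj X (n + 1)\<close>.\<close>

record ('a, 'm) cpx =
  obj :: "int \<Rightarrow> ('a, 'm) module"
  dif :: "int \<Rightarrow> 'm \<Rightarrow> 'm"

definition bounded_cpx :: "('k, 'a) module \<Rightarrow> ('a, 'm) cpx \<Rightarrow> bool" where
  "bounded_cpx A X \<longleftrightarrow>
    (\<forall>n. fd_module A (obj X n) \<and> dif X n \<in> rmod_hom A (obj X n) (obj X (n + 1)) \<and>
      (\<forall>x\<in>carrier (obj X n). dif X (n + 1) (dif X n x) = \<zero>\<^bsub>obj X (n + 1 + 1)\<^esub>)) \<and>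
    (\<exists>b. \<forall>n. \<bar>n\<bar> > b \<longrightarrow> carrier (obj X n) = {\<zero>\<^bsub>obj X n\<^esub>})"

definition chain_map ::
  "('k, 'a) module \<Rightarrow> ('a, 'm) cpx \<Rightarrow> ('a, 'm) cpx \<Rightarrow> (int \<Rightarrow> 'm \<Rightarrow> 'm) \<Rightarrow> bool" where
  "chain_map A X Y f \<longleftrightarrow>
    (\<forall>n. f n \<in> rmod_hom A (obj X n) (obj Y n) \<and>
      (\<forall>x\<in>carrier (obj X n). f (n + 1) (dif X n x) = dif Y n (f n x)))"

definition chain_comp :: "(int \<Rightarrow> 'm \<Rightarrow> 'm) \<Rightarrow> (int \<Rightarrow> 'm \<Rightarrow> 'm) \<Rightarrow> int \<Rightarrow> 'm \<Rightarrow> 'm" where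
  "chain_comp g f = (\<lambda>n. g n \<circ> f n)"

definition homotopic ::
  "('k, 'a) module \<Rightarrow> ('a, 'm) cpx \<Rightarrow> ('a, 'm) cpx \<Rightarrow>
    (int \<Rightarrow> 'm \<Rightarrow> 'm) \<Rightarrow> (int \<Rightarrow> 'm \<Rightarrow> 'm) \<Rightarrow> bool" where
  "homotopic A X Y f g \<longleftrightarrow>
    (\<exists>h. \<forall>n. h n \<in> rmod_hom A (obj X n) (obj Y (n - 1)) \<and>
      (\<forall>x\<in>carrier (obj X n).
        f n x \<ominus>\<^bsub>obj Y n\<^esub> g n x = dif Y (n - 1) (h n x) \<oplus>\<^bsub>obj Y n\<^esub> h (n + 1) (dif X n x)))"

definition cocycles :: "('a, 'm) cpx \<Rightarrow> int \<Rightarrow> 'm set" where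
  "cocycles X n = a_kernel (obj X n) (obj X (n + 1)) (dif X n)"

definition coboundaries :: "('a, 'm) cpx \<Rightarrow> int \<Rightarrow> 'm set" where
  "coboundaries X n = dif X (n - 1) ` carrier (obj X (n - 1))"

definition cohomology :: "('a, 'm) cpx \<Rightarrow> int \<Rightarrow> ('a, 'm set) module" where
  "cohomology X n = quot_module ((obj X n)\<lparr>carrier := cocycles X n\<rparr>) (coboundaries X n)"

definition cohomology_map ::
  "('a, 'm) cpx \<Rightarrow> (int \<Rightarrow> 'm \<Rightarrow> 'm) \<Rightarrow> int \<Rightarrow> 'm set \<Rightarrow> 'm set" where
  "cohomology_map Y f n C = coboundaries Y n <+>\<^bsub>obj Y n\<^esub> (f n ` C)"

definition quasi_iso ::
  "('k, 'a) module \<Rightarrow> ('a, 'm) cpx \<Rightarrow> ('a, 'm) cpx \<Rightarrow> (int \<Rightarrow> 'm \<Rightarrow> 'm) \<Rightarrow> bool" where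
  "quasi_iso A X Y f \<longleftrightarrow> chain_map A X Y f \<and>
    (\<forall>n. bij_betw (cohomology_map Y f n) (carrier (cohomology X n)) (carrier (cohomology Y n)))"

text \<open>
  The bounded derived category is the localisation of the homotopy category of bounded
  complexes at the quasi-isomorphisms: a morphism \<open>X \<rightarrow> Y\<close> is a class of roofs
  \<open>X \<leftarrow> Z \<rightarrow> Y\<close> whose left leg \<open>s\<close> is a quasi-isomorphism.
\<close>

type_synonym ('a, 'm) roof = "('a, 'm) cpx \<times> (int \<Rightarrow> 'm \<Rightarrow> 'm) \<times> (int \<Rightarrow> 'm \<Rightarrow> 'm)"

definition roofs ::
  "('k, 'a) module \<Rightarrow> ('a, 'm) cpx \<Rightarrow> ('a, 'm) cpx \<Rightarrow> ('a, 'm) roof set" where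
  "roofs A X Y = {(Z, s, f). bounded_cpx A Z \<and> quasi_iso A Z X s \<and> chain_map A Z Y f}"

definition roof_rel ::
  "('k, 'a) module \<Rightarrow> ('a, 'm) cpx \<Rightarrow> ('a, 'm) cpx \<Rightarrow> (('a, 'm) roof \<times> ('a, 'm) roof) set" where
  "roof_rel A X Y = {((Z, s, f), (Z', s', f')).
    (Z, s, f) \<in> roofs A X Y \<and> (Z', s', f') \<in> roofs A X Y \<and>
    (\<exists>W g g'. bounded_cpx A W \<and> chain_map A W Z g \<and> chain_map A W Z' g' \<and>
      quasi_iso A W X (chain_comp s g) \<and>
      homotopic A W X (chain_comp s g) (chain_comp s' g') \<and>
      homotopic A W Y (chain_comp f g) (chain_comp f' g'))}"

definition derived_hom ::
  "('k, 'a) module \<Rightarrow> ('a, 'm) cpx \<Rightarrow> ('a, 'm) cpx \<Rightarrow> ('a, 'm) roof set set" where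
  "derived_hom A X Y = roofs A X Y // roof_rel A X Y"

definition derived_of ::
  "('k, 'a) module \<Rightarrow> ('a, 'm) cpx \<Rightarrow> ('a, 'm) cpx \<Rightarrow> (int \<Rightarrow> 'm \<Rightarrow> 'm) \<Rightarrow> ('a, 'm) roof set" where
  "derived_of A X Y f = roof_rel A X Y `` {(X, \<lambda>n x. x, f)}"

definition derived_id :: "('k, 'a) module \<Rightarrow> ('a, 'm) cpx \<Rightarrow> ('a, 'm) roof set" where
  "derived_id A X = derived_of A X X (\<lambda>n x. x)"

definition derived_zero ::
  "('k, 'a) module \<Rightarrow> ('a, 'm) cpx \<Rightarrow> ('a, 'm) cpx \<Rightarrow> ('a, 'm) roof set" where
  "derived_zero A X Y = derived_of A X Y (\<lambda>n x. \<zero>\<^bsub>obj Y n\<^esub>)"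

text \<open>
  The composite of \<open>X \<leftarrow> U \<rightarrow> Y\<close> and \<open>Y \<leftarrow> V \<rightarrow> Z\<close> is the class of \<open>X \<leftarrow> U \<leftarrow> W \<rightarrow> V \<rightarrow> Z\<close>, where \<open>W \<rightarrow> U\<close>
  is a quasi-isomorphism and the square over \<open>Y\<close> commutes up to homotopy.
\<close>

definition derived_comp ::
  "('k, 'a) module \<Rightarrow> ('a, 'm) cpx \<Rightarrow> ('a, 'm) cpx \<Rightarrow> ('a, 'm) cpx \<Rightarrow>
    ('a, 'm) roof set \<Rightarrow> ('a, 'm) roof set \<Rightarrow> ('a, 'm) roof set" where
  "derived_comp A X Y Z \<phi> \<psi> =
    {r. \<exists>U s f V t g W u v. (U, s, f) \<in> \<phi> \<and> (V, t, g) \<in> \<psi> \<and>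
      bounded_cpx A W \<and> quasi_iso A W U u \<and> chain_map A W V v \<and>
      homotopic A W Y (chain_comp f u) (chain_comp t v) \<and>
      ((W, chain_comp s u, chain_comp g v), r) \<in> roof_rel A X Z}"

definition derived_iso :: "('k, 'a) module \<Rightarrow> ('a, 'm) cpx \<Rightarrow> ('a, 'm) cpx \<Rightarrow> bool" where
  "derived_iso A X Y \<longleftrightarrow> bounded_cpx A X \<and> bounded_cpx A Y \<and>
    (\<exists>\<phi>\<in>derived_hom A X Y. \<exists>\<psi>\<in>derived_hom A Y X.
      derived_comp A X Y X \<phi> \<psi> = derived_id A X \<and>
      derived_comp A Y X Y \<psi> \<phi> = derived_id A Y)"

definition shift :: "('a, 'm) cpx \<Rightarrow> int \<Rightarrow> ('a, 'm) cpx" where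
  "shift X r =
    \<lparr>obj = (\<lambda>n. obj X (n + r)),
     dif = (\<lambda>n x. if even r then dif X (n + r) x else \<ominus>\<^bsub>obj X (n + r + 1)\<^esub> dif X (n + r) x)\<rparr>"

definition stalk :: "('a, 'm) module \<Rightarrow> ('a, 'm) cpx" where
  "stalk M = \<lparr>obj = (\<lambda>n. if n = 0 then M else M\<lparr>carrier := {\<zero>\<^bsub>M\<^esub>}\<rparr>), dif = (\<lambda>n x. \<zero>\<^bsub>M\<^esub>)\<rparr>"

text \<open>\<open>M \<rightarrow> N\<close> with \<open>M\<close> in degree \<open>-1\<close>.\<close>

definition two_term :: "('a, 'm) module \<Rightarrow> ('m \<Rightarrow> 'm) \<Rightarrow> ('a, 'm) module \<Rightarrow> ('a, 'm) cpx" where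
  "two_term M f N =
    \<lparr>obj = (\<lambda>n. if n = -1 then M else if n = 0 then N else N\<lparr>carrier := {\<zero>\<^bsub>N\<^esub>}\<rparr>),
     dif = (\<lambda>n x. if n = -1 then f x else if n = -2 then \<zero>\<^bsub>M\<^esub> else \<zero>\<^bsub>N\<^esub>)\<rparr>"

type_synonym ('a, 'i) ecpx = "('a, ('a, 'i) elt) cpx"

definition cpx_sum :: "('a, 'i) ecpx \<Rightarrow> ('a, 'i) ecpx \<Rightarrow> ('a, 'i) ecpx" where
  "cpx_sum X Y =
    \<lparr>obj = (\<lambda>n. dsum2 (obj X n) (obj Y n)),
     dif = (\<lambda>n z. Two (dif X n (first z)) (dif Y n (second z)))\<rparr>"

definition cone ::
  "('a, 'i) ecpx \<Rightarrow> ('a, 'i) ecpx \<Rightarrow> (int \<Rightarrow> ('a, 'i) elt \<Rightarrow> ('a, 'i) elt) \<Rightarrow> ('a, 'i) ecpx" where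
  "cone X Y f =
    \<lparr>obj = (\<lambda>n. dsum2 (obj X (n + 1)) (obj Y n)),
     dif = (\<lambda>n z. Two (\<ominus>\<^bsub>obj X (n + 1 + 1)\<^esub> dif X (n + 1) (first z))
       (f (n + 1) (first z) \<oplus>\<^bsub>obj Y (n + 1)\<^esub> dif Y n (second z)))\<rparr>"

text \<open>
  Full triangulated subcategories, closed under isomorphism and given by their objects. Every
  morphism of the derived category becomes a chain map after replacing its source by an
  isomorphic complex, so closure under cones of chain maps is closure under all cones.
\<close>

definition triangulated_subcat :: "('k, 'a) module \<Rightarrow> ('a, 'i) ecpx set \<Rightarrow> bool" where
  "triangulated_subcat A T \<longleftrightarrow> T \<noteq> {} \<and> T \<subseteq> Collect (bounded_cpx A) \<and>
    (\<forall>X\<in>T. \<forall>Y. derived_iso A X Y \<longrightarrow> Y \<in> T) \<and>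
    (\<forall>X\<in>T. \<forall>r. shift X r \<in> T) \<and>
    (\<forall>X\<in>T. \<forall>Y\<in>T. \<forall>f. chain_map A X Y f \<longrightarrow> cone X Y f \<in> T)"

definition triangulated_hull ::
  "('k, 'a) module \<Rightarrow> ('a, 'i) ecpx set \<Rightarrow> ('a, 'i) ecpx set" where
  "triangulated_hull A S = \<Inter>{T. triangulated_subcat A T \<and> S \<subseteq> T}"

definition projective_cpx :: "('k, 'a) module \<Rightarrow> ('a, 'm) cpx \<Rightarrow> bool" where
  "projective_cpx A P \<longleftrightarrow> bounded_cpx A P \<and> (\<forall>n. fg_projective A (obj P n))"

definition per :: "('k, 'a) module \<Rightarrow> ('a, 'i) ecpx set" where
  "per A = {X. \<exists>P. projective_cpx A P \<and> derived_iso A X P}"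

definition direct_summands :: "('k, 'a) module \<Rightarrow> ('a, 'i) ecpx \<Rightarrow> ('a, 'i) ecpx set" where
  "direct_summands A T =
    {X. \<exists>Y. bounded_cpx A X \<and> bounded_cpx A Y \<and> derived_iso A T (cpx_sum X Y)}"


section \<open>Tilting complexes and tilting modules\<close>

definition tilting_complex :: "('k, 'a) module \<Rightarrow> ('a, 'i) ecpx \<Rightarrow> bool" where
  "tilting_complex A T \<longleftrightarrow> projective_cpx A T \<and>
    (\<forall>r. r \<noteq> 0 \<longrightarrow> derived_hom A T (shift T r) = {derived_zero A T (shift T r)}) \<and>
    triangulated_hull A (direct_summands A T) = per A"

definition tilting_module :: "('k, 'a) module \<Rightarrow> ('a, 'i) emodule \<Rightarrow> bool" where
  "tilting_module A M \<longleftrightarrow> fd_module A M \<and>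
    (\<exists>T. tilting_complex A T \<and> derived_iso A (stalk M) T)"

text \<open>A quasi-isomorphism from a complex of projectives in degrees \<open>-n, \<dots>, 0\<close> to the module \<open>M\<close> in
  degree \<open>0\<close> is a projective resolution of \<open>M\<close> of length at most \<open>n\<close>.\<close>

definition proj_dim_le :: "('k, 'a) module \<Rightarrow> ('a, 'm) module \<Rightarrow> nat \<Rightarrow> bool" where
  "proj_dim_le A M n \<longleftrightarrow>
    (\<exists>P q. projective_cpx A P \<and>
      (\<forall>i. i < - int n \<or> i > 0 \<longrightarrow> carrier (obj P i) = {\<zero>\<^bsub>obj P i\<^esub>}) \<and>
      quasi_iso A P (stalk M) q)"


section \<open>The complex and the module attached to a vertex\<close>

text \<open>
  The index type \<^typ>\<open>'v + 'e\<close> of families lets one form direct sums over vertices as well as over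
  arrows.
\<close>

type_synonym ('k, 'v, 'e) bq_elt = "((('v, 'e) qpath \<Rightarrow> 'k) set, 'v + 'e) elt"
type_synonym ('k, 'v, 'e) bq_module =
  "((('v, 'e) qpath \<Rightarrow> 'k) set, ('k, 'v, 'e) bq_elt) module"
type_synonym ('k, 'v, 'e) bq_cpx =
  "((('v, 'e) qpath \<Rightarrow> 'k) set, ('k, 'v, 'e) bq_elt) cpx"

text \<open>\<open>P\<^sub>i = e\<^sub>i A\<close>\<close>

definition proj_at ::
  "('v, 'e) pre_digraph \<Rightarrow> (('v, 'e) qpath \<Rightarrow> 'k::field) set \<Rightarrow> 'v \<Rightarrow> ('k, 'v, 'e) bq_module" where
  "proj_at Q I i = (let A = bq_algebra Q I in
    \<lparr>carrier = {Elem (bq_path Q I (i, []) \<otimes>\<^bsub>A\<^esub> a) | a. a \<in> carrier A},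
     mult = undefined, one = undefined, zero = Elem \<zero>\<^bsub>A\<^esub>,
     add = (\<lambda>x y. Elem (the_elem_of x \<oplus>\<^bsub>A\<^esub> the_elem_of y)),
     smult = (\<lambda>a x. Elem (the_elem_of x \<otimes>\<^bsub>A\<^esub> a))\<rparr>)"

text \<open>
  \<open>S\<^sub>i\<close> is one-dimensional; an element of the algebra acts by the coefficient of the trivial path at
  \<open>i\<close>, which is the same for all representatives of a coset of an admissible ideal.
\<close>

definition simple_at ::
  "'v \<Rightarrow> ((('v, 'e) qpath \<Rightarrow> 'k::field) set, 'k) module" where
  "simple_at i =
    \<lparr>carrier = UNIV, mult = undefined, one = undefined, zero = 0, add = (+),
     smult = (\<lambda>a c. c * the_elem ((\<lambda>x. x (i, [])) ` a))\<rparr>"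

definition proj_rest ::
  "('v, 'e) pre_digraph \<Rightarrow> (('v, 'e) qpath \<Rightarrow> 'k::field) set \<Rightarrow> 'v \<Rightarrow> ('k, 'v, 'e) bq_module" where
  "proj_rest Q I k =
    dsum (Inl ` (verts Q - {k})) (case_sum (proj_at Q I) (\<lambda>\<alpha>. undefined))"

definition L_cpx ::
  "('v, 'e) pre_digraph \<Rightarrow> (('v, 'e) qpath \<Rightarrow> 'k::field) set \<Rightarrow> 'v \<Rightarrow> ('k, 'v, 'e) bq_cpx" where
  "L_cpx Q I k =
    two_term (proj_at Q I k)
      (\<lambda>x. Fam (\<lambda>j\<in>Inr ` {\<alpha> \<in> arcs Q. head Q \<alpha> = k}. case_sum (\<lambda>i. undefined)
        (\<lambda>\<alpha>. Elem (bq_path Q I (tail Q \<alpha>, [\<alpha>]) \<otimes>\<^bsub>bq_algebra Q I\<^esub> the_elem_of x)) j))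
      (dsum (Inr ` {\<alpha> \<in> arcs Q. head Q \<alpha> = k})
        (case_sum (\<lambda>i. undefined) (\<lambda>\<alpha>. proj_at Q I (tail Q \<alpha>))))"

definition T_minus ::
  "('v, 'e) pre_digraph \<Rightarrow> (('v, 'e) qpath \<Rightarrow> 'k::field) set \<Rightarrow> 'v \<Rightarrow> ('k, 'v, 'e) bq_cpx" where
  "T_minus Q I k = cpx_sum (L_cpx Q I k) (stalk (proj_rest Q I k))"

definition T_BB ::
  "('v, 'e) pre_digraph \<Rightarrow> (('v, 'e) qpath \<Rightarrow> 'k::field) set \<Rightarrow> 'v \<Rightarrow> ('k, 'v, 'e) bq_module" where
  "T_BB Q I k = dsum2 (tau_inv (bq_algebra Q I) (simple_at k)) (proj_rest Q I k)"

definition BB_defined ::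
  "('v, 'e) pre_digraph \<Rightarrow> (('v, 'e) qpath \<Rightarrow> 'k::field) set \<Rightarrow> 'v \<Rightarrow> bool" where
  "BB_defined Q I k \<longleftrightarrow>
    tilting_module (bq_algebra Q I) (T_BB Q I k) \<and> proj_dim_le (bq_algebra Q I) (T_BB Q I k) 1"

end

theory Submission
  imports Defs
begin

text \<open>
  Write \<open>f : P\<^sub>k \<rightarrow> L\<^sup>0\<close> for the differential of \<open>L\<^sub>k\<close> and \<open>N = \<tau>\<^sup>-S\<^sub>k\<close>. The arrows ending at \<open>k\<close> give the
  minimal projective presentation over the opposite algebra of the dual of \<open>S\<^sub>k\<close>, and its \<open>A\<close>-dual is \<open>f\<close>;
  hence \<open>N = coker f\<close>, and \<open>T\<^sup>-\<^sub>k \<rightarrow> T\<^sup>B\<^sup>B\<^sub>k\<close> is a quasi-isomorphism as soon as \<open>f\<close> is injective.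
  In (b), \<open>ker f\<close> is the cohomology of \<open>T\<^sup>-\<^sub>k\<close> in degree \<open>-1\<close>, which vanishes.

  In (a), compare \<open>L\<^sub>k\<close> with a projective resolution \<open>P\<^sup>-\<^sup>1 \<rightarrow> P\<^sup>0\<close> of \<open>T\<^sup>B\<^sup>B\<^sub>k\<close>: lifting the inclusion and
  the projection of \<open>N\<close> gives \<open>g : P\<^sub>k \<rightarrow> P\<^sup>-\<^sup>1 \<rightarrow> P\<^sub>k\<close>. Since \<open>P\<^sup>-\<^sup>1 \<rightarrow> P\<^sup>0\<close> is injective, \<open>g\<close> kills
  \<open>ker f\<close>; but \<open>g\<close> is left multiplication by \<open>e\<^sub>k + r\<close> with \<open>r\<close> in the nilpotent radical, so it is
  injective. That \<open>r\<close> is in the radical uses that \<open>ker f\<close> is, i.e. that some arrow ends at \<open>k\<close>.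
  Otherwise \<open>N = 0\<close>, and \<open>e\<^sub>k\<close> annihilates the cohomology of every complex in the triangulated category
  generated by \<open>T\<^sup>B\<^sup>B\<^sub>k\<close>, but not \<open>P\<^sub>k\<close>, so \<open>T\<^sup>B\<^sup>B\<^sub>k\<close> is not tilting.
\<close>

section \<open>Right modules over an algebra\<close>

text \<open>\<open>derived_iso\<close> speaks of classes of roofs and \<open>tau_inv\<close> is an
  arbitrary choice, so neither can be computed with directly. The former is replaced by a single
  span of quasi-isomorphisms (\<open>qeq\<close>), with quasi-isomorphisms tested on cocycles;
  homotopy fibres supply the calculus of fractions behind this replacement. The latter is controlled
  by comparing every minimal presentation with the explicit one built from the arrows into
  \<open>k\<close>, whose minimality rests on Nakayama's lemma and on \<open>I\<close> lying in the
  square of the arrow ideal. The radical element r has two sources. The endomorphism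
  \<open>ba\<close> of the degree 0 term of L (through the resolution and back) and the identity
  both cover the identity of N, so they differ by f s for some map s from that term to the
  projective at \<open>k\<close>. Then g - 1 - s f takes values in ker f, which gives the first
  summand of r. The second is s applied to the image of the generator under f; it is radical because
  the components of that image are arrows and s is linear.\<close>

lemmas ag_simps =
  abelian_groupE(1,2) abelian_group.a_inv_closed abelian_group.minus_closed
  abelian_monoid.l_zero[OF abelian_group.axioms(1)] abelian_monoid.r_zero[OF abelian_group.axioms(1)]
  abelian_group.l_neg abelian_group.r_neg abelian_group.minus_minus

lemmas ag_ac = abelian_monoid.a_ac[OF abelian_group.axioms(1)]

lemma (in abelian_group) minus_eq_zero_iff:
  assumes "x \<in> carrier G" "y \<in> carrier G"
  shows "x \<ominus> y = \<zero> \<longleftrightarrow> x = y"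
  using assms by (metis a_minus_def add.inv_closed add.inv_inv minus_equality r_neg)

lemma (in abelian_group) minus_eq_iff:
  assumes "x \<in> carrier G" "y \<in> carrier G" "z \<in> carrier G"
  shows "x \<ominus> y = z \<longleftrightarrow> x = z \<oplus> y"
  using assms by (metis a_minus_def a_assoc add.inv_closed l_neg r_neg r_zero)

text \<open>All scalar actions in \<open>Defs\<close> go through \<open>c \<odot> \<one>\<close>, so these axioms suffice.\<close>

locale kalg = ring A for A :: "('k::field, 'a) module" (structure) +
  assumes sc_closed [simp, intro]: "c \<odot> \<one> \<in> carrier A"
    and sc_add: "(c + d) \<odot> \<one> = c \<odot> \<one> \<oplus> d \<odot> \<one>"
    and sc_mult: "(c * d) \<odot> \<one> = (c \<odot> \<one>) \<otimes> (d \<odot> \<one>)"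
    and sc_one: "1 \<odot> \<one> = \<one>"
    and sc_central: "a \<in> carrier A \<Longrightarrow> (c \<odot> \<one>) \<otimes> a = a \<otimes> (c \<odot> \<one>)"

lemma opp_simps [simp]:
  "carrier (opp A) = carrier A" "add (opp A) = add A" "zero (opp A) = zero A"
  "one (opp A) = one A" "smult (opp A) = smult A" "x \<otimes>\<^bsub>opp A\<^esub> y = y \<otimes>\<^bsub>A\<^esub> x"
  by (simp_all add: opp_def)

lemma abelian_group_cong:
  assumes "abelian_group G" "carrier H = carrier G" "add H = add G" "zero H = zero G"
  shows "abelian_group H"
  using abelian_groupE[OF assms(1)] by (intro abelian_groupI) (simp_all add: assms(2-4))

context kalg begin

lemma kalg_opp: "kalg (opp A)"
proof (intro kalg.intro kalg_axioms.intro)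
  show "ring (opp A)"
  proof (rule ringI)
    show "abelian_group (opp A)"
      by (rule abelian_group_cong[OF abelian_group_axioms]) simp_all
    show "Group.monoid (opp A)" by (rule monoidI) (simp_all add: m_assoc)
  qed (simp_all add: l_distr r_distr)
qed (simp_all add: sc_add sc_one sc_central[symmetric] flip: sc_mult, simp add: mult.commute sc_mult)

lemma sc_zero: "0 \<odot> \<one> = \<zero>"
  using sc_add[of 0 0] by (metis add.l_cancel_one' add_0 sc_closed)

end

lemma right_moduleI:
  assumes "abelian_group M"
    "\<And>a x. a \<in> carrier A \<Longrightarrow> x \<in> carrier M \<Longrightarrow> a \<odot>\<^bsub>M\<^esub> x \<in> carrier M"
    "\<And>a x y. a \<in> carrier A \<Longrightarrow> x \<in> carrier M \<Longrightarrow> y \<in> carrier M \<Longrightarrow>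
      a \<odot>\<^bsub>M\<^esub> (x \<oplus>\<^bsub>M\<^esub> y) = a \<odot>\<^bsub>M\<^esub> x \<oplus>\<^bsub>M\<^esub> a \<odot>\<^bsub>M\<^esub> y"
    "\<And>a b x. a \<in> carrier A \<Longrightarrow> b \<in> carrier A \<Longrightarrow> x \<in> carrier M \<Longrightarrow>
      (a \<oplus>\<^bsub>A\<^esub> b) \<odot>\<^bsub>M\<^esub> x = a \<odot>\<^bsub>M\<^esub> x \<oplus>\<^bsub>M\<^esub> b \<odot>\<^bsub>M\<^esub> x"
    "\<And>a b x. a \<in> carrier A \<Longrightarrow> b \<in> carrier A \<Longrightarrow> x \<in> carrier M \<Longrightarrow>
      (a \<otimes>\<^bsub>A\<^esub> b) \<odot>\<^bsub>M\<^esub> x = b \<odot>\<^bsub>M\<^esub> (a \<odot>\<^bsub>M\<^esub> x)"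
    "\<And>x. x \<in> carrier M \<Longrightarrow> \<one>\<^bsub>A\<^esub> \<odot>\<^bsub>M\<^esub> x = x"
  shows "right_module A M"
  using assms unfolding right_module_def by blast

locale rmod = kalg A + M: abelian_group M
  for A :: "('k::field, 'a) module" (structure) and M :: "('a, 'm) module" +
  assumes act_closed [simp]: "a \<in> carrier A \<Longrightarrow> x \<in> carrier M \<Longrightarrow> a \<odot>\<^bsub>M\<^esub> x \<in> carrier M"
    and act_add: "a \<in> carrier A \<Longrightarrow> x \<in> carrier M \<Longrightarrow> y \<in> carrier M \<Longrightarrow>
      a \<odot>\<^bsub>M\<^esub> (x \<oplus>\<^bsub>M\<^esub> y) = a \<odot>\<^bsub>M\<^esub> x \<oplus>\<^bsub>M\<^esub> a \<odot>\<^bsub>M\<^esub> y"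
    and add_act: "a \<in> carrier A \<Longrightarrow> b \<in> carrier A \<Longrightarrow> x \<in> carrier M \<Longrightarrow>
      (a \<oplus> b) \<odot>\<^bsub>M\<^esub> x = a \<odot>\<^bsub>M\<^esub> x \<oplus>\<^bsub>M\<^esub> b \<odot>\<^bsub>M\<^esub> x"
    and mult_act: "a \<in> carrier A \<Longrightarrow> b \<in> carrier A \<Longrightarrow> x \<in> carrier M \<Longrightarrow>
      (a \<otimes> b) \<odot>\<^bsub>M\<^esub> x = b \<odot>\<^bsub>M\<^esub> (a \<odot>\<^bsub>M\<^esub> x)"
    and one_act [simp]: "x \<in> carrier M \<Longrightarrow> \<one> \<odot>\<^bsub>M\<^esub> x = x"
begin

lemma right_module: "right_module A M"
  by (rule right_moduleI) (simp_all add: act_add add_act mult_act M.abelian_group_axioms)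

lemma act_zero [simp]: "a \<in> carrier A \<Longrightarrow> a \<odot>\<^bsub>M\<^esub> \<zero>\<^bsub>M\<^esub> = \<zero>\<^bsub>M\<^esub>"
  using act_add[of a "\<zero>\<^bsub>M\<^esub>" "\<zero>\<^bsub>M\<^esub>"] by (metis act_closed M.add.l_cancel_one' M.l_zero M.zero_closed)

lemma zero_act [simp]: "x \<in> carrier M \<Longrightarrow> \<zero> \<odot>\<^bsub>M\<^esub> x = \<zero>\<^bsub>M\<^esub>"
  using add_act[of "\<zero>" "\<zero>" x]
  by (metis act_closed M.add.l_cancel_one' l_zero zero_closed)

lemma act_neg: "a \<in> carrier A \<Longrightarrow> x \<in> carrier M \<Longrightarrow> a \<odot>\<^bsub>M\<^esub> (\<ominus>\<^bsub>M\<^esub> x) = \<ominus>\<^bsub>M\<^esub> (a \<odot>\<^bsub>M\<^esub> x)"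
  by (metis act_add act_closed act_zero M.add.inv_closed M.add.inv_equality M.l_neg)

lemma neg_act: "a \<in> carrier A \<Longrightarrow> x \<in> carrier M \<Longrightarrow> (\<ominus> a) \<odot>\<^bsub>M\<^esub> x = \<ominus>\<^bsub>M\<^esub> (a \<odot>\<^bsub>M\<^esub> x)"
  by (metis a_inv_closed l_neg act_closed add_act M.add.inv_equality zero_act)

lemma act_finsum:
  assumes "finite J" "a \<in> carrier A" "g \<in> J \<rightarrow> carrier M"
  shows "a \<odot>\<^bsub>M\<^esub> (\<Oplus>\<^bsub>M\<^esub>j\<in>J. g j) = (\<Oplus>\<^bsub>M\<^esub>j\<in>J. a \<odot>\<^bsub>M\<^esub> g j)"
  using assms by (induction J rule: finite_induct) (simp_all add: act_add M.finsum_closed Pi_def)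

lemma scal_closed [simp]: "x \<in> carrier M \<Longrightarrow> scal A M c x \<in> carrier M"
  by (simp add: scal_def)

lemma scal_add: "x \<in> carrier M \<Longrightarrow> scal A M (c + d) x = scal A M c x \<oplus>\<^bsub>M\<^esub> scal A M d x"
  by (simp add: scal_def sc_add add_act)

lemma scal_zero: "x \<in> carrier M \<Longrightarrow> scal A M 0 x = \<zero>\<^bsub>M\<^esub>"
  by (simp add: scal_def sc_zero)

end

context kalg begin

lemma rmodI: "right_module A M \<Longrightarrow> rmod A M"
  unfolding right_module_def by (intro rmod.intro rmod_axioms.intro kalg_axioms) auto

lemma right_module_ag: "right_module A M \<Longrightarrow> abelian_group M"
  by (simp add: right_module_def)

lemma fd_right_module: "fd_module A M \<Longrightarrow> right_module A M"
  by (simp add: fd_module_def)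

lemma fd_ag: "fd_module A M \<Longrightarrow> abelian_group M"
  by (simp add: fd_module_def right_module_def)

lemma homD:
  assumes "f \<in> rmod_hom A M N"
  shows "x \<in> carrier M \<Longrightarrow> f x \<in> carrier N"
    and "x \<in> carrier M \<Longrightarrow> y \<in> carrier M \<Longrightarrow> f (x \<oplus>\<^bsub>M\<^esub> y) = f x \<oplus>\<^bsub>N\<^esub> f y"
    and "a \<in> carrier A \<Longrightarrow> x \<in> carrier M \<Longrightarrow> f (a \<odot>\<^bsub>M\<^esub> x) = a \<odot>\<^bsub>N\<^esub> f x"
  using assms by (auto simp: rmod_hom_def)

lemma homI:
  assumes "\<And>x. x \<in> carrier M \<Longrightarrow> f x \<in> carrier N"
    and "\<And>x y. x \<in> carrier M \<Longrightarrow> y \<in> carrier M \<Longrightarrow> f (x \<oplus>\<^bsub>M\<^esub> y) = f x \<oplus>\<^bsub>N\<^esub> f y"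
    and "\<And>a x. a \<in> carrier A \<Longrightarrow> x \<in> carrier M \<Longrightarrow> f (a \<odot>\<^bsub>M\<^esub> x) = a \<odot>\<^bsub>N\<^esub> f x"
  shows "f \<in> rmod_hom A M N"
  using assms by (auto simp: rmod_hom_def)

lemma hom_zero:
  assumes "f \<in> rmod_hom A M N" "abelian_group M" "abelian_group N"
  shows "f \<zero>\<^bsub>M\<^esub> = \<zero>\<^bsub>N\<^esub>"
proof -
  interpret M: abelian_group M by fact
  interpret N: abelian_group N by fact
  show ?thesis
    using homD(1)[OF assms(1), of "\<zero>\<^bsub>M\<^esub>"] homD(2)[OF assms(1), of "\<zero>\<^bsub>M\<^esub>" "\<zero>\<^bsub>M\<^esub>"]
    by (metis M.l_zero M.zero_closed N.add.l_cancel_one')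
qed

lemma hom_neg:
  assumes "f \<in> rmod_hom A M N" "abelian_group M" "abelian_group N" "x \<in> carrier M"
  shows "f (\<ominus>\<^bsub>M\<^esub> x) = \<ominus>\<^bsub>N\<^esub> f x"
proof -
  interpret M: abelian_group M by fact
  interpret N: abelian_group N by fact
  show ?thesis
    using homD(1)[OF assms(1)] homD(2)[OF assms(1), of "\<ominus>\<^bsub>M\<^esub> x" x] assms(4) hom_zero[OF assms(1-3)]
    by (metis M.add.inv_closed M.l_neg N.minus_equality)
qed

lemma hom_minus:
  assumes "f \<in> rmod_hom A M N" "abelian_group M" "abelian_group N" "x \<in> carrier M" "y \<in> carrier M"
  shows "f (x \<ominus>\<^bsub>M\<^esub> y) = f x \<ominus>\<^bsub>N\<^esub> f y"
  using assms by (simp add: a_minus_def homD(2)[OF assms(1)] hom_neg[OF assms(1)] ag_simps)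

lemma hom_finsum:
  assumes "f \<in> rmod_hom A M N" "abelian_group M" "abelian_group N" "finite J" "g \<in> J \<rightarrow> carrier M"
  shows "f (\<Oplus>\<^bsub>M\<^esub>j\<in>J. g j) = (\<Oplus>\<^bsub>N\<^esub>j\<in>J. f (g j))"
proof -
  interpret M: abelian_group M by fact
  interpret N: abelian_group N by fact
  show ?thesis using assms(4,5)
    by (induction J rule: finite_induct)
      (simp_all add: hom_zero[OF assms(1-3)] homD[OF assms(1)] M.finsum_closed Pi_def)
qed

lemma hom_comp:
  assumes "f \<in> rmod_hom A M N" "g \<in> rmod_hom A N L"
  shows "g \<circ> f \<in> rmod_hom A M L"
  using homD[OF assms(1)] homD[OF assms(2)] by (intro homI) simp_all

lemma hom_comp':
  assumes "f \<in> rmod_hom A M N" "g \<in> rmod_hom A N L"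
  shows "(\<lambda>x. g (f x)) \<in> rmod_hom A M L"
  using homD[OF assms(1)] homD[OF assms(2)] by (intro homI) simp_all

lemma hom_id: "(\<lambda>x. x) \<in> rmod_hom A M M"
  by (auto simp: rmod_hom_def)

lemma hom_const_zero:
  assumes "right_module A N"
  shows "(\<lambda>x. \<zero>\<^bsub>N\<^esub>) \<in> rmod_hom A M N"
proof -
  interpret rmod A N by (rule rmodI) fact
  show ?thesis by (intro homI) auto
qed

lemma hom_add:
  assumes "f \<in> rmod_hom A M N" "g \<in> rmod_hom A M N" "right_module A N"
  shows "(\<lambda>x. f x \<oplus>\<^bsub>N\<^esub> g x) \<in> rmod_hom A M N"
proof -
  interpret rmod A N by (rule rmodI) fact
  show ?thesis using homD[OF assms(1)] homD[OF assms(2)]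
    by (intro homI) (auto simp: act_add M.a_ac)
qed

lemma hom_uminus:
  assumes "f \<in> rmod_hom A M N" "right_module A N"
  shows "(\<lambda>x. \<ominus>\<^bsub>N\<^esub> f x) \<in> rmod_hom A M N"
proof -
  interpret rmod A N by (rule rmodI) fact
  show ?thesis using homD[OF assms(1)]
    by (intro homI) (auto simp: act_neg M.minus_add)
qed

lemma hom_diff:
  assumes "f \<in> rmod_hom A M N" "g \<in> rmod_hom A M N" "right_module A N"
  shows "(\<lambda>x. f x \<ominus>\<^bsub>N\<^esub> g x) \<in> rmod_hom A M N"
  unfolding a_minus_def by (intro hom_add hom_uminus assms)

lemma hom_scal:
  assumes "f \<in> rmod_hom A M N" "x \<in> carrier M"
  shows "f (scal A M c x) = scal A N c (f x)"
  using homD(3)[OF assms(1)] assms(2) by (simp add: scal_def)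

lemma kernel_iff_inj:
  assumes "f \<in> rmod_hom A M N" "abelian_group M" "abelian_group N"
    "\<And>x. x \<in> carrier M \<Longrightarrow> f x = \<zero>\<^bsub>N\<^esub> \<Longrightarrow> x = \<zero>\<^bsub>M\<^esub>"
  shows "inj_on f (carrier M)"
proof (rule inj_onI)
  fix x y assume xy: "x \<in> carrier M" "y \<in> carrier M" "f x = f y"
  interpret M: abelian_group M by fact
  interpret N: abelian_group N by fact
  have "f (x \<ominus>\<^bsub>M\<^esub> y) = \<zero>\<^bsub>N\<^esub>"
    using xy homD(1)[OF assms(1)] by (simp add: hom_minus[OF assms(1-3)] N.minus_eq_zero_iff)
  hence "x \<ominus>\<^bsub>M\<^esub> y = \<zero>\<^bsub>M\<^esub>" using assms(4) xy by simp
  thus "x = y" using xy by (simp add: M.minus_eq_zero_iff)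
qed

lemma hom_inv:
  assumes "f \<in> rmod_hom A M N" "right_module A M" "bij_betw f (carrier M) (carrier N)"
  shows "inv_into (carrier M) f \<in> rmod_hom A N M"
proof -
  interpret rmod A M by (rule rmodI) fact
  note f = homD[OF assms(1)]
  have inj: "inj_on f (carrier M)" and im: "f ` carrier M = carrier N"
    using assms(3) by (auto simp: bij_betw_def)
  show ?thesis
  proof (rule homI)
    fix x assume "x \<in> carrier N"
    thus "inv_into (carrier M) f x \<in> carrier M" using im by (metis inv_into_into)
  next
    fix x y assume "x \<in> carrier N" "y \<in> carrier N"
    then obtain x' y' where "x' \<in> carrier M" "y' \<in> carrier M" "x = f x'" "y = f y'"
      using im by (metis imageE)
    thus "inv_into (carrier M) f (x \<oplus>\<^bsub>N\<^esub> y) = inv_into (carrier M) f x \<oplus>\<^bsub>M\<^esub> inv_into (carrier M) f y"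
      by (simp add: f(2,3)[symmetric] inv_into_f_f[OF inj])
  next
    fix a x assume "a \<in> carrier A" "x \<in> carrier N"
    then obtain x' where "x' \<in> carrier M" "x = f x'" "a \<in> carrier A"
      using im by (metis imageE)
    thus "inv_into (carrier M) f (a \<odot>\<^bsub>N\<^esub> x) = a \<odot>\<^bsub>M\<^esub> inv_into (carrier M) f x"
      by (simp add: f(2,3)[symmetric] inv_into_f_f[OF inj])
  qed
qed

subsection \<open>Finite generation over the ground field\<close>

text \<open>The span over the ground field in inductive form: images, enlargements and sums of spans
  are then handled by rule induction, without coefficient functions. \<open>kspan_explicit\<close>
  translates back to the sums in \<open>fd_module\<close>.\<close>

inductive_set kspan :: "('a, 'm) module \<Rightarrow> 'm set \<Rightarrow> 'm set" for M B where
  zero: "\<zero>\<^bsub>M\<^esub> \<in> kspan M B"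
| step: "b \<in> B \<Longrightarrow> y \<in> kspan M B \<Longrightarrow> scal A M c b \<oplus>\<^bsub>M\<^esub> y \<in> kspan M B"

end

context rmod begin

lemma kspan_carrier: "x \<in> kspan M B \<Longrightarrow> B \<subseteq> carrier M \<Longrightarrow> x \<in> carrier M"
  by (induction rule: kspan.induct) auto

lemma kspan_add:
  assumes "B \<subseteq> carrier M" "y \<in> kspan M B"
  shows "x \<in> kspan M B \<Longrightarrow> x \<oplus>\<^bsub>M\<^esub> y \<in> kspan M B"
proof (induction rule: kspan.induct)
  case zero
  thus ?case using assms kspan_carrier by simp
next
  case (step b x c)
  have "scal A M c b \<oplus>\<^bsub>M\<^esub> x \<oplus>\<^bsub>M\<^esub> y = scal A M c b \<oplus>\<^bsub>M\<^esub> (x \<oplus>\<^bsub>M\<^esub> y)"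
    using step assms kspan_carrier by (auto intro!: M.a_assoc)
  thus ?case using step kspan.step by simp
qed

lemma kspan_mono: "x \<in> kspan M B \<Longrightarrow> B \<subseteq> B' \<Longrightarrow> x \<in> kspan M B'"
  by (induction rule: kspan.induct) (auto intro: kspan.intros)

lemma kspan_finsum:
  assumes "finite J" "B \<subseteq> carrier M" "\<And>j. j \<in> J \<Longrightarrow> g j \<in> kspan M B"
  shows "(\<Oplus>\<^bsub>M\<^esub>j\<in>J. g j) \<in> kspan M B"
  using assms(1,3)
proof (induction J rule: finite_induct)
  case (insert j J)
  have "g \<in> insert j J \<rightarrow> carrier M" using insert assms(2) kspan_carrier by auto
  thus ?case using insert assms(2) by (simp add: kspan_add)
qed (simp add: kspan.zero)

lemma kspan_base: "b \<in> B \<Longrightarrow> B \<subseteq> carrier M \<Longrightarrow> scal A M c b \<in> kspan M B"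
  using kspan.step[OF _ kspan.zero, of b B M c] by (auto simp: subset_iff)

lemma kspan_explicit:
  assumes "finite B" "B \<subseteq> carrier M"
  shows "x \<in> kspan M B \<longleftrightarrow> (\<exists>c. x = (\<Oplus>\<^bsub>M\<^esub>b\<in>B. scal A M (c b) b))"
proof
  assume "x \<in> kspan M B"
  thus "\<exists>c. x = (\<Oplus>\<^bsub>M\<^esub>b\<in>B. scal A M (c b) b)"
  proof induction
    case zero
    have "(\<Oplus>\<^bsub>M\<^esub>b\<in>B. scal A M 0 b) = (\<Oplus>\<^bsub>M\<^esub>b\<in>B. \<zero>\<^bsub>M\<^esub>)"
      using assms(2) by (intro M.finsum_cong') (auto simp: scal_zero)
    thus ?case by (intro exI[of _ "\<lambda>_. 0"]) (simp add: M.finsum_zero)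
  next
    case (step b y d)
    then obtain c where y: "y = (\<Oplus>\<^bsub>M\<^esub>b\<in>B. scal A M (c b) b)" by blast
    \<comment> \<open>The element \<open>b\<close> may already carry the coefficient
      \<open>c b\<close>, so the new multiple is absorbed into it; the rest of the sum is
      unchanged.\<close>
    define c' where "c' = c(b := d + c b)"
    have B: "B = insert b (B - {b})" "finite (B - {b})" "b \<notin> B - {b}" using step assms by auto
    have cl: "(\<lambda>b. scal A M (c b) b) \<in> B - {b} \<rightarrow> carrier M" for c
      using assms(2) by auto
    have bc: "b \<in> carrier M" using step assms by auto
    have eq: "(\<Oplus>\<^bsub>M\<^esub>b\<in>B - {b}. scal A M (c' b) b) = (\<Oplus>\<^bsub>M\<^esub>b\<in>B - {b}. scal A M (c b) b)"
      using cl by (intro M.finsum_cong') (auto simp: c'_def)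
    have 1: "(\<Oplus>\<^bsub>M\<^esub>b\<in>B. scal A M (c b) b) = scal A M (c b) b \<oplus>\<^bsub>M\<^esub> (\<Oplus>\<^bsub>M\<^esub>b\<in>B - {b}. scal A M (c b) b)" for c
      using M.finsum_insert[OF B(2,3) cl, of c] bc step(1) by (simp add: insert_absorb)
    have "(\<Oplus>\<^bsub>M\<^esub>b\<in>B. scal A M (c' b) b) = scal A M d b \<oplus>\<^bsub>M\<^esub> y"
      unfolding 1[of c'] y 1[of c] eq using bc cl
      by (simp add: c'_def scal_add M.a_assoc M.finsum_closed)
    thus ?case by metis
  qed
next
  assume "\<exists>c. x = (\<Oplus>\<^bsub>M\<^esub>b\<in>B. scal A M (c b) b)"
  thus "x \<in> kspan M B" using assms by (auto intro!: kspan_finsum kspan_base)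
qed

end

context kalg begin

lemma fd_module_iff:
  "fd_module A M \<longleftrightarrow> right_module A M \<and> (\<exists>B. finite B \<and> B \<subseteq> carrier M \<and> carrier M \<subseteq> kspan M B)"
proof (cases "right_module A M")
  case True
  interpret rmod A M by (rule rmodI) fact
  have "(\<forall>x\<in>carrier M. \<exists>c. x = (\<Oplus>\<^bsub>M\<^esub>b\<in>B. scal A M (c b) b)) \<longleftrightarrow> carrier M \<subseteq> kspan M B"
    if "finite B" "B \<subseteq> carrier M" for B
    unfolding subset_iff kspan_explicit[OF that] Ball_def ..
  thus ?thesis by (simp add: fd_module_def True cong: conj_cong)
qed (simp add: fd_module_def)

lemma hom_kspan:
  assumes "f \<in> rmod_hom A M N" "right_module A M" "right_module A N" "B \<subseteq> carrier M"
  shows "x \<in> kspan M B \<Longrightarrow> f x \<in> kspan N (f ` B)"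
proof (induction rule: kspan.induct)
  case zero
  show ?case using hom_zero[OF assms(1)] assms right_module_ag by (metis kspan.zero)
next
  case (step b y c)
  interpret rmod A M by (rule rmodI) fact
  have "y \<in> carrier M" "b \<in> carrier M" using step assms(4) kspan_carrier by auto
  thus ?case using step homD[OF assms(1)] hom_scal[OF assms(1)] by (auto intro!: kspan.step)
qed

lemma fd_image:
  assumes "fd_module A M" "right_module A N" "f \<in> rmod_hom A M N" "f ` carrier M = carrier N"
  shows "fd_module A N"
proof -
  obtain B where B: "finite B" "B \<subseteq> carrier M" "carrier M \<subseteq> kspan M B" "right_module A M"
    using assms(1) by (auto simp: fd_module_iff)
  have "f x \<in> kspan N (f ` B)" if "x \<in> carrier M" for x
    using hom_kspan[OF assms(3) B(4) assms(2) B(2)] B(3) that by blast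
  hence "carrier N \<subseteq> kspan N (f ` B)" unfolding assms(4)[symmetric] by (rule image_subsetI)
  moreover have "f ` B \<subseteq> carrier N" using B assms(4) by auto
  ultimately show ?thesis using B(1) assms(2) by (auto simp: fd_module_iff)
qed

lemma zero_right_module:
  assumes "right_module A M"
  shows "right_module A (M\<lparr>carrier := {\<zero>\<^bsub>M\<^esub>}\<rparr>)"
proof -
  interpret rmod A M by (rule rmodI) fact
  show ?thesis by (auto intro!: right_moduleI abelian_groupI)
qed

lemma zero_fd:
  assumes "right_module A M"
  shows "fd_module A (M\<lparr>carrier := {\<zero>\<^bsub>M\<^esub>}\<rparr>)"
  unfolding fd_module_iff using zero_right_module[OF assms] kspan.zero[of "M\<lparr>carrier := {\<zero>\<^bsub>M\<^esub>}\<rparr>" "{}"]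
  by (auto intro!: exI[of _ "{}"])

subsection \<open>Direct sums\<close>

lemma dsum2_simps [simp]:
  "carrier (dsum2 M N) = {Two x y | x y. x \<in> carrier M \<and> y \<in> carrier N}"
  "zero (dsum2 M N) = Two \<zero>\<^bsub>M\<^esub> \<zero>\<^bsub>N\<^esub>"
  "Two x y \<oplus>\<^bsub>dsum2 M N\<^esub> Two x' y' = Two (x \<oplus>\<^bsub>M\<^esub> x') (y \<oplus>\<^bsub>N\<^esub> y')"
  "a \<odot>\<^bsub>dsum2 M N\<^esub> Two x y = Two (a \<odot>\<^bsub>M\<^esub> x) (a \<odot>\<^bsub>N\<^esub> y)"
  by (simp_all add: dsum2_def)

end

lemma dsum2_ag:
  assumes "abelian_group M" "abelian_group N"
  shows "abelian_group (dsum2 M N)"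
proof -
  interpret M: abelian_group M by fact
  interpret N: abelian_group N by fact
  have "\<exists>w\<in>carrier (dsum2 M N). w \<oplus>\<^bsub>dsum2 M N\<^esub> z = \<zero>\<^bsub>dsum2 M N\<^esub>" if "z \<in> carrier (dsum2 M N)" for z
    using that by (intro bexI[of _ "Two (\<ominus>\<^bsub>M\<^esub> first z) (\<ominus>\<^bsub>N\<^esub> second z)"])
      (auto simp: dsum2_def M.l_neg N.l_neg)
  thus ?thesis
    by (intro abelian_groupI; (assumption | force simp: dsum2_def M.a_ac N.a_ac)?)
qed

context kalg begin

lemma dsum2_right_module:
  assumes "right_module A M" "right_module A N"
  shows "right_module A (dsum2 M N)"
proof -
  interpret M: rmod A M by (rule rmodI) fact
  interpret N: rmod A N by (rule rmodI) fact
  show ?thesis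
    using M.act_add N.act_add M.add_act N.add_act M.mult_act N.mult_act
    by (intro right_moduleI dsum2_ag) (auto intro: M.M.abelian_group_axioms N.M.abelian_group_axioms)
qed

lemma dsum2_inl: 
  assumes "right_module A N" shows "(\<lambda>x. Two x \<zero>\<^bsub>N\<^esub>) \<in> rmod_hom A M (dsum2 M N)"
proof -
  interpret N: rmod A N by (rule rmodI) fact
  show ?thesis by (intro homI) auto
qed

lemma dsum2_inr: 
  assumes "right_module A M" shows "(\<lambda>x. Two \<zero>\<^bsub>M\<^esub> x) \<in> rmod_hom A N (dsum2 M N)"
proof -
  interpret M: rmod A M by (rule rmodI) fact
  show ?thesis by (intro homI) auto
qed

lemma dsum2_fst: "first \<in> rmod_hom A (dsum2 M N) M"
  by (intro homI) auto

lemma dsum2_snd: "second \<in> rmod_hom A (dsum2 M N) N"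
  by (intro homI) auto

lemma dsum2_fd:
  assumes "fd_module A M" "fd_module A N"
  shows "fd_module A (dsum2 M N)"
proof -
  have M: "right_module A M" and N: "right_module A N" using assms fd_right_module by auto
  obtain B where B: "finite B" "B \<subseteq> carrier M" "carrier M \<subseteq> kspan M B"
    using assms(1) by (auto simp: fd_module_iff)
  obtain C where C: "finite C" "C \<subseteq> carrier N" "carrier N \<subseteq> kspan N C"
    using assms(2) by (auto simp: fd_module_iff)
  interpret M: rmod A M by (rule rmodI) fact
  interpret N: rmod A N by (rule rmodI) fact
  interpret S: rmod A "dsum2 M N" by (rule rmodI[OF dsum2_right_module[OF M N]])
  let ?D = "(\<lambda>x. Two x \<zero>\<^bsub>N\<^esub>) ` B \<union> (\<lambda>y. Two \<zero>\<^bsub>M\<^esub> y) ` C"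
  have D: "?D \<subseteq> carrier (dsum2 M N)" using B C by auto
  have "Two x y \<in> kspan (dsum2 M N) ?D" if "x \<in> carrier M" "y \<in> carrier N" for x y
  proof -
    have "Two x \<zero>\<^bsub>N\<^esub> \<in> kspan (dsum2 M N) ((\<lambda>x. Two x \<zero>\<^bsub>N\<^esub>) ` B)"
      using that(1) B(3) by (intro hom_kspan[OF dsum2_inl M dsum2_right_module B(2)] M N) blast
    hence "Two x \<zero>\<^bsub>N\<^esub> \<in> kspan (dsum2 M N) ?D" by (rule S.kspan_mono) simp
    moreover have "Two \<zero>\<^bsub>M\<^esub> y \<in> kspan (dsum2 M N) ((\<lambda>y. Two \<zero>\<^bsub>M\<^esub> y) ` C)"
      using that(2) C(3) by (intro hom_kspan[OF dsum2_inr N dsum2_right_module C(2)] M N) blast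
    hence "Two \<zero>\<^bsub>M\<^esub> y \<in> kspan (dsum2 M N) ?D" by (rule S.kspan_mono) simp
    ultimately have "Two x \<zero>\<^bsub>N\<^esub> \<oplus>\<^bsub>dsum2 M N\<^esub> Two \<zero>\<^bsub>M\<^esub> y \<in> kspan (dsum2 M N) ?D"
      using D S.kspan_add by blast
    thus ?thesis using that by simp
  qed
  hence "carrier (dsum2 M N) \<subseteq> kspan (dsum2 M N) ?D" by auto
  thus ?thesis using D B(1) C(1) dsum2_right_module[OF M N] unfolding fd_module_iff
    by (intro conjI exI[of _ ?D]) auto
qed

end

lemma dsum_simps:
  "carrier (dsum J M) = Fam ` (\<Pi>\<^sub>E j\<in>J. carrier (M j))"
  "zero (dsum J M) = Fam (\<lambda>j\<in>J. \<zero>\<^bsub>M j\<^esub>)"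
  "z \<oplus>\<^bsub>dsum J M\<^esub> w = Fam (\<lambda>j\<in>J. component z j \<oplus>\<^bsub>M j\<^esub> component w j)"
  "a \<odot>\<^bsub>dsum J M\<^esub> z = Fam (\<lambda>j\<in>J. a \<odot>\<^bsub>M j\<^esub> component z j)"
  by (simp_all add: dsum_def)

lemma dsum_carrierI:
  assumes "\<And>j. j \<in> J \<Longrightarrow> g j \<in> carrier (M j)"
  shows "Fam (\<lambda>j\<in>J. g j) \<in> carrier (dsum J M)"
  using assms by (auto simp: dsum_simps)

lemma dsum_component_closed:
  "z \<in> carrier (dsum J M) \<Longrightarrow> j \<in> J \<Longrightarrow> component z j \<in> carrier (M j)"
  by (auto simp: dsum_simps)

lemma dsum_eqI:
  assumes "z \<in> carrier (dsum J M)" "w \<in> carrier (dsum J M)"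
    "\<And>j. j \<in> J \<Longrightarrow> component z j = component w j"
  shows "z = w"
proof -
  obtain x y where "z = Fam x" "w = Fam y" "x \<in> extensional J" "y \<in> extensional J"
    using assms(1,2) by (auto simp: dsum_simps PiE_def)
  thus ?thesis using assms(3) by (auto intro: extensionalityI)
qed

definition dsum_in :: "'i set \<Rightarrow> ('i \<Rightarrow> ('a, 'i) emodule) \<Rightarrow> 'i \<Rightarrow> ('a, 'i) elt \<Rightarrow> ('a, 'i) elt" where
  "dsum_in J M j x = Fam (\<lambda>i\<in>J. if i = j then x else \<zero>\<^bsub>M i\<^esub>)"

context kalg begin

lemma dsum_right_module:
  assumes "\<And>j. j \<in> J \<Longrightarrow> right_module A (M j)"
  shows "right_module A (dsum J M)"
proof -
  note R = rmodI[OF assms]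
  note ag = rmod.axioms(2)[OF R]
  note simps = rmod.act_closed[OF R] rmod.act_add[OF R] rmod.add_act[OF R] rmod.mult_act[OF R]
    rmod.one_act[OF R] ag_simps[OF ag] ag_ac[OF ag] dsum_component_closed[of _ J M]
  note eq = dsum_eqI[of _ J M] 
  have cl1: "z \<oplus>\<^bsub>dsum J M\<^esub> w \<in> carrier (dsum J M)"
    if "z \<in> carrier (dsum J M)" "w \<in> carrier (dsum J M)" for z w
    unfolding dsum_simps(3) using that by (intro dsum_carrierI) (simp add: simps)
  have cl2: "a \<odot>\<^bsub>dsum J M\<^esub> z \<in> carrier (dsum J M)"
    if "z \<in> carrier (dsum J M)" "a \<in> carrier A" for z a
    unfolding dsum_simps(4) using that by (intro dsum_carrierI) (simp add: simps)
  note cl = cl1 cl2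
  have z: "\<zero>\<^bsub>dsum J M\<^esub> \<in> carrier (dsum J M)"
    unfolding dsum_simps(2) by (intro dsum_carrierI) (simp add: simps)
  have co: "component (z \<oplus>\<^bsub>dsum J M\<^esub> w) j = component z j \<oplus>\<^bsub>M j\<^esub> component w j"
    "component (a \<odot>\<^bsub>dsum J M\<^esub> z) j = a \<odot>\<^bsub>M j\<^esub> component z j"
    "component \<zero>\<^bsub>dsum J M\<^esub> j = \<zero>\<^bsub>M j\<^esub>" if "j \<in> J" for z w a j
    using that by (simp_all add: dsum_simps)
  show ?thesis
  proof (rule right_moduleI)
    show "abelian_group (dsum J M)"
    proof (rule abelian_groupI)
      fix z assume zc: "z \<in> carrier (dsum J M)"
      let ?w = "Fam (\<lambda>j\<in>J. \<ominus>\<^bsub>M j\<^esub> component z j)"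
      have "?w \<in> carrier (dsum J M)" using zc by (intro dsum_carrierI) (simp add: simps)
      moreover have "?w \<oplus>\<^bsub>dsum J M\<^esub> z = \<zero>\<^bsub>dsum J M\<^esub>"
        using zc calculation by (intro eq[OF cl1 z]) (simp_all add: co simps)
      ultimately show "\<exists>w\<in>carrier (dsum J M). w \<oplus>\<^bsub>dsum J M\<^esub> z = \<zero>\<^bsub>dsum J M\<^esub>" by blast
    next
      fix x y z assume "x \<in> carrier (dsum J M)" "y \<in> carrier (dsum J M)" "z \<in> carrier (dsum J M)"
      thus "x \<oplus>\<^bsub>dsum J M\<^esub> y \<oplus>\<^bsub>dsum J M\<^esub> z = x \<oplus>\<^bsub>dsum J M\<^esub> (y \<oplus>\<^bsub>dsum J M\<^esub> z)"
        by - (rule eq, simp_all add: co cl z simps)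
    next
      fix x y assume "x \<in> carrier (dsum J M)" "y \<in> carrier (dsum J M)"
      thus "x \<oplus>\<^bsub>dsum J M\<^esub> y = y \<oplus>\<^bsub>dsum J M\<^esub> x"
        by - (rule eq, simp_all add: co cl z simps)
    next
      fix x assume "x \<in> carrier (dsum J M)"
      thus "\<zero>\<^bsub>dsum J M\<^esub> \<oplus>\<^bsub>dsum J M\<^esub> x = x"
        by - (rule eq, simp_all add: co cl z simps)
    qed (simp_all add: cl z)
  qed (simp_all add: cl, (rule eq; simp add: co cl simps)+)
qed

lemma dsum_proj:
  assumes "j \<in> J" shows "(\<lambda>z. component z j) \<in> rmod_hom A (dsum J M) (M j)"
  using assms by (intro homI) (auto simp: dsum_component_closed dsum_simps)

lemma component_in: "i \<in> J \<Longrightarrow> component (dsum_in J M j x) i = (if i = j then x else \<zero>\<^bsub>M i\<^esub>)"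
  by (simp add: dsum_in_def)

lemma dsum_in_hom:
  assumes "\<And>j. j \<in> J \<Longrightarrow> right_module A (M j)" "j \<in> J"
  shows "dsum_in J M j \<in> rmod_hom A (M j) (dsum J M)"
proof (rule homI)
  note R = rmodI[OF assms(1)]
  note ag = rmod.axioms(2)[OF R]
  show "dsum_in J M j x \<in> carrier (dsum J M)" if "x \<in> carrier (M j)" for x
    unfolding dsum_in_def using that ag_simps(2)[OF ag] by (intro dsum_carrierI) auto
  show "dsum_in J M j (x \<oplus>\<^bsub>M j\<^esub> y) = dsum_in J M j x \<oplus>\<^bsub>dsum J M\<^esub> dsum_in J M j y"
    if "x \<in> carrier (M j)" "y \<in> carrier (M j)" for x y
    using that ag_simps[OF ag] by (auto simp: dsum_in_def dsum_simps fun_eq_iff)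
  show "dsum_in J M j (a \<odot>\<^bsub>M j\<^esub> x) = a \<odot>\<^bsub>dsum J M\<^esub> dsum_in J M j x"
    if "a \<in> carrier A" "x \<in> carrier (M j)" for a x
    using that rmod.act_zero[OF R] by (auto simp: dsum_in_def dsum_simps fun_eq_iff)
qed

lemma dsum_decomp:
  assumes "finite J" "\<And>j. j \<in> J \<Longrightarrow> right_module A (M j)" "z \<in> carrier (dsum J M)"
  shows "z = (\<Oplus>\<^bsub>dsum J M\<^esub>j\<in>J. dsum_in J M j (component z j))" (is "_ = ?s")
proof (rule dsum_eqI[OF assms(3)])
  note R = rmodI[OF assms(2)]
  interpret S: rmod A "dsum J M" by (rule rmodI[OF dsum_right_module[OF assms(2)]])
  have cl: "(\<lambda>j. dsum_in J M j (component z j)) \<in> J \<rightarrow> carrier (dsum J M)"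
    using homD(1)[OF dsum_in_hom[OF assms(2)]] dsum_component_closed[OF assms(3)] by auto
  show "?s \<in> carrier (dsum J M)" using cl by (rule S.M.finsum_closed)
  fix i assume i: "i \<in> J"
  interpret M: rmod A "M i" using R i .
  have "component ?s i = (\<Oplus>\<^bsub>M i\<^esub>j\<in>J. component (dsum_in J M j (component z j)) i)"
    using S.M.abelian_group_axioms M.M.abelian_group_axioms
    by (intro hom_finsum[OF dsum_proj] i assms(1) cl)
  also have "\<dots> = (\<Oplus>\<^bsub>M i\<^esub>j\<in>J. if i = j then component z j else \<zero>\<^bsub>M i\<^esub>)"
    using dsum_component_closed[OF assms(3) i] i by (intro M.M.finsum_cong') (auto simp: component_in)
  also have "\<dots> = component z i"
  proof -
    have "(\<Oplus>\<^bsub>M i\<^esub>j\<in>J. if i = j then component z j else \<zero>\<^bsub>M i\<^esub>)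
        = (\<Oplus>\<^bsub>M i\<^esub>j\<in>J. if i = j then (\<lambda>_. component z i) j else \<zero>\<^bsub>M i\<^esub>)"
      using dsum_component_closed[OF assms(3) i] by (intro M.M.finsum_cong') auto
    thus ?thesis
      using M.M.finsum_singleton[OF i assms(1), of "\<lambda>_. component z i"] dsum_component_closed[OF assms(3) i]
      by auto
  qed
  finally show "component z i = component ?s i" ..
qed

lemma dsum_out_hom:
  assumes "finite J" "right_module A N" "\<And>j. j \<in> J \<Longrightarrow> g j \<in> rmod_hom A (M j) N"
  shows "(\<lambda>z. \<Oplus>\<^bsub>N\<^esub>j\<in>J. g j (component z j)) \<in> rmod_hom A (dsum J M) N"
proof -
  interpret N: rmod A N by (rule rmodI) fact
  have cl: "(\<lambda>j. g j (component z j)) \<in> J \<rightarrow> carrier N" if "z \<in> carrier (dsum J M)" for z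
    using homD(1)[OF assms(3)] dsum_component_closed[OF that] by auto
  show ?thesis
  proof (rule homI)
    fix z w assume zw: "z \<in> carrier (dsum J M)" "w \<in> carrier (dsum J M)"
    have "(\<Oplus>\<^bsub>N\<^esub>j\<in>J. g j (component (z \<oplus>\<^bsub>dsum J M\<^esub> w) j))
        = (\<Oplus>\<^bsub>N\<^esub>j\<in>J. g j (component z j) \<oplus>\<^bsub>N\<^esub> g j (component w j))"
      using cl[OF zw(1)] cl[OF zw(2)] homD(2)[OF assms(3)] zw
      by (intro N.M.finsum_cong') (auto simp: dsum_simps(3) dsum_component_closed Pi_def)
    also have "\<dots> = (\<Oplus>\<^bsub>N\<^esub>j\<in>J. g j (component z j)) \<oplus>\<^bsub>N\<^esub> (\<Oplus>\<^bsub>N\<^esub>j\<in>J. g j (component w j))"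
      using cl zw by (intro N.M.finsum_addf) auto
    finally show "(\<Oplus>\<^bsub>N\<^esub>j\<in>J. g j (component (z \<oplus>\<^bsub>dsum J M\<^esub> w) j)) = \<dots>" .
  next
    fix a z assume az: "a \<in> carrier A" "z \<in> carrier (dsum J M)"
    have "(\<Oplus>\<^bsub>N\<^esub>j\<in>J. g j (component (a \<odot>\<^bsub>dsum J M\<^esub> z) j)) = (\<Oplus>\<^bsub>N\<^esub>j\<in>J. a \<odot>\<^bsub>N\<^esub> g j (component z j))"
      using cl[OF az(2)] homD(3)[OF assms(3)] az
      by (intro N.M.finsum_cong') (auto simp: dsum_simps(4) dsum_component_closed Pi_def)
    thus "(\<Oplus>\<^bsub>N\<^esub>j\<in>J. g j (component (a \<odot>\<^bsub>dsum J M\<^esub> z) j)) = a \<odot>\<^bsub>N\<^esub> (\<Oplus>\<^bsub>N\<^esub>j\<in>J. g j (component z j))"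
      using N.act_finsum[OF assms(1) az(1) cl[OF az(2)]] by simp
  qed (rule N.M.finsum_closed, rule cl)
qed

lemma dsum_hom_eq:
  assumes "finite J" "\<And>j. j \<in> J \<Longrightarrow> right_module A (M j)" "right_module A N"
    "g \<in> rmod_hom A (dsum J M) N" "z \<in> carrier (dsum J M)"
  shows "g z = (\<Oplus>\<^bsub>N\<^esub>j\<in>J. g (dsum_in J M j (component z j)))"
proof -
  have ag: "abelian_group (dsum J M)" "abelian_group N"
    using dsum_right_module assms(2,3) right_module_ag by auto
  have cl: "(\<lambda>j. dsum_in J M j (component z j)) \<in> J \<rightarrow> carrier (dsum J M)"
    using homD(1)[OF dsum_in_hom[OF assms(2)]] dsum_component_closed[OF assms(5)] by auto
  have "g z = g (\<Oplus>\<^bsub>dsum J M\<^esub>j\<in>J. dsum_in J M j (component z j))"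
    using dsum_decomp[OF assms(1,2,5)] by simp
  thus ?thesis using hom_finsum[OF assms(4) ag assms(1) cl] by simp
qed

lemma dsum_out_in:
  assumes "finite J" "\<And>j. j \<in> J \<Longrightarrow> right_module A (M j)" "right_module A N"
    "\<And>j. j \<in> J \<Longrightarrow> g j \<in> rmod_hom A (M j) N" "i \<in> J" "x \<in> carrier (M i)"
  shows "(\<Oplus>\<^bsub>N\<^esub>j\<in>J. g j (component (dsum_in J M i x) j)) = g i x"
proof -
  interpret N: rmod A N by (rule rmodI) fact
  note ag = right_module_ag[OF assms(2)]
  have "(\<Oplus>\<^bsub>N\<^esub>j\<in>J. g j (component (dsum_in J M i x) j)) = (\<Oplus>\<^bsub>N\<^esub>j\<in>J. if i = j then g j x else \<zero>\<^bsub>N\<^esub>)"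
    using hom_zero[OF assms(4) ag N.M.abelian_group_axioms] homD(1)[OF assms(4)] assms(6)
    by (intro N.M.finsum_cong') (auto simp: component_in)
  also have "\<dots> = (\<Oplus>\<^bsub>N\<^esub>j\<in>J. if i = j then (\<lambda>j. g i x) j else \<zero>\<^bsub>N\<^esub>)"
    using homD(1)[OF assms(4)] assms(5,6) by (intro N.M.finsum_cong') auto
  also have "\<dots> = g i x"
    using homD(1)[OF assms(4)] assms(1,5,6) by (intro N.M.finsum_singleton) auto
  finally show ?thesis .
qed

lemma dsum_fd:
  assumes "finite J" "\<And>j. j \<in> J \<Longrightarrow> fd_module A (M j)"
  shows "fd_module A (dsum J M)"
proof -
  have R: "right_module A (M j)" if "j \<in> J" for j using assms(2)[OF that] fd_right_module by auto
  interpret S: rmod A "dsum J M" by (rule rmodI[OF dsum_right_module[OF R]])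
  have "\<exists>B. finite B \<and> B \<subseteq> carrier (M j) \<and> carrier (M j) \<subseteq> kspan (M j) B" if "j \<in> J" for j
    using assms(2)[OF that] by (simp add: fd_module_iff)
  then obtain B where B: "\<And>j. j \<in> J \<Longrightarrow> finite (B j) \<and> B j \<subseteq> carrier (M j) \<and> carrier (M j) \<subseteq> kspan (M j) (B j)"
    by metis
  let ?B = "\<Union>j\<in>J. dsum_in J M j ` B j"
  have Bc: "?B \<subseteq> carrier (dsum J M)"
    using homD(1)[OF dsum_in_hom[OF R]] B by (auto simp: subset_iff)
  have "z \<in> kspan (dsum J M) ?B" if z: "z \<in> carrier (dsum J M)" for z
  proof -
    have "dsum_in J M j (component z j) \<in> kspan (dsum J M) ?B" if j: "j \<in> J" for j
    proof -
      have "component z j \<in> kspan (M j) (B j)" using B[OF j] dsum_component_closed[OF z j] by blast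
      hence "dsum_in J M j (component z j) \<in> kspan (dsum J M) (dsum_in J M j ` B j)"
        using B[OF j] by (intro hom_kspan[OF dsum_in_hom[OF R j] R[OF j] S.right_module]) auto
      thus ?thesis using j by (elim S.kspan_mono) blast
    qed
    hence "(\<Oplus>\<^bsub>dsum J M\<^esub>j\<in>J. dsum_in J M j (component z j)) \<in> kspan (dsum J M) ?B"
      by (intro S.kspan_finsum assms(1) Bc)
    thus ?thesis using dsum_decomp[OF assms(1) R z] by simp
  qed
  moreover have "finite ?B" using assms(1) B by auto
  ultimately show ?thesis using Bc S.right_module unfolding fd_module_iff by blast
qed

subsection \<open>Submodules\<close>

lemma submodI:
  assumes "right_module A M" "L \<subseteq> carrier M" "\<zero>\<^bsub>M\<^esub> \<in> L"
    "\<And>x y. x \<in> L \<Longrightarrow> y \<in> L \<Longrightarrow> x \<oplus>\<^bsub>M\<^esub> y \<in> L"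
    "\<And>a x. a \<in> carrier A \<Longrightarrow> x \<in> L \<Longrightarrow> a \<odot>\<^bsub>M\<^esub> x \<in> L"
  shows "submod A L M"
proof -
  interpret M: rmod A M by (rule rmodI) fact
  have L: "x \<in> carrier M" if "x \<in> L" for x using that assms(2) by auto
  \<comment> \<open>Negatives arise as the action of -1 in the algebra.\<close>
  have neg: "\<ominus>\<^bsub>M\<^esub> x \<in> L" if "x \<in> L" for x
    using assms(5)[of "\<ominus> \<one>" x] M.neg_act[of \<one> x] that L by simp
  have "right_module A (M\<lparr>carrier := L\<rparr>)"
  proof (rule right_moduleI)
    show "abelian_group (M\<lparr>carrier := L\<rparr>)"
    proof (rule abelian_groupI)
      fix x assume "x \<in> carrier (M\<lparr>carrier := L\<rparr>)"
      thus "\<exists>y\<in>carrier (M\<lparr>carrier := L\<rparr>). y \<oplus>\<^bsub>M\<lparr>carrier := L\<rparr>\<^esub> x = \<zero>\<^bsub>M\<lparr>carrier := L\<rparr>\<^esub>"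
        using neg[of x] M.M.l_neg[of x] L by auto
    qed (use assms in \<open>simp_all add: L M.M.a_ac\<close>)
  qed (use assms L in \<open>simp_all add: M.act_add M.add_act M.mult_act\<close>)
  thus ?thesis using assms(2) by (simp add: submod_def)
qed

lemma submodD:
  assumes "submod A L M" "right_module A M"
  shows "L \<subseteq> carrier M" "\<zero>\<^bsub>M\<^esub> \<in> L" "x \<in> L \<Longrightarrow> y \<in> L \<Longrightarrow> x \<oplus>\<^bsub>M\<^esub> y \<in> L"
    "a \<in> carrier A \<Longrightarrow> x \<in> L \<Longrightarrow> a \<odot>\<^bsub>M\<^esub> x \<in> L"
proof -
  interpret L: rmod A "M\<lparr>carrier := L\<rparr>" using assms(1) by (auto intro: rmodI simp: submod_def)
  show "L \<subseteq> carrier M" using assms by (simp add: submod_def)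
  show "\<zero>\<^bsub>M\<^esub> \<in> L" "x \<in> L \<Longrightarrow> y \<in> L \<Longrightarrow> x \<oplus>\<^bsub>M\<^esub> y \<in> L" "a \<in> carrier A \<Longrightarrow> x \<in> L \<Longrightarrow> a \<odot>\<^bsub>M\<^esub> x \<in> L"
    using L.M.zero_closed L.M.a_closed[of x y] L.act_closed[of a x] by simp_all
qed

lemma submod_image:
  assumes "f \<in> rmod_hom A M N" "right_module A M" "right_module A N"
  shows "submod A (f ` carrier M) N"
proof -
  interpret M: rmod A M by (rule rmodI) fact
  interpret N: rmod A N by (rule rmodI) fact
  note f = homD[OF assms(1)] 
  have "f \<zero>\<^bsub>M\<^esub> = \<zero>\<^bsub>N\<^esub>" by (rule hom_zero[OF assms(1) M.M.abelian_group_axioms N.M.abelian_group_axioms])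
  thus ?thesis
    using f by (intro submodI assms) (auto simp flip: f(2,3) intro!: imageI intro: image_eqI[of _ _ "\<zero>\<^bsub>M\<^esub>"])
qed

lemma submod_kernel:
  assumes "f \<in> rmod_hom A M N" "right_module A M" "right_module A N"
  shows "submod A (a_kernel M N f) M"
proof -
  interpret M: rmod A M by (rule rmodI) fact
  interpret N: rmod A N by (rule rmodI) fact
  note f = homD[OF assms(1)] hom_zero[OF assms(1) M.M.abelian_group_axioms N.M.abelian_group_axioms]
  show ?thesis using f by (intro submodI assms) (auto simp: a_kernel_def')
qed

subsection \<open>Transport of structure\<close>

text \<open>\<open>fg_projective\<close> quantifies only over modules on the carrier type of the
  projective itself. Modules on other types, such as duals or sets of cosets, have to be copied into
  that type along an injection before its definition applies to them.\<close>

definition transport :: "('a, 'm) module \<Rightarrow> ('m \<Rightarrow> 'n) \<Rightarrow> ('a, 'n) module" where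
  "transport M s = \<lparr>carrier = s ` carrier M, mult = undefined, one = undefined, zero = s \<zero>\<^bsub>M\<^esub>,
    add = (\<lambda>x y. s (inv_into (carrier M) s x \<oplus>\<^bsub>M\<^esub> inv_into (carrier M) s y)),
    smult = (\<lambda>a x. s (a \<odot>\<^bsub>M\<^esub> inv_into (carrier M) s x))\<rparr>"

lemma transport_hom:
  assumes "inj_on s (carrier M)"
  shows "s \<in> rmod_hom A M (transport M s)"
  using assms by (intro homI) (auto simp: transport_def)

lemma transport_right_module:
  assumes "inj_on s (carrier M)" "right_module A M"
  shows "right_module A (transport M s)"
proof -
  interpret M: rmod A M by (rule rmodI) fact
  have "\<exists>w\<in>carrier (transport M s). w \<oplus>\<^bsub>transport M s\<^esub> z = \<zero>\<^bsub>transport M s\<^esub>"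
    if "z \<in> carrier (transport M s)" for z
    using that assms(1) by (auto simp: transport_def M.M.l_neg intro!: bexI[of _ "\<ominus>\<^bsub>M\<^esub> _"])
  hence "abelian_group (transport M s)"
    using assms(1) by (intro abelian_groupI; (assumption | force simp: transport_def M.M.a_ac)?)
  thus ?thesis using assms(1)
    by (intro right_moduleI) (auto simp: transport_def M.act_add M.add_act M.mult_act)
qed

lemma transport_bij: "inj_on s (carrier M) \<Longrightarrow> bij_betw s (carrier M) (carrier (transport M s))"
  by (auto simp: transport_def bij_betw_def)

lemma transport_section:
  assumes "f ` carrier P = carrier N"
  shows "inj_on (inv_into (carrier P) f) (carrier N)"
  using assms by (metis inj_on_inv_into subset_refl)

subsection \<open>Projective modules\<close>

text \<open>The target \<open>N\<close> may have any carrier type: a set-theoretic section of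
  \<open>g\<close> embeds it into the type of \<open>M\<close>, and the lifting problem is solved
  for the copy. Injectivity of the section brings the solution back.\<close>

lemma proj_lift:
  fixes P M :: "('a, 'm) module" and N :: "('a, 'n) module"
  assumes "fg_projective A P" "fd_module A M" "right_module A N"
    "g \<in> rmod_hom A M N" "g ` carrier M = carrier N" "h \<in> rmod_hom A P N"
  shows "\<exists>l\<in>rmod_hom A P M. \<forall>x\<in>carrier P. g (l x) = h x"
proof -
  define s where "s = inv_into (carrier M) g"
  have inj: "inj_on s (carrier N)" unfolding s_def by (rule transport_section) fact
  let ?N = "transport N s"
  have N: "right_module A ?N" by (rule transport_right_module) fact+
  have s: "s \<in> rmod_hom A N ?N" by (rule transport_hom) fact
  have sg: "(\<lambda>x. s (g x)) \<in> rmod_hom A M ?N" by (rule hom_comp'[OF assms(4) s])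
  have im: "(\<lambda>x. s (g x)) ` carrier M = carrier ?N"
    using assms(5) by (simp add: transport_def image_image[symmetric])
  have "fd_module A ?N" by (rule fd_image[OF assms(2) N sg im])
  moreover have "(\<lambda>x. s (h x)) \<in> rmod_hom A P ?N" by (rule hom_comp'[OF assms(6) s])
  ultimately obtain l where l: "l \<in> rmod_hom A P M" "\<forall>x\<in>carrier P. s (g (l x)) = s (h x)"
    using assms(1,2) sg im unfolding fg_projective_def by meson
  have "g (l x) = h x" if "x \<in> carrier P" for x
    using l that homD(1)[OF assms(4)] homD(1)[OF l(1)] homD(1)[OF assms(6)] inj
    by (auto dest: inj_onD)
  thus ?thesis using l(1) by blast
qed

lemma projI:
  fixes P :: "('a, 'm) module"
  assumes "fd_module A P"
    "\<And>(M :: ('a, 'm) module) (N :: ('a, 'm) module) g h.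
      right_module A M \<Longrightarrow> right_module A N \<Longrightarrow> g \<in> rmod_hom A M N \<Longrightarrow> g ` carrier M = carrier N \<Longrightarrow>
      h \<in> rmod_hom A P N \<Longrightarrow> \<exists>l\<in>rmod_hom A P M. \<forall>x\<in>carrier P. g (l x) = h x"
  shows "fg_projective A P"
  unfolding fg_projective_def using assms fd_right_module by blast

lemma proj_fd: "fg_projective A P \<Longrightarrow> fd_module A P"
  by (simp add: fg_projective_def)

lemma proj_right_module: "fg_projective A P \<Longrightarrow> right_module A P"
  using proj_fd fd_right_module by blast

lemma zero_proj:
  fixes M :: "('a, 'm) module"
  assumes "right_module A M"
  shows "fg_projective A (M\<lparr>carrier := {\<zero>\<^bsub>M\<^esub>}\<rparr>)"
proof (rule projI[OF zero_fd[OF assms]])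
  fix M' N' :: "('a, 'm) module" and g h
  let ?Z = "M\<lparr>carrier := {\<zero>\<^bsub>M\<^esub>}\<rparr>"
  assume a: "right_module A M'" "right_module A N'" "g \<in> rmod_hom A M' N'" "h \<in> rmod_hom A ?Z N'"
  have "g \<zero>\<^bsub>M'\<^esub> = \<zero>\<^bsub>N'\<^esub>" using hom_zero[OF a(3)] a right_module_ag by auto
  moreover have "h \<zero>\<^bsub>M\<^esub> = \<zero>\<^bsub>N'\<^esub>" using hom_zero[OF a(4)] a right_module_ag zero_right_module[OF assms] by auto
  ultimately show "\<exists>l\<in>rmod_hom A ?Z M'. \<forall>x\<in>carrier ?Z. g (l x) = h x"
    by (intro bexI[OF _ hom_const_zero[OF a(1)]]) auto
qed

lemma dsum_proj_mod:
  fixes M :: "'i \<Rightarrow> ('a, 'i) emodule"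
  assumes "finite J" "\<And>j. j \<in> J \<Longrightarrow> fg_projective A (M j)"
  shows "fg_projective A (dsum J M)"
proof -
  have fd: "fd_module A (M j)" if "j \<in> J" for j using assms(2)[OF that] by (simp add: fg_projective_def)
  have R: "right_module A (M j)" if "j \<in> J" for j using fd[OF that] fd_right_module by auto
  show ?thesis unfolding fg_projective_def
  proof (intro conjI allI impI dsum_fd assms(1) fd; (elim conjE)?)
    fix M' N' :: "('a, 'i) emodule" and g h
    assume a: "fd_module A M'" "fd_module A N'" "g \<in> rmod_hom A M' N'" "g ` carrier M' = carrier N'"
      "h \<in> rmod_hom A (dsum J M) N'"
    have a': "right_module A M'" "right_module A N'" using a fd_right_module by auto
    have "\<exists>l\<in>rmod_hom A (M j) M'. \<forall>x\<in>carrier (M j). g (l x) = h (dsum_in J M j x)" if "j \<in> J" for j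
      by (rule proj_lift[OF assms(2)[OF that] a(1) a'(2) a(3,4) hom_comp'[OF dsum_in_hom[OF R that] a(5)]])
    then obtain l where l: "\<And>j. j \<in> J \<Longrightarrow> l j \<in> rmod_hom A (M j) M'"
      "\<And>j x. j \<in> J \<Longrightarrow> x \<in> carrier (M j) \<Longrightarrow> g (l j x) = h (dsum_in J M j x)" by metis
    interpret N: rmod A N' by (rule rmodI[OF a'(2)])
    have "g (\<Oplus>\<^bsub>M'\<^esub>j\<in>J. l j (component z j)) = h z" if z: "z \<in> carrier (dsum J M)" for z
    proof -
      have "g (\<Oplus>\<^bsub>M'\<^esub>j\<in>J. l j (component z j)) = (\<Oplus>\<^bsub>N'\<^esub>j\<in>J. g (l j (component z j)))"
        using homD(1)[OF l(1)] dsum_component_closed[OF z] right_module_ag a'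
        by (intro hom_finsum[OF a(3)] assms(1)) auto
      also have "\<dots> = (\<Oplus>\<^bsub>N'\<^esub>j\<in>J. h (dsum_in J M j (component z j)))"
        using l(2) dsum_component_closed[OF z] homD(1)[OF a(5)] homD(1)[OF dsum_in_hom[OF R]]
        by (intro N.M.finsum_cong') auto
      also have "\<dots> = h z" using dsum_hom_eq[OF assms(1) R a'(2) a(5) z] ..
      finally show ?thesis .
    qed
    thus "\<exists>l\<in>rmod_hom A (dsum J M) M'. \<forall>x\<in>carrier (dsum J M). g (l x) = h x"
      by (intro bexI[OF _ dsum_out_hom[OF assms(1) a'(1) l(1)]]) auto
  qed
qed

lemma dsum2_proj_mod:
  fixes P P' :: "('a, 'i) emodule"
  assumes "fg_projective A P" "fg_projective A P'"
  shows "fg_projective A (dsum2 P P')"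
proof -
  have fd: "fd_module A P" "fd_module A P'" using assms by (simp_all add: fg_projective_def)
  have R: "right_module A P" "right_module A P'" using fd fd_right_module by auto
  interpret P: rmod A P by (rule rmodI[OF R(1)])
  interpret P': rmod A P' by (rule rmodI[OF R(2)])
  show ?thesis unfolding fg_projective_def
  proof (intro conjI allI impI dsum2_fd fd; (elim conjE)?)
    fix M' N' :: "('a, 'i) emodule" and g h
    assume a: "fd_module A M'" "fd_module A N'" "g \<in> rmod_hom A M' N'" "g ` carrier M' = carrier N'"
      "h \<in> rmod_hom A (dsum2 P P') N'"
    have a': "right_module A M'" "right_module A N'" using a fd_right_module by auto
    obtain l where l: "l \<in> rmod_hom A P M'" "\<And>x. x \<in> carrier P \<Longrightarrow> g (l x) = h (Two x \<zero>\<^bsub>P'\<^esub>)"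
      using proj_lift[OF assms(1) a(1) a'(2) a(3,4) hom_comp'[OF dsum2_inl[OF R(2)] a(5)]] by blast
    obtain l' where l': "l' \<in> rmod_hom A P' M'" "\<And>x. x \<in> carrier P' \<Longrightarrow> g (l' x) = h (Two \<zero>\<^bsub>P\<^esub> x)"
      using proj_lift[OF assms(2) a(1) a'(2) a(3,4) hom_comp'[OF dsum2_inr[OF R(1)] a(5)]] by blast
    have "(\<lambda>z. l (first z) \<oplus>\<^bsub>M'\<^esub> l' (second z)) \<in> rmod_hom A (dsum2 P P') M'"
      by (intro hom_add hom_comp'[OF dsum2_fst l(1)] hom_comp'[OF dsum2_snd l'(1)] a')
    moreover have "g (l x \<oplus>\<^bsub>M'\<^esub> l' y) = h (Two x y)" if "x \<in> carrier P" "y \<in> carrier P'" for x y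
      using homD(2)[OF a(5), of "Two x \<zero>\<^bsub>P'\<^esub>" "Two \<zero>\<^bsub>P\<^esub> y"] that homD(2)[OF a(3)] l l'
        homD(1)[OF l(1)] homD(1)[OF l'(1)] by simp
    ultimately show "\<exists>l\<in>rmod_hom A (dsum2 P P') M'. \<forall>x\<in>carrier (dsum2 P P'). g (l x) = h x"
      by (intro bexI) auto
  qed
qed

subsection \<open>Projective covers\<close>

lemma superfluous_surj:
  assumes "superfluous A (a_kernel P M p) P" "right_module A P" "right_module A Q" "right_module A M"
    "p \<in> rmod_hom A P M" "f \<in> rmod_hom A Q P" "p ` f ` carrier Q = p ` carrier P"
  shows "f ` carrier Q = carrier P"
proof -
  interpret P: rmod A P by (rule rmodI) fact
  interpret M: rmod A M by (rule rmodI) fact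
  have "carrier P \<subseteq> f ` carrier Q <+>\<^bsub>P\<^esub> a_kernel P M p"
  proof
    fix x assume x: "x \<in> carrier P"
    hence "p x \<in> p ` f ` carrier Q" using assms(7) by auto
    then obtain y where y: "y \<in> carrier Q" "p x = p (f y)" by auto
    have fy: "f y \<in> carrier P" using homD(1)[OF assms(6)] y by auto
    have "x \<ominus>\<^bsub>P\<^esub> f y \<in> a_kernel P M p"
      using x fy y homD(1)[OF assms(5)]
      by (simp add: a_kernel_def' hom_minus[OF assms(5)] P.M.abelian_group_axioms M.M.abelian_group_axioms M.M.minus_eq_zero_iff)
    moreover have "x = f y \<oplus>\<^bsub>P\<^esub> (x \<ominus>\<^bsub>P\<^esub> f y)"
      using x fy P.M.minus_eq_iff[of x "f y" "x \<ominus>\<^bsub>P\<^esub> f y"] by (simp add: P.M.a_comm)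
    ultimately show "x \<in> f ` carrier Q <+>\<^bsub>P\<^esub> a_kernel P M p"
      using y(1) by (auto simp: set_add_def')
  qed
  moreover have "f ` carrier Q <+>\<^bsub>P\<^esub> a_kernel P M p \<subseteq> carrier P"
    using homD(1)[OF assms(6)] by (auto simp: set_add_def' a_kernel_def')
  ultimately show ?thesis
    using assms(1) submod_image[OF assms(6,3,2)] unfolding superfluous_def by blast
qed

lemma projective_cover_unique:
  fixes P P' :: "('a, 'm) module" and M :: "('a, 'n) module"
  assumes "projective_cover A P p M" "projective_cover A P' p' M" "right_module A M"
  shows "\<exists>t\<in>rmod_hom A P P'. bij_betw t (carrier P) (carrier P') \<and> (\<forall>x\<in>carrier P. p' (t x) = p x)"
proof -
  have P: "fg_projective A P" "fd_module A P" "right_module A P" "p \<in> rmod_hom A P M"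
    "p ` carrier P = carrier M" "superfluous A (a_kernel P M p) P"
    using assms(1) by (auto simp: projective_cover_def dest: proj_fd proj_right_module)
  have P': "fg_projective A P'" "fd_module A P'" "right_module A P'" "p' \<in> rmod_hom A P' M"
    "p' ` carrier P' = carrier M" "superfluous A (a_kernel P' M p') P'"
    using assms(2) by (auto simp: projective_cover_def dest: proj_fd proj_right_module)
  obtain t where t: "t \<in> rmod_hom A P P'" "\<And>x. x \<in> carrier P \<Longrightarrow> p' (t x) = p x"
    using proj_lift[OF P(1) P'(2) assms(3) P'(4,5) P(4)] by blast
  have surj: "t ` carrier P = carrier P'"
    by (rule superfluous_surj[OF P'(6,3) P(3) assms(3) P'(4) t(1)])
      (use t(2) P(5) P'(5) in \<open>simp add: image_image\<close>)
  obtain s where s: "s \<in> rmod_hom A P' P" "\<And>x. x \<in> carrier P' \<Longrightarrow> t (s x) = x"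
    using proj_lift[OF P'(1) P(2) P'(3) t(1) surj hom_id] by blast
  have ps: "p (s x) = p' x" if "x \<in> carrier P'" for x
    using s(2)[OF that] t(2)[of "s x"] homD(1)[OF s(1) that] by simp
  have "s ` carrier P' = carrier P"
    by (rule superfluous_surj[OF P(6,3) P'(3) assms(3) P(4) s(1)])
      (use ps P(5) P'(5) in \<open>simp add: image_image\<close>)
  hence "inj_on t (carrier P)" using s(2) unfolding inj_on_def by (metis imageE)
  thus ?thesis using t surj by (auto simp: bij_betw_def)
qed

text \<open>Uniqueness of covers is used twice. The isomorphism \<open>t\<close> of the degree 0
  terms carries the kernel of \<open>p0\<close> onto that of \<open>p0'\<close>; composing
  \<open>p1\<close> with it does not change the kernel of \<open>p1\<close>, so the composite is
  still a cover, now of the second kernel.\<close>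

lemma min_presentation_unique:
  fixes P0 P0' P1 P1' :: "('a, 'm) module" and M :: "('a, 'n) module"
  assumes "min_presentation A P1 p1 P0 p0 M" "min_presentation A P1' p1' P0' p0' M" "right_module A M"
  shows "\<exists>t1\<in>rmod_hom A P1 P1'. \<exists>t0\<in>rmod_hom A P0 P0'.
    bij_betw t1 (carrier P1) (carrier P1') \<and> bij_betw t0 (carrier P0) (carrier P0') \<and>
    (\<forall>x\<in>carrier P1. p1' (t1 x) = t0 (p1 x))"
proof -
  let ?K = "P0\<lparr>carrier := a_kernel P0 M p0\<rparr>" and ?K' = "P0'\<lparr>carrier := a_kernel P0' M p0'\<rparr>"
  have c: "projective_cover A P0 p0 M" "projective_cover A P0' p0' M"
    "projective_cover A P1 p1 ?K" "projective_cover A P1' p1' ?K'"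
    using assms by (auto simp: min_presentation_def)
  have R: "right_module A P0" "right_module A P0'" "p0 \<in> rmod_hom A P0 M" "p0' \<in> rmod_hom A P0' M"
    "right_module A P1" "right_module A P1'"
    using c by (auto simp: projective_cover_def dest: proj_fd proj_right_module)
  obtain t where t: "t \<in> rmod_hom A P0 P0'" "bij_betw t (carrier P0) (carrier P0')"
    "\<And>x. x \<in> carrier P0 \<Longrightarrow> p0' (t x) = p0 x"
    using projective_cover_unique[OF c(1,2) assms(3)] by blast
  have K': "right_module A ?K'" using submod_kernel[OF R(4,2) assms(3)] by (simp add: submod_def)
  have K: "right_module A ?K" using submod_kernel[OF R(3,1) assms(3)] by (simp add: submod_def)
  interpret P0: rmod A P0 by (rule rmodI) fact
  interpret P0': rmod A P0' by (rule rmodI) fact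
  have tz: "t \<zero>\<^bsub>P0\<^esub> = \<zero>\<^bsub>P0'\<^esub>" by (rule hom_zero[OF t(1) P0.M.abelian_group_axioms P0'.M.abelian_group_axioms])
  have tK: "t ` a_kernel P0 M p0 = a_kernel P0' M p0'"
    using t(2,3) unfolding a_kernel_def' bij_betw_def by (auto 0 3 simp: image_iff)
  have tK_hom: "t \<in> rmod_hom A ?K ?K'"
    using homD[OF t(1)] tK by (intro homI) (auto simp: a_kernel_def')
  have p1: "p1 \<in> rmod_hom A P1 ?K" "p1 ` carrier P1 = carrier ?K" "fg_projective A P1"
    "superfluous A (a_kernel P1 ?K p1) P1"
    using c(3) by (auto simp: projective_cover_def)
  have inj: "t x = \<zero>\<^bsub>P0'\<^esub> \<longleftrightarrow> x = \<zero>\<^bsub>P0\<^esub>" if "x \<in> carrier P0" for x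
    using t(2) that tz P0.M.zero_closed by (metis bij_betw_def inj_onD)
  have "a_kernel P1 ?K' (\<lambda>x. t (p1 x)) = a_kernel P1 ?K p1"
    using homD(1)[OF p1(1)] inj by (auto simp: a_kernel_def')
  hence "projective_cover A P1 (\<lambda>x. t (p1 x)) ?K'"
    using p1 hom_comp'[OF p1(1) tK_hom] tK unfolding projective_cover_def
    by (auto simp flip: image_image)
  then obtain t1 where "t1 \<in> rmod_hom A P1 P1'" "bij_betw t1 (carrier P1) (carrier P1')"
    "\<forall>x\<in>carrier P1. p1' (t1 x) = t (p1 x)"
    using projective_cover_unique[OF _ c(4) K'] by blast
  thus ?thesis using t by blast
qed

end

subsection \<open>Modules generated by an idempotent\<close>

text \<open>The right ideal eA in the encoding of \<open>proj_at\<close>, over any algebra. The same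
  lemmas then serve the projectives over \<open>A\<close> and those over
  \<open>opp A\<close>.\<close>

definition idem_mod :: "('k, 'a) module \<Rightarrow> 'a \<Rightarrow> ('a, 'i) emodule" where
  "idem_mod A e =
    \<lparr>carrier = {Elem (e \<otimes>\<^bsub>A\<^esub> a) | a. a \<in> carrier A},
     mult = undefined, one = undefined, zero = Elem \<zero>\<^bsub>A\<^esub>,
     add = (\<lambda>x y. Elem (the_elem_of x \<oplus>\<^bsub>A\<^esub> the_elem_of y)),
     smult = (\<lambda>a x. Elem (the_elem_of x \<otimes>\<^bsub>A\<^esub> a))\<rparr>"

lemma idem_mod_simps [simp]:
  "zero (idem_mod A e) = Elem \<zero>\<^bsub>A\<^esub>"
  "x \<oplus>\<^bsub>idem_mod A e\<^esub> y = Elem (the_elem_of x \<oplus>\<^bsub>A\<^esub> the_elem_of y)"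
  "a \<odot>\<^bsub>idem_mod A e\<^esub> x = Elem (the_elem_of x \<otimes>\<^bsub>A\<^esub> a)"
  by (simp_all add: idem_mod_def)

locale idem = kalg A for A :: "('k::field, 'a) module" (structure) +
  fixes e assumes e_closed [simp]: "e \<in> carrier A" and e_idem [simp]: "e \<otimes> e = e"
begin

lemma idem_carrier: "z \<in> carrier (idem_mod A e) \<longleftrightarrow> (\<exists>x\<in>carrier A. e \<otimes> x = x \<and> z = Elem x)"
proof
  assume "z \<in> carrier (idem_mod A e)"
  then obtain a where "a \<in> carrier A" "z = Elem (e \<otimes> a)" by (auto simp: idem_mod_def)
  thus "\<exists>x\<in>carrier A. e \<otimes> x = x \<and> z = Elem x"
    by (intro bexI[of _ "e \<otimes> a"]) (simp_all add: m_assoc[symmetric])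
qed (auto simp: idem_mod_def intro: exI[of _ "the_elem_of z"])

lemma Elem_idem_iff [simp]: "Elem x \<in> carrier (idem_mod A e) \<longleftrightarrow> x \<in> carrier A \<and> e \<otimes> x = x"
  by (auto simp: idem_carrier)

lemma idem_carrierE:
  assumes "z \<in> carrier (idem_mod A e)"
  obtains x where "x \<in> carrier A" "e \<otimes> x = x" "z = Elem x"
  using assms idem_carrier by blast

lemma idem_right_module: "right_module A (idem_mod A e)"
proof (rule right_moduleI)
  show "abelian_group (idem_mod A e)"
  proof (rule abelian_groupI)
    fix z assume "z \<in> carrier (idem_mod A e)"
    then obtain x where "x \<in> carrier A" "e \<otimes> x = x" "z = Elem x" by (rule idem_carrierE)
    thus "\<exists>w\<in>carrier (idem_mod A e). w \<oplus>\<^bsub>idem_mod A e\<^esub> z = \<zero>\<^bsub>idem_mod A e\<^esub>"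
      by (intro bexI[of _ "Elem (\<ominus> x)"]) (simp_all add: l_neg r_minus)
  qed (auto elim!: idem_carrierE simp: r_distr a_ac)
qed (auto elim!: idem_carrierE simp: r_distr l_distr m_assoc[symmetric])

text \<open>A map out of eA is left multiplication by an element of the target;
  \<open>idem_hom_eq\<close> is the converse, with the image of e as that element.\<close>

lemma idem_hom:
  assumes "right_module A M" "m \<in> carrier M" 
  shows "(\<lambda>z. the_elem_of z \<odot>\<^bsub>M\<^esub> m) \<in> rmod_hom A (idem_mod A e) M"
proof -
  interpret M: rmod A M by (rule rmodI) fact
  show ?thesis using assms(2)
    by (intro homI) (auto elim!: idem_carrierE simp: M.add_act M.mult_act)
qed

lemma idem_hom_eq:
  assumes "g \<in> rmod_hom A (idem_mod A e) M" "x \<in> carrier A" "e \<otimes> x = x"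
  shows "g (Elem x) = x \<odot>\<^bsub>M\<^esub> g (Elem e)"
  using homD(3)[OF assms(1,2), of "Elem e"] assms(3) by simp

lemma idem_fd:
  assumes "fd_module A (regular A)"
  shows "fd_module A (idem_mod A e :: ('a, 'i) emodule)"
proof (rule fd_image[OF assms idem_right_module])
  show "(\<lambda>x. Elem (e \<otimes> x)) \<in> rmod_hom A (regular A) (idem_mod A e)"
    by (intro homI) (auto simp: regular_def r_distr m_assoc[symmetric])
  show "(\<lambda>x. Elem (e \<otimes> x)) ` carrier (regular A) = carrier (idem_mod A e)"
    by (auto simp: idem_mod_def regular_def)
qed

text \<open>Any preimage \<open>m\<close> of \<open>h\<close> at the generator gives a lift: the
  elements of eA satisfy ex = x, so g(mx) = h(e)x = h(x).\<close>

lemma idem_proj: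
  assumes "fd_module A (regular A)"
  shows "fg_projective A (idem_mod A e :: ('a, 'i) emodule)"
proof (rule projI[OF idem_fd[OF assms]])
  fix M N :: "('a, 'i) emodule" and g h
  assume a: "right_module A M" "right_module A N" "g \<in> rmod_hom A M N" "g ` carrier M = carrier N"
    "h \<in> rmod_hom A (idem_mod A e) N"
  have "h (Elem e) \<in> carrier N" using homD(1)[OF a(5)] by simp
  then obtain m where m: "m \<in> carrier M" "g m = h (Elem e)" using a(4) by (metis imageE)
  have "g (the_elem_of z \<odot>\<^bsub>M\<^esub> m) = h z" if z: "z \<in> carrier (idem_mod A e)" for z
  proof -
    obtain x where x: "x \<in> carrier A" "e \<otimes> x = x" "z = Elem x" using z by (rule idem_carrierE)
    thus ?thesis using m(2) homD(3)[OF a(3) x(1) m(1)] idem_hom_eq[OF a(5) x(1,2)] by simp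
  qed
  thus "\<exists>l\<in>rmod_hom A (idem_mod A e) M. \<forall>x\<in>carrier (idem_mod A e). g (l x) = h x"
    by (intro bexI[OF _ idem_hom[OF a(1) m(1)]]) simp
qed

end

context kalg begin

lemma idemI: "e \<in> carrier A \<Longrightarrow> e \<otimes> e = e \<Longrightarrow> idem A e"
  by (intro idem.intro kalg_axioms idem_axioms.intro)

lemma regular_right_module: "right_module A (regular A)"
proof (rule right_moduleI)
  show "abelian_group (regular A)"
    by (rule abelian_group_cong[OF abelian_group_axioms]) (simp_all add: regular_def)
qed (simp_all add: regular_def l_distr r_distr m_assoc)

text \<open>Scalars are central, so the same finite set spans the algebra from either side.\<close>

lemma regular_opp_fd:
  assumes "fd_module A (regular A)"
  shows "fd_module (opp A) (regular (opp A))"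
proof -
  interpret o: kalg "opp A" by (rule kalg_opp)
  obtain B where B: "finite B" "B \<subseteq> carrier A" "carrier A \<subseteq> kspan (regular A) B"
    using assms by (auto simp: fd_module_iff regular_def)
  have "x \<in> o.kspan (regular (opp A)) B" if "x \<in> kspan (regular A) B" for x
    using that
  proof induction
    case zero
    thus ?case using o.kspan.zero[of "regular (opp A)" B] by (simp add: regular_def)
  next
    case (step b y c)
    thus ?case using o.kspan.step[of b B y "regular (opp A)" c] B(2) sc_central[of b c]
      by (auto simp: regular_def scal_def)
  qed
  thus ?thesis using B o.regular_right_module
    by (auto simp: o.fd_module_iff regular_def intro!: exI[of _ B])
qed

subsection \<open>Nakayama's lemma\<close>

inductive_set mod_gen :: "('a, 'm) module \<Rightarrow> 'a set \<Rightarrow> 'm set" for M X where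
  zero: "\<zero>\<^bsub>M\<^esub> \<in> mod_gen M X"
| step: "a \<in> X \<Longrightarrow> y \<in> carrier M \<Longrightarrow> s \<in> mod_gen M X \<Longrightarrow> (a \<odot>\<^bsub>M\<^esub> y) \<oplus>\<^bsub>M\<^esub> s \<in> mod_gen M X"

end

context rmod begin

lemma mod_gen_carrier: "s \<in> mod_gen M X \<Longrightarrow> X \<subseteq> carrier A \<Longrightarrow> s \<in> carrier M"
  by (induction rule: mod_gen.induct) auto

lemma mod_gen_add:
  assumes "X \<subseteq> carrier A" "t \<in> mod_gen M X"
  shows "s \<in> mod_gen M X \<Longrightarrow> s \<oplus>\<^bsub>M\<^esub> t \<in> mod_gen M X"
proof (induction rule: mod_gen.induct)
  case zero
  thus ?case using assms mod_gen_carrier by simp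
next
  case (step a y s)
  have "a \<in> carrier A" "s \<in> carrier M" "t \<in> carrier M" using step assms mod_gen_carrier by auto
  hence "(a \<odot>\<^bsub>M\<^esub> y) \<oplus>\<^bsub>M\<^esub> s \<oplus>\<^bsub>M\<^esub> t = (a \<odot>\<^bsub>M\<^esub> y) \<oplus>\<^bsub>M\<^esub> (s \<oplus>\<^bsub>M\<^esub> t)"
    using step by (simp add: M.a_assoc)
  thus ?case using step mod_gen.step by simp
qed

lemma mod_gen_base:
  assumes "a \<in> X" "y \<in> carrier M" "X \<subseteq> carrier A"
  shows "a \<odot>\<^bsub>M\<^esub> y \<in> mod_gen M X"
proof -
  have "a \<odot>\<^bsub>M\<^esub> y \<in> carrier M" using assms by auto
  thus ?thesis using mod_gen.step[OF assms(1,2) mod_gen.zero] by simp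
qed

lemma mod_gen_act:
  assumes "X \<subseteq> carrier A" "b \<in> carrier A" "\<And>a. a \<in> X \<Longrightarrow> a \<otimes> b \<in> Y"
  shows "s \<in> mod_gen M X \<Longrightarrow> b \<odot>\<^bsub>M\<^esub> s \<in> mod_gen M Y"
proof (induction rule: mod_gen.induct)
  case zero
  show ?case using assms(2) mod_gen.zero by simp
next
  case (step a y s)
  have "a \<in> carrier A" "s \<in> carrier M" using step assms mod_gen_carrier by auto
  hence "b \<odot>\<^bsub>M\<^esub> ((a \<odot>\<^bsub>M\<^esub> y) \<oplus>\<^bsub>M\<^esub> s) = ((a \<otimes> b) \<odot>\<^bsub>M\<^esub> y) \<oplus>\<^bsub>M\<^esub> (b \<odot>\<^bsub>M\<^esub> s)"
    using step assms(2) by (simp add: act_add mult_act)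
  thus ?case using step mod_gen.step assms(3) by metis
qed

text \<open>The sets \<open>X i\<close> play the role of the powers of the radical. Substituting M =
  L + M X(i) into each generator y r of M R turns M = L + M R into M = L + M X(i+1); at i = m the
  second summand vanishes.\<close>

lemma nakayama:
  assumes "R \<subseteq> carrier A" "\<And>i. X i \<subseteq> carrier A" "X 0 = carrier A" "X m \<subseteq> {\<zero>}"
    "\<And>i a r. a \<in> X i \<Longrightarrow> r \<in> R \<Longrightarrow> a \<otimes> r \<in> X (Suc i)"
    "submod A L M" "N \<subseteq> mod_gen M R" "L <+>\<^bsub>M\<^esub> N = carrier M"
  shows "L = carrier M"
proof -
  note L = submodD[OF assms(6) right_module]
  have Lc: "x \<in> carrier M" if "x \<in> L" for x using L(1) that by auto
  have key: "\<exists>l\<in>L. \<exists>s\<in>mod_gen M (X i). x = l \<oplus>\<^bsub>M\<^esub> s" if "x \<in> carrier M" for i x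
    using that
  proof (induction i arbitrary: x)
    case 0
    have "x \<in> mod_gen M (X 0)" using mod_gen_base[of \<one> "X 0" x] assms(3) 0 by simp
    thus ?case using L(2) 0 by (intro bexI[of _ "\<zero>\<^bsub>M\<^esub>"] bexI[of _ x]) simp_all
  next
    case (Suc i)
    have gen: "\<exists>l\<in>L. \<exists>s\<in>mod_gen M (X (Suc i)). n = l \<oplus>\<^bsub>M\<^esub> s" if "n \<in> mod_gen M R" for n
      using that
    proof induction
      case zero
      thus ?case using L(2) mod_gen.zero[of M "X (Suc i)"]
        by (intro bexI[of _ "\<zero>\<^bsub>M\<^esub>"]) simp_all
    next
      case (step r y n)
      obtain l s where ls: "l \<in> L" "s \<in> mod_gen M (X (Suc i))" "n = l \<oplus>\<^bsub>M\<^esub> s" using step by auto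
      obtain l' s' where ls': "l' \<in> L" "s' \<in> mod_gen M (X i)" "y = l' \<oplus>\<^bsub>M\<^esub> s'"
        using Suc.IH[OF step(2)] by auto
      have r: "r \<in> carrier A" using step assms(1) by auto
      have rs: "r \<odot>\<^bsub>M\<^esub> s' \<in> mod_gen M (X (Suc i))"
        using mod_gen_act[OF assms(2) r assms(5)[OF _ step(1)] ls'(2)] .
      have c: "s \<in> carrier M" "s' \<in> carrier M" using ls ls' mod_gen_carrier assms(2) by blast+
      have "(r \<odot>\<^bsub>M\<^esub> y) \<oplus>\<^bsub>M\<^esub> n = (r \<odot>\<^bsub>M\<^esub> l' \<oplus>\<^bsub>M\<^esub> l) \<oplus>\<^bsub>M\<^esub> (r \<odot>\<^bsub>M\<^esub> s' \<oplus>\<^bsub>M\<^esub> s)"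
        using ls ls' r c Lc by (simp add: act_add M.a_ac)
      moreover have "r \<odot>\<^bsub>M\<^esub> l' \<oplus>\<^bsub>M\<^esub> l \<in> L" using L ls ls' r by simp
      moreover have "r \<odot>\<^bsub>M\<^esub> s' \<oplus>\<^bsub>M\<^esub> s \<in> mod_gen M (X (Suc i))" using mod_gen_add[OF assms(2) ls(2) rs] .
      ultimately show ?case by blast
    qed
    obtain l n where ln: "l \<in> L" "n \<in> N" "x = l \<oplus>\<^bsub>M\<^esub> n"
    proof -
      have "x \<in> (\<Union>l\<in>L. \<Union>n\<in>N. {l \<oplus>\<^bsub>M\<^esub> n})" using Suc.prems assms(8) unfolding set_add_def' by simp
      thus ?thesis using that by blast
    qed
    then obtain l' s where ls: "l' \<in> L" "s \<in> mod_gen M (X (Suc i))" "n = l' \<oplus>\<^bsub>M\<^esub> s"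
      using gen assms(7) by blast
    have "s \<in> carrier M" using ls mod_gen_carrier assms(2) by blast
    hence "x = (l \<oplus>\<^bsub>M\<^esub> l') \<oplus>\<^bsub>M\<^esub> s" using ln ls Lc by (simp add: M.a_assoc)
    thus ?case using ls ln L(3) by blast
  qed
  have zero: "s = \<zero>\<^bsub>M\<^esub>" if "s \<in> mod_gen M (X m)" for s
    using that assms(4) by induction auto
  have "x \<in> L" if x: "x \<in> carrier M" for x
    using key[OF x, of m] zero Lc by fastforce
  thus ?thesis using L(1) by blast
qed

end

section \<open>Arithmetic of differences in abelian groups\<close>

context abelian_group
begin

lemma diff_add_eq: "x \<in> carrier G \<Longrightarrow> y \<in> carrier G \<Longrightarrow> z \<in> carrier G \<Longrightarrow> (x \<ominus> y) \<oplus> z = (x \<oplus> z) \<ominus> y"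
  by (simp add: a_minus_def a_ac)

lemma add_diff_eq: "x \<in> carrier G \<Longrightarrow> y \<in> carrier G \<Longrightarrow> z \<in> carrier G \<Longrightarrow> x \<oplus> (y \<ominus> z) = (x \<oplus> y) \<ominus> z"
  by (simp add: a_minus_def a_ac)

lemma diff_diff_eq: "x \<in> carrier G \<Longrightarrow> y \<in> carrier G \<Longrightarrow> z \<in> carrier G \<Longrightarrow> (x \<ominus> y) \<ominus> z = x \<ominus> (y \<oplus> z)"
  by (simp add: a_minus_def a_ac minus_add)

lemma diff_diff_eq2: "x \<in> carrier G \<Longrightarrow> y \<in> carrier G \<Longrightarrow> z \<in> carrier G \<Longrightarrow> x \<ominus> (y \<ominus> z) = (x \<oplus> z) \<ominus> y"
  by (simp add: a_minus_def a_ac minus_add minus_minus)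

lemma eq_diff_iff: "x \<in> carrier G \<Longrightarrow> y \<in> carrier G \<Longrightarrow> z \<in> carrier G \<Longrightarrow> z = x \<ominus> y \<longleftrightarrow> z \<oplus> y = x"
  using minus_eq_iff by metis

lemma neg_to_diff:
  "x \<in> carrier G \<Longrightarrow> y \<in> carrier G \<Longrightarrow> (\<ominus> x) \<oplus> y = y \<ominus> x"
  "x \<in> carrier G \<Longrightarrow> y \<in> carrier G \<Longrightarrow> y \<oplus> (\<ominus> x) = y \<ominus> x"
  "x \<in> carrier G \<Longrightarrow> y \<in> carrier G \<Longrightarrow> y \<ominus> (\<ominus> x) = y \<oplus> x"
  "x \<in> carrier G \<Longrightarrow> y \<in> carrier G \<Longrightarrow> \<ominus> x \<ominus> y = \<ominus> (x \<oplus> y)"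
  "x \<in> carrier G \<Longrightarrow> y \<in> carrier G \<Longrightarrow> \<ominus> (x \<ominus> y) = y \<ominus> x"
  "x \<in> carrier G \<Longrightarrow> y \<in> carrier G \<Longrightarrow> \<ominus> x = y \<longleftrightarrow> x \<oplus> y = \<zero>"
  "x \<in> carrier G \<Longrightarrow> y \<in> carrier G \<Longrightarrow> y = \<ominus> x \<longleftrightarrow> x \<oplus> y = \<zero>"
  "x \<in> carrier G \<Longrightarrow> x \<ominus> \<zero> = x"
  by (simp_all add: a_minus_def a_ac minus_add minus_minus)
    (metis a_comm add.inv_closed minus_equality r_neg)+

end

lemmas ag_diff =
  abelian_group.diff_add_eq abelian_group.add_diff_eq abelian_group.diff_diff_eq abelian_group.diff_diff_eq2
  abelian_group.eq_diff_iff abelian_group.minus_eq_iff abelian_group.neg_to_diff abelian_group.minus_closed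
  abelian_group.a_inv_closed abelian_group.minus_minus abelian_groupE(1,2)
  abelian_monoid.l_zero[OF abelian_group.axioms(1)] abelian_monoid.r_zero[OF abelian_group.axioms(1)]

section \<open>Complexes\<close>

context kalg begin

abbreviation cx :: "('a, 'm) cpx \<Rightarrow> bool" where "cx \<equiv> bounded_cpx A"
abbreviation cm :: "('a, 'm) cpx \<Rightarrow> ('a, 'm) cpx \<Rightarrow> (int \<Rightarrow> 'm \<Rightarrow> 'm) \<Rightarrow> bool" where "cm \<equiv> chain_map A"

lemma cx_fd: "cx X \<Longrightarrow> fd_module A (obj X n)"
  by (simp add: bounded_cpx_def)

lemma cx_rm: "cx X \<Longrightarrow> right_module A (obj X n)"
  using cx_fd fd_right_module by blast

lemma cx_ag: "cx X \<Longrightarrow> abelian_group (obj X n)"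
  using cx_fd fd_ag by blast

lemma cx_hom: "cx X \<Longrightarrow> m = n + 1 \<Longrightarrow> dif X n \<in> rmod_hom A (obj X n) (obj X m)"
  by (simp add: bounded_cpx_def)

lemma d_closed: "cx X \<Longrightarrow> x \<in> carrier (obj X n) \<Longrightarrow> m = n + 1 \<Longrightarrow> dif X n x \<in> carrier (obj X m)"
  by (rule homD(1)[OF cx_hom])

lemma d_add:
  "cx X \<Longrightarrow> m = n + 1 \<Longrightarrow> x \<in> carrier (obj X n) \<Longrightarrow> y \<in> carrier (obj X n) \<Longrightarrow>
    dif X n (x \<oplus>\<^bsub>obj X n\<^esub> y) = dif X n x \<oplus>\<^bsub>obj X m\<^esub> dif X n y"
  by (rule homD(2)[OF cx_hom])

lemma d_act:
  "cx X \<Longrightarrow> m = n + 1 \<Longrightarrow> x \<in> carrier (obj X n) \<Longrightarrow> a \<in> carrier A \<Longrightarrow>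
    dif X n (a \<odot>\<^bsub>obj X n\<^esub> x) = a \<odot>\<^bsub>obj X m\<^esub> dif X n x"
  by (rule homD(3)[OF cx_hom])

lemma d_zero: "cx X \<Longrightarrow> m = n + 1 \<Longrightarrow> dif X n \<zero>\<^bsub>obj X n\<^esub> = \<zero>\<^bsub>obj X m\<^esub>"
  by (rule hom_zero[OF cx_hom cx_ag cx_ag])

lemma d_neg:
  "cx X \<Longrightarrow> m = n + 1 \<Longrightarrow> x \<in> carrier (obj X n) \<Longrightarrow> dif X n (\<ominus>\<^bsub>obj X n\<^esub> x) = \<ominus>\<^bsub>obj X m\<^esub> dif X n x"
  by (rule hom_neg[OF cx_hom cx_ag cx_ag])

lemma d_minus:
  "cx X \<Longrightarrow> m = n + 1 \<Longrightarrow> x \<in> carrier (obj X n) \<Longrightarrow> y \<in> carrier (obj X n) \<Longrightarrow>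
    dif X n (x \<ominus>\<^bsub>obj X n\<^esub> y) = dif X n x \<ominus>\<^bsub>obj X m\<^esub> dif X n y"
  by (rule hom_minus[OF cx_hom cx_ag cx_ag])

lemma d_d: "cx X \<Longrightarrow> x \<in> carrier (obj X n) \<Longrightarrow> m = n + 1 \<Longrightarrow> l = m + 1 \<Longrightarrow> dif X m (dif X n x) = \<zero>\<^bsub>obj X l\<^esub>"
  by (simp add: bounded_cpx_def)

lemma cx_act: "cx X \<Longrightarrow> a \<in> carrier A \<Longrightarrow> x \<in> carrier (obj X n) \<Longrightarrow> a \<odot>\<^bsub>obj X n\<^esub> x \<in> carrier (obj X n)"
  by (rule rmod.act_closed[OF rmodI[OF cx_rm]])

lemma cm_hom: "cm X Y f \<Longrightarrow> f n \<in> rmod_hom A (obj X n) (obj Y n)"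
  by (simp add: chain_map_def)

lemma cm_closed: "cm X Y f \<Longrightarrow> x \<in> carrier (obj X n) \<Longrightarrow> f n x \<in> carrier (obj Y n)"
  by (rule homD(1)[OF cm_hom])

lemma cm_add: "cm X Y f \<Longrightarrow> x \<in> carrier (obj X n) \<Longrightarrow> y \<in> carrier (obj X n) \<Longrightarrow>
    f n (x \<oplus>\<^bsub>obj X n\<^esub> y) = f n x \<oplus>\<^bsub>obj Y n\<^esub> f n y"
  by (rule homD(2)[OF cm_hom])

lemma cm_act: "cm X Y f \<Longrightarrow> x \<in> carrier (obj X n) \<Longrightarrow> a \<in> carrier A \<Longrightarrow>
    f n (a \<odot>\<^bsub>obj X n\<^esub> x) = a \<odot>\<^bsub>obj Y n\<^esub> f n x"
  by (rule homD(3)[OF cm_hom])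

lemma cm_zero: "cm X Y f \<Longrightarrow> cx X \<Longrightarrow> cx Y \<Longrightarrow> f n \<zero>\<^bsub>obj X n\<^esub> = \<zero>\<^bsub>obj Y n\<^esub>"
  by (rule hom_zero[OF cm_hom cx_ag cx_ag])

lemma cm_minus: "cm X Y f \<Longrightarrow> cx X \<Longrightarrow> cx Y \<Longrightarrow> x \<in> carrier (obj X n) \<Longrightarrow> y \<in> carrier (obj X n) \<Longrightarrow>
    f n (x \<ominus>\<^bsub>obj X n\<^esub> y) = f n x \<ominus>\<^bsub>obj Y n\<^esub> f n y"
  by (rule hom_minus[OF cm_hom cx_ag cx_ag])

lemma cm_d: "cm X Y f \<Longrightarrow> x \<in> carrier (obj X n) \<Longrightarrow> m = n + 1 \<Longrightarrow> f m (dif X n x) = dif Y n (f n x)"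
  by (simp add: chain_map_def)

lemma cm_comp: "cm X Y f \<Longrightarrow> cm Y Z g \<Longrightarrow> cm X Z (chain_comp g f)"
  unfolding chain_map_def[of A X Z] chain_comp_def
  using cm_hom[of X Y f] cm_hom[of Y Z g]
  by (auto intro: hom_comp simp: cm_d[of X Y f] cm_d[of Y Z g] cm_closed[of X Y f])

lemma cm_id: "cm X X (\<lambda>n x. x)"
  by (simp add: chain_map_def hom_id)

lemma cm_zero_map: "cx X \<Longrightarrow> cx Y \<Longrightarrow> cm X Y (\<lambda>n x. \<zero>\<^bsub>obj Y n\<^esub>)"
  by (simp add: chain_map_def hom_const_zero cx_rm d_zero)

subsection \<open>Cocycles and coboundaries\<close>

lemma cocycles_iff: "m = n + 1 \<Longrightarrow> x \<in> cocycles X n \<longleftrightarrow> x \<in> carrier (obj X n) \<and> dif X n x = \<zero>\<^bsub>obj X m\<^esub>"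
  by (simp add: cocycles_def a_kernel_def')

lemma cobI: "x \<in> carrier (obj X m) \<Longrightarrow> m + 1 = n \<Longrightarrow> dif X m x \<in> coboundaries X n"
  by (auto simp: coboundaries_def)

lemma cobE:
  assumes "x \<in> coboundaries X n"
  obtains y where "y \<in> carrier (obj X (n - 1))" "x = dif X (n - 1) y"
  using assms by (auto simp: coboundaries_def)

lemma cocycle_closed: "x \<in> cocycles X n \<Longrightarrow> x \<in> carrier (obj X n)"
  by (simp add: cocycles_iff)

lemma cob_cocycle: "cx X \<Longrightarrow> x \<in> coboundaries X n \<Longrightarrow> x \<in> cocycles X n"
  by (auto simp: coboundaries_def cocycles_iff d_closed d_d)

lemma cob_closed: "cx X \<Longrightarrow> x \<in> coboundaries X n \<Longrightarrow> x \<in> carrier (obj X n)"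
  by (rule cocycle_closed[OF cob_cocycle])

lemma cob_zero: "cx X \<Longrightarrow> \<zero>\<^bsub>obj X n\<^esub> \<in> coboundaries X n"
  using cobI[of "\<zero>\<^bsub>obj X (n - 1)\<^esub>" X "n - 1" n] by (simp add: d_zero ag_simps cx_ag)

lemma cob_add: "cx X \<Longrightarrow> x \<in> coboundaries X n \<Longrightarrow> y \<in> coboundaries X n \<Longrightarrow> x \<oplus>\<^bsub>obj X n\<^esub> y \<in> coboundaries X n"
  by (elim cobE) (simp add: d_add[where m = n, symmetric] cobI ag_simps cx_ag)

lemma cob_neg: "cx X \<Longrightarrow> x \<in> coboundaries X n \<Longrightarrow> \<ominus>\<^bsub>obj X n\<^esub> x \<in> coboundaries X n"
  by (elim cobE) (simp flip: d_neg[where m = n] add: cobI ag_simps cx_ag)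

lemma cob_act: "cx X \<Longrightarrow> x \<in> coboundaries X n \<Longrightarrow> a \<in> carrier A \<Longrightarrow> a \<odot>\<^bsub>obj X n\<^esub> x \<in> coboundaries X n"
  by (elim cobE) (simp flip: d_act[where m = n] add: cobI cx_act)

lemma cocycle_act: "cx X \<Longrightarrow> x \<in> cocycles X n \<Longrightarrow> a \<in> carrier A \<Longrightarrow> a \<odot>\<^bsub>obj X n\<^esub> x \<in> cocycles X n"
  using rmod.act_zero[OF rmodI[OF cx_rm]] by (simp add: cocycles_iff cx_act d_act)

lemma cocycle_minus: "cx X \<Longrightarrow> x \<in> cocycles X n \<Longrightarrow> y \<in> cocycles X n \<Longrightarrow> x \<ominus>\<^bsub>obj X n\<^esub> y \<in> cocycles X n"
  by (simp add: cocycles_iff d_minus[where m = "n + 1"] ag_diff cx_ag)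

lemma cocycle_add: "cx X \<Longrightarrow> x \<in> cocycles X n \<Longrightarrow> y \<in> cocycles X n \<Longrightarrow> x \<oplus>\<^bsub>obj X n\<^esub> y \<in> cocycles X n"
  by (simp add: cocycles_iff d_add[where m = "n + 1"] ag_diff cx_ag)

lemma cm_cocycle: "cm X Y f \<Longrightarrow> cx X \<Longrightarrow> cx Y \<Longrightarrow> x \<in> cocycles X n \<Longrightarrow> f n x \<in> cocycles Y n"
  using cm_d[of X Y f x n "n + 1"] cm_zero[of X Y f "n + 1"] by (simp add: cocycles_iff cm_closed)

lemma cm_cob: "cm X Y f \<Longrightarrow> x \<in> coboundaries X n \<Longrightarrow> f n x \<in> coboundaries Y n"
  by (elim cobE) (simp add: cm_d[where n = "n - 1"] cobI cm_closed)

lemma cob_diff_swap: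
  assumes "cx X" "x \<in> carrier (obj X n)" "y \<in> carrier (obj X n)" "x \<ominus>\<^bsub>obj X n\<^esub> y \<in> coboundaries X n"
  shows "y \<ominus>\<^bsub>obj X n\<^esub> x \<in> coboundaries X n"
  using cob_neg[OF assms(1,4)] assms by (simp add: ag_diff cx_ag)

lemma cob_diff_mem:
  assumes "cx X" "x \<in> carrier (obj X n)" "y \<in> coboundaries X n" "x \<ominus>\<^bsub>obj X n\<^esub> y \<in> coboundaries X n"
  shows "x \<in> coboundaries X n"
proof -
  have "(x \<ominus>\<^bsub>obj X n\<^esub> y) \<oplus>\<^bsub>obj X n\<^esub> y = x"
    using abelian_group.minus_eq_iff[OF cx_ag[OF assms(1)], of x n y "x \<ominus>\<^bsub>obj X n\<^esub> y"]
      assms(1,2) cob_closed[OF assms(1,3)] by (simp add: ag_simps cx_ag)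
  thus ?thesis using cob_add[OF assms(1,4,3)] by simp
qed

lemma cob_diff_trans:
  assumes "cx X" "x \<in> carrier (obj X n)" "y \<in> carrier (obj X n)" "z \<in> carrier (obj X n)"
    "x \<ominus>\<^bsub>obj X n\<^esub> y \<in> coboundaries X n" "y \<ominus>\<^bsub>obj X n\<^esub> z \<in> coboundaries X n"
  shows "x \<ominus>\<^bsub>obj X n\<^esub> z \<in> coboundaries X n"
proof -
  have "(x \<ominus>\<^bsub>obj X n\<^esub> y) \<oplus>\<^bsub>obj X n\<^esub> (y \<ominus>\<^bsub>obj X n\<^esub> z) = x \<ominus>\<^bsub>obj X n\<^esub> z"
    using assms(1-4) by (simp add: ag_diff cx_ag ag_ac)
  thus ?thesis using cob_add[OF assms(1,5,6)] by simp
qed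

text \<open>Injectivity on cohomology, expressed on cocycles. Together with \<open>Hsurj\<close> it
  replaces the bijections of coset spaces in \<open>quasi_iso\<close> (see
  \<open>quasi_iso_iff\<close>), so that later diagram chases involve elements only.\<close>

definition Hinj :: "('a, 'm) cpx \<Rightarrow> ('a, 'm) cpx \<Rightarrow> (int \<Rightarrow> 'm \<Rightarrow> 'm) \<Rightarrow> bool" where
  "Hinj X Y f \<longleftrightarrow> (\<forall>n. \<forall>x\<in>cocycles X n. f n x \<in> coboundaries Y n \<longrightarrow> x \<in> coboundaries X n)"

definition Hsurj :: "('a, 'm) cpx \<Rightarrow> ('a, 'm) cpx \<Rightarrow> (int \<Rightarrow> 'm \<Rightarrow> 'm) \<Rightarrow> bool" where
  "Hsurj X Y f \<longleftrightarrow> (\<forall>n. \<forall>y\<in>cocycles Y n. \<exists>x\<in>cocycles X n. y \<ominus>\<^bsub>obj Y n\<^esub> f n x \<in> coboundaries Y n)"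

lemma cohomology_carrier:
  "carrier (cohomology X n) = (\<lambda>x. coboundaries X n +>\<^bsub>obj X n\<^esub> x) ` cocycles X n"
  by (auto simp: cohomology_def quot_module_def A_RCOSETS_def' a_r_coset_def')

lemma coset_eq_iff:
  assumes "cx X" "x \<in> carrier (obj X n)" "y \<in> carrier (obj X n)"
  shows "coboundaries X n +>\<^bsub>obj X n\<^esub> x = coboundaries X n +>\<^bsub>obj X n\<^esub> y
    \<longleftrightarrow> x \<ominus>\<^bsub>obj X n\<^esub> y \<in> coboundaries X n" (is "?L \<longleftrightarrow> ?R")
proof
  interpret G: abelian_group "obj X n" using assms cx_ag by blast
  assume ?L
  moreover have "x \<in> coboundaries X n +>\<^bsub>obj X n\<^esub> x"
    using cob_zero[OF assms(1), of n] assms by (force simp: a_r_coset_def')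
  ultimately obtain b where "b \<in> coboundaries X n" "x = b \<oplus>\<^bsub>obj X n\<^esub> y" by (auto simp: a_r_coset_def')
  thus ?R using assms cob_closed by (metis G.minus_eq_iff)
next
  interpret G: abelian_group "obj X n" using assms cx_ag by blast
  assume R: ?R
  have sub: "coboundaries X n +>\<^bsub>obj X n\<^esub> x \<subseteq> coboundaries X n +>\<^bsub>obj X n\<^esub> y"
    if "x \<ominus>\<^bsub>obj X n\<^esub> y \<in> coboundaries X n" "x \<in> carrier (obj X n)" "y \<in> carrier (obj X n)" for x y
  proof
    fix w assume "w \<in> coboundaries X n +>\<^bsub>obj X n\<^esub> x"
    then obtain b where b: "b \<in> coboundaries X n" "w = b \<oplus>\<^bsub>obj X n\<^esub> x" by (auto simp: a_r_coset_def')
    have "w = (b \<oplus>\<^bsub>obj X n\<^esub> (x \<ominus>\<^bsub>obj X n\<^esub> y)) \<oplus>\<^bsub>obj X n\<^esub> y"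
      using b cob_closed[OF assms(1) b(1)] that by (simp add: ag_diff cx_ag assms ag_ac)
    thus "w \<in> coboundaries X n +>\<^bsub>obj X n\<^esub> y" using cob_add[OF assms(1) b(1) that(1)] by (auto simp: a_r_coset_def')
  qed
  show ?L using sub R sub[OF cob_diff_swap[OF assms R]] assms by blast
qed

lemma cohomology_map_coset:
  assumes "cx X" "cx Y" "cm X Y f" "x \<in> carrier (obj X n)"
  shows "cohomology_map Y f n (coboundaries X n +>\<^bsub>obj X n\<^esub> x) = coboundaries Y n +>\<^bsub>obj Y n\<^esub> f n x"
proof -
  interpret G: abelian_group "obj Y n" using assms cx_ag by blast
  have fx: "f n x \<in> carrier (obj Y n)" by (rule cm_closed[OF assms(3,4)])
  have "\<exists>c\<in>coboundaries Y n. b \<oplus>\<^bsub>obj Y n\<^esub> f n (b' \<oplus>\<^bsub>obj X n\<^esub> x) = c \<oplus>\<^bsub>obj Y n\<^esub> f n x"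
    if "b \<in> coboundaries Y n" "b' \<in> coboundaries X n" for b b'
    using that cob_closed[OF assms(2) that(1)] cob_closed[OF assms(1) that(2)] assms fx
      cob_add[OF assms(2) that(1) cm_cob[OF assms(3) that(2)]] cm_closed[OF assms(3)]
    by (intro bexI[of _ "b \<oplus>\<^bsub>obj Y n\<^esub> f n b'"]) (simp_all add: cm_add[OF assms(3)] G.a_assoc)
  moreover have "\<exists>b'\<in>coboundaries X n. b \<oplus>\<^bsub>obj Y n\<^esub> f n x = b \<oplus>\<^bsub>obj Y n\<^esub> f n (b' \<oplus>\<^bsub>obj X n\<^esub> x)" for b
    using cob_zero[OF assms(1)] assms by (intro bexI[of _ "\<zero>\<^bsub>obj X n\<^esub>"]) (simp_all add: ag_simps cx_ag)
  ultimately show ?thesis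
    unfolding cohomology_map_def set_add_def' a_r_coset_def' by fast
qed

lemma quasi_iso_iff:
  assumes "cx X" "cx Y"
  shows "quasi_iso A X Y f \<longleftrightarrow> cm X Y f \<and> Hinj X Y f \<and> Hsurj X Y f"
proof (cases "cm X Y f")
  case True
  note c = cocycle_closed cm_closed[OF True]
  have "inj_on (cohomology_map Y f n) (carrier (cohomology X n)) \<longleftrightarrow>
      (\<forall>x\<in>cocycles X n. f n x \<in> coboundaries Y n \<longrightarrow> x \<in> coboundaries X n)" (is "?I \<longleftrightarrow> ?J") for n
  proof
    assume ?I
    show ?J
    proof (intro ballI impI)
      fix x assume x: "x \<in> cocycles X n" "f n x \<in> coboundaries Y n"
      have z: "\<zero>\<^bsub>obj X n\<^esub> \<in> cocycles X n" by (rule cob_cocycle[OF assms(1) cob_zero[OF assms(1)]])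
      have "f n x \<ominus>\<^bsub>obj Y n\<^esub> f n \<zero>\<^bsub>obj X n\<^esub> \<in> coboundaries Y n"
        using x cm_zero[OF True assms] cob_closed[OF assms(2) x(2)] assms by (simp add: ag_diff cx_ag)
      hence "cohomology_map Y f n (coboundaries X n +>\<^bsub>obj X n\<^esub> x) = cohomology_map Y f n (coboundaries X n +>\<^bsub>obj X n\<^esub> \<zero>\<^bsub>obj X n\<^esub>)"
        using x z by (simp add: c cohomology_map_coset[OF assms True] coset_eq_iff assms)
      hence "coboundaries X n +>\<^bsub>obj X n\<^esub> x = coboundaries X n +>\<^bsub>obj X n\<^esub> \<zero>\<^bsub>obj X n\<^esub>"
        using \<open>?I\<close> x z unfolding cohomology_carrier by (auto dest: inj_onD)
      thus "x \<in> coboundaries X n"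
        using x z by (simp add: c coset_eq_iff assms ag_diff cx_ag)
    qed
  next
    assume J: ?J
    show ?I unfolding cohomology_carrier
    proof (intro inj_onI, elim imageE, hypsubst)
      fix x y assume xy: "x \<in> cocycles X n" "y \<in> cocycles X n"
        "cohomology_map Y f n (coboundaries X n +>\<^bsub>obj X n\<^esub> x) = cohomology_map Y f n (coboundaries X n +>\<^bsub>obj X n\<^esub> y)"
      hence "f n (x \<ominus>\<^bsub>obj X n\<^esub> y) \<in> coboundaries Y n"
        using True by (simp add: c cohomology_map_coset[OF assms True] coset_eq_iff assms cm_minus)
      hence "x \<ominus>\<^bsub>obj X n\<^esub> y \<in> coboundaries X n" using J cocycle_minus[OF assms(1) xy(1,2)] by blast
      thus "coboundaries X n +>\<^bsub>obj X n\<^esub> x = coboundaries X n +>\<^bsub>obj X n\<^esub> y"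
        using xy by (simp add: c coset_eq_iff assms)
    qed
  qed
  moreover have "cohomology_map Y f n ` carrier (cohomology X n) = carrier (cohomology Y n) \<longleftrightarrow>
      (\<forall>y\<in>cocycles Y n. \<exists>x\<in>cocycles X n. y \<ominus>\<^bsub>obj Y n\<^esub> f n x \<in> coboundaries Y n)" for n
  proof -
    have im: "cohomology_map Y f n ` carrier (cohomology X n) = (\<lambda>x. coboundaries Y n +>\<^bsub>obj Y n\<^esub> f n x) ` cocycles X n"
      unfolding cohomology_carrier image_image
      by (intro image_cong refl cohomology_map_coset assms True cocycle_closed)
    have sub: "\<dots> \<subseteq> carrier (cohomology Y n)"
      using cm_cocycle[OF True assms] unfolding cohomology_carrier by blast
    have "(y \<ominus>\<^bsub>obj Y n\<^esub> f n x \<in> coboundaries Y n) \<longleftrightarrow>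
        coboundaries Y n +>\<^bsub>obj Y n\<^esub> y = coboundaries Y n +>\<^bsub>obj Y n\<^esub> f n x"
      if "x \<in> cocycles X n" "y \<in> cocycles Y n" for x y
      using that by (simp add: c coset_eq_iff assms)
    hence "(\<forall>y\<in>cocycles Y n. \<exists>x\<in>cocycles X n. y \<ominus>\<^bsub>obj Y n\<^esub> f n x \<in> coboundaries Y n) \<longleftrightarrow>
        carrier (cohomology Y n) \<subseteq> (\<lambda>x. coboundaries Y n +>\<^bsub>obj Y n\<^esub> f n x) ` cocycles X n"
      unfolding cohomology_carrier image_subset_iff image_iff by (metis (no_types, lifting))
    thus ?thesis using sub im by auto
  qed
  ultimately show ?thesis using True by (auto simp: quasi_iso_def bij_betw_def Hinj_def Hsurj_def)
qed (simp add: quasi_iso_def)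

text \<open>This lemma and the next five split the two-out-of-three property of quasi-isomorphisms
  into injective and surjective halves. The halves are needed separately, because a one-sided
  inverse in the derived category yields only one of them for each map.\<close>

lemma Hinj_comp: "cm X Y f \<Longrightarrow> cx X \<Longrightarrow> cx Y \<Longrightarrow> Hinj X Y f \<Longrightarrow> Hinj Y Z g \<Longrightarrow> Hinj X Z (chain_comp g f)"
  using cm_cocycle unfolding Hinj_def chain_comp_def by fastforce

lemma Hinj_cancel: "cm Y Z g \<Longrightarrow> Hinj X Z (chain_comp g f) \<Longrightarrow> Hinj X Y f"
  using cm_cob unfolding Hinj_def chain_comp_def by fastforce

lemma Hsurj_cancel: "cm X Y f \<Longrightarrow> cx X \<Longrightarrow> cx Y \<Longrightarrow> Hsurj X Z (chain_comp g f) \<Longrightarrow> Hsurj Y Z g"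
  using cm_cocycle unfolding Hsurj_def chain_comp_def by (metis comp_apply)

lemma Hsurj_comp:
  assumes "cx X" "cx Y" "cx Z" "cm X Y f" "cm Y Z g" "Hsurj X Y f" "Hsurj Y Z g"
  shows "Hsurj X Z (chain_comp g f)"
  unfolding Hsurj_def
proof (intro allI ballI)
  fix n z assume z: "z \<in> cocycles Z n"
  obtain y where y: "y \<in> cocycles Y n" "z \<ominus>\<^bsub>obj Z n\<^esub> g n y \<in> coboundaries Z n"
    using assms(7) z by (auto simp: Hsurj_def)
  obtain x where x: "x \<in> cocycles X n" "y \<ominus>\<^bsub>obj Y n\<^esub> f n x \<in> coboundaries Y n"
    using assms(6) y by (auto simp: Hsurj_def)
  have c: "z \<in> carrier (obj Z n)" "y \<in> carrier (obj Y n)" "f n x \<in> carrier (obj Y n)" 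
    using z y x by (auto intro!: cocycle_closed cm_closed[OF assms(4)])
  have "g n y \<ominus>\<^bsub>obj Z n\<^esub> g n (f n x) \<in> coboundaries Z n"
    using cm_cob[OF assms(5) x(2)] c by (simp add: cm_minus[OF assms(5,2,3)])
  hence "z \<ominus>\<^bsub>obj Z n\<^esub> g n (f n x) \<in> coboundaries Z n"
    using cob_diff_trans[OF assms(3) c(1) _ _ y(2)] c cm_closed[OF assms(5)] by blast
  thus "\<exists>x\<in>cocycles X n. z \<ominus>\<^bsub>obj Z n\<^esub> chain_comp g f n x \<in> coboundaries Z n"
    using x by (auto simp: chain_comp_def)
qed

lemma Hinj_right:
  assumes "cx X" "cx Y" "cx Z" "cm X Y f" "cm Y Z g" "Hinj X Z (chain_comp g f)" "Hsurj X Y f"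
  shows "Hinj Y Z g"
  unfolding Hinj_def
proof (intro allI ballI impI)
  fix n y assume y: "y \<in> cocycles Y n" "g n y \<in> coboundaries Z n"
  obtain x where x: "x \<in> cocycles X n" "y \<ominus>\<^bsub>obj Y n\<^esub> f n x \<in> coboundaries Y n"
    using assms(7) y by (auto simp: Hsurj_def)
  have c: "y \<in> carrier (obj Y n)" "x \<in> carrier (obj X n)" "f n x \<in> carrier (obj Y n)" 
    using y x by (auto intro!: cocycle_closed cm_closed[OF assms(4)])
  have "g n (f n x) \<ominus>\<^bsub>obj Z n\<^esub> g n y \<in> coboundaries Z n"
    using cm_cob[OF assms(5) cob_diff_swap[OF assms(2) _ _ x(2)]] c by (simp add: cm_minus[OF assms(5,2,3)])
  hence "g n (f n x) \<in> coboundaries Z n"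
    using y(2) cob_diff_mem[OF assms(3)] c cm_closed[OF assms(5)] by blast
  hence "x \<in> coboundaries X n" using assms(6) x by (simp add: Hinj_def chain_comp_def)
  thus "y \<in> coboundaries Y n" using cob_diff_mem[OF assms(2) c(1) _ x(2)] cm_cob[OF assms(4)] by blast
qed

lemma Hsurj_left:
  assumes "cx X" "cx Y" "cx Z" "cm X Y f" "cm Y Z g" "Hsurj X Z (chain_comp g f)" "Hinj Y Z g"
  shows "Hsurj X Y f"
  unfolding Hsurj_def
proof (intro allI ballI)
  fix n y assume y: "y \<in> cocycles Y n"
  have "g n y \<in> cocycles Z n" by (rule cm_cocycle[OF assms(5,2,3) y])
  then obtain x where x: "x \<in> cocycles X n" "g n y \<ominus>\<^bsub>obj Z n\<^esub> g n (f n x) \<in> coboundaries Z n"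
    using assms(6) by (auto simp: Hsurj_def chain_comp_def)
  have fx: "f n x \<in> cocycles Y n" by (rule cm_cocycle[OF assms(4,1,2) x(1)])
  have "g n (y \<ominus>\<^bsub>obj Y n\<^esub> f n x) \<in> coboundaries Z n"
    using x y fx by (simp add: cocycle_closed cm_minus[OF assms(5,2,3)])
  thus "\<exists>x\<in>cocycles X n. y \<ominus>\<^bsub>obj Y n\<^esub> f n x \<in> coboundaries Y n"
    using assms(7) cocycle_minus[OF assms(2) y fx] x by (auto simp: Hinj_def)
qed

subsection \<open>Homotopies\<close>

text \<open>On a cocycle the term h(dx) of the homotopy formula vanishes and d(hx) remains; hence
  homotopic maps agree on cohomology.\<close>

lemma homotopic_cob:
  assumes "homotopic A X Y f g" "cx X" "cx Y" "x \<in> cocycles X n"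
  shows "f n x \<ominus>\<^bsub>obj Y n\<^esub> g n x \<in> coboundaries Y n"
proof -
  obtain h where h: "\<And>n. h n \<in> rmod_hom A (obj X n) (obj Y (n - 1))"
    "\<And>n x. x \<in> carrier (obj X n) \<Longrightarrow>
        f n x \<ominus>\<^bsub>obj Y n\<^esub> g n x = dif Y (n - 1) (h n x) \<oplus>\<^bsub>obj Y n\<^esub> h (n + 1) (dif X n x)"
    using assms(1) unfolding homotopic_def by blast
  have "h (n + 1) (dif X n x) = \<zero>\<^bsub>obj Y n\<^esub>"
    using assms(4) hom_zero[OF h(1)[of "n + 1"]] by (simp add: cocycles_iff cx_ag assms(2,3))
  hence "f n x \<ominus>\<^bsub>obj Y n\<^esub> g n x = dif Y (n - 1) (h n x)"
    using h(2) assms homD(1)[OF h(1)] cocycle_closed[OF assms(4)]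
    by (simp add: d_closed ag_simps cx_ag)
  thus ?thesis using homD(1)[OF h(1)] cocycle_closed[OF assms(4)] by (auto simp: coboundaries_def)
qed

lemma homotopic_refl:
  assumes "cx X" "cx Y" "cm X Y f"
  shows "homotopic A X Y f f"
  unfolding homotopic_def
  using assms by (intro exI[of _ "\<lambda>n x. \<zero>\<^bsub>obj Y (n - 1)\<^esub>"])
    (auto intro: hom_const_zero cx_rm simp: d_zero ag_diff cx_ag cm_closed)

lemma homotopic_sym:
  assumes "cx X" "cx Y" "cm X Y f" "cm X Y g" "homotopic A X Y f g"
  shows "homotopic A X Y g f"
proof -
  obtain h where h: "\<And>n. h n \<in> rmod_hom A (obj X n) (obj Y (n - 1))"
    "\<And>n x. x \<in> carrier (obj X n) \<Longrightarrow>
        f n x \<ominus>\<^bsub>obj Y n\<^esub> g n x = dif Y (n - 1) (h n x) \<oplus>\<^bsub>obj Y n\<^esub> h (n + 1) (dif X n x)"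
    using assms(5) unfolding homotopic_def by blast
  have "g n x \<ominus>\<^bsub>obj Y n\<^esub> f n x =
      dif Y (n - 1) (\<ominus>\<^bsub>obj Y (n - 1)\<^esub> h n x) \<oplus>\<^bsub>obj Y n\<^esub> \<ominus>\<^bsub>obj Y n\<^esub> h (n + 1) (dif X n x)"
    if x: "x \<in> carrier (obj X n)" for n x
    using h(2)[OF x] homD(1)[OF h(1) x] homD(1)[OF h(1)[of "n + 1"], of "dif X n x"] x assms
      cm_closed[OF assms(3) x] cm_closed[OF assms(4) x]
    by (simp add: d_neg[where m = n] d_closed ag_diff cx_ag ag_ac)
  thus ?thesis unfolding homotopic_def using hom_uminus[OF h(1) cx_rm[OF assms(2)]]
    by (intro exI[of _ "\<lambda>n x. \<ominus>\<^bsub>obj Y (n - 1)\<^esub> h n x"]) auto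
qed

lemma homotopic_trans:
  assumes "cx X" "cx Y" "cm X Y f" "cm X Y g" "cm X Y k" "homotopic A X Y f g" "homotopic A X Y g k"
  shows "homotopic A X Y f k"
proof -
  obtain h where h: "\<And>n. h n \<in> rmod_hom A (obj X n) (obj Y (n - 1))"
    "\<And>n x. x \<in> carrier (obj X n) \<Longrightarrow>
        f n x \<ominus>\<^bsub>obj Y n\<^esub> g n x = dif Y (n - 1) (h n x) \<oplus>\<^bsub>obj Y n\<^esub> h (n + 1) (dif X n x)"
    using assms(6) unfolding homotopic_def by blast
  obtain h' where h': "\<And>n. h' n \<in> rmod_hom A (obj X n) (obj Y (n - 1))"
    "\<And>n x. x \<in> carrier (obj X n) \<Longrightarrow>
        g n x \<ominus>\<^bsub>obj Y n\<^esub> k n x = dif Y (n - 1) (h' n x) \<oplus>\<^bsub>obj Y n\<^esub> h' (n + 1) (dif X n x)"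
    using assms(7) unfolding homotopic_def by blast
  have "f n x \<ominus>\<^bsub>obj Y n\<^esub> k n x =
      dif Y (n - 1) (h n x \<oplus>\<^bsub>obj Y (n - 1)\<^esub> h' n x) \<oplus>\<^bsub>obj Y n\<^esub> (h (n + 1) (dif X n x) \<oplus>\<^bsub>obj Y n\<^esub> h' (n + 1) (dif X n x))"
    if x: "x \<in> carrier (obj X n)" for n x
  proof -
    have c: "f n x \<in> carrier (obj Y n)" "g n x \<in> carrier (obj Y n)" "k n x \<in> carrier (obj Y n)"
      by (rule cm_closed[OF assms(3) x] cm_closed[OF assms(4) x] cm_closed[OF assms(5) x])+
    have "f n x \<ominus>\<^bsub>obj Y n\<^esub> k n x = (f n x \<ominus>\<^bsub>obj Y n\<^esub> g n x) \<oplus>\<^bsub>obj Y n\<^esub> (g n x \<ominus>\<^bsub>obj Y n\<^esub> k n x)"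
      using c assms(2) by (simp add: ag_diff cx_ag ag_ac)
    thus ?thesis unfolding h(2)[OF x] h'(2)[OF x]
      using homD(1)[OF h(1) x] homD(1)[OF h(1)[of "n + 1"], of "dif X n x"] x assms
      homD(1)[OF h'(1) x] homD(1)[OF h'(1)[of "n + 1"], of "dif X n x"]
    by (simp add: d_add[where m = n] d_closed ag_diff cx_ag ag_ac)
  qed
  thus ?thesis unfolding homotopic_def using hom_add[OF h(1) h'(1) cx_rm[OF assms(2)]]
    by (intro exI[of _ "\<lambda>n x. h n x \<oplus>\<^bsub>obj Y (n - 1)\<^esub> h' n x"]) auto
qed

lemma homotopic_comp_right:
  assumes "cm W X u" "homotopic A X Y f g"
  shows "homotopic A W Y (chain_comp f u) (chain_comp g u)"
proof -
  obtain h where h: "\<And>n. h n \<in> rmod_hom A (obj X n) (obj Y (n - 1))"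
    "\<And>n x. x \<in> carrier (obj X n) \<Longrightarrow>
        f n x \<ominus>\<^bsub>obj Y n\<^esub> g n x = dif Y (n - 1) (h n x) \<oplus>\<^bsub>obj Y n\<^esub> h (n + 1) (dif X n x)"
    using assms(2) unfolding homotopic_def by blast
  show ?thesis unfolding homotopic_def
    using hom_comp'[OF cm_hom[OF assms(1)] h(1)] h(2) cm_d[OF assms(1)] cm_closed[OF assms(1)]
    by (intro exI[of _ "\<lambda>n x. h n (u n x)"]) (auto simp: chain_comp_def)
qed

lemma homotopic_comp_left:
  assumes "cx X" "cx Y" "cx Z" "cm X Y f" "cm X Y g" "cm Y Z v" "homotopic A X Y f g"
  shows "homotopic A X Z (chain_comp v f) (chain_comp v g)"
proof -
  obtain h where h: "\<And>n. h n \<in> rmod_hom A (obj X n) (obj Y (n - 1))"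
    "\<And>n x. x \<in> carrier (obj X n) \<Longrightarrow>
        f n x \<ominus>\<^bsub>obj Y n\<^esub> g n x = dif Y (n - 1) (h n x) \<oplus>\<^bsub>obj Y n\<^esub> h (n + 1) (dif X n x)"
    using assms(7) unfolding homotopic_def by blast
  have "v n (f n x) \<ominus>\<^bsub>obj Z n\<^esub> v n (g n x) = dif Z (n - 1) (v (n - 1) (h n x)) \<oplus>\<^bsub>obj Z n\<^esub> v n (h (n + 1) (dif X n x))"
    if x: "x \<in> carrier (obj X n)" for n x
  proof -
    have "v n (f n x) \<ominus>\<^bsub>obj Z n\<^esub> v n (g n x) = v n (dif Y (n - 1) (h n x) \<oplus>\<^bsub>obj Y n\<^esub> h (n + 1) (dif X n x))"
      using h(2)[OF x, symmetric] cm_closed[OF assms(4) x] cm_closed[OF assms(5) x] by (simp add: cm_minus[OF assms(6,2,3)])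
    thus ?thesis using homD(1)[OF h(1) x] homD(1)[OF h(1)[of "n + 1"], of "dif X n x"] x assms
      by (simp add: cm_add[OF assms(6)] d_closed cm_d[OF assms(6), where n = "n - 1"])
  qed
  thus ?thesis unfolding homotopic_def
    using hom_comp'[OF h(1) cm_hom[OF assms(6)]]
    by (intro exI[of _ "\<lambda>n x. v (n - 1) (h n x)"]) (auto simp: chain_comp_def)
qed

lemma Hinj_homotopic:
  assumes "cx X" "cx Y" "cm X Y f" "cm X Y g" "homotopic A X Y f g" "Hinj X Y f"
  shows "Hinj X Y g"
  unfolding Hinj_def
proof (intro allI ballI impI)
  fix n x assume x: "x \<in> cocycles X n" "g n x \<in> coboundaries Y n"
  have "f n x \<in> coboundaries Y n"
    using cob_diff_mem[OF assms(2) _ x(2) homotopic_cob[OF assms(5,1,2) x(1)]]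
      cm_closed[OF assms(3)] cocycle_closed[OF x(1)] by blast
  thus "x \<in> coboundaries X n" using assms(6) x by (simp add: Hinj_def)
qed

lemma Hsurj_homotopic:
  assumes "cx X" "cx Y" "cm X Y f" "cm X Y g" "homotopic A X Y f g" "Hsurj X Y f"
  shows "Hsurj X Y g"
  unfolding Hsurj_def
proof (intro allI ballI)
  fix n y assume y: "y \<in> cocycles Y n"
  then obtain x where x: "x \<in> cocycles X n" "y \<ominus>\<^bsub>obj Y n\<^esub> f n x \<in> coboundaries Y n"
    using assms(6) by (auto simp: Hsurj_def)
  show "\<exists>x\<in>cocycles X n. y \<ominus>\<^bsub>obj Y n\<^esub> g n x \<in> coboundaries Y n"
    using x(1) y by (intro bexI[OF _ x(1)] cob_diff_trans[OF assms(2) _ _ _ x(2) homotopic_cob[OF assms(5,1,2) x(1)]])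
      (simp_all add: cm_closed[OF assms(3)] cm_closed[OF assms(4)] cocycle_closed)
qed

end

section \<open>Direct sums of complexes\<close>

context kalg begin

lemma pair_hom:
  assumes "f \<in> rmod_hom A M N" "g \<in> rmod_hom A M N'"
  shows "(\<lambda>x. Two (f x) (g x)) \<in> rmod_hom A M (dsum2 N N')"
  using homD[OF assms(1)] homD[OF assms(2)] by (intro homI) auto

lemma cx_boundE:
  assumes "cx X"
  obtains b where "\<And>n. \<bar>n\<bar> > b \<Longrightarrow> carrier (obj X n) = {\<zero>\<^bsub>obj X n\<^esub>}"
  using assms by (auto simp: bounded_cpx_def)

lemma cxI:
  assumes "\<And>n. fd_module A (obj X n)" "\<And>n. dif X n \<in> rmod_hom A (obj X n) (obj X (n + 1))"
    "\<And>n x. x \<in> carrier (obj X n) \<Longrightarrow> dif X (n + 1) (dif X n x) = \<zero>\<^bsub>obj X (n + 1 + 1)\<^esub>"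
    "\<And>n. \<bar>n\<bar> > b \<Longrightarrow> carrier (obj X n) = {\<zero>\<^bsub>obj X n\<^esub>}"
  shows "cx X"
  using assms unfolding bounded_cpx_def by blast

lemma cmI:
  assumes "\<And>n. f n \<in> rmod_hom A (obj X n) (obj Y n)"
    "\<And>n x. x \<in> carrier (obj X n) \<Longrightarrow> f (n + 1) (dif X n x) = dif Y n (f n x)"
  shows "cm X Y f"
  using assms unfolding chain_map_def by blast

lemma homotopicI:
  assumes "\<And>n. h n \<in> rmod_hom A (obj X n) (obj Y (n - 1))"
    "\<And>n x. x \<in> carrier (obj X n) \<Longrightarrow>
        f n x \<ominus>\<^bsub>obj Y n\<^esub> g n x = dif Y (n - 1) (h n x) \<oplus>\<^bsub>obj Y n\<^esub> h (n + 1) (dif X n x)"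
  shows "homotopic A X Y f g"
  using assms unfolding homotopic_def by blast

lemma cpx_sum_simps:
  "obj (cpx_sum X Y) n = dsum2 (obj X n) (obj Y n)"
  "dif (cpx_sum X Y) n z = Two (dif X n (first z)) (dif Y n (second z))"
  by (simp_all add: cpx_sum_def)

lemma cpx_sum_cx:
  assumes "cx X" "cx Y" shows "cx (cpx_sum X Y)"
proof -
  obtain b where b: "\<And>n. \<bar>n\<bar> > b \<Longrightarrow> carrier (obj X n) = {\<zero>\<^bsub>obj X n\<^esub>}" by (rule cx_boundE[OF assms(1)]) blast
  obtain c where c: "\<And>n. \<bar>n\<bar> > c \<Longrightarrow> carrier (obj Y n) = {\<zero>\<^bsub>obj Y n\<^esub>}" by (rule cx_boundE[OF assms(2)]) blast
  show ?thesis
  proof (rule cxI[where b = "max b c"])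
    show "dif (cpx_sum X Y) n \<in> rmod_hom A (obj (cpx_sum X Y) n) (obj (cpx_sum X Y) (n + 1))" for n
      unfolding cpx_sum_simps(1) using assms
      by (auto simp: cpx_sum_def intro!: pair_hom hom_comp'[OF dsum2_fst] hom_comp'[OF dsum2_snd] cx_hom)
  qed (use assms b c in \<open>auto simp: cpx_sum_simps dsum2_fd cx_fd d_d\<close>)
qed

subsection \<open>Homotopy fibres\<close>

text \<open>
  The shifted cone of \<open>\<phi>\<close>: a chain map into it is a chain map \<open>u\<close> into \<open>V\<close> together with a null-homotopy of
  \<open>\<phi>u\<close>. For \<open>\<phi> : X \<oplus> Y' \<rightarrow> Y\<close> it is the homotopy pullback behind the Ore condition below.
\<close>

definition hfib :: "('a, 'i) ecpx \<Rightarrow> ('a, 'i) ecpx \<Rightarrow> (int \<Rightarrow> ('a, 'i) elt \<Rightarrow> ('a, 'i) elt) \<Rightarrow> ('a, 'i) ecpx" where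
  "hfib V Y \<phi> =
    \<lparr>obj = (\<lambda>n. dsum2 (obj V n) (obj Y (n - 1))),
     dif = (\<lambda>n z. Two (dif V n (first z)) (\<phi> n (first z) \<ominus>\<^bsub>obj Y n\<^esub> dif Y (n - 1) (second z)))\<rparr>"

lemma hfib_simps:
  "obj (hfib V Y \<phi>) n = dsum2 (obj V n) (obj Y (n - 1))"
  "dif (hfib V Y \<phi>) n (Two v y) = Two (dif V n v) (\<phi> n v \<ominus>\<^bsub>obj Y n\<^esub> dif Y (n - 1) y)"
  by (simp_all add: hfib_def)

lemma hfib_cx:
  assumes "cx V" "cx Y" "cm V Y \<phi>" shows "cx (hfib V Y \<phi>)"
proof -
  obtain b where b: "\<And>n. \<bar>n\<bar> > b \<Longrightarrow> carrier (obj V n) = {\<zero>\<^bsub>obj V n\<^esub>}" by (rule cx_boundE[OF assms(1)]) blast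
  obtain c where c: "\<And>n. \<bar>n\<bar> > c \<Longrightarrow> carrier (obj Y n) = {\<zero>\<^bsub>obj Y n\<^esub>}" by (rule cx_boundE[OF assms(2)]) blast
  show ?thesis
  proof (rule cxI[where b = "max b (c + 1)"])
    show "dif (hfib V Y \<phi>) n \<in> rmod_hom A (obj (hfib V Y \<phi>) n) (obj (hfib V Y \<phi>) (n + 1))" for n
      unfolding hfib_simps(1) using assms
      by (auto simp: hfib_def intro!: pair_hom hom_diff hom_comp'[OF dsum2_fst] hom_comp'[OF dsum2_snd] cx_hom cm_hom cx_rm)
    fix n z assume "z \<in> carrier (obj (hfib V Y \<phi>) n)"
    then obtain v y where z: "z = Two v y" "v \<in> carrier (obj V n)" "y \<in> carrier (obj Y (n - 1))"
      by (auto simp: hfib_simps)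
    have "dif Y n (\<phi> n v \<ominus>\<^bsub>obj Y n\<^esub> dif Y (n - 1) y) = \<phi> (n + 1) (dif V n v)"
      using z assms by (simp add: d_minus[where m = "n + 1"] d_closed cm_closed d_d[where n = "n - 1" and l = "n + 1"]
        cm_d[OF assms(3)] ag_diff cx_ag)
    thus "dif (hfib V Y \<phi>) (n + 1) (dif (hfib V Y \<phi>) n z) = \<zero>\<^bsub>obj (hfib V Y \<phi>) (n + 1 + 1)\<^esub>"
      using z assms cm_closed[OF assms(3), of "dif V n v" "n + 1"]
      by (simp add: hfib_simps d_d d_closed abelian_group.minus_eq_zero_iff cx_ag add.commute[of 1 n])
  next
    fix n :: int assume "max b (c + 1) < \<bar>n\<bar>"
    hence "carrier (obj V n) = {\<zero>\<^bsub>obj V n\<^esub>}" "carrier (obj Y (n - 1)) = {\<zero>\<^bsub>obj Y (n - 1)\<^esub>}"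
      using b c by auto
    thus "carrier (obj (hfib V Y \<phi>) n) = {\<zero>\<^bsub>obj (hfib V Y \<phi>) n\<^esub>}" by (auto simp: hfib_simps)
  qed (use assms in \<open>auto simp: hfib_simps dsum2_fd cx_fd\<close>)
qed

lemma hfib_fst_cm: "cm (hfib V Y \<phi>) V (\<lambda>n. first)"
  by (rule cmI) (auto simp: hfib_simps dsum2_fst)

lemma hfib_null:
  assumes "cx V" "cx Y" "cm V Y \<phi>"
  shows "homotopic A (hfib V Y \<phi>) Y (chain_comp \<phi> (\<lambda>n. first)) (\<lambda>n x. \<zero>\<^bsub>obj Y n\<^esub>)"
proof (rule homotopicI[where h = "\<lambda>n. second"])
  fix n z assume "z \<in> carrier (obj (hfib V Y \<phi>) n)"
  thus "chain_comp \<phi> (\<lambda>n. first) n z \<ominus>\<^bsub>obj Y n\<^esub> \<zero>\<^bsub>obj Y n\<^esub> =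
      dif Y (n - 1) (second z) \<oplus>\<^bsub>obj Y n\<^esub> second (dif (hfib V Y \<phi>) n z)"
    using assms by (auto simp: hfib_simps chain_comp_def ag_diff cx_ag d_closed cm_closed ag_ac)
qed (simp add: hfib_simps dsum2_snd)

lemma hfib_cocycle:
  assumes "cx V" "cx Y" "cm V Y \<phi>"
  shows "Two v y \<in> cocycles (hfib V Y \<phi>) n \<longleftrightarrow>
    v \<in> cocycles V n \<and> y \<in> carrier (obj Y (n - 1)) \<and> \<phi> n v = dif Y (n - 1) y"
  using assms abelian_group.minus_eq_zero_iff[OF cx_ag[OF assms(2)], of "\<phi> n v" n "dif Y (n - 1) y"]
  by (auto simp: cocycles_iff hfib_simps d_closed cm_closed)

lemma hfib_cob:
  assumes "v' \<in> carrier (obj V (n - 1))" "y' \<in> carrier (obj Y (n - 1 - 1))" "v = dif V (n - 1) v'"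
    "y = \<phi> (n - 1) v' \<ominus>\<^bsub>obj Y (n - 1)\<^esub> dif Y (n - 1 - 1) y'"
  shows "Two v y \<in> coboundaries (hfib V Y \<phi>) n"
proof -
  have "dif (hfib V Y \<phi>) (n - 1) (Two v' y') \<in> coboundaries (hfib V Y \<phi>) n"
    using assms(1,2) by (intro cobI) (auto simp: hfib_simps)
  thus ?thesis by (simp add: hfib_simps assms(3,4))
qed

lemma hfib_cocycleE:
  assumes "z \<in> cocycles (hfib V Y \<phi>) n"
  obtains v y where "z = Two v y" "v \<in> carrier (obj V n)" "y \<in> carrier (obj Y (n - 1))"
  using cocycle_closed[OF assms] by (auto simp: hfib_simps)

definition acyclic :: "('a, 'm) cpx \<Rightarrow> bool" where
  "acyclic X \<longleftrightarrow> (\<forall>n. cocycles X n \<subseteq> coboundaries X n)"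

text \<open>An elementwise form of the long exact sequence. For a cocycle (v, y) with v = d v0, the
  element \<phi>(v0) - y is a cocycle of the acyclic \<open>Y\<close>, hence equals dt for some t,
  and (v0, t) is a primitive of (v, y). Surjectivity only needs a primitive of \<phi>(v).\<close>

lemma hfib_quasi_iso:
  assumes "cx V" "cx Y" "cm V Y \<phi>" "acyclic Y"
  shows "quasi_iso A (hfib V Y \<phi>) V (\<lambda>n. first)"
proof -
  have "Hinj (hfib V Y \<phi>) V (\<lambda>n. first)"
    unfolding Hinj_def
  proof (intro allI ballI impI)
    fix n z assume z: "z \<in> cocycles (hfib V Y \<phi>) n" "first z \<in> coboundaries V n"
    obtain v y where vy: "z = Two v y" "v \<in> carrier (obj V n)" "y \<in> carrier (obj Y (n - 1))"
      using z(1) by (rule hfib_cocycleE)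
    have v: "v \<in> cocycles V n" "\<phi> n v = dif Y (n - 1) y"
      using z(1) vy hfib_cocycle[OF assms(1-3)] by auto
    obtain v0 where v0: "v0 \<in> carrier (obj V (n - 1))" "v = dif V (n - 1) v0"
      using z(2) vy by (auto elim: cobE)
    have c: "\<phi> (n - 1) v0 \<in> carrier (obj Y (n - 1))" by (rule cm_closed) fact+
    have "dif Y (n - 1) (\<phi> (n - 1) v0 \<ominus>\<^bsub>obj Y (n - 1)\<^esub> y) = \<zero>\<^bsub>obj Y n\<^esub>"
      using v v0 vy c assms cm_d[OF assms(3) v0(1), of n] cm_closed[OF assms(3), of v n]
      by (simp add: d_minus[where m = n] abelian_group.minus_eq_zero_iff cx_ag d_closed)
    hence "\<phi> (n - 1) v0 \<ominus>\<^bsub>obj Y (n - 1)\<^esub> y \<in> cocycles Y (n - 1)"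
      using c vy assms by (simp add: cocycles_iff ag_simps cx_ag)
    then obtain t where t: "t \<in> carrier (obj Y (n - 1 - 1))" "\<phi> (n - 1) v0 \<ominus>\<^bsub>obj Y (n - 1)\<^esub> y = dif Y (n - 1 - 1) t"
      using assms(4) unfolding acyclic_def by (meson subsetD cobE)
    have "y = \<phi> (n - 1) v0 \<ominus>\<^bsub>obj Y (n - 1)\<^esub> dif Y (n - 1 - 1) t"
      unfolding t(2)[symmetric] using c vy(3) assms(2) by (simp add: ag_diff cx_ag ag_ac)
    thus "z \<in> coboundaries (hfib V Y \<phi>) n"
      unfolding vy(1) by (rule hfib_cob[OF v0(1) t(1) v0(2)])
  qed
  moreover have "Hsurj (hfib V Y \<phi>) V (\<lambda>n. first)"
    unfolding Hsurj_def
  proof (intro allI ballI)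
    fix n v assume v: "v \<in> cocycles V n"
    hence "\<phi> n v \<in> coboundaries Y n"
      using cm_cocycle[OF assms(3,1,2)] assms(4) by (auto simp: acyclic_def)
    then obtain y where "y \<in> carrier (obj Y (n - 1))" "\<phi> n v = dif Y (n - 1) y" by (rule cobE)
    hence "Two v y \<in> cocycles (hfib V Y \<phi>) n" using v hfib_cocycle[OF assms(1-3)] by simp
    moreover have "v \<ominus>\<^bsub>obj V n\<^esub> first (Two v y) \<in> coboundaries V n"
      using cocycle_closed[OF v] cob_zero[OF assms(1)]
      by (simp add: abelian_group.r_neg cx_ag assms a_minus_def)
    ultimately show "\<exists>z\<in>cocycles (hfib V Y \<phi>) n. v \<ominus>\<^bsub>obj V n\<^esub> first z \<in> coboundaries V n" by blast
  qed
  ultimately show ?thesis using hfib_fst_cm by (simp add: quasi_iso_iff hfib_cx assms)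
qed

text \<open>For a cocycle (x, y), injectivity of \<open>q\<close> on cohomology gives a primitive x0
  of x. The element q(x0) - y is then a cocycle, and surjectivity corrects x0 by a cocycle w until
  it becomes a coboundary.\<close>

lemma hfib_acyclic:
  assumes "cx X" "cx Y" "quasi_iso A X Y q"
  shows "acyclic (hfib X Y q)"
  unfolding acyclic_def
proof (intro allI subsetI)
  have q: "cm X Y q" "Hinj X Y q" "Hsurj X Y q" using assms(3) by (simp_all add: quasi_iso_iff assms(1,2))
  fix n z assume z: "z \<in> cocycles (hfib X Y q) n"
  obtain x y where xy: "z = Two x y" "x \<in> carrier (obj X n)" "y \<in> carrier (obj Y (n - 1))"
    using z by (rule hfib_cocycleE)
  have x: "x \<in> cocycles X n" "q n x = dif Y (n - 1) y"
    using z xy hfib_cocycle[OF assms(1,2) q(1)] by auto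
  have "q n x \<in> coboundaries Y n" unfolding x(2) by (rule cobI) (simp_all add: xy)
  hence "x \<in> coboundaries X n" using q(2) x by (simp add: Hinj_def)
  then obtain x0 where x0: "x0 \<in> carrier (obj X (n - 1))" "x = dif X (n - 1) x0" by (rule cobE)
  have c: "q (n - 1) x0 \<in> carrier (obj Y (n - 1))" by (rule cm_closed) fact+
  have "dif Y (n - 1) (q (n - 1) x0 \<ominus>\<^bsub>obj Y (n - 1)\<^esub> y) = \<zero>\<^bsub>obj Y n\<^esub>"
    using x x0 xy c assms cm_d[OF q(1) x0(1), of n] cm_closed[OF q(1), of x n]
    by (simp add: d_minus[where m = n] abelian_group.minus_eq_zero_iff cx_ag d_closed)
  hence "q (n - 1) x0 \<ominus>\<^bsub>obj Y (n - 1)\<^esub> y \<in> cocycles Y (n - 1)"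
    using c xy assms by (simp add: cocycles_iff ag_simps cx_ag)
  then obtain w where w: "w \<in> cocycles X (n - 1)"
    "(q (n - 1) x0 \<ominus>\<^bsub>obj Y (n - 1)\<^esub> y) \<ominus>\<^bsub>obj Y (n - 1)\<^esub> q (n - 1) w \<in> coboundaries Y (n - 1)"
    using q(3) unfolding Hsurj_def by blast
  then obtain t where t: "t \<in> carrier (obj Y (n - 1 - 1))"
    "(q (n - 1) x0 \<ominus>\<^bsub>obj Y (n - 1)\<^esub> y) \<ominus>\<^bsub>obj Y (n - 1)\<^esub> q (n - 1) w = dif Y (n - 1 - 1) t" by (auto elim: cobE)
  have wc: "w \<in> carrier (obj X (n - 1))" "dif X (n - 1) w = \<zero>\<^bsub>obj X n\<^esub>"
    using w(1) by (simp_all add: cocycles_iff)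
  show "z \<in> coboundaries (hfib X Y q) n"
    unfolding xy(1)
  proof (rule hfib_cob[of "x0 \<ominus>\<^bsub>obj X (n - 1)\<^esub> w" _ _ t])
    show "x = dif X (n - 1) (x0 \<ominus>\<^bsub>obj X (n - 1)\<^esub> w)"
      using x0 wc assms by (simp add: d_minus[where m = n] d_closed ag_diff cx_ag)
    show "y = q (n - 1) (x0 \<ominus>\<^bsub>obj X (n - 1)\<^esub> w) \<ominus>\<^bsub>obj Y (n - 1)\<^esub> dif Y (n - 1 - 1) t"
      unfolding t(2)[symmetric] using c x0 wc xy assms cm_closed[OF q(1) wc(1)]
      by (simp add: cm_minus[OF q(1)] ag_diff cx_ag ag_ac)
  qed (use x0 wc t assms in \<open>simp_all add: ag_simps cx_ag\<close>)
qed

text \<open>\<open>W\<close> is the homotopy pullback of \<open>f\<close> and \<open>q\<close>, with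
  the two projections as \<open>u\<close> and \<open>v\<close>. The third coordinate is the homotopy
  making the square commute, and \<open>u\<close> inherits being a quasi-isomorphism from
  \<open>q\<close>.\<close>

lemma ore:
  fixes X Y Y' :: "('a, 'i) ecpx"
  assumes "cx X" "cx Y" "cx Y'" "cm X Y f" "quasi_iso A Y' Y q"
  shows "\<exists>W u v. cx W \<and> quasi_iso A W X u \<and> cm W Y' v \<and> homotopic A W Y (chain_comp f u) (chain_comp q v)"
proof -
  have q: "cm Y' Y q" "Hinj Y' Y q" "Hsurj Y' Y q" using assms(5) by (simp_all add: quasi_iso_iff assms(1-3))
  define V where "V = cpx_sum X Y'"
  define \<phi> where "\<phi> = (\<lambda>n z. f n (first z) \<ominus>\<^bsub>obj Y n\<^esub> q n (second z))"
  have V: "cx V" unfolding V_def by (intro cpx_sum_cx assms)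
  have \<phi>: "cm V Y \<phi>"
  proof (rule cmI)
    show "\<phi> n \<in> rmod_hom A (obj V n) (obj Y n)" for n
      unfolding V_def \<phi>_def cpx_sum_simps
      by (intro hom_diff hom_comp'[OF dsum2_fst] hom_comp'[OF dsum2_snd] cm_hom q assms cx_rm)
    show "\<phi> (n + 1) (dif V n x) = dif Y n (\<phi> n x)" if "x \<in> carrier (obj V n)" for n x
      using that assms q unfolding V_def \<phi>_def
      by (auto simp: cpx_sum_simps d_minus[where m = "n + 1"] cm_closed[of X Y f] cm_closed[of Y' Y q]
          cm_d[of X Y f] cm_d[of Y' Y q])
  qed
  define W where "W = hfib V Y \<phi>"
  define u where "u = (\<lambda>n :: int. \<lambda>z :: ('a, 'i) elt. first (first z))"
  define v where "v = (\<lambda>n :: int. \<lambda>z :: ('a, 'i) elt. second (first z))"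
  have W: "cx W" unfolding W_def by (intro hfib_cx V \<phi> assms)
  have VX: "cm V X (\<lambda>n. first)" "cm V Y' (\<lambda>n. second)"
    unfolding V_def by (rule cmI; auto simp: cpx_sum_simps dsum2_fst dsum2_snd)+
  have u: "cm W X u"
    using cm_comp[OF hfib_fst_cm VX(1)] by (simp add: W_def u_def chain_comp_def comp_def)
  have v: "cm W Y' v"
    using cm_comp[OF hfib_fst_cm VX(2)] by (simp add: W_def v_def chain_comp_def comp_def)
  have h: "homotopic A W Y (chain_comp f u) (chain_comp q v)"
  proof (rule homotopicI[where h = "\<lambda>n. second"])
    fix n z assume "z \<in> carrier (obj W n)"
    then obtain x y' y where z: "z = Two (Two x y') y" "x \<in> carrier (obj X n)" "y' \<in> carrier (obj Y' n)"
      "y \<in> carrier (obj Y (n - 1))" by (auto simp: W_def V_def hfib_simps cpx_sum_simps)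
    show "chain_comp f u n z \<ominus>\<^bsub>obj Y n\<^esub> chain_comp q v n z =
        dif Y (n - 1) (second z) \<oplus>\<^bsub>obj Y n\<^esub> second (dif W n z)"
      using z cm_closed[OF assms(4) z(2)] cm_closed[OF q(1) z(3)] assms
      by (simp add: W_def hfib_simps \<phi>_def chain_comp_def u_def v_def d_closed[where n = "n - 1"] ag_diff cx_ag ag_ac)
  qed (simp add: W_def hfib_simps dsum2_snd)
  have "Hinj W X u"
    unfolding Hinj_def
  proof (intro allI ballI impI)
    fix n z assume z: "z \<in> cocycles W n" "u n z \<in> coboundaries X n"
    obtain x y' y where zz: "z = Two (Two x y') y" "x \<in> carrier (obj X n)" "y' \<in> carrier (obj Y' n)"
      "y \<in> carrier (obj Y (n - 1))" using cocycle_closed[OF z(1)] by (auto simp: W_def V_def hfib_simps cpx_sum_simps)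
    have "Two x y' \<in> cocycles V n" and eq: "f n x \<ominus>\<^bsub>obj Y n\<^esub> q n y' = dif Y (n - 1) y"
      using z(1) zz hfib_cocycle[OF V assms(2) \<phi>] by (auto simp: W_def \<phi>_def)
    hence xy: "x \<in> cocycles X n" "y' \<in> cocycles Y' n" by (simp_all add: cocycles_iff V_def cpx_sum_simps)
    obtain x0 where x0: "x0 \<in> carrier (obj X (n - 1))" "x = dif X (n - 1) x0"
      using z(2) by (auto simp: zz u_def elim: cobE)
    have c: "f n x \<in> carrier (obj Y n)" "q n y' \<in> carrier (obj Y n)" "f (n - 1) x0 \<in> carrier (obj Y (n - 1))"
      using zz x0 by (simp_all add: cm_closed[OF assms(4)] cm_closed[OF q(1)])
    have dy: "dif Y (n - 1) y \<in> carrier (obj Y n)" using zz assms by (simp add: d_closed)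
    have fx: "f n x = dif Y (n - 1) (f (n - 1) x0)" unfolding x0(2) by (rule cm_d[OF assms(4) x0(1)]) simp
    have qy: "q n y' = dif Y (n - 1) (f (n - 1) x0 \<ominus>\<^bsub>obj Y (n - 1)\<^esub> y)"
      using c zz assms dy unfolding d_minus[OF assms(2) _ c(3) zz(4), of n, simplified] fx[symmetric] eq[symmetric]
      by (simp add: ag_diff cx_ag ag_ac)
    have "q n y' \<in> coboundaries Y n" unfolding qy using c zz assms by (intro cobI) (simp_all add: ag_simps cx_ag)
    hence "y' \<in> coboundaries Y' n" using q(2) xy by (simp add: Hinj_def)
    then obtain y0 where y0: "y0 \<in> carrier (obj Y' (n - 1))" "y' = dif Y' (n - 1) y0" by (rule cobE)
    have c2: "q (n - 1) y0 \<in> carrier (obj Y (n - 1))" using y0 by (simp add: cm_closed[OF q(1)])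
    \<comment> \<open>Both q(y0) and f(x0) - y are primitives of q(y'). Their difference
      \<open>s\<close> is a cocycle, which surjectivity of \<open>q\<close> on cohomology matches
      with some q(w).\<close>
    define s where "s = q (n - 1) y0 \<ominus>\<^bsub>obj Y (n - 1)\<^esub> (f (n - 1) x0 \<ominus>\<^bsub>obj Y (n - 1)\<^esub> y)"
    have "dif Y (n - 1) s = \<zero>\<^bsub>obj Y n\<^esub>"
      unfolding s_def using c c2 zz assms qy y0 cm_d[OF q(1) y0(1), of n]
      by (simp add: d_minus[where m = n and x = "q (n - 1) y0"] ag_simps cx_ag abelian_group.minus_eq_zero_iff d_closed)
    hence "s \<in> cocycles Y (n - 1)" using c c2 zz assms by (simp add: cocycles_iff s_def ag_simps cx_ag)
    then obtain w where w: "w \<in> cocycles Y' (n - 1)" "s \<ominus>\<^bsub>obj Y (n - 1)\<^esub> q (n - 1) w \<in> coboundaries Y (n - 1)"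
      using q(3) unfolding Hsurj_def by blast
    then obtain t where t: "t \<in> carrier (obj Y (n - 1 - 1))" "s \<ominus>\<^bsub>obj Y (n - 1)\<^esub> q (n - 1) w = dif Y (n - 1 - 1) t"
      by (auto elim: cobE)
    have wc: "w \<in> carrier (obj Y' (n - 1))" "dif Y' (n - 1) w = \<zero>\<^bsub>obj Y' n\<^esub>"
      using w(1) by (simp_all add: cocycles_iff)
    have qw: "q (n - 1) w \<in> carrier (obj Y (n - 1))" using wc by (simp add: cm_closed[OF q(1)])
    show "z \<in> coboundaries W n"
      unfolding zz(1) W_def
    \<comment> \<open>The differential of the fibre subtracts the differential of its second
      coordinate, whence -t; subtracting \<open>w\<close> from \<open>y0\<close> leaves the boundary
      of \<open>y0\<close> unchanged.\<close>
    proof (rule hfib_cob[of "Two x0 (y0 \<ominus>\<^bsub>obj Y' (n - 1)\<^esub> w)" _ _ "\<ominus>\<^bsub>obj Y (n - 1 - 1)\<^esub> t"])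
      show "Two x y' = dif V (n - 1) (Two x0 (y0 \<ominus>\<^bsub>obj Y' (n - 1)\<^esub> w))"
        using x0 y0 wc assms by (simp add: V_def cpx_sum_simps d_minus[where m = n] d_closed ag_diff cx_ag)
      have "\<phi> (n - 1) (Two x0 (y0 \<ominus>\<^bsub>obj Y' (n - 1)\<^esub> w)) \<ominus>\<^bsub>obj Y (n - 1)\<^esub> dif Y (n - 1 - 1) (\<ominus>\<^bsub>obj Y (n - 1 - 1)\<^esub> t)
        = (f (n - 1) x0 \<ominus>\<^bsub>obj Y (n - 1)\<^esub> (q (n - 1) y0 \<ominus>\<^bsub>obj Y (n - 1)\<^esub> q (n - 1) w)) \<ominus>\<^bsub>obj Y (n - 1)\<^esub>
          \<ominus>\<^bsub>obj Y (n - 1)\<^esub> (s \<ominus>\<^bsub>obj Y (n - 1)\<^esub> q (n - 1) w)"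
        unfolding t(2) using y0 wc t assms by (simp add: \<phi>_def cm_minus[OF q(1)] d_neg[where m = "n - 1"])
      also have "\<dots> = y"
        unfolding s_def using c c2 qw zz(4) assms(2) by (simp add: ag_diff cx_ag ag_ac)
      finally show "y = \<phi> (n - 1) (Two x0 (y0 \<ominus>\<^bsub>obj Y' (n - 1)\<^esub> w)) \<ominus>\<^bsub>obj Y (n - 1)\<^esub>
          dif Y (n - 1 - 1) (\<ominus>\<^bsub>obj Y (n - 1 - 1)\<^esub> t)" ..
    qed (use x0 y0 wc t assms in \<open>simp_all add: ag_simps cx_ag V_def cpx_sum_simps\<close>)
  qed
  moreover have "Hsurj W X u"
    unfolding Hsurj_def
  proof (intro allI ballI)
    fix n x assume x: "x \<in> cocycles X n"
    obtain y' where y': "y' \<in> cocycles Y' n" "f n x \<ominus>\<^bsub>obj Y n\<^esub> q n y' \<in> coboundaries Y n"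
      using q(3) cm_cocycle[OF assms(4,1,2) x] unfolding Hsurj_def by blast
    then obtain y where y: "y \<in> carrier (obj Y (n - 1))" "f n x \<ominus>\<^bsub>obj Y n\<^esub> q n y' = dif Y (n - 1) y" by (auto elim: cobE)
    have "Two x y' \<in> cocycles V n" using x y' by (simp add: V_def cocycles_iff cpx_sum_simps)
    hence "Two (Two x y') y \<in> cocycles W n"
      using y unfolding W_def hfib_cocycle[OF V assms(2) \<phi>] by (simp add: \<phi>_def)
    moreover have "x \<ominus>\<^bsub>obj X n\<^esub> u n (Two (Two x y') y) \<in> coboundaries X n"
      using cocycle_closed[OF x] cob_zero[OF assms(1)]
      by (simp add: u_def abelian_group.r_neg cx_ag assms a_minus_def)
    ultimately show "\<exists>z\<in>cocycles W n. x \<ominus>\<^bsub>obj X n\<^esub> u n z \<in> coboundaries X n" by blast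
  qed
  ultimately have "quasi_iso A W X u" using u by (simp add: quasi_iso_iff W assms)
  thus ?thesis using W v h by blast
qed

text \<open>A null-homotopy \<open>h\<close> of q f turns f into a chain map (f, h) to the homotopy
  fibre of \<open>q\<close>, which is acyclic. The fibre of that map is quasi-isomorphic to
  \<open>X\<close>, and over it f factors through a null-homotopic map.\<close>

lemma ore_cancel:
  fixes X Y Y' :: "('a, 'i) ecpx"
  assumes "cx X" "cx Y" "cx Y'" "cm X Y f" "quasi_iso A Y Y' q"
    "homotopic A X Y' (chain_comp q f) (\<lambda>n x. \<zero>\<^bsub>obj Y' n\<^esub>)"
  shows "\<exists>W u. cx W \<and> quasi_iso A W X u \<and> homotopic A W Y (chain_comp f u) (\<lambda>n x. \<zero>\<^bsub>obj Y n\<^esub>)"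
proof -
  have q: "cm Y Y' q" using assms(5) by (simp_all add: quasi_iso_iff assms(1-3))
  obtain h where h: "\<And>n. h n \<in> rmod_hom A (obj X n) (obj Y' (n - 1))"
    "\<And>n x. x \<in> carrier (obj X n) \<Longrightarrow> q n (f n x) \<ominus>\<^bsub>obj Y' n\<^esub> \<zero>\<^bsub>obj Y' n\<^esub> =
      dif Y' (n - 1) (h n x) \<oplus>\<^bsub>obj Y' n\<^esub> h (n + 1) (dif X n x)"
    using assms(6) unfolding homotopic_def chain_comp_def by auto
  define C where "C = hfib Y Y' q"
  have C: "cx C" "acyclic C" unfolding C_def using hfib_cx hfib_acyclic assms q by blast+
  define \<phi> where "\<phi> = (\<lambda>n x. Two (f n x) (h n x))"
  have \<phi>: "cm X C \<phi>"
  proof (rule cmI)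
    show "\<phi> n \<in> rmod_hom A (obj X n) (obj C n)" for n
      unfolding \<phi>_def C_def hfib_simps by (intro pair_hom cm_hom[OF assms(4)] h)
    fix n x assume x: "x \<in> carrier (obj X n)"
    have c: "q n (f n x) \<in> carrier (obj Y' n)" "dif Y' (n - 1) (h n x) \<in> carrier (obj Y' n)"
      "h (n + 1) (dif X n x) \<in> carrier (obj Y' n)"
      using x homD(1)[OF h(1) x] homD(1)[OF h(1)[of "n + 1"], of "dif X n x"] assms
      by (simp_all add: cm_closed[OF q] cm_closed[OF assms(4)] d_closed)
    have "q n (f n x) \<ominus>\<^bsub>obj Y' n\<^esub> dif Y' (n - 1) (h n x) = h (n + 1) (dif X n x)"
      using h(2)[OF x] c assms(3) by (simp add: ag_diff cx_ag ag_ac)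
    thus "\<phi> (n + 1) (dif X n x) = dif C n (\<phi> n x)"
      using cm_d[OF assms(4) x] by (simp add: \<phi>_def C_def hfib_simps)
  qed
  have W: "cx (hfib X C \<phi>)" "quasi_iso A (hfib X C \<phi>) X (\<lambda>n. first)"
    using hfib_cx hfib_quasi_iso assms(1) C \<phi> by blast+
  have CY: "cm C Y (\<lambda>n. first)" unfolding C_def by (rule hfib_fst_cm)
  have u: "cm (hfib X C \<phi>) X (\<lambda>n. first)" by (rule hfib_fst_cm)
  have "homotopic A (hfib X C \<phi>) Y (chain_comp (\<lambda>n. first) (chain_comp \<phi> (\<lambda>n. first)))
      (chain_comp (\<lambda>n. first) (\<lambda>n x. \<zero>\<^bsub>obj C n\<^esub>))"
    by (intro homotopic_comp_left[OF W(1) C(1) assms(2) _ _ CY] cm_comp[OF u \<phi>] cm_zero_map W C hfib_null \<phi> assms)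
  moreover have "chain_comp (\<lambda>n. first) (chain_comp \<phi> (\<lambda>n. first)) = chain_comp f (\<lambda>n. first)"
    by (simp add: chain_comp_def comp_def \<phi>_def)
  moreover have "chain_comp (\<lambda>n. first) (\<lambda>n x. \<zero>\<^bsub>obj C n\<^esub>) = (\<lambda>n x. \<zero>\<^bsub>obj Y n\<^esub>)"
    by (simp add: chain_comp_def comp_def C_def hfib_simps)
  ultimately show ?thesis using W by metis
qed

end

lemma chain_comp_assoc: "chain_comp h (chain_comp g f) = chain_comp (chain_comp h g) f"
  by (simp add: chain_comp_def o_assoc)

lemma chain_comp_id [simp]: "chain_comp f (\<lambda>n x. x) = f" "chain_comp (\<lambda>n x. x) f = f"
  by (simp_all add: chain_comp_def comp_def)

section \<open>Roofs, their equivalence, and vanishing of morphisms in the derived category\<close>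

context kalg begin

abbreviation qi :: "('a, 'm) cpx \<Rightarrow> ('a, 'm) cpx \<Rightarrow> (int \<Rightarrow> 'm \<Rightarrow> 'm) \<Rightarrow> bool" where "qi \<equiv> quasi_iso A"
abbreviation ht :: "('a, 'm) cpx \<Rightarrow> ('a, 'm) cpx \<Rightarrow> (int \<Rightarrow> 'm \<Rightarrow> 'm) \<Rightarrow> (int \<Rightarrow> 'm \<Rightarrow> 'm) \<Rightarrow> bool"
  where "ht \<equiv> homotopic A"

lemma qi_cm: "qi X Y f \<Longrightarrow> cm X Y f"
  by (simp add: quasi_iso_def)

lemma qi_id: "cx X \<Longrightarrow> qi X X (\<lambda>n x. x)"
proof -
  assume X: "cx X"
  have "\<exists>x\<in>cocycles X n. y \<ominus>\<^bsub>obj X n\<^esub> x \<in> coboundaries X n" if "y \<in> cocycles X n" for n y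
    using that X by (intro bexI[of _ y]) (simp_all add: a_minus_def abelian_group.r_neg cx_ag cocycle_closed cob_zero)
  thus ?thesis using X by (simp add: quasi_iso_iff cm_id Hinj_def Hsurj_def)
qed

lemma qi_comp:
  "cx X \<Longrightarrow> cx Y \<Longrightarrow> cx Z \<Longrightarrow> qi X Y f \<Longrightarrow> qi Y Z g \<Longrightarrow> qi X Z (chain_comp g f)"
  using Hinj_comp[of X Y f Z g] Hsurj_comp[of X Y Z f g] by (simp add: quasi_iso_iff cm_comp[of X Y f Z g])

lemma qi_right:
  assumes "cx X" "cx Y" "cx Z" "cm X Y f" "qi Y Z g" "qi X Z (chain_comp g f)"
  shows "qi X Y f"
proof -
  have "cm Y Z g" "Hinj Y Z g" "Hinj X Z (chain_comp g f)" "Hsurj X Z (chain_comp g f)"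
    using assms(5,6) by (simp_all add: quasi_iso_iff assms(1-3))
  thus ?thesis using assms(1-4) Hinj_cancel[of Y Z g X f] Hsurj_left[OF assms(1-4), of g] by (simp add: quasi_iso_iff)
qed

lemma qi_left:
  assumes "cx X" "cx Y" "cx Z" "qi X Y f" "cm Y Z g" "qi X Z (chain_comp g f)"
  shows "qi Y Z g"
proof -
  have "cm X Y f" "Hsurj X Y f" "Hinj X Z (chain_comp g f)" "Hsurj X Z (chain_comp g f)"
    using assms(4,6) by (simp_all add: quasi_iso_iff assms(1-3))
  thus ?thesis using assms(1-3,5) Hsurj_cancel[of X Y f Z g] Hinj_right[OF assms(1-3), of f g] by (simp add: quasi_iso_iff)
qed

lemma qi_homotopic:
  assumes "cx X" "cx Y" "cm X Y g" "ht X Y f g" "qi X Y f"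
  shows "qi X Y g"
  using assms Hinj_homotopic[OF assms(1,2) _ assms(3,4)] Hsurj_homotopic[OF assms(1,2) _ assms(3,4)]
  by (simp add: quasi_iso_iff)

lemma roofs_iff: "(Z, s, f) \<in> roofs A X Y \<longleftrightarrow> cx Z \<and> qi Z X s \<and> cm Z Y f"
  by (simp add: roofs_def)

lemma roof_rel_iff:
  "((Z, s, f), (Z', s', f')) \<in> roof_rel A X Y \<longleftrightarrow>
    (Z, s, f) \<in> roofs A X Y \<and> (Z', s', f') \<in> roofs A X Y \<and>
    (\<exists>W g g'. cx W \<and> cm W Z g \<and> cm W Z' g' \<and> qi W X (chain_comp s g) \<and>
      ht W X (chain_comp s g) (chain_comp s' g') \<and> ht W Y (chain_comp f g) (chain_comp f' g'))"
  by (simp add: roof_rel_def)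

lemma roof_rel_refl:
  assumes "cx X" "cx Y" "r \<in> roofs A X Y"
  shows "(r, r) \<in> roof_rel A X Y"
proof (cases r)
  case (fields Z s f)
  hence r: "cx Z" "qi Z X s" "cm Z Y f" using assms by (simp_all add: roofs_iff)
  show ?thesis unfolding fields roof_rel_iff
    using assms r fields homotopic_refl[OF r(1) assms(1) qi_cm[OF r(2)]] homotopic_refl[OF r(1) assms(2) r(3)]
    by (intro conjI exI[of _ Z] exI[of _ "\<lambda>n x. x"] cm_id) simp_all
qed

lemma roof_rel_sym:
  assumes "cx X" "cx Y" "(r, r') \<in> roof_rel A X Y"
  shows "(r', r) \<in> roof_rel A X Y"
proof (cases r, cases r')
  fix Z s f Z' s' f' assume rr: "r = (Z, s, f)" "r' = (Z', s', f')"
  obtain W g g' where W: "cx W" "cm W Z g" "cm W Z' g'" "qi W X (chain_comp s g)"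
      "ht W X (chain_comp s g) (chain_comp s' g')" "ht W Y (chain_comp f g) (chain_comp f' g')"
    and r: "(Z, s, f) \<in> roofs A X Y" "(Z', s', f') \<in> roofs A X Y"
    using assms(3) unfolding rr roof_rel_iff by blast
  have c: "cm Z X s" "cm Z Y f" "cm Z' X s'" "cm Z' Y f'" using r qi_cm by (auto simp: roofs_iff)
  have "qi W X (chain_comp s' g')"
    using qi_homotopic[OF W(1) assms(1) cm_comp[OF W(3) c(3)] W(5,4)] .
  moreover have "ht W X (chain_comp s' g') (chain_comp s g)"
    using homotopic_sym[OF W(1) assms(1) cm_comp[OF W(2) c(1)] cm_comp[OF W(3) c(3)] W(5)] .
  moreover have "ht W Y (chain_comp f' g') (chain_comp f g)"
    using homotopic_sym[OF W(1) assms(2) cm_comp[OF W(2) c(2)] cm_comp[OF W(3) c(4)] W(6)] .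
  ultimately show ?thesis unfolding rr roof_rel_iff using W r by blast
qed

text \<open>The refinements \<open>W\<close> and \<open>W'\<close> both map to the middle apex
  \<open>Z'\<close>, and the leg of \<open>W'\<close> is a quasi-isomorphism by two-out-of-three. So
  \<open>ore\<close> gives a common refinement \<open>V\<close> of both.\<close>

lemma roof_rel_trans:
  fixes X Y :: "('a, 'i) ecpx"
  assumes "cx X" "cx Y" "(r, r') \<in> roof_rel A X Y" "(r', r'') \<in> roof_rel A X Y"
  shows "(r, r'') \<in> roof_rel A X Y"
proof (cases r, cases r', cases r'')
  fix Z s f Z' s' f' Z'' s'' f'' assume rr: "r = (Z, s, f)" "r' = (Z', s', f')" "r'' = (Z'', s'', f'')"
  obtain W a b where W: "cx W" "cm W Z a" "cm W Z' b" "qi W X (chain_comp s a)"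
      "ht W X (chain_comp s a) (chain_comp s' b)" "ht W Y (chain_comp f a) (chain_comp f' b)"
    and r: "(Z, s, f) \<in> roofs A X Y" "(Z', s', f') \<in> roofs A X Y"
    using assms(3) unfolding rr roof_rel_iff by blast
  obtain W' c d where W': "cx W'" "cm W' Z' c" "cm W' Z'' d" "qi W' X (chain_comp s' c)"
      "ht W' X (chain_comp s' c) (chain_comp s'' d)" "ht W' Y (chain_comp f' c) (chain_comp f'' d)"
    and r': "(Z'', s'', f'') \<in> roofs A X Y"
    using assms(4) unfolding rr roof_rel_iff by blast
  have Z: "cx Z" "qi Z X s" "cm Z Y f" "cx Z'" "qi Z' X s'" "cm Z' Y f'" "cx Z''" "qi Z'' X s''" "cm Z'' Y f''"
    using r r' by (simp_all add: roofs_iff)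
  note q = qi_cm[OF Z(2)] qi_cm[OF Z(5)] qi_cm[OF Z(8)]
  have c: "qi W' Z' c" using qi_right[OF W'(1) Z(4) assms(1) W'(2) Z(5) W'(4)] .
  obtain V u v where V: "cx V" "qi V W u" "cm V W' v" "ht V Z' (chain_comp b u) (chain_comp c v)"
    using ore[OF W(1) Z(4) W'(1) W(3) c] by blast
  note u = qi_cm[OF V(2)]
  \<comment> \<open>Stated for a general target \<open>T\<close>, because the argument is needed
    once for the left legs into \<open>X\<close> and once for the right legs into
    \<open>Y\<close>.\<close>
  have k: "ht V T (chain_comp h (chain_comp a u)) (chain_comp h'' (chain_comp d v))"
    if T: "cx T" "cm Z T h" "cm Z' T h'" "cm Z'' T h''" "ht W T (chain_comp h a) (chain_comp h' b)"
      "ht W' T (chain_comp h' c) (chain_comp h'' d)" for T h h' h''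
  proof -
    have 1: "ht V T (chain_comp (chain_comp h a) u) (chain_comp (chain_comp h' b) u)"
      by (rule homotopic_comp_right[OF u T(5)])
    have 2: "ht V T (chain_comp h' (chain_comp b u)) (chain_comp h' (chain_comp c v))"
      by (rule homotopic_comp_left[OF V(1) Z(4) T(1) cm_comp[OF u W(3)] cm_comp[OF V(3) W'(2)] T(3) V(4)])
    have 3: "ht V T (chain_comp (chain_comp h' c) v) (chain_comp (chain_comp h'' d) v)"
      by (rule homotopic_comp_right[OF V(3) T(6)])
    note m = cm_comp[OF cm_comp[OF u W(2)] T(2)] cm_comp[OF cm_comp[OF u W(3)] T(3)]
      cm_comp[OF cm_comp[OF V(3) W'(2)] T(3)] cm_comp[OF cm_comp[OF V(3) W'(3)] T(4)]
    show ?thesis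
      using homotopic_trans[OF V(1) T(1) m(1,2,4) _ homotopic_trans[OF V(1) T(1) m(2,3,4)]] 1 2 3
      by (simp add: chain_comp_assoc)
  qed
  have "qi V X (chain_comp s (chain_comp a u))"
    using qi_comp[OF V(1) W(1) assms(1) V(2) W(4)] by (simp add: chain_comp_assoc)
  thus ?thesis unfolding rr roof_rel_iff
    using r r' V(1) cm_comp[OF u W(2)] cm_comp[OF V(3) W'(3)]
      k[OF assms(1) q(1,2,3) W(5) W'(5)] k[OF assms(2) Z(3,6,9) W(6) W'(6)] by blast
qed

lemma roof_class_eq:
  fixes X Y :: "('a, 'i) ecpx"
  assumes "cx X" "cx Y" "(r, r') \<in> roof_rel A X Y"
  shows "roof_rel A X Y `` {r} = roof_rel A X Y `` {r'}"
  using roof_rel_trans[OF assms(1,2)] roof_rel_sym[OF assms(1,2)] assms(3) by blast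

text \<open>Being equivalent to the zero roof on \<open>X\<close> means becoming null-homotopic on a
  refinement \<open>W\<close> of the apex: the leg of \<open>W\<close> into \<open>X\<close> can be
  taken to be s g, and g is a quasi-isomorphism by two-out-of-three.\<close>

lemma derived_hom_zero_iff:
  fixes X Y :: "('a, 'i) ecpx"
  assumes "cx X" "cx Y"
  shows "derived_hom A X Y = {derived_zero A X Y} \<longleftrightarrow>
    (\<forall>Z s f. cx Z \<longrightarrow> qi Z X s \<longrightarrow> cm Z Y f \<longrightarrow>
      (\<exists>W g. cx W \<and> qi W Z g \<and> ht W Y (chain_comp f g) (\<lambda>n x. \<zero>\<^bsub>obj Y n\<^esub>)))"
proof -
  let ?z = "(X, \<lambda>n x. x, \<lambda>n x. \<zero>\<^bsub>obj Y n\<^esub>)"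
  have z: "?z \<in> roofs A X Y" using assms by (simp add: roofs_iff qi_id cm_zero_map)
  have key: "((Z, s, f), ?z) \<in> roof_rel A X Y \<longleftrightarrow>
      (\<exists>W g. cx W \<and> qi W Z g \<and> ht W Y (chain_comp f g) (\<lambda>n x. \<zero>\<^bsub>obj Y n\<^esub>))"
    if Z: "cx Z" "qi Z X s" "cm Z Y f" for Z s f
  proof
    assume "((Z, s, f), ?z) \<in> roof_rel A X Y"
    then obtain W g g' where W: "cx W" "cm W Z g" "qi W X (chain_comp s g)"
      "ht W Y (chain_comp f g) (chain_comp (\<lambda>n x. \<zero>\<^bsub>obj Y n\<^esub>) g')"
      unfolding roof_rel_iff by blast
    have "qi W Z g" using qi_right[OF W(1) Z(1) assms(1) W(2) Z(2) W(3)] .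
    thus "\<exists>W g. cx W \<and> qi W Z g \<and> ht W Y (chain_comp f g) (\<lambda>n x. \<zero>\<^bsub>obj Y n\<^esub>)"
      using W(1,4) by (auto simp: chain_comp_def comp_def)
  next
    assume "\<exists>W g. cx W \<and> qi W Z g \<and> ht W Y (chain_comp f g) (\<lambda>n x. \<zero>\<^bsub>obj Y n\<^esub>)"
    then obtain W g where W: "cx W" "qi W Z g" "ht W Y (chain_comp f g) (\<lambda>n x. \<zero>\<^bsub>obj Y n\<^esub>)" by blast
    note sg = qi_comp[OF W(1) Z(1) assms(1) W(2) Z(2)]
    have "ht W X (chain_comp s g) (chain_comp (\<lambda>n x. x) (chain_comp s g))"
      using homotopic_refl[OF W(1) assms(1) qi_cm[OF sg]] by simp
    moreover have "chain_comp (\<lambda>n x. \<zero>\<^bsub>obj Y n\<^esub>) (chain_comp s g) = (\<lambda>n x. \<zero>\<^bsub>obj Y n\<^esub>)"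
      by (simp add: chain_comp_def comp_def)
    ultimately show "((Z, s, f), ?z) \<in> roof_rel A X Y"
      unfolding roof_rel_iff using z W sg Z qi_cm[OF sg] qi_cm[OF W(2)]
      by (intro conjI exI[of _ W] exI[of _ g] exI[of _ "chain_comp s g"]) (simp_all add: roofs_iff)
  qed
  have "derived_hom A X Y = {derived_zero A X Y} \<longleftrightarrow> (\<forall>r\<in>roofs A X Y. (r, ?z) \<in> roof_rel A X Y)"
  proof
    assume e: "derived_hom A X Y = {derived_zero A X Y}"
    show "\<forall>r\<in>roofs A X Y. (r, ?z) \<in> roof_rel A X Y"
    proof
      fix r assume r: "r \<in> roofs A X Y"
      have "roof_rel A X Y `` {r} \<in> derived_hom A X Y" unfolding derived_hom_def using r by (rule quotientI)
      hence "roof_rel A X Y `` {r} = roof_rel A X Y `` {?z}" using e by (simp add: derived_zero_def derived_of_def)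
      thus "(r, ?z) \<in> roof_rel A X Y" using roof_rel_refl[OF assms z] by blast
    qed
  next
    assume a: "\<forall>r\<in>roofs A X Y. (r, ?z) \<in> roof_rel A X Y"
    have "derived_zero A X Y \<in> derived_hom A X Y"
      unfolding derived_hom_def derived_zero_def derived_of_def using z by (rule quotientI)
    moreover have "c = derived_zero A X Y" if c: "c \<in> derived_hom A X Y" for c
    proof -
      obtain r where "r \<in> roofs A X Y" "c = roof_rel A X Y `` {r}"
        using c unfolding derived_hom_def by (rule quotientE)
      thus ?thesis using roof_class_eq[OF assms] a by (simp add: derived_zero_def derived_of_def)
    qed
    ultimately show "derived_hom A X Y = {derived_zero A X Y}" by blast
  qed
  also have "\<dots> \<longleftrightarrow> (\<forall>Z s f. cx Z \<longrightarrow> qi Z X s \<longrightarrow> cm Z Y f \<longrightarrow> ((Z, s, f), ?z) \<in> roof_rel A X Y)"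
    by (auto simp: roofs_iff)
  finally show ?thesis using key by auto
qed

text \<open>Composition with \<open>t\<close> turns roofs from \<open>U\<close> into roofs from
  \<open>X\<close>. Conversely, a roof from \<open>X\<close> is pulled back to one from
  \<open>U\<close> by the Ore square of its left leg with \<open>t\<close>.\<close>

lemma derived_hom_zero_left:
  fixes X Y U :: "('a, 'i) ecpx"
  assumes "cx X" "cx Y" "cx U" "qi U X t"
  shows "derived_hom A X Y = {derived_zero A X Y} \<longleftrightarrow> derived_hom A U Y = {derived_zero A U Y}"
proof
  assume "derived_hom A X Y = {derived_zero A X Y}"
  thus "derived_hom A U Y = {derived_zero A U Y}"
    unfolding derived_hom_zero_iff[OF assms(1,2)] derived_hom_zero_iff[OF assms(3,2)]
    using qi_comp[OF _ assms(3,1) _ assms(4)] by blast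
next
  assume V: "derived_hom A U Y = {derived_zero A U Y}"
  show "derived_hom A X Y = {derived_zero A X Y}"
    unfolding derived_hom_zero_iff[OF assms(1,2)]
  proof (intro allI impI)
    fix Z s f assume Z: "cx Z" "qi Z X s" "cm Z Y f"
    obtain Z' u v where Z': "cx Z'" "qi Z' Z u" "cm Z' U v" "ht Z' X (chain_comp s u) (chain_comp t v)"
      using ore[OF Z(1) assms(1,3) qi_cm[OF Z(2)] assms(4)] by blast
    have "qi Z' X (chain_comp t v)"
      using qi_homotopic[OF Z'(1) assms(1) cm_comp[OF Z'(3) qi_cm[OF assms(4)]] Z'(4)
        qi_comp[OF Z'(1) Z(1) assms(1) Z'(2) Z(2)]] .
    hence v: "qi Z' U v" using qi_right[OF Z'(1) assms(3,1) Z'(3) assms(4)] by blast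
    obtain W g where W: "cx W" "qi W Z' g" "ht W Y (chain_comp (chain_comp f u) g) (\<lambda>n x. \<zero>\<^bsub>obj Y n\<^esub>)"
      using V[unfolded derived_hom_zero_iff[OF assms(3,2)]] Z'(1) v cm_comp[OF qi_cm[OF Z'(2)] Z(3)] by blast
    show "\<exists>W g. cx W \<and> qi W Z g \<and> ht W Y (chain_comp f g) (\<lambda>n x. \<zero>\<^bsub>obj Y n\<^esub>)"
      using W qi_comp[OF W(1) Z'(1) Z(1) W(2) Z'(2)]
      by (intro exI[of _ W] exI[of _ "chain_comp u g"]) (simp add: chain_comp_assoc)
  qed
qed

lemma null_comp_left:
  assumes "cx X" "cx Y" "cx Z" "cm X Y f" "cm Y Z v" "ht X Y f (\<lambda>n x. \<zero>\<^bsub>obj Y n\<^esub>)"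
  shows "ht X Z (chain_comp v f) (\<lambda>n x. \<zero>\<^bsub>obj Z n\<^esub>)"
  using homotopic_comp_left[OF assms(1-4) cm_zero_map[OF assms(1,2)] assms(5,6)] cm_zero[OF assms(5,2,3)]
  by (simp add: chain_comp_def comp_def)

text \<open>The two directions use the two halves of the calculus of fractions: a map into
  \<open>Y'\<close> is brought back to \<open>Y\<close> by \<open>ore\<close>, and a map into
  \<open>Y\<close> that dies in \<open>Y'\<close> is killed by a refinement through
  \<open>ore_cancel\<close>.\<close>

lemma derived_hom_zero_right:
  fixes X Y Y' :: "('a, 'i) ecpx"
  assumes "cx X" "cx Y" "cx Y'" "qi Y Y' q"
  shows "derived_hom A X Y = {derived_zero A X Y} \<longleftrightarrow> derived_hom A X Y' = {derived_zero A X Y'}"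
proof
  note q = qi_cm[OF assms(4)]
  assume V: "derived_hom A X Y = {derived_zero A X Y}"
  show "derived_hom A X Y' = {derived_zero A X Y'}"
    unfolding derived_hom_zero_iff[OF assms(1,3)]
  proof (intro allI impI)
    fix Z s f assume Z: "cx Z" "qi Z X s" "cm Z Y' f"
    obtain Z' u v where Z': "cx Z'" "qi Z' Z u" "cm Z' Y v" "ht Z' Y' (chain_comp f u) (chain_comp q v)"
      using ore[OF Z(1) assms(3,2) Z(3) assms(4)] by blast
    obtain W g where W: "cx W" "qi W Z' g" "ht W Y (chain_comp v g) (\<lambda>n x. \<zero>\<^bsub>obj Y n\<^esub>)"
      using V[unfolded derived_hom_zero_iff[OF assms(1,2)]] Z'(1,3) qi_comp[OF Z'(1) Z(1) assms(1) Z'(2) Z(2)] by blast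
    note g = qi_cm[OF W(2)] and u = qi_cm[OF Z'(2)]
    have "ht W Y' (chain_comp q (chain_comp v g)) (\<lambda>n x. \<zero>\<^bsub>obj Y' n\<^esub>)"
      by (rule null_comp_left[OF W(1) assms(2,3) cm_comp[OF g Z'(3)] q W(3)])
    moreover have "ht W Y' (chain_comp (chain_comp f u) g) (chain_comp (chain_comp q v) g)"
      by (rule homotopic_comp_right[OF g Z'(4)])
    ultimately have "ht W Y' (chain_comp f (chain_comp u g)) (\<lambda>n x. \<zero>\<^bsub>obj Y' n\<^esub>)"
      using homotopic_trans[OF W(1) assms(3) cm_comp[OF cm_comp[OF g u] Z(3)]
        cm_comp[OF cm_comp[OF g Z'(3)] q] cm_zero_map[OF W(1) assms(3)]] by (simp add: chain_comp_assoc)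
    thus "\<exists>W g. cx W \<and> qi W Z g \<and> ht W Y' (chain_comp f g) (\<lambda>n x. \<zero>\<^bsub>obj Y' n\<^esub>)"
      using W qi_comp[OF W(1) Z'(1) Z(1) W(2) Z'(2)] by blast
  qed
next
  note q = qi_cm[OF assms(4)]
  assume V: "derived_hom A X Y' = {derived_zero A X Y'}"
  show "derived_hom A X Y = {derived_zero A X Y}"
    unfolding derived_hom_zero_iff[OF assms(1,2)]
  proof (intro allI impI)
    fix Z s f assume Z: "cx Z" "qi Z X s" "cm Z Y f"
    obtain W g where W: "cx W" "qi W Z g" "ht W Y' (chain_comp (chain_comp q f) g) (\<lambda>n x. \<zero>\<^bsub>obj Y' n\<^esub>)"
      using V[unfolded derived_hom_zero_iff[OF assms(1,3)]] Z(1,2) cm_comp[OF Z(3) q] by blast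
    obtain W' u where W': "cx W'" "qi W' W u" "ht W' Y (chain_comp (chain_comp f g) u) (\<lambda>n x. \<zero>\<^bsub>obj Y n\<^esub>)"
      using ore_cancel[OF W(1) assms(2,3) cm_comp[OF qi_cm[OF W(2)] Z(3)] assms(4)] W(3)
      by (auto simp: chain_comp_assoc)
    show "\<exists>W g. cx W \<and> qi W Z g \<and> ht W Y (chain_comp f g) (\<lambda>n x. \<zero>\<^bsub>obj Y n\<^esub>)"
      using W' qi_comp[OF W'(1) W(1) Z(1) W'(2) W(2)]
      by (intro exI[of _ W'] exI[of _ "chain_comp g u"]) (simp add: chain_comp_assoc)
  qed
qed

subsection \<open>Isomorphisms in the derived category\<close>

text \<open>A working substitute for \<open>derived_iso\<close>, justified by
  \<open>derived_iso_iff_qeq\<close>: a roof both of whose legs are quasi-isomorphisms.\<close>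

definition qeq :: "('a, 'i) ecpx \<Rightarrow> ('a, 'i) ecpx \<Rightarrow> bool" where
  "qeq X Y \<longleftrightarrow> cx X \<and> cx Y \<and> (\<exists>Z s t. cx Z \<and> qi Z X s \<and> qi Z Y t)"

text \<open>\<open>derived_comp\<close> collects the composites over all representatives and all Ore
  squares. The equality with the identity class therefore contains the well-definedness of
  composition in this case, which is the bulk of the argument; the reverse inclusion uses the
  obvious square over \<open>Z\<close>.\<close>

lemma roof_inverse:
  fixes X Y Z :: "('a, 'i) ecpx"
  assumes "cx X" "cx Y" "cx Z" "qi Z X s" "qi Z Y t"
  shows "derived_comp A X Y X (roof_rel A X Y `` {(Z, s, t)}) (roof_rel A Y X `` {(Z, t, s)}) = derived_id A X"
proof -
  have rZ: "(Z, s, t) \<in> roofs A X Y" "(Z, t, s) \<in> roofs A Y X"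
    using assms qi_cm by (simp_all add: roofs_iff)
  note s = qi_cm[OF assms(4)] and t = qi_cm[OF assms(5)]
  let ?i = "(X, \<lambda>n x. x, \<lambda>n x. x)"
  have i: "?i \<in> roofs A X X" using assms by (simp add: roofs_iff qi_id cm_id)
  have ss: "((Z, s, s), ?i) \<in> roof_rel A X X"
    unfolding roof_rel_iff using i assms s
    by (intro conjI exI[of _ Z] exI[of _ "\<lambda>n x. x"] exI[of _ s] cm_id) (simp_all add: roofs_iff homotopic_refl)
  have main: "((W, chain_comp s1 u, chain_comp g1 v), ?i) \<in> roof_rel A X X"
    if a: "((Z, s, t), (U, s1, f1)) \<in> roof_rel A X Y" "((Z, t, s), (V, t1, g1)) \<in> roof_rel A Y X"
      "cx W" "qi W U u" "cm W V v" "ht W Y (chain_comp f1 u) (chain_comp t1 v)" for U s1 f1 V t1 g1 W u v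
  proof -
    obtain W1 a b where W1: "cx W1" "cm W1 Z a" "cm W1 U b" "qi W1 X (chain_comp s a)"
        "ht W1 X (chain_comp s a) (chain_comp s1 b)" "ht W1 Y (chain_comp t a) (chain_comp f1 b)"
      and U: "cx U" "qi U X s1" "cm U Y f1"
      using a(1) unfolding roof_rel_iff roofs_iff by blast
    obtain W2 c d where W2: "cx W2" "cm W2 Z c" "cm W2 V d" "qi W2 Y (chain_comp t c)"
        "ht W2 Y (chain_comp t c) (chain_comp t1 d)" "ht W2 X (chain_comp s c) (chain_comp g1 d)"
      and V: "cx V" "qi V Y t1" "cm V X g1"
      using a(2) unfolding roof_rel_iff roofs_iff by blast
    note s1 = qi_cm[OF U(2)] and t1 = qi_cm[OF V(2)] and u = qi_cm[OF a(4)]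
    have b: "qi W1 U b"
      using qi_right[OF W1(1) U(1) assms(1) W1(3) U(2)]
        qi_homotopic[OF W1(1) assms(1) cm_comp[OF W1(3) s1] W1(5,4)] by blast
    have d: "qi W2 V d"
      using qi_right[OF W2(1) V(1) assms(2) W2(3) V(2)]
        qi_homotopic[OF W2(1) assms(2) cm_comp[OF W2(3) t1] W2(5,4)] by blast
    \<comment> \<open>Two Ore squares produce \<open>W4\<close>, which refines the given square
      \<open>W\<close> as well as the witnesses \<open>W1\<close> and \<open>W2\<close> of the
      equivalences with the original roofs.\<close>
    obtain W3 e e' where W3: "cx W3" "qi W3 W e" "cm W3 W1 e'" "ht W3 U (chain_comp u e) (chain_comp b e')"
      using ore[OF a(3) U(1) W1(1) u b] by blast
    note e = qi_cm[OF W3(2)]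
    obtain W4 p p' where W4: "cx W4" "qi W4 W3 p" "cm W4 W2 p'"
      "ht W4 V (chain_comp (chain_comp v e) p) (chain_comp d p')"
      using ore[OF W3(1) V(1) W2(1) cm_comp[OF e a(5)] d] by blast
    note p = qi_cm[OF W4(2)]
    define k1 where "k1 = chain_comp e' p"
    define k where "k = chain_comp e p"
    have k: "qi W4 W k" unfolding k_def by (rule qi_comp[OF W4(1) W3(1) a(3) W4(2) W3(2)])
    note k' = qi_cm[OF k]
    have k1: "cm W4 W1 k1" unfolding k1_def by (rule cm_comp[OF p W3(3)])
    have h1: "ht W4 U (chain_comp u k) (chain_comp b k1)"
      using homotopic_comp_right[OF p W3(4)] by (simp add: k_def k1_def chain_comp_assoc)
    have h2: "ht W4 V (chain_comp v k) (chain_comp d p')"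
      using W4(4) by (simp add: k_def chain_comp_assoc)
    note m = cm_comp[OF k1 W1(2)] cm_comp[OF W4(3) W2(2)] cm_comp[OF k1 W1(3)] cm_comp[OF W4(3) W2(3)]
      cm_comp[OF k' u] cm_comp[OF k' a(5)]
    have tr: "\<And>f g h T. cx T \<Longrightarrow> ht W4 T f g \<Longrightarrow> ht W4 T g h \<Longrightarrow> cm W4 T f \<Longrightarrow> cm W4 T g \<Longrightarrow> cm W4 T h \<Longrightarrow> ht W4 T f h"
      using homotopic_trans[OF W4(1)] by blast
    have sy: "\<And>f g T. cx T \<Longrightarrow> ht W4 T f g \<Longrightarrow> cm W4 T f \<Longrightarrow> cm W4 T g \<Longrightarrow> ht W4 T g f"
      using homotopic_sym[OF W4(1)] by blast
    \<comment> \<open>Up to homotopy on \<open>W4\<close>: t a k1 = f1 b k1 = f1 u k = t1 v k = t1 d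
      p' = t c p'. So the two maps a k1 and c p' to \<open>Z\<close> agree after composition with
      \<open>t\<close>.\<close>
    have e1: "ht W4 Y (chain_comp t (chain_comp a k1)) (chain_comp f1 (chain_comp b k1))"
      using homotopic_comp_right[OF k1 W1(6)] by (simp add: chain_comp_assoc)
    have e2: "ht W4 Y (chain_comp f1 (chain_comp u k)) (chain_comp f1 (chain_comp b k1))"
      by (rule homotopic_comp_left[OF W4(1) U(1) assms(2) m(5,3) U(3) h1])
    have e3: "ht W4 Y (chain_comp f1 (chain_comp u k)) (chain_comp t1 (chain_comp v k))"
      using homotopic_comp_right[OF k' a(6)] by (simp add: chain_comp_assoc)
    have e4: "ht W4 Y (chain_comp t1 (chain_comp v k)) (chain_comp t1 (chain_comp d p'))"
      by (rule homotopic_comp_left[OF W4(1) V(1) assms(2) m(6,4) t1 h2])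
    have e5: "ht W4 Y (chain_comp t (chain_comp c p')) (chain_comp t1 (chain_comp d p'))"
      using homotopic_comp_right[OF W4(3) W2(5)] by (simp add: chain_comp_assoc)
    note n = cm_comp[OF m(1) t] cm_comp[OF m(3) U(3)] cm_comp[OF m(5) U(3)] cm_comp[OF m(6) t1]
      cm_comp[OF m(4) t1] cm_comp[OF m(2) t]
    have e14: "ht W4 Y (chain_comp t (chain_comp a k1)) (chain_comp t1 (chain_comp d p'))"
      by (rule tr[OF assms(2) tr[OF assms(2) tr[OF assms(2) e1 sy[OF assms(2) e2]] e3] e4]) (rule n)+
    have e15: "ht W4 Y (chain_comp t (chain_comp a k1)) (chain_comp t (chain_comp c p'))"
      by (rule tr[OF assms(2) e14 sy[OF assms(2) e5]]) (rule n)+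
    \<comment> \<open>\<open>ore_cancel\<close> is formulated for null-homotopic maps, so
      \<open>t\<close> is cancelled from the difference; this costs a further refinement
      \<open>q\<close>.\<close>
    define df where "df = (\<lambda>n x. chain_comp a k1 n x \<ominus>\<^bsub>obj Z n\<^esub> chain_comp c p' n x)"
    have df: "cm W4 Z df"
    proof (rule cmI)
      show "df n \<in> rmod_hom A (obj W4 n) (obj Z n)" for n
        unfolding df_def by (intro hom_diff cm_hom m cx_rm assms)
      show "df (n + 1) (dif W4 n x) = dif Z n (df n x)" if "x \<in> carrier (obj W4 n)" for n x
        using that m[THEN cm_closed] assms(3) m(1,2)[THEN cm_d] by (simp add: df_def d_minus[where m = "n + 1"])
    qed
    obtain h where h: "\<And>n. h n \<in> rmod_hom A (obj W4 n) (obj Y (n - 1))"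
      "\<And>n x. x \<in> carrier (obj W4 n) \<Longrightarrow>
        chain_comp t (chain_comp a k1) n x \<ominus>\<^bsub>obj Y n\<^esub> chain_comp t (chain_comp c p') n x
          = dif Y (n - 1) (h n x) \<oplus>\<^bsub>obj Y n\<^esub> h (n + 1) (dif W4 n x)"
      using e15 unfolding homotopic_def by blast
    have "ht W4 Y (chain_comp t df) (\<lambda>n x. \<zero>\<^bsub>obj Y n\<^esub>)"
    proof (rule homotopicI[of h])
      fix n x assume x: "x \<in> carrier (obj W4 n)"
      have "t n (df n x) = chain_comp t (chain_comp a k1) n x \<ominus>\<^bsub>obj Y n\<^esub> chain_comp t (chain_comp c p') n x"
        using m(1,2)[THEN cm_closed, OF x] cm_minus[OF t assms(3,2)] by (simp add: df_def chain_comp_def)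
      thus "chain_comp t df n x \<ominus>\<^bsub>obj Y n\<^esub> \<zero>\<^bsub>obj Y n\<^esub> = dif Y (n - 1) (h n x) \<oplus>\<^bsub>obj Y n\<^esub> h (n + 1) (dif W4 n x)"
        using h(2)[OF x] cm_closed[OF cm_comp[OF df t] x] assms(2) by (simp add: chain_comp_def ag_diff cx_ag)
    qed (rule h)
    then obtain W5 q where W5: "cx W5" "qi W5 W4 q" "ht W5 Z (chain_comp df q) (\<lambda>n x. \<zero>\<^bsub>obj Z n\<^esub>)"
      using ore_cancel[OF W4(1) assms(3,2) df assms(5)] by blast
    note q = qi_cm[OF W5(2)]
    note mq = cm_comp[OF q m(1)] cm_comp[OF q m(2)]
    obtain h' where h': "\<And>n. h' n \<in> rmod_hom A (obj W5 n) (obj Z (n - 1))"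
      "\<And>n x. x \<in> carrier (obj W5 n) \<Longrightarrow>
        chain_comp df q n x \<ominus>\<^bsub>obj Z n\<^esub> \<zero>\<^bsub>obj Z n\<^esub>
          = dif Z (n - 1) (h' n x) \<oplus>\<^bsub>obj Z n\<^esub> h' (n + 1) (dif W5 n x)"
      using W5(3) unfolding homotopic_def by blast
    have e6: "ht W5 Z (chain_comp (chain_comp a k1) q) (chain_comp (chain_comp c p') q)"
    proof (rule homotopicI[of h'])
      fix n x assume x: "x \<in> carrier (obj W5 n)"
      show "chain_comp (chain_comp a k1) q n x \<ominus>\<^bsub>obj Z n\<^esub> chain_comp (chain_comp c p') q n x
          = dif Z (n - 1) (h' n x) \<oplus>\<^bsub>obj Z n\<^esub> h' (n + 1) (dif W5 n x)"
        using h'(2)[OF x] cm_closed[OF cm_comp[OF q df] x] assms(3)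
        by (simp add: chain_comp_def df_def abelian_group.neg_to_diff(8) cx_ag) 
    qed (rule h')
    define kq where "kq = chain_comp k q"
    have kq: "qi W5 W kq" unfolding kq_def by (rule qi_comp[OF W5(1) W4(1) a(3) W5(2) k])
    note kq' = qi_cm[OF kq]
    \<comment> \<open>With \<open>t\<close> cancelled, the legs into \<open>X\<close> can be
      compared on \<open>W5\<close>, up to homotopy and after restriction: s1 u = s1 b = s a = s c =
      g1 d = g1 v.\<close>
    have f1: "ht W5 X (chain_comp s1 (chain_comp u kq)) (chain_comp s1 (chain_comp b (chain_comp k1 q)))"
      using homotopic_comp_right[OF q homotopic_comp_left[OF W4(1) U(1) assms(1) m(5,3) s1 h1]]
      by (simp add: kq_def chain_comp_assoc)
    have f2: "ht W5 X (chain_comp s (chain_comp a (chain_comp k1 q))) (chain_comp s1 (chain_comp b (chain_comp k1 q)))"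
      using homotopic_comp_right[OF cm_comp[OF q k1] W1(5)] by (simp add: chain_comp_assoc)
    have f3: "ht W5 X (chain_comp s (chain_comp a (chain_comp k1 q))) (chain_comp s (chain_comp c (chain_comp p' q)))"
      using homotopic_comp_left[OF W5(1) assms(3,1) mq s e6] by (simp add: chain_comp_assoc)
    have f4: "ht W5 X (chain_comp s (chain_comp c (chain_comp p' q))) (chain_comp g1 (chain_comp d (chain_comp p' q)))"
      using homotopic_comp_right[OF cm_comp[OF q W4(3)] W2(6)] by (simp add: chain_comp_assoc)
    have f5: "ht W5 X (chain_comp g1 (chain_comp v kq)) (chain_comp g1 (chain_comp d (chain_comp p' q)))"
      using homotopic_comp_right[OF q homotopic_comp_left[OF W4(1) V(1) assms(1) m(6,4) V(3) h2]]
      by (simp add: kq_def chain_comp_assoc)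
    have tr5: "\<And>f g h. ht W5 X f g \<Longrightarrow> ht W5 X g h \<Longrightarrow> cm W5 X f \<Longrightarrow> cm W5 X g \<Longrightarrow> cm W5 X h \<Longrightarrow> ht W5 X f h"
      using homotopic_trans[OF W5(1) assms(1)] by blast
    have sy5: "\<And>f g. ht W5 X f g \<Longrightarrow> cm W5 X f \<Longrightarrow> cm W5 X g \<Longrightarrow> ht W5 X g f"
      using homotopic_sym[OF W5(1) assms(1)] by blast
    note l = cm_comp[OF cm_comp[OF kq' u] s1] cm_comp[OF cm_comp[OF cm_comp[OF q k1] W1(3)] s1]
      cm_comp[OF cm_comp[OF cm_comp[OF q k1] W1(2)] s] cm_comp[OF cm_comp[OF cm_comp[OF q W4(3)] W2(2)] s]
      cm_comp[OF cm_comp[OF cm_comp[OF q W4(3)] W2(3)] V(3)] cm_comp[OF cm_comp[OF kq' a(5)] V(3)]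
    have "ht W5 X (chain_comp s1 (chain_comp u kq)) (chain_comp g1 (chain_comp v kq))"
      by (rule tr5[OF tr5[OF tr5[OF tr5[OF f1 sy5[OF f2]] f3] f4] sy5[OF f5]]) (rule l)+
    moreover have "qi W5 X (chain_comp (chain_comp s1 u) kq)"
      by (rule qi_comp[OF W5(1) a(3) assms(1) kq qi_comp[OF a(3) U(1) assms(1) a(4) U(2)]])
    moreover have "(W, chain_comp s1 u, chain_comp g1 v) \<in> roofs A X X"
      using a(3) qi_comp[OF a(3) U(1) assms(1) a(4) U(2)] cm_comp[OF a(5) V(3)] by (simp add: roofs_iff)
    moreover have "ht W5 X (chain_comp s1 (chain_comp u kq)) (chain_comp s1 (chain_comp u kq))"
      by (rule homotopic_refl[OF W5(1) assms(1) l(1)])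
    moreover have "ht W5 X (chain_comp g1 (chain_comp v kq)) (chain_comp s1 (chain_comp u kq))"
      by (rule sy5[OF calculation(1)]) (rule l)+
    ultimately show ?thesis unfolding roof_rel_iff using W5(1) kq' l(1) i
      by (auto simp: chain_comp_assoc)
  qed
  show ?thesis
  proof (intro Set.set_eqI iffI)
    fix r assume "r \<in> derived_comp A X Y X (roof_rel A X Y `` {(Z, s, t)}) (roof_rel A Y X `` {(Z, t, s)})"
    then obtain U s1 f1 V t1 g1 W u v where
      "((Z, s, t), (U, s1, f1)) \<in> roof_rel A X Y" "((Z, t, s), (V, t1, g1)) \<in> roof_rel A Y X"
      "cx W" "qi W U u" "cm W V v" "ht W Y (chain_comp f1 u) (chain_comp t1 v)"
      and r: "((W, chain_comp s1 u, chain_comp g1 v), r) \<in> roof_rel A X X"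
      unfolding derived_comp_def by auto
    hence "((W, chain_comp s1 u, chain_comp g1 v), ?i) \<in> roof_rel A X X" using main by blast
    hence "(?i, r) \<in> roof_rel A X X"
      using roof_rel_trans[OF assms(1,1) roof_rel_sym[OF assms(1,1)] r] by blast
    thus "r \<in> derived_id A X" by (simp add: derived_id_def derived_of_def)
  next
    fix r assume "r \<in> derived_id A X"
    hence "(?i, r) \<in> roof_rel A X X" by (simp add: derived_id_def derived_of_def)
    hence "((Z, s, s), r) \<in> roof_rel A X X" using roof_rel_trans[OF assms(1,1) ss] by blast
    moreover have "(Z, s, t) \<in> roof_rel A X Y `` {(Z, s, t)}" "(Z, t, s) \<in> roof_rel A Y X `` {(Z, t, s)}"
      using roof_rel_refl[OF assms(1,2) rZ(1)] roof_rel_refl[OF assms(2,1) rZ(2)] by blast+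
    moreover have "ht Z Y (chain_comp t (\<lambda>n x. x)) (chain_comp t (\<lambda>n x. x))"
      using homotopic_refl[OF assms(3,2) t] by simp
    moreover have "qi Z Z (\<lambda>n x. x)" "cm Z Z (\<lambda>n x. x)" using qi_id[OF assms(3)] cm_id by blast+
    ultimately show "r \<in> derived_comp A X Y X (roof_rel A X Y `` {(Z, s, t)}) (roof_rel A Y X `` {(Z, t, s)})"
      unfolding derived_comp_def using assms(3) by (force simp: )
  qed
qed

lemma qeq_derived_iso:
  assumes "qeq X Y" shows "derived_iso A X Y"
proof -
  obtain Z s t where Z: "cx Z" "qi Z X s" "qi Z Y t" and c: "cx X" "cx Y"
    using assms by (auto simp: qeq_def)
  have "(Z, s, t) \<in> roofs A X Y" "(Z, t, s) \<in> roofs A Y X" using Z qi_cm by (simp_all add: roofs_iff)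
  hence "roof_rel A X Y `` {(Z, s, t)} \<in> derived_hom A X Y" "roof_rel A Y X `` {(Z, t, s)} \<in> derived_hom A Y X"
    unfolding derived_hom_def by (auto intro: quotientI)
  thus ?thesis unfolding derived_iso_def
    using c roof_inverse[OF c Z] roof_inverse[OF c(2,1) Z(1,3,2)] by blast
qed

text \<open>The identity roof lies in the composite, so g v is a quasi-isomorphism on the apex of
  some Ore square. Hence \<open>g\<close> is surjective and \<open>v\<close> injective on
  cohomology, and the homotopy between f u and t v passes the injectivity on to
  \<open>f\<close>.\<close>

lemma derived_comp_id_split:
  fixes X Y :: "('a, 'i) ecpx"
  assumes "cx X" "cx Y" "derived_comp A X Y X \<phi> \<psi> = derived_id A X"
    "\<phi> \<in> derived_hom A X Y" "\<psi> \<in> derived_hom A Y X"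
  shows "\<exists>U s f V t g. (U, s, f) \<in> \<phi> \<and> (V, t, g) \<in> \<psi> \<and> (U, s, f) \<in> roofs A X Y \<and> (V, t, g) \<in> roofs A Y X \<and>
    Hinj U Y f \<and> Hsurj V X g"
proof -
  let ?i = "(X, \<lambda>n x. x, \<lambda>n x. x)"
  have i: "?i \<in> roofs A X X" using assms by (simp add: roofs_iff qi_id cm_id)
  hence "?i \<in> derived_id A X" using roof_rel_refl[OF assms(1,1) i] by (simp add: derived_id_def derived_of_def)
  then obtain U s f V t g W u v where a: "(U, s, f) \<in> \<phi>" "(V, t, g) \<in> \<psi>"
      "cx W" "qi W U u" "cm W V v" "ht W Y (chain_comp f u) (chain_comp t v)"
      "((W, chain_comp s u, chain_comp g v), ?i) \<in> roof_rel A X X"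
    using assms(3)[symmetric] unfolding derived_comp_def by blast
  have "\<phi> \<subseteq> roofs A X Y" "\<psi> \<subseteq> roofs A Y X"
    using assms(4,5) unfolding derived_hom_def by (auto elim!: quotientE simp: roof_rel_def)
  hence r: "(U, s, f) \<in> roofs A X Y" "(V, t, g) \<in> roofs A Y X" using a by auto
  hence UV: "cx U" "qi U X s" "cm U Y f" "cx V" "qi V Y t" "cm V X g" by (simp_all add: roofs_iff)
  obtain W' h h' where W': "cx W'" "cm W' W h" "cm W' X h'" "qi W' X (chain_comp (chain_comp s u) h)"
      "ht W' X (chain_comp (chain_comp s u) h) h'" "ht W' X (chain_comp (chain_comp g v) h) h'"
    using a(7) unfolding roof_rel_iff by auto
  note u = qi_cm[OF a(4)]
  have su: "qi W X (chain_comp s u)" by (rule qi_comp[OF a(3) UV(1) assms(1) a(4) UV(2)])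
  note su' = qi_cm[OF su] and gv = cm_comp[OF a(5) UV(6)]
  have h: "qi W' W h" by (rule qi_right[OF W'(1) a(3) assms(1) W'(2) su W'(4)])
  have "qi W' X h'" by (rule qi_homotopic[OF W'(1) assms(1) W'(3,5,4)])
  hence "qi W' X (chain_comp (chain_comp g v) h)"
    by (rule qi_homotopic[OF W'(1) assms(1) cm_comp[OF W'(2) gv] homotopic_sym[OF W'(1) assms(1) cm_comp[OF W'(2) gv] W'(3,6)]])
  hence "qi W X (chain_comp g v)" by (rule qi_left[OF W'(1) a(3) assms(1) h gv])
  hence gv2: "Hinj W X (chain_comp g v)" "Hsurj W X (chain_comp g v)" by (simp_all add: quasi_iso_iff a(3) assms(1))
  have "Hsurj V X g" by (rule Hsurj_cancel[OF a(5,3) UV(4) gv2(2)])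
  moreover have "Hinj W V v" by (rule Hinj_cancel[OF UV(6) gv2(1)])
  hence "Hinj W Y (chain_comp t v)"
    using UV(5) by (intro Hinj_comp[OF a(5,3) UV(4)]) (simp_all add: quasi_iso_iff UV(4) assms(2))
  hence "Hinj W Y (chain_comp f u)"
    by (rule Hinj_homotopic[OF a(3) assms(2) cm_comp[OF a(5) qi_cm[OF UV(5)]] cm_comp[OF u UV(3)]
       homotopic_sym[OF a(3) assms(2) cm_comp[OF u UV(3)] cm_comp[OF a(5) qi_cm[OF UV(5)]] a(6)]])
  hence "Hinj U Y f"
    using a(4) by (intro Hinj_right[OF a(3) UV(1) assms(2) u UV(3)]) (simp_all add: quasi_iso_iff UV(1) a(3))
  ultimately show ?thesis using a(1,2) r by blast
qed

text \<open>The two composites of an isomorphism with its inverse yield an injective and a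
  surjective representative, possibly different ones. Invariance of surjectivity under equivalence
  of roofs puts both properties on the same one.\<close>

lemma Hsurj_roof_rel:
  assumes "cx X" "cx Y" "((Z, s, f), (Z', s', f')) \<in> roof_rel A X Y" "Hsurj Z Y f"
  shows "Hsurj Z' Y f'"
proof -
  obtain W g g' where W: "cx W" "cm W Z g" "cm W Z' g'" "qi W X (chain_comp s g)"
      "ht W X (chain_comp s g) (chain_comp s' g')" "ht W Y (chain_comp f g) (chain_comp f' g')"
    and Z: "cx Z" "qi Z X s" "cm Z Y f" "cx Z'" "qi Z' X s'" "cm Z' Y f'"
    using assms(3) unfolding roof_rel_iff roofs_iff by blast
  have "qi W Z g" by (rule qi_right[OF W(1) Z(1) assms(1) W(2) Z(2) W(4)])
  hence "Hsurj W Z g" by (simp add: quasi_iso_iff W Z)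
  hence "Hsurj W Y (chain_comp f g)" by (rule Hsurj_comp[OF W(1) Z(1) assms(2) W(2) Z(3) _ assms(4)])
  hence "Hsurj W Y (chain_comp f' g')"
    by (rule Hsurj_homotopic[OF W(1) assms(2) cm_comp[OF W(2) Z(3)] cm_comp[OF W(3) Z(6)] W(6)])
  thus ?thesis by (rule Hsurj_cancel[OF W(3,1) Z(4)])
qed

lemma derived_iso_iff_qeq:
  fixes X Y :: "('a, 'i) ecpx"
  shows "derived_iso A X Y \<longleftrightarrow> qeq X Y"
proof
  assume "derived_iso A X Y"
  then obtain \<phi> \<psi> where c: "cx X" "cx Y" and m: "\<phi> \<in> derived_hom A X Y" "\<psi> \<in> derived_hom A Y X"
      "derived_comp A X Y X \<phi> \<psi> = derived_id A X" "derived_comp A Y X Y \<psi> \<phi> = derived_id A Y"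
    unfolding derived_iso_def by blast
  obtain U s f where U: "(U, s, f) \<in> \<phi>" "(U, s, f) \<in> roofs A X Y" "Hinj U Y f"
    using derived_comp_id_split[OF c m(3,1,2)] by blast
  obtain U' s' f' where U': "(U', s', f') \<in> \<phi>" "(U', s', f') \<in> roofs A X Y" "Hsurj U' Y f'"
    using derived_comp_id_split[OF c(2,1) m(4,2,1)] by blast
  obtain r where r: "\<phi> = roof_rel A X Y `` {r}" using m(1) unfolding derived_hom_def by (rule quotientE)
  have "((U', s', f'), (U, s, f)) \<in> roof_rel A X Y"
    using U(1) U'(1) roof_rel_trans[OF c roof_rel_sym[OF c]] unfolding r by blast
  hence "Hsurj U Y f" using Hsurj_roof_rel[OF c _ U'(3)] by blast
  hence "cx U" "qi U X s" "qi U Y f" using U c by (simp_all add: roofs_iff quasi_iso_iff)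
  thus "qeq X Y" using c by (auto simp: qeq_def)
qed (rule qeq_derived_iso)

lemma qeqI: "cx X \<Longrightarrow> cx Y \<Longrightarrow> qi X Y f \<Longrightarrow> qeq X Y"
  using qi_id by (auto simp: qeq_def)

lemma derived_iso_refl: "cx X \<Longrightarrow> derived_iso A X X" for X :: "('a, 'i) ecpx"
  using qeqI[OF _ _ qi_id] by (auto simp: derived_iso_iff_qeq)

lemma derived_iso_sym: "derived_iso A X Y \<Longrightarrow> derived_iso A Y X" for X Y :: "('a, 'i) ecpx"
  by (auto simp: derived_iso_iff_qeq qeq_def)

lemma derived_iso_trans:
  fixes X Y Z :: "('a, 'i) ecpx"
  assumes "derived_iso A X Y" "derived_iso A Y Z" shows "derived_iso A X Z"
proof -
  obtain U s t where U: "cx U" "qi U X s" "qi U Y t" and c: "cx X" "cx Y"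
    using assms(1) by (auto simp: derived_iso_iff_qeq qeq_def)
  obtain V s' t' where V: "cx V" "qi V Y s'" "qi V Z t'" and c': "cx Z"
    using assms(2) by (auto simp: derived_iso_iff_qeq qeq_def)
  obtain W u v where W: "cx W" "qi W U u" "cm W V v" "ht W Y (chain_comp t u) (chain_comp s' v)"
    using ore[OF U(1) c(2) V(1) qi_cm[OF U(3)] V(2)] by blast
  have "qi W Y (chain_comp s' v)"
    by (rule qi_homotopic[OF W(1) c(2) cm_comp[OF W(3) qi_cm[OF V(2)]] W(4) qi_comp[OF W(1) U(1) c(2) W(2) U(3)]])
  hence "qi W V v" by (rule qi_right[OF W(1) V(1) c(2) W(3) V(2)])
  hence "qi W X (chain_comp s u)" "qi W Z (chain_comp t' v)"
    using qi_comp W U V c c' by blast+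
  thus ?thesis using W(1) c c' by (auto simp: derived_iso_iff_qeq qeq_def)
qed

end

context kalg begin

subsection \<open>Shifts and cones\<close>

lemma shift_simps:
  "obj (shift X r) n = obj X (n + r)"
  "dif (shift X r) n x = (if even r then dif X (n + r) x else \<ominus>\<^bsub>obj X (n + r + 1)\<^esub> dif X (n + r) x)"
  by (simp_all add: shift_def)

lemma shift_cx:
  assumes "cx X" shows "cx (shift X r)"
proof -
  obtain b where b: "\<And>n. \<bar>n\<bar> > b \<Longrightarrow> carrier (obj X n) = {\<zero>\<^bsub>obj X n\<^esub>}" by (rule cx_boundE[OF assms]) blast
  have i: "n + 1 + r = n + r + 1" "n + 1 + 1 + r = n + r + 1 + 1" for n by simp_all
  show ?thesis
  proof (rule cxI[where b = "b + \<bar>r\<bar>"])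
    show "dif (shift X r) n \<in> rmod_hom A (obj (shift X r) n) (obj (shift X r) (n + 1))" for n
      unfolding shift_simps(1) i using assms
      by (cases "even r") (simp_all add: shift_def hom_uminus[OF cx_hom[where m = "n + r + 1"]] cx_rm cx_hom)
    fix n x assume "x \<in> carrier (obj (shift X r) n)"
    thus "dif (shift X r) (n + 1) (dif (shift X r) n x) = \<zero>\<^bsub>obj (shift X r) (n + 1 + 1)\<^esub>"
      unfolding shift_simps i using assms
      by (auto simp: d_d d_neg[where m = "n + r + 1 + 1"] d_closed abelian_group.minus_minus ag_simps cx_ag)
  next
    fix n :: int assume "b + \<bar>r\<bar> < \<bar>n\<bar>"
    hence "\<bar>n + r\<bar> > b" by linarith
    thus "carrier (obj (shift X r) n) = {\<zero>\<^bsub>obj (shift X r) n\<^esub>}" using b by (simp add: shift_simps)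
  qed (simp add: shift_simps cx_fd assms)
qed

lemma neg_eq_zero:
  assumes "abelian_group G" "x \<in> carrier G" shows "\<ominus>\<^bsub>G\<^esub> x = \<zero>\<^bsub>G\<^esub> \<longleftrightarrow> x = \<zero>\<^bsub>G\<^esub>"
  using assms abelian_group.neg_to_diff(6)[OF assms(1,2), of "\<zero>\<^bsub>G\<^esub>"] by (simp add: ag_simps)

lemma neg_zero: "abelian_group G \<Longrightarrow> \<ominus>\<^bsub>G\<^esub> \<zero>\<^bsub>G\<^esub> = \<zero>\<^bsub>G\<^esub>"
  by (simp add: neg_eq_zero ag_simps)

lemma cocycles_shift:
  assumes "cx X" shows "cocycles (shift X r) n = cocycles X (n + r)"
proof -
  have i: "n + 1 + r = n + r + 1" by simp
  show ?thesis unfolding set_eq_iff cocycles_iff[OF refl] shift_simps i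
    using assms neg_eq_zero[OF cx_ag[OF assms]] d_closed[OF assms] neg_zero[OF cx_ag[OF assms]] by auto
qed

text \<open>An odd shift negates the differential, which is harmless because coboundaries are closed
  under negation.\<close>

lemma coboundaries_shift:
  assumes "cx X" shows "coboundaries (shift X r) n = coboundaries X (n + r)"
proof -
  have i: "n - 1 + r = n + r - 1" by simp
  have "x \<in> coboundaries (shift X r) n \<longleftrightarrow> x \<in> coboundaries X (n + r)" for x
  proof (cases "even r")
    case False
    have c: "dif X (n + r - 1) y \<in> coboundaries X (n + r)" if "y \<in> carrier (obj X (n + r - 1))" for y
      using that by (intro cobI) simp_all
    show ?thesis
    proof
      assume "x \<in> coboundaries (shift X r) n"
      thus "x \<in> coboundaries X (n + r)"
        using False cob_neg[OF assms c] by (auto simp: coboundaries_def[of "shift X r"] shift_simps i)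
    next
      assume x: "x \<in> coboundaries X (n + r)"
      hence "\<ominus>\<^bsub>obj X (n + r)\<^esub> x \<in> coboundaries X (n + r)" by (rule cob_neg[OF assms])
      then obtain y where y: "y \<in> carrier (obj X (n + r - 1))" "\<ominus>\<^bsub>obj X (n + r)\<^esub> x = dif X (n + r - 1) y" by (rule cobE)
      have "x = \<ominus>\<^bsub>obj X (n + r)\<^esub> dif X (n + r - 1) y"
        unfolding y(2)[symmetric] using cob_closed[OF assms x] assms by (simp add: ag_simps cx_ag)
      thus "x \<in> coboundaries (shift X r) n"
        using False y by (auto simp: coboundaries_def[of "shift X r"] shift_simps i)
    qed
  qed (auto simp: coboundaries_def shift_simps i)
  thus ?thesis by blast
qed

lemma shift_qi:
  assumes "cx X" "cx Y" "qi X Y f" shows "qi (shift X r) (shift Y r) (\<lambda>n. f (n + r))"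
proof -
  have f: "cm X Y f" "Hinj X Y f" "Hsurj X Y f" using assms(3) by (simp_all add: quasi_iso_iff assms(1,2))
  have i: "n + 1 + r = n + r + 1" for n by simp
  have "cm (shift X r) (shift Y r) (\<lambda>n. f (n + r))"
  proof (rule cmI)
    fix n x assume "x \<in> carrier (obj (shift X r) n)"
    hence x: "x \<in> carrier (obj X (n + r))" by (simp add: shift_simps)
    show "f (n + 1 + r) (dif (shift X r) n x) = dif (shift Y r) n (f (n + r) x)"
      unfolding shift_simps i using x cm_d[OF f(1) x refl]
        hom_neg[OF cm_hom[OF f(1)] cx_ag[OF assms(1)] cx_ag[OF assms(2)] d_closed[OF assms(1) x refl]]
      by simp
  qed (simp add: shift_simps cm_hom f)
  thus ?thesis using f
    by (simp add: quasi_iso_iff shift_cx assms(1,2) Hinj_def Hsurj_def cocycles_shift coboundaries_shift shift_simps)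
qed

lemma cone_simps:
  "obj (cone X Y f) n = dsum2 (obj X (n + 1)) (obj Y n)"
  "dif (cone X Y f) n (Two x y) = Two (\<ominus>\<^bsub>obj X (n + 1 + 1)\<^esub> dif X (n + 1) x) (f (n + 1) x \<oplus>\<^bsub>obj Y (n + 1)\<^esub> dif Y n y)"
  by (simp_all add: cone_def)

lemma cone_cx:
  assumes "cx X" "cx Y" "cm X Y f" shows "cx (cone X Y f)"
proof -
  obtain b where b: "\<And>n. \<bar>n\<bar> > b \<Longrightarrow> carrier (obj X n) = {\<zero>\<^bsub>obj X n\<^esub>}" by (rule cx_boundE[OF assms(1)]) blast
  obtain c where c: "\<And>n. \<bar>n\<bar> > c \<Longrightarrow> carrier (obj Y n) = {\<zero>\<^bsub>obj Y n\<^esub>}" by (rule cx_boundE[OF assms(2)]) blast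
  show ?thesis
  proof (rule cxI[where b = "max (b + 1) c"])
    show "dif (cone X Y f) n \<in> rmod_hom A (obj (cone X Y f) n) (obj (cone X Y f) (n + 1))" for n
      unfolding cone_simps(1) cone_def cpx.simps using assms
      by (intro pair_hom hom_add hom_uminus hom_comp'[OF dsum2_fst] hom_comp'[OF dsum2_snd] cx_hom cm_hom cx_rm)
        (simp_all add: algebra_simps)
    fix n z assume "z \<in> carrier (obj (cone X Y f) n)"
    then obtain x y where z: "z = Two x y" "x \<in> carrier (obj X (n + 1))" "y \<in> carrier (obj Y n)"
      by (auto simp: cone_simps)
    let ?dx = "dif X (n + 1) x"
    have dx: "?dx \<in> carrier (obj X (n + 1 + 1))" "dif X (n + 1 + 1) ?dx = \<zero>\<^bsub>obj X (n + 1 + 1 + 1)\<^esub>"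
      using z assms d_d[OF assms(1) z(2) refl refl] by (simp_all add: d_closed)
    have fx: "f (n + 1) x \<in> carrier (obj Y (n + 1))" "f (n + 1 + 1) ?dx = dif Y (n + 1) (f (n + 1) x)"
      using z cm_d[OF assms(3) z(2) refl] by (simp_all add: cm_closed[OF assms(3)])
    have dfx: "dif Y (n + 1) (f (n + 1) x) \<in> carrier (obj Y (n + 1 + 1))" by (rule d_closed[OF assms(2) fx(1) refl])
    have dy: "dif Y n y \<in> carrier (obj Y (n + 1))" "dif Y (n + 1) (dif Y n y) = \<zero>\<^bsub>obj Y (n + 1 + 1)\<^esub>"
      using z d_d[OF assms(2) z(3) refl refl] assms by (simp_all add: d_closed)
    have 1: "\<ominus>\<^bsub>obj X (n + 1 + 1 + 1)\<^esub> dif X (n + 1 + 1) (\<ominus>\<^bsub>obj X (n + 1 + 1)\<^esub> ?dx) = \<zero>\<^bsub>obj X (n + 1 + 1 + 1)\<^esub>"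
      unfolding d_neg[OF assms(1) refl dx(1)] dx(2) by (simp only: neg_zero[OF cx_ag[OF assms(1)]])
    have "f (n + 1 + 1) (\<ominus>\<^bsub>obj X (n + 1 + 1)\<^esub> ?dx) = \<ominus>\<^bsub>obj Y (n + 1 + 1)\<^esub> dif Y (n + 1) (f (n + 1) x)"
      unfolding hom_neg[OF cm_hom[OF assms(3)] cx_ag[OF assms(1)] cx_ag[OF assms(2)] dx(1)] fx(2) ..
    moreover have "dif Y (n + 1) (f (n + 1) x \<oplus>\<^bsub>obj Y (n + 1)\<^esub> dif Y n y) = dif Y (n + 1) (f (n + 1) x)"
      unfolding d_add[OF assms(2) refl fx(1) dy(1)] dy(2) by (rule ag_simps(6)[OF cx_ag[OF assms(2)] dfx])
    ultimately have 2: "f (n + 1 + 1) (\<ominus>\<^bsub>obj X (n + 1 + 1)\<^esub> ?dx) \<oplus>\<^bsub>obj Y (n + 1 + 1)\<^esub>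
        dif Y (n + 1) (f (n + 1) x \<oplus>\<^bsub>obj Y (n + 1)\<^esub> dif Y n y) = \<zero>\<^bsub>obj Y (n + 1 + 1)\<^esub>"
      using ag_simps(7)[OF cx_ag[OF assms(2)] dfx] by simp
    show "dif (cone X Y f) (n + 1) (dif (cone X Y f) n z) = \<zero>\<^bsub>obj (cone X Y f) (n + 1 + 1)\<^esub>"
      unfolding z(1) cone_simps 1 2 dsum2_simps ..
  next
    fix n :: int assume "max (b + 1) c < \<bar>n\<bar>"
    hence "b < \<bar>n + 1\<bar>" "c < \<bar>n\<bar>" by linarith+
    hence "carrier (obj X (n + 1)) = {\<zero>\<^bsub>obj X (n + 1)\<^esub>}" "carrier (obj Y n) = {\<zero>\<^bsub>obj Y n\<^esub>}"
      using b c by blast+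
    thus "carrier (obj (cone X Y f) n) = {\<zero>\<^bsub>obj (cone X Y f) n\<^esub>}" by (auto simp: cone_simps)
  qed (use assms in \<open>auto simp: cone_simps dsum2_fd cx_fd\<close>)
qed

subsection \<open>Complexes whose cohomology is annihilated by an element\<close>

text \<open>For an idempotent e this says that e acts as zero on all cohomology. Such complexes form
  a triangulated subcategory closed under summands, which serves to show that certain complexes do
  not generate the perfect ones.\<close>

definition Hann :: "'a \<Rightarrow> ('a, 'm) cpx \<Rightarrow> bool" where
  "Hann e X \<longleftrightarrow> cx X \<and> (\<forall>n. \<forall>x\<in>cocycles X n. e \<odot>\<^bsub>obj X n\<^esub> x \<in> coboundaries X n)"

lemma Hann_qi_source:
  assumes "e \<in> carrier A" "cx X" "cx Y" "qi X Y f" "Hann e Y" shows "Hann e X"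
proof -
  have f: "cm X Y f" "Hinj X Y f" using assms(4) by (simp_all add: quasi_iso_iff assms(2,3))
  have "e \<odot>\<^bsub>obj X n\<^esub> x \<in> coboundaries X n" if x: "x \<in> cocycles X n" for n x
  proof -
    have "e \<odot>\<^bsub>obj Y n\<^esub> f n x \<in> coboundaries Y n"
      using assms(5) cm_cocycle[OF f(1) assms(2,3) x] by (simp add: Hann_def)
    hence "f n (e \<odot>\<^bsub>obj X n\<^esub> x) \<in> coboundaries Y n" using cm_act[OF f(1) cocycle_closed[OF x] assms(1)] by simp
    thus ?thesis using f(2) cocycle_act[OF assms(2) x assms(1)] by (simp add: Hinj_def)
  qed
  thus ?thesis using assms(2) by (simp add: Hann_def)
qed

lemma Hann_qi_target:
  assumes "e \<in> carrier A" "cx X" "cx Y" "qi X Y f" "Hann e X" shows "Hann e Y"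
proof -
  have f: "cm X Y f" "Hsurj X Y f" using assms(4) by (simp_all add: quasi_iso_iff assms(2,3))
  have "e \<odot>\<^bsub>obj Y n\<^esub> y \<in> coboundaries Y n" if y: "y \<in> cocycles Y n" for n y
  proof -
    obtain x where x: "x \<in> cocycles X n" "y \<ominus>\<^bsub>obj Y n\<^esub> f n x \<in> coboundaries Y n"
      using f(2) y unfolding Hsurj_def by blast
    have c: "y \<in> carrier (obj Y n)" "f n x \<in> carrier (obj Y n)" "x \<in> carrier (obj X n)"
      using x y by (simp_all add: cocycle_closed cm_closed[OF f(1)])
    interpret M: rmod A "obj Y n" by (rule rmodI[OF cx_rm[OF assms(3)]])
    have "e \<odot>\<^bsub>obj Y n\<^esub> y \<ominus>\<^bsub>obj Y n\<^esub> f n (e \<odot>\<^bsub>obj X n\<^esub> x) = e \<odot>\<^bsub>obj Y n\<^esub> (y \<ominus>\<^bsub>obj Y n\<^esub> f n x)"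
      using c assms(1) by (simp add: cm_act[OF f(1)] a_minus_def M.act_add M.act_neg)
    hence "e \<odot>\<^bsub>obj Y n\<^esub> y \<ominus>\<^bsub>obj Y n\<^esub> f n (e \<odot>\<^bsub>obj X n\<^esub> x) \<in> coboundaries Y n"
      using cob_act[OF assms(3) x(2) assms(1)] by simp
    moreover have "f n (e \<odot>\<^bsub>obj X n\<^esub> x) \<in> coboundaries Y n"
      using assms(5) x by (intro cm_cob[OF f(1)]) (simp add: Hann_def)
    ultimately show ?thesis by (intro cob_diff_mem[OF assms(3) M.act_closed[OF assms(1) c(1)]])
  qed
  thus ?thesis using assms(3) by (simp add: Hann_def)
qed

lemma Hann_derived_iso:
  fixes X Y :: "('a, 'i) ecpx"
  assumes "e \<in> carrier A" "derived_iso A X Y" "Hann e X" shows "Hann e Y"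
proof -
  obtain Z s t where Z: "cx Z" "qi Z X s" "qi Z Y t" "cx X" "cx Y"
    using assms(2) by (auto simp: derived_iso_iff_qeq qeq_def)
  show ?thesis using Hann_qi_target[OF assms(1) Z(1,5,3)] Hann_qi_source[OF assms(1) Z(1,4,2) assms(3)] by blast
qed

lemma Hann_shift: "Hann e X \<Longrightarrow> Hann e (shift X r)"
  by (simp add: Hann_def shift_cx cocycles_shift coboundaries_shift shift_simps)

lemma Hann_summand:
  assumes "Hann e (cpx_sum X Y)" "cx X" "cx Y" "e \<in> carrier A" shows "Hann e X"
proof -
  have "e \<odot>\<^bsub>obj X n\<^esub> x \<in> coboundaries X n" if x: "x \<in> cocycles X n" for n x
  proof -
    have "Two x \<zero>\<^bsub>obj Y n\<^esub> \<in> cocycles (cpx_sum X Y) n"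
      using x assms by (simp add: cocycles_iff cpx_sum_simps d_zero ag_simps cx_ag)
    hence "Two (e \<odot>\<^bsub>obj X n\<^esub> x) (e \<odot>\<^bsub>obj Y n\<^esub> \<zero>\<^bsub>obj Y n\<^esub>) \<in> coboundaries (cpx_sum X Y) n"
      using assms(1) unfolding Hann_def by (force simp: cpx_sum_simps)
    thus ?thesis by (auto simp: coboundaries_def cpx_sum_simps)
  qed
  thus ?thesis using assms by (simp add: Hann_def)
qed

text \<open>The exact sequence of the cone only shows that applying e twice kills cohomology: the
  first application moves a cocycle into the part coming from \<open>Y\<close>, the second kills it
  there. Idempotence of e reduces two applications to one.\<close>

lemma Hann_cone:
  assumes "Hann e X" "Hann e Y" "cm X Y f" "e \<in> carrier A" "e \<otimes> e = e"
  shows "Hann e (cone X Y f)"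
proof -
  have c: "cx X" "cx Y" using assms by (simp_all add: Hann_def)
  note cc = cone_cx[OF c assms(3)]
  let ?C = "cone X Y f"
  have "e \<odot>\<^bsub>obj ?C n\<^esub> z \<in> coboundaries ?C n" if z: "z \<in> cocycles ?C n" for n z
  proof -
    obtain x y where xy: "z = Two x y" "x \<in> carrier (obj X (n + 1))" "y \<in> carrier (obj Y n)"
      using cocycle_closed[OF z] by (auto simp: cone_simps)
    interpret C: rmod A "obj ?C n" by (rule rmodI[OF cx_rm[OF cc]])
    have "\<ominus>\<^bsub>obj X (n + 1 + 1)\<^esub> dif X (n + 1) x = \<zero>\<^bsub>obj X (n + 1 + 1)\<^esub>"
      using z unfolding cocycles_iff[OF refl] xy(1) cone_simps by simp
    hence "x \<in> cocycles X (n + 1)"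
      using xy(2) neg_eq_zero[OF cx_ag[OF c(1)] d_closed[OF c(1) xy(2) refl]] by (simp add: cocycles_iff[OF refl])
    hence "e \<odot>\<^bsub>obj X (n + 1)\<^esub> x \<in> coboundaries X (n + 1)" using assms(1) by (simp add: Hann_def)
    then obtain x0 where x0: "x0 \<in> carrier (obj X n)" "e \<odot>\<^bsub>obj X (n + 1)\<^esub> x = dif X n x0" by (auto elim: cobE)
    have ex: "e \<odot>\<^bsub>obj X (n + 1)\<^esub> x \<in> carrier (obj X (n + 1))" "e \<odot>\<^bsub>obj Y n\<^esub> y \<in> carrier (obj Y n)"
      "f n x0 \<in> carrier (obj Y n)"
      using cx_act[OF c(1) assms(4) xy(2)] cx_act[OF c(2) assms(4) xy(3)] cm_closed[OF assms(3) x0(1)] by simp_all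
    \<comment> \<open>Adding the boundary of (x0, 0) to e z cancels the first coordinate, since e x
      = d x0; \<open>y1\<close> is what remains in the second and is a cocycle of
      \<open>Y\<close>.\<close>
    define y1 where "y1 = (e \<odot>\<^bsub>obj Y n\<^esub> y) \<oplus>\<^bsub>obj Y n\<^esub> f n x0"
    have x0': "Two x0 \<zero>\<^bsub>obj Y (n - 1)\<^esub> \<in> carrier (obj ?C (n - 1))"
      using x0 c by (simp add: cone_simps ag_simps cx_ag)
    have w: "dif ?C (n - 1) (Two x0 \<zero>\<^bsub>obj Y (n - 1)\<^esub>) = Two (\<ominus>\<^bsub>obj X (n + 1)\<^esub> dif X n x0) (f n x0)"
      using x0 c ex by (simp add: cone_simps d_zero[where m = n] ag_simps cx_ag)
    have b: "dif ?C (n - 1) (Two x0 \<zero>\<^bsub>obj Y (n - 1)\<^esub>) \<in> coboundaries ?C n" using x0' by (intro cobI) simp_all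
    have sum: "(e \<odot>\<^bsub>obj ?C n\<^esub> z) \<oplus>\<^bsub>obj ?C n\<^esub> dif ?C (n - 1) (Two x0 \<zero>\<^bsub>obj Y (n - 1)\<^esub>) = Two \<zero>\<^bsub>obj X (n + 1)\<^esub> y1"
      unfolding w using ex x0 c by (simp add: xy(1) cone_simps(1) y1_def ag_simps cx_ag)
    have "(e \<odot>\<^bsub>obj ?C n\<^esub> z) \<oplus>\<^bsub>obj ?C n\<^esub> dif ?C (n - 1) (Two x0 \<zero>\<^bsub>obj Y (n - 1)\<^esub>) \<in> cocycles ?C n"
      by (rule cocycle_add[OF cc cocycle_act[OF cc z assms(4)] cob_cocycle[OF cc b]])
    hence "Two \<zero>\<^bsub>obj X (n + 1)\<^esub> y1 \<in> cocycles ?C n" unfolding sum .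
    hence "f (n + 1) \<zero>\<^bsub>obj X (n + 1)\<^esub> \<oplus>\<^bsub>obj Y (n + 1)\<^esub> dif Y n y1 = \<zero>\<^bsub>obj Y (n + 1)\<^esub>"
      unfolding cocycles_iff[OF refl] cone_simps by simp
    moreover have y1: "y1 \<in> carrier (obj Y n)" using ex c by (simp add: y1_def ag_simps cx_ag)
    ultimately have "y1 \<in> cocycles Y n"
      using c by (simp add: cocycles_iff cm_zero[OF assms(3)] ag_simps cx_ag d_closed)
    hence "e \<odot>\<^bsub>obj Y n\<^esub> y1 \<in> coboundaries Y n" using assms(2) by (simp add: Hann_def)
    then obtain v where v: "v \<in> carrier (obj Y (n - 1))" "e \<odot>\<^bsub>obj Y n\<^esub> y1 = dif Y (n - 1) v" by (rule cobE)
    have "Two \<zero>\<^bsub>obj X n\<^esub> v \<in> carrier (obj ?C (n - 1))" using v c by (simp add: cone_simps ag_simps cx_ag)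
    hence "dif ?C (n - 1) (Two \<zero>\<^bsub>obj X n\<^esub> v) \<in> coboundaries ?C n" by (intro cobI) simp_all
    moreover have "dif ?C (n - 1) (Two \<zero>\<^bsub>obj X n\<^esub> v) = Two \<zero>\<^bsub>obj X (n + 1)\<^esub> (e \<odot>\<^bsub>obj Y n\<^esub> y1)"
      using v c neg_eq_zero[OF cx_ag[OF c(1)], of "\<zero>\<^bsub>obj X (n + 1)\<^esub>"]
      by (simp add: cone_simps d_zero[where m = "n + 1"] cm_zero[OF assms(3)] ag_simps cx_ag d_closed)
    moreover have "e \<odot>\<^bsub>obj X (n + 1)\<^esub> \<zero>\<^bsub>obj X (n + 1)\<^esub> = \<zero>\<^bsub>obj X (n + 1)\<^esub>"
      by (rule rmod.act_zero[OF rmodI[OF cx_rm[OF c(1)]] assms(4)])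
    ultimately have "e \<odot>\<^bsub>obj ?C n\<^esub> Two \<zero>\<^bsub>obj X (n + 1)\<^esub> y1 \<in> coboundaries ?C n"
      by (simp add: cone_simps(1))
    hence "e \<odot>\<^bsub>obj ?C n\<^esub> (e \<odot>\<^bsub>obj ?C n\<^esub> z) \<oplus>\<^bsub>obj ?C n\<^esub>
        e \<odot>\<^bsub>obj ?C n\<^esub> dif ?C (n - 1) (Two x0 \<zero>\<^bsub>obj Y (n - 1)\<^esub>) \<in> coboundaries ?C n"
      unfolding sum[symmetric]
      using C.act_add[OF assms(4) C.act_closed[OF assms(4) cocycle_closed[OF z]] cob_closed[OF cc b]] by simp
    moreover have "e \<odot>\<^bsub>obj ?C n\<^esub> (e \<odot>\<^bsub>obj ?C n\<^esub> z) = e \<odot>\<^bsub>obj ?C n\<^esub> z"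
      using C.mult_act[OF assms(4,4) cocycle_closed[OF z]] assms(5) by simp
    ultimately have "(e \<odot>\<^bsub>obj ?C n\<^esub> z) \<ominus>\<^bsub>obj ?C n\<^esub>
        \<ominus>\<^bsub>obj ?C n\<^esub> (e \<odot>\<^bsub>obj ?C n\<^esub> dif ?C (n - 1) (Two x0 \<zero>\<^bsub>obj Y (n - 1)\<^esub>)) \<in> coboundaries ?C n"
      using C.act_closed[OF assms(4)] cocycle_closed[OF z] cob_closed[OF cc b] by (simp add: C.M.neg_to_diff)
    thus ?thesis
      using cob_diff_mem[OF cc C.act_closed[OF assms(4) cocycle_closed[OF z]] cob_neg[OF cc cob_act[OF cc b assms(4)]]]
      by blast
  qed
  thus ?thesis using cc by (simp add: Hann_def)
qed

text \<open>The given \<open>X\<close> witnesses the nonemptiness demanded of a triangulated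
  subcategory.\<close>

lemma Hann_triangulated:
  fixes X :: "('a, 'i) ecpx"
  assumes "e \<in> carrier A" "e \<otimes> e = e" "Hann e X"
  shows "triangulated_subcat A {X :: ('a, 'i) ecpx. Hann e X}"
proof -
  have "{X :: ('a, 'i) ecpx. Hann e X} \<subseteq> Collect cx" by (auto simp: Hann_def)
  thus ?thesis unfolding triangulated_subcat_def mem_Collect_eq Ball_def
    using assms(3) Hann_derived_iso[OF assms(1)] Hann_shift Hann_cone[OF _ _ _ assms(1,2)] by blast
qed

text \<open>The class of annihilated complexes contains the summands of \<open>T\<close>, hence the
  triangulated category that they generate, and for a tilting complex this is
  \<open>per A\<close>.\<close>

lemma per_Hann:
  fixes T X :: "('a, 'i) ecpx"
  assumes "tilting_complex A T" "e \<in> carrier A" "e \<otimes> e = e" "Hann e T" "X \<in> per A"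
  shows "Hann e X"
proof -
  have "direct_summands A T \<subseteq> {X. Hann e X}"
    using Hann_derived_iso[OF assms(2) _ assms(4)] Hann_summand[OF _ _ _ assms(2)]
    by (auto simp: direct_summands_def)
  hence "triangulated_hull A (direct_summands A T) \<subseteq> {X. Hann e X}"
    unfolding triangulated_hull_def using Hann_triangulated[OF assms(2,3,4)] by blast
  thus ?thesis using assms(1,5) by (auto simp: tilting_complex_def)
qed

subsection \<open>Invariance of tilting complexes\<close>

text \<open>A span of quasi-isomorphisms between \<open>T\<close> and \<open>T'\<close> also gives
  one between their shifts; source and target are exchanged leg by leg.\<close>

lemma derived_hom_shift_transfer:
  fixes T T' :: "('a, 'i) ecpx"
  assumes "derived_iso A T T'" "derived_hom A T (shift T r) = {derived_zero A T (shift T r)}"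
  shows "derived_hom A T' (shift T' r) = {derived_zero A T' (shift T' r)}"
proof -
  obtain Z s t where Z: "cx Z" "qi Z T s" "qi Z T' t" and c: "cx T" "cx T'"
    using assms(1) by (auto simp: derived_iso_iff_qeq qeq_def)
  note sh = shift_cx[OF c(1), of r] shift_cx[OF c(2), of r] shift_cx[OF Z(1), of r]
  have "derived_hom A Z (shift T r) = {derived_zero A Z (shift T r)}"
    using derived_hom_zero_left[OF c(1) sh(1) Z(1,2)] assms(2) by blast
  hence "derived_hom A Z (shift Z r) = {derived_zero A Z (shift Z r)}"
    using derived_hom_zero_right[OF Z(1) sh(3,1) shift_qi[OF Z(1) c(1) Z(2)]] by blast
  hence "derived_hom A Z (shift T' r) = {derived_zero A Z (shift T' r)}"
    using derived_hom_zero_right[OF Z(1) sh(3,2) shift_qi[OF Z(1) c(2) Z(3)]] by blast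
  thus ?thesis using derived_hom_zero_left[OF c(2) sh(2) Z(1,3)] by blast
qed

lemma tilting_complex_transfer:
  fixes T T' :: "('a, 'i) ecpx"
  assumes "tilting_complex A T" "derived_iso A T T'" "projective_cpx A T'"
  shows "tilting_complex A T'"
proof -
  have "direct_summands A T = direct_summands A T'"
    unfolding direct_summands_def
    using derived_iso_trans assms(2) derived_iso_sym[OF assms(2)] by blast
  thus ?thesis using assms(1,3) derived_hom_shift_transfer[OF assms(2)]
    unfolding tilting_complex_def by simp
qed

end

section \<open>Bound quiver algebras\<close>

lemma ring_cong:
  assumes "ring R" "carrier S = carrier R" "add S = add R" "zero S = zero R" "mult S = mult R" "one S = one R"
  shows "ring S"
proof (rule ringI)
  interpret R: ring R by fact
  show "abelian_group S" by (rule abelian_group_cong[OF R.is_abelian_group assms(2-4)])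
  show "Group.monoid S" by (rule monoidI) (simp_all add: assms R.m_assoc)
qed (simp_all add: assms ringE(3,4)[OF assms(1)])

section \<open>The path algebra as a ring\<close>

context wf_digraph
begin

abbreviation PA :: "('k::field, ('a, 'b) qpath \<Rightarrow> 'k) module" where "PA \<equiv> path_algebra G"

lemma pa_carrier: "x \<in> carrier PA \<longleftrightarrow> finite {w. x w \<noteq> 0} \<and> {w. x w \<noteq> 0} \<subseteq> qpaths G"
  by (simp add: path_algebra_def)

lemma pa_simps:
  "zero PA = (\<lambda>_. 0)" "x \<oplus>\<^bsub>PA\<^esub> y = (\<lambda>w. x w + y w)" "c \<odot>\<^bsub>PA\<^esub> x = (\<lambda>w. c * x w)"
  "one PA = (\<lambda>(u, p). if u \<in> verts G \<and> p = [] then 1 else 0)"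
  by (simp_all add: path_algebra_def)

lemma pa_mult: "(x \<otimes>\<^bsub>PA\<^esub> y) (u, p) = (\<Sum>i\<le>length p. x (u, take i p) * y (awlast u (take i p), drop i p))"
  by (simp add: path_algebra_def)

lemma qpath_iff: "(u, p) \<in> qpaths G \<longleftrightarrow> awalk u p (awlast u p)"
  by (auto simp: qpaths_def awalk_def awlast_if_cas)

lemma awlast_app: "awlast u (p @ q) = awlast (awlast u p) q"
  by (induction p arbitrary: u) auto

lemma qpath_append: "(u, p @ q) \<in> qpaths G \<longleftrightarrow> (u, p) \<in> qpaths G \<and> (awlast u p, q) \<in> qpaths G"
  unfolding qpath_iff awalk_append_iff awlast_app ..

lemma qpath_Nil: "(u, []) \<in> qpaths G \<longleftrightarrow> u \<in> verts G"
  by (simp add: qpath_iff awalk_Nil_iff)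

lemma qpath_arc: "(u, [a]) \<in> qpaths G \<longleftrightarrow> a \<in> arcs G \<and> u = tail G a"
  by (auto simp: qpath_iff awalk_simps)

lemma pa_mult_closed:
  assumes "x \<in> carrier PA" "y \<in> carrier PA" shows "x \<otimes>\<^bsub>PA\<^esub> y \<in> carrier PA"
proof -
  let ?S = "(\<lambda>((u, p), (w, q)). (u, p @ q)) ` ({w. x w \<noteq> 0} \<times> {w. y w \<noteq> 0})"
  have *: "\<exists>i. x (u, take i p) \<noteq> 0 \<and> y (awlast u (take i p), drop i p) \<noteq> 0"
    if "(x \<otimes>\<^bsub>PA\<^esub> y) (u, p) \<noteq> 0" for u p
    using that unfolding pa_mult by (metis (mono_tags, lifting) mult_zero_left mult_zero_right sum.neutral)
  have "{w. (x \<otimes>\<^bsub>PA\<^esub> y) w \<noteq> 0} \<subseteq> ?S"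
  proof clarify
    fix u p assume "(x \<otimes>\<^bsub>PA\<^esub> y) (u, p) \<noteq> 0"
    then obtain i where i: "x (u, take i p) \<noteq> 0" "y (awlast u (take i p), drop i p) \<noteq> 0" using * by blast
    show "(u, p) \<in> ?S"
      by (rule image_eqI[where x = "((u, take i p), (awlast u (take i p), drop i p))"]) (simp_all add: i)
  qed
  moreover have "finite ?S" using assms by (simp add: pa_carrier)
  moreover have "{w. (x \<otimes>\<^bsub>PA\<^esub> y) w \<noteq> 0} \<subseteq> qpaths G"
  proof clarify
    fix u p assume "(x \<otimes>\<^bsub>PA\<^esub> y) (u, p) \<noteq> 0"
    then obtain i where i: "x (u, take i p) \<noteq> 0" "y (awlast u (take i p), drop i p) \<noteq> 0" using * by blast
    hence "(u, take i p @ drop i p) \<in> qpaths G"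
      unfolding qpath_append using assms by (auto simp: pa_carrier)
    thus "(u, p) \<in> qpaths G" by simp
  qed
  ultimately show ?thesis unfolding pa_carrier by (auto intro: finite_subset)
qed

lemma pa_add_closed:
  assumes "x \<in> carrier PA" "y \<in> carrier PA" shows "(\<lambda>w. x w + y w) \<in> carrier PA"
proof -
  have "{w. x w + y w \<noteq> 0} \<subseteq> {w. x w \<noteq> 0} \<union> {w. y w \<noteq> 0}" by auto
  thus ?thesis using assms unfolding pa_carrier by (auto intro: finite_subset)
qed

lemma pa_scale_closed:
  assumes "x \<in> carrier PA" shows "(\<lambda>w. c * x w) \<in> carrier PA"
proof -
  have "{w. c * x w \<noteq> 0} \<subseteq> {w. x w \<noteq> 0}" by auto
  thus ?thesis using assms unfolding pa_carrier by (auto intro: finite_subset)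
qed

lemma pa_assoc: "x \<otimes>\<^bsub>PA\<^esub> y \<otimes>\<^bsub>PA\<^esub> z = x \<otimes>\<^bsub>PA\<^esub> (y \<otimes>\<^bsub>PA\<^esub> z)"
proof (rule ext, clarify)
  fix u p
  \<comment> \<open>\<open>T j l\<close> is the contribution of cutting \<open>p\<close> into a
    piece of length j, a piece of length l and the rest. Both bracketings sum it over all j + l up
    to the length of \<open>p\<close>, in different orders.\<close>
  define T where "T = (\<lambda>j l. x (u, take j p) * y (awlast u (take j p), take l (drop j p)) *
    z (awlast u (take (j + l) p), drop (j + l) p))"
  have "(x \<otimes>\<^bsub>PA\<^esub> y \<otimes>\<^bsub>PA\<^esub> z) (u, p) = (\<Sum>i\<le>length p. \<Sum>j\<le>i. T j (i - j))"
    unfolding pa_mult sum_distrib_right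
  proof (rule sum.cong[OF refl])
    fix i assume "i \<in> {..length p}"
    hence i: "length (take i p) = i" by simp
    show "(\<Sum>j\<le>length (take i p). x (u, take j (take i p)) * y (awlast u (take j (take i p)), drop j (take i p)) *
        z (awlast u (take i p), drop i p)) = (\<Sum>j\<le>i. T j (i - j))"
      unfolding i by (intro sum.cong refl) (simp add: T_def min_absorb1 drop_take)
  qed
  also have "\<dots> = (\<Sum>(j, l)\<in>{(j, l). j + l \<le> length p}. T j l)"
    by (rule sum.triangle_reindex_eq[symmetric])
  also have "{(j, l). j + l \<le> length p} = (SIGMA j:{..length p}. {..length p - j})" by auto
  also have "(\<Sum>(j, l)\<in>\<dots>. T j l) = (\<Sum>j\<le>length p. \<Sum>l\<le>length p - j. T j l)"
    by (rule sum.Sigma[symmetric]) auto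
  also have "\<dots> = (x \<otimes>\<^bsub>PA\<^esub> (y \<otimes>\<^bsub>PA\<^esub> z)) (u, p)"
    unfolding pa_mult sum_distrib_left
  proof (rule sum.cong[OF refl])
    fix j assume "j \<in> {..length p}"
    have "awlast (awlast u (take j p)) (take l (drop j p)) = awlast u (take (j + l) p)" for l
      by (simp add: take_add awlast_app)
    thus "(\<Sum>l\<le>length p - j. T j l) = (\<Sum>i\<le>length (drop j p). x (u, take j p) *
        (y (awlast u (take j p), take i (drop j p)) *
         z (awlast (awlast u (take j p)) (take i (drop j p)), drop i (drop j p))))"
      by (simp add: T_def mult.assoc add.commute)
  qed
  finally show "(x \<otimes>\<^bsub>PA\<^esub> y \<otimes>\<^bsub>PA\<^esub> z) (u, p) = (x \<otimes>\<^bsub>PA\<^esub> (y \<otimes>\<^bsub>PA\<^esub> z)) (u, p)" .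
qed

lemma pa_one_left:
  assumes "x \<in> carrier PA" shows "\<one>\<^bsub>PA\<^esub> \<otimes>\<^bsub>PA\<^esub> x = x"
proof (rule ext, clarify)
  fix u p
  have "(\<one>\<^bsub>PA\<^esub> \<otimes>\<^bsub>PA\<^esub> x) (u, p) = (\<Sum>i\<le>length p. if i = 0 then (if u \<in> verts G then x (u, p) else 0) else 0)"
    unfolding pa_mult by (intro sum.cong refl) (auto simp: pa_simps)
  also have "\<dots> = (if u \<in> verts G then x (u, p) else 0)" by simp
  also have "\<dots> = x (u, p)"
    using assms by (auto simp: pa_carrier qpath_iff awalk_def)
  finally show "(\<one>\<^bsub>PA\<^esub> \<otimes>\<^bsub>PA\<^esub> x) (u, p) = x (u, p)" .
qed

lemma pa_one_right:
  assumes "x \<in> carrier PA" shows "x \<otimes>\<^bsub>PA\<^esub> \<one>\<^bsub>PA\<^esub> = x"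
proof (rule ext, clarify)
  fix u p
  have "(x \<otimes>\<^bsub>PA\<^esub> \<one>\<^bsub>PA\<^esub>) (u, p) = (\<Sum>i\<le>length p. if i = length p then (if awlast u p \<in> verts G then x (u, p) else 0) else 0)"
    unfolding pa_mult by (intro sum.cong refl) (auto simp: pa_simps)
  also have "\<dots> = (if awlast u p \<in> verts G then x (u, p) else 0)" by simp
  also have "\<dots> = x (u, p)"
    using assms by (auto simp: pa_carrier qpath_iff dest!: awlast_in_verts[rotated] simp: awalk_def)
  finally show "(x \<otimes>\<^bsub>PA\<^esub> \<one>\<^bsub>PA\<^esub>) (u, p) = x (u, p)" .
qed

lemma pa_scale_mult:
  "(\<lambda>w. c * x w) \<otimes>\<^bsub>PA\<^esub> y = (\<lambda>w. c * (x \<otimes>\<^bsub>PA\<^esub> y) w)" "x \<otimes>\<^bsub>PA\<^esub> (\<lambda>w. c * y w) = (\<lambda>w. c * (x \<otimes>\<^bsub>PA\<^esub> y) w)"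
  by (rule ext, clarify, simp add: pa_mult sum_distrib_left algebra_simps)+

lemma pa_distr:
  "(\<lambda>w. x w + y w) \<otimes>\<^bsub>PA\<^esub> z = (\<lambda>w. (x \<otimes>\<^bsub>PA\<^esub> z) w + (y \<otimes>\<^bsub>PA\<^esub> z) w)"
  "z \<otimes>\<^bsub>PA\<^esub> (\<lambda>w. x w + y w) = (\<lambda>w. (z \<otimes>\<^bsub>PA\<^esub> x) w + (z \<otimes>\<^bsub>PA\<^esub> y) w)"
  by (rule ext, clarify, simp add: pa_mult sum.distrib algebra_simps)+

lemma path_elt_closed: "w \<in> qpaths G \<Longrightarrow> path_elt w \<in> carrier PA"
  by (auto simp: pa_carrier path_elt_def)

lemma path_elt_mult_left:
  "(path_elt (u, p) \<otimes>\<^bsub>PA\<^esub> y) (u', q) = (if u' = u \<and> (\<exists>r. q = p @ r) then y (awlast u p, drop (length p) q) else 0)"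
proof -
  have "(path_elt (u, p) \<otimes>\<^bsub>PA\<^esub> y) (u', q) =
    (\<Sum>i\<le>length q. if i = length p then (if u' = u \<and> (\<exists>r. q = p @ r) then y (awlast u p, drop (length p) q) else 0) else 0)"
    unfolding pa_mult
  proof (intro sum.cong refl)
    fix i assume "i \<in> {..length q}"
    hence i: "i \<le> length q" by simp
    show "path_elt (u, p) (u', take i q) * y (awlast u' (take i q), drop i q) =
      (if i = length p then if u' = u \<and> (\<exists>r. q = p @ r) then y (awlast u p, drop (length p) q) else 0 else 0)"
    proof (cases "take i q = p")
      case True
      hence "length p = i" using i by auto
      moreover have "q = p @ drop i q" using True by (metis append_take_drop_id)
      ultimately show ?thesis using True by (auto simp: path_elt_def)
    next
      case False
      thus ?thesis using i by (auto simp: path_elt_def)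
    qed
  qed
  also have "\<dots> = (if u' = u \<and> (\<exists>r. q = p @ r) then y (awlast u p, drop (length p) q) else 0)" by auto
  finally show ?thesis .
qed

lemma path_elt_mult: "path_elt (u, p) \<otimes>\<^bsub>PA\<^esub> path_elt (w, q) = (if w = awlast u p then path_elt (u, p @ q) else (\<lambda>_. 0))"
proof (rule ext, clarify)
  fix u' q'
  show "(path_elt (u, p) \<otimes>\<^bsub>PA\<^esub> path_elt (w, q)) (u', q') =
      (if w = awlast u p then path_elt (u, p @ q) else (\<lambda>_. 0)) (u', q')"
    unfolding path_elt_mult_left by (auto simp: path_elt_def)
qed

text \<open>Induction on the finite support, one path at a time. The set \<open>S\<close> records
  which paths may occur, so that elements of the length filtration can be treated without leaving
  it.\<close>

lemma pa_induct:
  assumes "x \<in> carrier PA" "\<And>w. x w \<noteq> 0 \<Longrightarrow> w \<in> S" "P (\<lambda>_. 0)"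
    "\<And>c w y. w \<in> S \<Longrightarrow> w \<in> qpaths G \<Longrightarrow> y \<in> carrier PA \<Longrightarrow> P y \<Longrightarrow> P (\<lambda>v. c * path_elt w v + y v)"
  shows "P x"
proof -
  have "\<forall>x. {w. x w \<noteq> 0} = F \<longrightarrow> F \<subseteq> S \<inter> qpaths G \<longrightarrow> P x \<and> x \<in> carrier PA" if "finite F" for F
    using that
  proof induction
    case empty
    have "x = (\<lambda>_. 0)" if "{w. x w \<noteq> 0} = {}" for x :: "'a \<times> 'b list \<Rightarrow> 'c" using that by auto
    moreover have "(\<lambda>_. 0 :: 'c) \<in> carrier PA" by (simp add: pa_carrier)
    ultimately show ?case using assms(3) by metis
  next
    case (insert w F)
    show ?case
    proof (intro allI impI)
      fix x :: "'a \<times> 'b list \<Rightarrow> 'c" assume x: "{w. x w \<noteq> 0} = insert w F" "insert w F \<subseteq> S \<inter> qpaths G"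
      define y where "y = x(w := 0)"
      have "{w. y w \<noteq> 0} = F" using x(1) insert(2) by (auto simp: y_def set_eq_iff split: if_splits)
      hence y: "P y" "y \<in> carrier PA" using insert.IH x(2) by auto
      have eq: "x = (\<lambda>v. x w * path_elt w v + y v)" by (rule ext) (simp add: y_def path_elt_def)
      have "P (\<lambda>v. x w * path_elt w v + y v)" using x(2) y by (intro assms(4)) auto
      moreover have "x \<in> carrier PA" unfolding pa_carrier x(1) using insert(1) x(2) by auto
      ultimately show "P x \<and> x \<in> carrier PA" using eq by simp
    qed
  qed
  moreover have "finite {w. x w \<noteq> 0}" "{w. x w \<noteq> 0} \<subseteq> S \<inter> qpaths G" using assms(1,2) by (auto simp: pa_carrier)
  ultimately show ?thesis by blast
qed

end

context fin_digraph
begin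

lemma pa_one_closed: "\<one>\<^bsub>PA\<^esub> \<in> carrier PA"
proof -
  have "{w. \<one>\<^bsub>PA\<^esub> w \<noteq> (0::'c)} \<subseteq> (\<lambda>u. (u, [])) ` verts G" by (auto simp: pa_simps split: if_splits)
  thus ?thesis unfolding pa_carrier by (auto intro: finite_subset simp: pa_simps qpath_Nil split: if_splits)
qed

lemma pa_ring: "ring (PA :: ('k::field, ('a, 'b) qpath \<Rightarrow> 'k) module)"
proof (rule ringI)
  show "abelian_group (PA :: ('k, ('a, 'b) qpath \<Rightarrow> 'k) module)"
  proof (rule abelian_groupI)
    fix x :: "('a, 'b) qpath \<Rightarrow> 'k" assume "x \<in> carrier PA"
    thus "\<exists>y\<in>carrier PA. y \<oplus>\<^bsub>PA\<^esub> x = \<zero>\<^bsub>PA\<^esub>"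
      using pa_scale_closed[of x "-1"] by (intro bexI[of _ "\<lambda>w. -1 * x w"]) (auto simp: pa_simps)
  qed (auto simp: pa_simps pa_add_closed algebra_simps, simp add: pa_carrier)
  show "Group.monoid (PA :: ('k, ('a, 'b) qpath \<Rightarrow> 'k) module)"
    by (rule monoidI) (simp_all add: pa_mult_closed pa_one_closed pa_assoc pa_one_left pa_one_right)
qed (simp_all only: pa_simps pa_distr)

lemma pa_minus:
  assumes "x \<in> carrier PA" "y \<in> carrier PA" shows "x \<ominus>\<^bsub>PA\<^esub> y = (\<lambda>w. x w - y w)"
proof -
  interpret ring PA by (rule pa_ring)
  have "\<ominus>\<^bsub>PA\<^esub> y = (\<lambda>w. - 1 * y w)"
    using assms pa_scale_closed[OF assms(2), of "-1"] by (intro minus_equality) (auto simp: pa_simps)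
  thus ?thesis by (simp add: a_minus_def pa_simps)
qed

text \<open>An explicit stand-in for the n-th power of the arrow ideal, described by path
  lengths.\<close>

definition pa_filt :: "nat \<Rightarrow> (('a, 'b) qpath \<Rightarrow> 'k::field) set" where
  "pa_filt n = {x \<in> carrier PA. \<forall>u p. x (u, p) \<noteq> 0 \<longrightarrow> n \<le> length p}"

lemma pa_filt_mult:
  assumes "x \<in> pa_filt m" "y \<in> pa_filt n" shows "x \<otimes>\<^bsub>PA\<^esub> y \<in> pa_filt (m + n)"
proof -
  have "m + n \<le> length p" if nz: "(x \<otimes>\<^bsub>PA\<^esub> y) (u, p) \<noteq> 0" for u p
  proof -
    obtain i where i: "i \<le> length p" "x (u, take i p) \<noteq> 0" "y (awlast u (take i p), drop i p) \<noteq> 0"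
      using nz unfolding pa_mult by (metis (mono_tags, lifting) atMost_iff mult_zero_left mult_zero_right sum.neutral)
    hence "m \<le> length (take i p)" "n \<le> length (drop i p)" using assms unfolding pa_filt_def by blast+
    thus ?thesis using i(1) by simp
  qed
  thus ?thesis using assms pa_mult_closed by (auto simp: pa_filt_def)
qed

lemma pa_filt_0: "pa_filt 0 = carrier PA"
  by (auto simp: pa_filt_def)

lemma pa_filt_ideal: "ideal (pa_filt n) (PA :: ('k::field, ('a, 'b) qpath \<Rightarrow> 'k) module)"
proof (rule idealI)
  interpret ring "PA :: ('k, ('a, 'b) qpath \<Rightarrow> 'k) module" by (rule pa_ring)
  show "ring (PA :: ('k, ('a, 'b) qpath \<Rightarrow> 'k) module)" by (rule pa_ring)
  show "subgroup (pa_filt n) (add_monoid (PA :: ('k, ('a, 'b) qpath \<Rightarrow> 'k) module))"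
  proof (rule add.subgroupI)
    show "pa_filt n \<noteq> ({} :: (('a, 'b) qpath \<Rightarrow> 'k) set)"
      by (auto simp: pa_filt_def pa_carrier intro!: exI[of _ "\<lambda>_. 0"])
    fix a b :: "('a, 'b) qpath \<Rightarrow> 'k" assume a: "a \<in> pa_filt n"
    have "\<ominus>\<^bsub>PA\<^esub> a = \<zero>\<^bsub>PA\<^esub> \<ominus>\<^bsub>PA\<^esub> a" using a by (simp add: a_minus_def pa_filt_def)
    also have "\<dots> = (\<lambda>w. - a w)" using a pa_minus[of "\<zero>\<^bsub>PA\<^esub>" a] by (simp add: pa_filt_def) (simp add: pa_simps)
    finally have "\<ominus>\<^bsub>PA\<^esub> a = (\<lambda>w. - a w)" .
    moreover have "\<ominus>\<^bsub>PA\<^esub> a \<in> carrier PA" using a by (simp add: pa_filt_def)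
    ultimately show "\<ominus>\<^bsub>PA\<^esub> a \<in> pa_filt n" using a by (auto simp: pa_filt_def)
    assume b: "b \<in> pa_filt n"
    show "a \<oplus>\<^bsub>PA\<^esub> b \<in> pa_filt n"
    proof -
      have "n \<le> length p" if "a (u, p) + b (u, p) \<noteq> 0" for u p
      proof -
        have "a (u, p) \<noteq> 0 \<or> b (u, p) \<noteq> 0" using that by auto
        thus ?thesis using a b unfolding pa_filt_def by blast
      qed
      moreover have "(\<lambda>w. a w + b w) \<in> carrier PA" using a b by (intro pa_add_closed) (auto simp: pa_filt_def)
      ultimately show ?thesis by (simp add: pa_filt_def pa_simps)
    qed
  qed (auto simp: pa_filt_def)
qed (use pa_filt_mult[of _ n _ 0] pa_filt_mult[of _ 0 _ n] in \<open>auto simp: pa_filt_0\<close>)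

end

section \<open>Admissible ideals and the length filtration\<close>

locale bound_quiver = fin_digraph Q
  for Q :: "('v, 'e) pre_digraph" +
  fixes I :: "(('v, 'e) qpath \<Rightarrow> 'k::field) set"
  assumes adm: "admissible Q I"
begin

sublocale pa: ring "PA :: ('k, ('v, 'e) qpath \<Rightarrow> 'k) module" by (rule pa_ring)

sublocale I: ideal I "PA :: ('k, ('v, 'e) qpath \<Rightarrow> 'k) module"
  using adm by (simp add: admissible_def)

abbreviation A where "A \<equiv> bq_algebra Q I"

abbreviation co :: "(('v, 'e) qpath \<Rightarrow> 'k) \<Rightarrow> (('v, 'e) qpath \<Rightarrow> 'k) set" where
  "co x \<equiv> I +>\<^bsub>path_algebra Q\<^esub> x"

lemma arrows_closed: "(\<lambda>\<alpha>. path_elt (tail Q \<alpha>, [\<alpha>])) ` arcs Q \<subseteq> carrier PA"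
  by (auto intro!: path_elt_closed simp: qpath_arc)

lemma arrow_pow_filt: "arrow_ideal Q [^]\<^bsub>ideals_set PA\<^esub> (n::nat) \<subseteq> (pa_filt n :: (('v, 'e) qpath \<Rightarrow> 'k) set)"
proof (induction n)
  case 0
  thus ?case by (simp add: nat_pow_def ideals_set_def pa_filt_0)
next
  case (Suc n)
  have ar: "arrow_ideal Q \<subseteq> (pa_filt 1 :: (('v, 'e) qpath \<Rightarrow> 'k) set)"
    unfolding arrow_ideal_def using arrows_closed
    by (intro pa.genideal_minimal pa_filt_ideal) (auto simp: pa_filt_def path_elt_def split: if_splits)
  interpret F: ideal "pa_filt (Suc n)" "PA :: ('k, ('v, 'e) qpath \<Rightarrow> 'k) module" by (rule pa_filt_ideal)
  have "x \<in> pa_filt (Suc n)"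
    if "x \<in> (arrow_ideal Q [^]\<^bsub>ideals_set PA\<^esub> n) \<cdot>\<^bsub>PA\<^esub> arrow_ideal Q" for x :: "('v, 'e) qpath \<Rightarrow> 'k"
    using that
  proof induction
    case (prod i j)
    thus ?case using pa_filt_mult[of i n j 1] Suc ar by auto
  qed (rule F.a_closed)
  thus ?case by (auto simp: nat_pow_def ideals_set_def)
qed

text \<open>The last arrow of the path is split off. With \<open>arrow_pow_filt\<close> this lets
  \<open>pa_filt\<close> replace the powers of the arrow ideal in both inclusions of
  admissibility.\<close>

lemma path_in_arrow_pow:
  "(u, p) \<in> qpaths Q \<Longrightarrow> n \<le> length p \<Longrightarrow>
    (path_elt (u, p) :: ('v, 'e) qpath \<Rightarrow> 'k) \<in> arrow_ideal Q [^]\<^bsub>ideals_set PA\<^esub> (n::nat)"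
proof (induction n arbitrary: p)
  case 0
  thus ?case using path_elt_closed[OF 0(1)] by (simp add: nat_pow_def ideals_set_def)
next
  case (Suc n)
  obtain q a where p: "p = q @ [a]" using Suc(3) by (metis Suc_le_length_iff append_butlast_last_id list.distinct(1))
  have qa: "(u, q) \<in> qpaths Q" "a \<in> arcs Q" "awlast u q = tail Q a"
    using Suc(2) unfolding p qpath_append qpath_arc by auto
  have "(path_elt (tail Q a, [a]) :: ('v, 'e) qpath \<Rightarrow> 'k) \<in> arrow_ideal Q"
    unfolding arrow_ideal_def using pa.genideal_self[OF arrows_closed] qa(2) by blast
  hence "path_elt (u, q) \<otimes>\<^bsub>PA\<^esub> path_elt (tail Q a, [a]) \<in> (arrow_ideal Q [^]\<^bsub>ideals_set PA\<^esub> n) \<cdot>\<^bsub>PA\<^esub> (arrow_ideal Q :: (('v, 'e) qpath \<Rightarrow> 'k) set)"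
    using Suc.IH[OF qa(1)] Suc(3) p by (intro ideal_prod.prod) auto
  thus ?case using qa(3) p by (simp add: path_elt_mult nat_pow_def ideals_set_def)
qed

lemma I_filt: "I \<subseteq> pa_filt 2"
  using adm arrow_pow_filt[of 2] by (auto simp: admissible_def)

lemma filt_I: obtains m where "pa_filt m \<subseteq> I"
proof -
  obtain m where m: "arrow_ideal Q [^]\<^bsub>ideals_set PA\<^esub> (m::nat) \<subseteq> I" using adm by (auto simp: admissible_def)
  have "x \<in> I" if "x \<in> pa_filt m" for x
  proof (rule pa_induct[where S = "{(u, p). m \<le> length p}"])
    show "x \<in> carrier PA" using that by (simp add: pa_filt_def)
    show "\<And>w. x w \<noteq> 0 \<Longrightarrow> w \<in> {(u, p). m \<le> length p}" using that by (auto simp: pa_filt_def)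
    show "(\<lambda>_. 0) \<in> I" using I.zero_closed by (simp add: pa_simps)
    fix c :: 'k and w y assume a: "w \<in> {(u, p). m \<le> length p}" "w \<in> qpaths Q" "y \<in> I"
    hence "path_elt w \<in> I" using m path_in_arrow_pow[of "fst w" "snd w" m] by auto
    \<comment> \<open>An ideal is closed under ring multiplication; a scalar c is brought in as the
      ring element c times one.\<close>
    hence "(\<lambda>v. c * \<one>\<^bsub>PA\<^esub> v) \<otimes>\<^bsub>PA\<^esub> path_elt w \<in> I"
      by (intro I.I_l_closed pa_scale_closed pa.one_closed)
    moreover have "\<one>\<^bsub>PA\<^esub> \<otimes>\<^bsub>PA\<^esub> path_elt w = (path_elt w :: ('v, 'e) qpath \<Rightarrow> 'k)"
      by (rule pa_one_left[OF path_elt_closed[OF a(2)]])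
    ultimately have "(\<lambda>v. c * path_elt w v) \<in> I" by (simp add: pa_scale_mult)
    thus "(\<lambda>v. c * path_elt w v + y v) \<in> I" using I.a_closed[OF _ a(3)] by (simp add: pa_simps)
  qed
  thus ?thesis using that by blast
qed

subsection \<open>The quotient\<close>

lemma A_carrier: "carrier A = co ` carrier PA"
  by (auto simp: bq_algebra_def quot_algebra_def ring.defs module.defs FactRing_def A_RCOSETS_def')

lemma co_closed [simp]: "x \<in> carrier PA \<Longrightarrow> co x \<in> carrier A"
  by (simp add: A_carrier)

lemma A_cases:
  assumes "C \<in> carrier A" obtains x where "x \<in> carrier PA" "C = co x"
  using assms by (auto simp: A_carrier)

lemma A_quot: "mult A = mult (PA Quot I)" "add A = add (PA Quot I)" "zero A = zero (PA Quot I)"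
  "one A = one (PA Quot I)" "carrier A = carrier (PA Quot I)"
  by (simp_all add: bq_algebra_def quot_algebra_def ring.defs module.defs)

lemma co_mult: "x \<in> carrier PA \<Longrightarrow> y \<in> carrier PA \<Longrightarrow> co x \<otimes>\<^bsub>A\<^esub> co y = co (x \<otimes>\<^bsub>PA\<^esub> y)"
  unfolding A_quot FactRing_def monoid.simps using I.rcoset_mult_add by simp

lemma co_add: "x \<in> carrier PA \<Longrightarrow> y \<in> carrier PA \<Longrightarrow> co x \<oplus>\<^bsub>A\<^esub> co y = co (\<lambda>w. x w + y w)"
  unfolding A_quot FactRing_def ring.simps using I.a_rcos_sum by (simp add: pa_simps)

lemma co_zero: "\<zero>\<^bsub>A\<^esub> = co (\<lambda>_. 0)"
  using pa.a_coset_add_zero[OF I.a_subset] by (simp add: A_quot FactRing_def pa_simps)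

lemma co_one: "\<one>\<^bsub>A\<^esub> = co \<one>\<^bsub>PA\<^esub>"
  by (simp add: A_quot FactRing_def)

lemma co_mem: "x \<in> carrier PA \<Longrightarrow> x \<in> co x"
  by (rule I.a_rcos_self)

lemma co_eq:
  assumes "x \<in> carrier PA" "y \<in> carrier PA" shows "co x = co y \<longleftrightarrow> (\<lambda>w. x w - y w) \<in> I"
proof -
  have "co x = co y \<longleftrightarrow> x \<in> co y"
    using I.a_rcos_self[OF assms(1)] pa.a_repr_independence[OF _ assms(2) I.a_subgroup] by blast
  also have "\<dots> \<longleftrightarrow> x \<ominus>\<^bsub>PA\<^esub> y \<in> I"
    by (rule I.a_rcos_module_minus[OF pa_ring assms(2,1)])
  finally show ?thesis by (simp add: pa_minus assms)
qed

lemma co_smult: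
  assumes "x \<in> carrier PA" shows "c \<odot>\<^bsub>A\<^esub> co x = co (\<lambda>w. c * x w)"
proof -
  have cI: "(\<lambda>w. c * b w) \<in> I" if "b \<in> I" for b
  proof -
    have "(\<lambda>v. c * \<one>\<^bsub>PA\<^esub> v) \<otimes>\<^bsub>PA\<^esub> b \<in> I"
      using that by (intro I.I_l_closed pa_scale_closed pa.one_closed)
    thus ?thesis using pa_one_left[OF I.Icarr[OF that]] by (simp add: pa_scale_mult)
  qed
  have "c \<odot>\<^bsub>A\<^esub> co x = (\<Union>h\<in>I. \<Union>b\<in>I. {\<lambda>w. h w + c * (b w + x w)})"
    by (auto simp: bq_algebra_def quot_algebra_def ring.defs module.defs set_add_def' a_r_coset_def' pa_simps)
  also have "\<dots> = (\<Union>h\<in>I. {\<lambda>w. h w + c * x w})"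
  proof (intro equalityI subsetI)
    fix z assume "z \<in> (\<Union>h\<in>I. \<Union>b\<in>I. {\<lambda>w. h w + c * (b w + x w)})"
    then obtain h b where hb: "h \<in> I" "b \<in> I" "z = (\<lambda>w. h w + c * (b w + x w))" by blast
    have "(\<lambda>w. h w + c * b w) \<in> I" using I.a_closed[OF hb(1) cI[OF hb(2)]] by (simp add: pa_simps)
    moreover have "z = (\<lambda>w. (\<lambda>w. h w + c * b w) w + c * x w)" by (simp add: hb(3) algebra_simps)
    ultimately show "z \<in> (\<Union>h\<in>I. {\<lambda>w. h w + c * x w})" by blast
  next
    fix z assume "z \<in> (\<Union>h\<in>I. {\<lambda>w. h w + c * x w})"
    then obtain h where h: "h \<in> I" "z = (\<lambda>w. h w + c * x w)" by blast
    have "(\<lambda>_. 0) \<in> I" using I.zero_closed by (simp add: pa_simps)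
    thus "z \<in> (\<Union>h\<in>I. \<Union>b\<in>I. {\<lambda>w. h w + c * (b w + x w)})"
      using h by (intro UN_I[of h] UN_I[of "\<lambda>_. 0"]) auto
  qed
  also have "\<dots> = co (\<lambda>w. c * x w)" by (simp add: a_r_coset_def' pa_simps)
  finally show ?thesis .
qed

lemma kalg_A: "kalg A"
proof (intro kalg.intro kalg_axioms.intro)
  show "ring A" by (rule ring_cong[OF I.quotient_is_ring]) (simp_all add: A_quot)
  show "c \<odot>\<^bsub>A\<^esub> \<one>\<^bsub>A\<^esub> \<in> carrier A" for c
    by (simp add: co_one co_smult pa_scale_closed pa_one_closed)
  show "(c + d) \<odot>\<^bsub>A\<^esub> \<one>\<^bsub>A\<^esub> = c \<odot>\<^bsub>A\<^esub> \<one>\<^bsub>A\<^esub> \<oplus>\<^bsub>A\<^esub> d \<odot>\<^bsub>A\<^esub> \<one>\<^bsub>A\<^esub>" for c d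
    by (simp add: co_one co_smult co_add pa_scale_closed pa_one_closed algebra_simps)
  show "(c * d) \<odot>\<^bsub>A\<^esub> \<one>\<^bsub>A\<^esub> = (c \<odot>\<^bsub>A\<^esub> \<one>\<^bsub>A\<^esub>) \<otimes>\<^bsub>A\<^esub> (d \<odot>\<^bsub>A\<^esub> \<one>\<^bsub>A\<^esub>)" for c d
    by (simp add: co_one co_smult co_mult pa_scale_closed pa_one_closed pa_scale_mult pa_one_left mult.assoc)
  show "1 \<odot>\<^bsub>A\<^esub> \<one>\<^bsub>A\<^esub> = \<one>\<^bsub>A\<^esub>" by (simp add: co_one co_smult pa_one_closed)
  fix a c assume "a \<in> carrier A"
  then obtain x where "x \<in> carrier PA" "a = co x" by (rule A_cases)
  thus "(c \<odot>\<^bsub>A\<^esub> \<one>\<^bsub>A\<^esub>) \<otimes>\<^bsub>A\<^esub> a = a \<otimes>\<^bsub>A\<^esub> (c \<odot>\<^bsub>A\<^esub> \<one>\<^bsub>A\<^esub>)"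
    by (simp add: co_one co_smult co_mult pa_scale_closed pa_one_closed pa_scale_mult pa_one_left pa_one_right)
qed

sublocale kalg A by (rule kalg_A)

text \<open>The paths shorter than \<open>m\<close> span the quotient, as all longer ones lie in
  \<open>I\<close>; there are finitely many of them because the quiver is finite.\<close>

lemma regular_fd: "fd_module A (regular A)"
proof -
  obtain m where m: "pa_filt m \<subseteq> I" by (rule filt_I)
  define W where "W = {w \<in> qpaths Q. length (snd w) < m}"
  have "W \<subseteq> verts Q \<times> {p. set p \<subseteq> arcs Q \<and> length p \<le> m}"
    by (auto simp: W_def qpaths_def awalk_def)
  hence fin: "finite W" by (rule finite_subset) (simp add: finite_lists_length_le)
  let ?B = "(\<lambda>w. co (path_elt w)) ` W"
  have B: "?B \<subseteq> carrier (regular A)" by (auto simp: regular_def W_def path_elt_closed)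
  have "co x \<in> kspan (regular A) ?B" if "x \<in> carrier PA" for x
  proof (rule pa_induct[OF that, where S = UNIV])
    show "co (\<lambda>_. 0) \<in> kspan (regular A) ?B"
      using kspan.zero[of "regular A" ?B] by (simp add: regular_def co_zero)
    fix c :: 'k and w y assume a: "w \<in> qpaths Q" "y \<in> carrier PA" "co y \<in> kspan (regular A) ?B"
    note pc = pa_scale_closed[OF path_elt_closed[OF a(1)], of c]
    show "co (\<lambda>v. c * path_elt w v + y v) \<in> kspan (regular A) ?B"
    proof (cases "w \<in> W")
      case True
      have "scal A (regular A) c (co (path_elt w)) = co (\<lambda>v. c * path_elt w v)"
        using a(1) by (simp add: scal_def regular_def co_one co_smult co_mult path_elt_closed pa_scale_closed
            pa_one_closed pa_scale_mult pa_one_right)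
      moreover have "scal A (regular A) c (co (path_elt w)) \<oplus>\<^bsub>regular A\<^esub> co y \<in> kspan (regular A) ?B"
        using True by (intro kspan.step a) auto
      ultimately show ?thesis using co_add[OF pc a(2)] by (simp add: regular_def)
    next
      case False
      have "(\<lambda>v. c * path_elt w v) \<in> pa_filt m"
        using False a(1) pc by (auto simp: W_def pa_filt_def path_elt_def split: if_splits)
      hence "co (\<lambda>v. c * path_elt w v + y v) = co y"
        using m a pc by (subst co_eq) (auto simp: pa_add_closed)
      thus ?thesis using a by simp
    qed
  qed simp
  hence "carrier (regular A) \<subseteq> kspan (regular A) ?B" by (auto simp: regular_def elim!: A_cases)
  thus ?thesis using fin B regular_right_module unfolding fd_module_iff by blast
qed

subsection \<open>Coefficients at short paths\<close>

text \<open>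
  Only meaningful for paths of length less than 2: there the coefficient is constant on cosets because \<open>I\<close>
  lies in the square of the arrow ideal; otherwise \<^const>\<open>the_elem\<close> may be unspecified.
\<close>

definition cf :: "('v, 'e) qpath \<Rightarrow> (('v, 'e) qpath \<Rightarrow> 'k) set \<Rightarrow> 'k" where
  "cf w C = the_elem ((\<lambda>x. x w) ` C)"

lemma cf_co:
  assumes "x \<in> carrier PA" "length (snd w) < 2" shows "cf w (co x) = x w"
proof -
  have "b w = 0" if "b \<in> I" for b
  proof (cases w)
    fix u p assume Pair: "w = (u, p)"
    have "b (u, p) \<noteq> 0 \<Longrightarrow> 2 \<le> length p" using I_filt that unfolding pa_filt_def by blast
    thus ?thesis using assms(2) Pair by auto
  qed
  hence "y w = x w" if "y \<in> co x" for y
    using that unfolding a_r_coset_def' by (auto simp: pa_simps)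
  hence "(\<lambda>y. y w) ` co x = (\<lambda>y. x w) ` co x" by (rule image_cong[OF refl])
  also have "\<dots> = {x w}" by (rule image_constant[OF co_mem[OF assms(1)]])
  finally have "(\<lambda>y. y w) ` co x = {x w}" .
  thus ?thesis by (simp add: cf_def)
qed

abbreviation vx :: "'v \<Rightarrow> (('v, 'e) qpath \<Rightarrow> 'k) set" where "vx i \<equiv> bq_path Q I (i, [])"
abbreviation ar :: "'e \<Rightarrow> (('v, 'e) qpath \<Rightarrow> 'k) set" where "ar \<alpha> \<equiv> bq_path Q I (tail Q \<alpha>, [\<alpha>])"

lemma vx_closed [simp]: "i \<in> verts Q \<Longrightarrow> vx i \<in> carrier A"
  by (simp add: bq_path_def path_elt_closed qpath_Nil)

lemma ar_closed [simp]: "\<alpha> \<in> arcs Q \<Longrightarrow> ar \<alpha> \<in> carrier A"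
  by (simp add: bq_path_def path_elt_closed qpath_arc)

lemma vx_idem: "i \<in> verts Q \<Longrightarrow> vx i \<otimes>\<^bsub>A\<^esub> vx i = vx i"
  by (simp add: bq_path_def co_mult path_elt_closed qpath_Nil path_elt_mult)

lemma vx_ar: "\<alpha> \<in> arcs Q \<Longrightarrow> vx (tail Q \<alpha>) \<otimes>\<^bsub>A\<^esub> ar \<alpha> = ar \<alpha>"
  by (simp add: bq_path_def co_mult path_elt_closed qpath_Nil qpath_arc path_elt_mult)

lemma ar_vx: "\<alpha> \<in> arcs Q \<Longrightarrow> ar \<alpha> \<otimes>\<^bsub>A\<^esub> vx (head Q \<alpha>) = ar \<alpha>"
  by (simp add: bq_path_def co_mult path_elt_closed qpath_Nil qpath_arc path_elt_mult)

lemma idem_vx: "i \<in> verts Q \<Longrightarrow> idem A (vx i)"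
  by (rule idemI) (simp_all add: vx_idem)

lemma cf_add:
  assumes "C \<in> carrier A" "D \<in> carrier A" "length (snd w) < 2"
  shows "cf w (C \<oplus>\<^bsub>A\<^esub> D) = cf w C + cf w D"
proof -
  obtain x y where "x \<in> carrier PA" "C = co x" "y \<in> carrier PA" "D = co y" using assms(1,2) by (auto simp: A_carrier)
  thus ?thesis using assms(3) by (simp add: co_add cf_co pa_add_closed)
qed

lemma cf_zero: "length (snd w) < 2 \<Longrightarrow> cf w \<zero>\<^bsub>A\<^esub> = 0"
  by (simp add: co_zero cf_co pa_carrier)

text \<open>A trivial path can be cut in only one way. Hence its coefficient is a character of the
  algebra, the one through which \<open>simple_at\<close> lets the algebra act.\<close>

lemma eps_mult:
  assumes "C \<in> carrier A" "D \<in> carrier A"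
  shows "cf (u, []) (C \<otimes>\<^bsub>A\<^esub> D) = cf (u, []) C * cf (u, []) D"
proof -
  obtain x y where "x \<in> carrier PA" "C = co x" "y \<in> carrier PA" "D = co y" using assms(1,2) by (auto simp: A_carrier)
  thus ?thesis by (simp add: co_mult cf_co pa_mult_closed pa_mult)
qed

lemma eps_smult: "C \<in> carrier A \<Longrightarrow> cf (u, []) (c \<odot>\<^bsub>A\<^esub> C) = c * cf (u, []) C"
  by (elim A_cases) (simp add: co_smult cf_co pa_scale_closed)

lemma eps_one: "u \<in> verts Q \<Longrightarrow> cf (u, []) \<one>\<^bsub>A\<^esub> = 1"
  by (simp add: co_one cf_co pa_one_closed) (simp add: pa_simps)

lemma eps_vx: "i \<in> verts Q \<Longrightarrow> cf (u, []) (vx i) = (if u = i then 1 else 0)"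
  by (simp add: bq_path_def cf_co path_elt_closed qpath_Nil) (simp add: path_elt_def)

text \<open>Cutting a path of length one leaves the splittings (trivial, arrow) and (arrow,
  trivial); the second contributes nothing against an arrow. So coefficients at arrows read off
  coefficients at trivial paths, from which membership in the radical is deduced.\<close>

lemma cf_arrow_right:
  assumes "C \<in> carrier A" "\<alpha> \<in> arcs Q" "\<beta> \<in> arcs Q"
  shows "cf (tail Q \<alpha>, [\<alpha>]) (C \<otimes>\<^bsub>A\<^esub> ar \<beta>) = (if \<alpha> = \<beta> then cf (tail Q \<alpha>, []) C else 0)"
proof -
  obtain x where "x \<in> carrier PA" "C = co x" using assms(1) by (rule A_cases)
  thus ?thesis using assms(2,3)
    by (simp add: bq_path_def co_mult cf_co path_elt_closed qpath_arc pa_mult_closed pa_mult) (simp add: path_elt_def)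
qed

lemma cf_arrow_left:
  assumes "C \<in> carrier A" "\<alpha> \<in> arcs Q"
  shows "cf (tail Q \<alpha>, [\<alpha>]) (ar \<alpha> \<otimes>\<^bsub>A\<^esub> C) = cf (head Q \<alpha>, []) C"
proof -
  obtain x where "x \<in> carrier PA" "C = co x" using assms(1) by (rule A_cases)
  thus ?thesis using assms(2)
    by (simp add: bq_path_def co_mult cf_co path_elt_closed qpath_arc pa_mult_closed path_elt_mult_left)
qed

subsection \<open>The radical filtration\<close>

text \<open>The image of the length filtration in the quotient; this is the filtration by the powers
  of the radical of \<open>A\<close>.\<close>

definition rad :: "nat \<Rightarrow> (('v, 'e) qpath \<Rightarrow> 'k) set set" where "rad n = co ` pa_filt n"

lemma rad_closed: "rad n \<subseteq> carrier A"
  by (auto simp: rad_def pa_filt_def)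

lemma rad_0: "rad 0 = carrier A"
  by (simp add: rad_def pa_filt_0 A_carrier)

lemma rad_nilpotent: obtains m where "rad m \<subseteq> {\<zero>\<^bsub>A\<^esub>}"
proof -
  obtain m where m: "pa_filt m \<subseteq> I" by (rule filt_I)
  have "co x = \<zero>\<^bsub>A\<^esub>" if "x \<in> pa_filt m" for x
    using that m by (subst co_zero, subst co_eq) (auto simp: pa_filt_def pa_carrier)
  hence "rad m \<subseteq> {\<zero>\<^bsub>A\<^esub>}" by (auto simp: rad_def)
  thus ?thesis by (rule that)
qed

lemma rad_mult:
  assumes "C \<in> rad m" "D \<in> rad n" shows "C \<otimes>\<^bsub>A\<^esub> D \<in> rad (m + n)"
proof -
  obtain x y where xy: "x \<in> pa_filt m" "C = co x" "y \<in> pa_filt n" "D = co y" using assms by (auto simp: rad_def)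
  hence "C \<otimes>\<^bsub>A\<^esub> D = co (x \<otimes>\<^bsub>PA\<^esub> y)" by (simp add: co_mult pa_filt_def)
  thus ?thesis using pa_filt_mult[OF xy(1,3)] by (simp add: rad_def)
qed

text \<open>The paths excluded from \<open>pa_filt 1\<close> are the trivial ones, and their
  coefficients are well defined on cosets.\<close>

lemma rad_1_iff: "C \<in> carrier A \<Longrightarrow> C \<in> rad 1 \<longleftrightarrow> (\<forall>u. cf (u, []) C = 0)"
proof
  assume "C \<in> rad 1"
  then obtain x where x: "x \<in> pa_filt 1" "C = co x" by (auto simp: rad_def)
  hence "x (u, []) = 0" for u by (force simp: pa_filt_def)
  thus "\<forall>u. cf (u, []) C = 0" using x by (simp add: cf_co pa_filt_def)
next
  assume C: "C \<in> carrier A" "\<forall>u. cf (u, []) C = 0"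
  then obtain x where x: "x \<in> carrier PA" "C = co x" by (blast elim: A_cases)
  hence "x (u, []) = 0" for u using C(2) by (simp add: cf_co)
  hence "x \<in> pa_filt 1" using x by (auto simp: pa_filt_def) (metis Suc_leI length_greater_0_conv)
  thus "C \<in> rad 1" using x by (simp add: rad_def)
qed

lemma rad_ideal:
  assumes "C \<in> rad 1" "D \<in> carrier A" shows "C \<otimes>\<^bsub>A\<^esub> D \<in> rad 1" "D \<otimes>\<^bsub>A\<^esub> C \<in> rad 1"
  using rad_mult[of C 1 D 0] rad_mult[of D 0 C 1] assms by (simp_all add: rad_0)

text \<open>A path of positive length ends in an arrow, and right multiplication by the vertex
  \<open>k\<close> keeps it only if that arrow ends at \<open>k\<close>. Thus rad times this vertex
  is generated by the arrows into \<open>k\<close>. The additive set \<open>S\<close> is left open: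
  it is the image of a map in one application and zero in another.\<close>

lemma rad_decomp:
  assumes "C \<in> rad 1" "\<zero>\<^bsub>A\<^esub> \<in> S" "\<And>x y. x \<in> S \<Longrightarrow> y \<in> S \<Longrightarrow> x \<oplus>\<^bsub>A\<^esub> y \<in> S"
    "\<And>\<alpha> y. \<alpha> \<in> arcs Q \<Longrightarrow> head Q \<alpha> = k \<Longrightarrow> y \<in> carrier A \<Longrightarrow> y \<otimes>\<^bsub>A\<^esub> ar \<alpha> \<in> S" "k \<in> verts Q"
  shows "C \<otimes>\<^bsub>A\<^esub> vx k \<in> S"
proof -
  obtain x where x: "x \<in> pa_filt 1" "C = co x" using assms(1) by (auto simp: rad_def)
  have kc: "(path_elt (k, []) :: ('v, 'e) qpath \<Rightarrow> 'k) \<in> carrier PA" using assms(5) by (simp add: path_elt_closed qpath_Nil)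
  have "co x \<otimes>\<^bsub>A\<^esub> vx k \<in> S"
  proof (rule pa_induct[where S = "{(u, p). 1 \<le> length p}"])
    show "x \<in> carrier PA" "\<And>w. x w \<noteq> 0 \<Longrightarrow> w \<in> {(u, p). 1 \<le> length p}" using x by (auto simp: pa_filt_def)
    show "co (\<lambda>_. 0) \<otimes>\<^bsub>A\<^esub> vx k \<in> S" using assms(2,5) by (simp flip: co_zero)
    fix c :: 'k and w y assume a: "w \<in> {(u, p). 1 \<le> length p}" "w \<in> qpaths Q" "y \<in> carrier PA" "co y \<otimes>\<^bsub>A\<^esub> vx k \<in> S"
    obtain u p where w: "w = (u, p)" by (cases w)
    obtain q \<alpha> where p: "p = q @ [\<alpha>]" using a(1) w by (cases p rule: rev_cases) auto
    have qa: "(u, q) \<in> qpaths Q" "\<alpha> \<in> arcs Q" "awlast u q = tail Q \<alpha>" "awlast u p = head Q \<alpha>"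
      using a(2) unfolding w p qpath_append qpath_arc by (auto simp: awlast_app)
    note pc = pa_scale_closed[OF path_elt_closed[OF a(2)], of c]
    have "co (\<lambda>v. c * path_elt w v) \<otimes>\<^bsub>A\<^esub> vx k \<in> S"
    proof (cases "head Q \<alpha> = k")
      case True
      have "(\<lambda>v. c * path_elt (u, q) v) \<otimes>\<^bsub>PA\<^esub> path_elt (tail Q \<alpha>, [\<alpha>]) = (\<lambda>v. c * path_elt w v)"
        using qa by (simp add: pa_scale_mult path_elt_mult w p)
      moreover have "(\<lambda>v. c * path_elt w v) \<otimes>\<^bsub>PA\<^esub> path_elt (k, []) = (\<lambda>v. c * path_elt w v)"
        using qa True by (simp add: pa_scale_mult path_elt_mult w)
      ultimately have "co (\<lambda>v. c * path_elt w v) \<otimes>\<^bsub>A\<^esub> vx k = co (\<lambda>v. c * path_elt (u, q) v) \<otimes>\<^bsub>A\<^esub> ar \<alpha>"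
        using pc kc qa by (simp add: bq_path_def co_mult pa_scale_closed path_elt_closed qpath_arc)
      thus ?thesis using assms(4)[OF qa(2) True] qa(1) by (simp add: pa_scale_closed path_elt_closed)
    next
      case False
      have "(\<lambda>v. c * path_elt w v) \<otimes>\<^bsub>PA\<^esub> path_elt (k, []) = (\<lambda>_. 0 :: 'k)"
        using qa False by (auto simp add: pa_scale_mult path_elt_mult w)
      thus ?thesis using assms(2) pc kc by (simp add: bq_path_def co_mult co_zero)
    qed
    hence "co (\<lambda>v. c * path_elt w v) \<otimes>\<^bsub>A\<^esub> vx k \<oplus>\<^bsub>A\<^esub> co y \<otimes>\<^bsub>A\<^esub> vx k \<in> S" using assms(3) a(4) by blast
    thus "co (\<lambda>v. c * path_elt w v + y v) \<otimes>\<^bsub>A\<^esub> vx k \<in> S"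
      using pc a(3) assms(5) by (simp add: l_distr co_add[OF pc a(3), symmetric])
  qed
  thus ?thesis using x by simp
qed

text \<open>For i distinct from k the product is radical, and without arrows into \<open>k\<close>
  the choice of zero as the additive set in \<open>rad_decomp\<close> is admissible.\<close>

lemma source_vertex:
  assumes "i \<in> verts Q" "k \<in> verts Q" "i \<noteq> k" "\<And>\<alpha>. \<alpha> \<in> arcs Q \<Longrightarrow> head Q \<alpha> \<noteq> k" "C \<in> carrier A"
  shows "vx i \<otimes>\<^bsub>A\<^esub> C \<otimes>\<^bsub>A\<^esub> vx k = \<zero>\<^bsub>A\<^esub>"
proof -
  have "vx i \<otimes>\<^bsub>A\<^esub> C \<otimes>\<^bsub>A\<^esub> vx k \<otimes>\<^bsub>A\<^esub> vx k \<in> {\<zero>\<^bsub>A\<^esub>}"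
  proof (rule rad_decomp)
    show "vx i \<otimes>\<^bsub>A\<^esub> C \<otimes>\<^bsub>A\<^esub> vx k \<in> rad 1"
      using assms by (subst rad_1_iff) (simp_all add: eps_mult eps_vx)
  qed (use assms in auto)
  thus ?thesis using assms by (simp add: m_assoc vx_idem)
qed

end

text \<open>The families in the definitions of the complex and of the module are
  \<open>undefined\<close> on the wrong side of the sum type. Restricting attention to the index set
  allows their replacement by uniform families.\<close>

lemma dsum_cong:
  assumes "\<And>j. j \<in> J \<Longrightarrow> M j = M' j" shows "dsum J M = dsum J M'"
proof -
  have "(\<Pi>\<^sub>E j\<in>J. carrier (M j)) = (\<Pi>\<^sub>E j\<in>J. carrier (M' j))" using assms by (intro PiE_cong) simp
  moreover have "(\<lambda>j\<in>J. \<zero>\<^bsub>M j\<^esub>) = (\<lambda>j\<in>J. \<zero>\<^bsub>M' j\<^esub>)" using assms by (intro restrict_ext) simp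
  moreover have "(\<lambda>j\<in>J. component z j \<oplus>\<^bsub>M j\<^esub> component w j) = (\<lambda>j\<in>J. component z j \<oplus>\<^bsub>M' j\<^esub> component w j)" for z w
    using assms by (intro restrict_ext) simp
  moreover have "(\<lambda>j\<in>J. a \<odot>\<^bsub>M j\<^esub> component z j) = (\<lambda>j\<in>J. a \<odot>\<^bsub>M' j\<^esub> component z j)" for a z
    using assms by (intro restrict_ext) simp
  ultimately show ?thesis unfolding dsum_def by simp
qed

lemma proj_at_idem: "proj_at Q I i = idem_mod (bq_algebra Q I) (bq_path Q I (i, []))"
  by (simp add: proj_at_def idem_mod_def Let_def)

context kalg begin

subsection \<open>Complexes concentrated in few degrees\<close>

lemma stalk_simps:
  "obj (stalk M) n = (if n = 0 then M else M\<lparr>carrier := {\<zero>\<^bsub>M\<^esub>}\<rparr>)" "dif (stalk M) n x = \<zero>\<^bsub>M\<^esub>"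
  by (simp_all add: stalk_def)

lemma stalk_cx: assumes "fd_module A M" shows "cx (stalk M)"
proof -
  interpret M: rmod A M by (rule rmodI[OF fd_right_module[OF assms]])
  have "dif (stalk M) n \<in> rmod_hom A (obj (stalk M) n) (obj (stalk M) (n + 1))" for n
    by (intro homI) (auto simp: stalk_simps)
  thus ?thesis using assms zero_fd[OF M.right_module]
    by (intro cxI[where b = 0]) (auto simp: stalk_simps)
qed

lemma stalk_cocycles: "cocycles (stalk M) n = carrier (obj (stalk M) n)"
  by (auto simp: cocycles_iff stalk_simps)

lemma stalk_coboundaries: "abelian_group M \<Longrightarrow> coboundaries (stalk M) n = {\<zero>\<^bsub>M\<^esub>}"
  using ag_simps(2)[of M] by (auto simp: coboundaries_def stalk_simps image_constant_conv)

lemma two_term_simps: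
  "obj (two_term M f N) n = (if n = -1 then M else if n = 0 then N else N\<lparr>carrier := {\<zero>\<^bsub>N\<^esub>}\<rparr>)"
  "dif (two_term M f N) n x = (if n = -1 then f x else if n = -2 then \<zero>\<^bsub>M\<^esub> else \<zero>\<^bsub>N\<^esub>)"
  by (simp_all add: two_term_def)

lemma two_term_cx:
  assumes "fd_module A M" "fd_module A N" "f \<in> rmod_hom A M N" shows "cx (two_term M f N)"
proof -
  interpret M: rmod A M by (rule rmodI[OF fd_right_module[OF assms(1)]])
  interpret N: rmod A N by (rule rmodI[OF fd_right_module[OF assms(2)]])
  note f = homD[OF assms(3)] hom_zero[OF assms(3) M.M.abelian_group_axioms N.M.abelian_group_axioms]
  have "dif (two_term M f N) n \<in> rmod_hom A (obj (two_term M f N) n) (obj (two_term M f N) (n + 1))" for n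
    using f by (intro homI) (auto simp: two_term_simps)
  thus ?thesis using assms zero_fd[OF N.right_module] f(4)
    by (intro cxI[where b = 1]) (auto simp: two_term_simps)
qed

lemma cohomology_zero_source:
  assumes "cx X" "cx Y" "qi X Y f" "cocycles Y n \<subseteq> coboundaries Y n"
  shows "cocycles X n \<subseteq> coboundaries X n"
proof -
  have "cm X Y f" "Hinj X Y f" using assms(3) by (simp_all add: quasi_iso_iff assms(1,2))
  thus ?thesis using assms(4) cm_cocycle[OF _ assms(1,2)] unfolding Hinj_def by blast
qed

lemma cohomology_zero_target:
  assumes "cx X" "cx Y" "qi X Y f" "cocycles X n \<subseteq> coboundaries X n"
  shows "cocycles Y n \<subseteq> coboundaries Y n"
proof
  have f: "cm X Y f" "Hsurj X Y f" using assms(3) by (simp_all add: quasi_iso_iff assms(1,2))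
  fix y assume y: "y \<in> cocycles Y n"
  then obtain x where x: "x \<in> cocycles X n" "y \<ominus>\<^bsub>obj Y n\<^esub> f n x \<in> coboundaries Y n"
    using f(2) unfolding Hsurj_def by blast
  have "f n x \<in> coboundaries Y n" using x(1) assms(4) by (intro cm_cob[OF f(1)]) auto
  thus "y \<in> coboundaries Y n" by (rule cob_diff_mem[OF assms(2) cocycle_closed[OF y] _ x(2)])
qed

lemma cohomology_zero_derived_iso:
  fixes X Y :: "('a, 'i) ecpx"
  assumes "derived_iso A X Y" "cocycles X n \<subseteq> coboundaries X n"
  shows "cocycles Y n \<subseteq> coboundaries Y n"
proof -
  obtain Z s t where Z: "cx Z" "qi Z X s" "qi Z Y t" "cx X" "cx Y"
    using assms(1) by (auto simp: derived_iso_iff_qeq qeq_def)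
  show ?thesis
    by (rule cohomology_zero_target[OF Z(1,5,3) cohomology_zero_source[OF Z(1,4,2) assms(2)]])
qed

subsection \<open>Quotient modules\<close>

text \<open>The module laws pass along a surjection that respects the operations, which spares
  verifying them on cosets and on functionals.\<close>

lemma right_module_image:
  assumes "right_module A M" "q ` carrier M = carrier N" "q \<zero>\<^bsub>M\<^esub> = \<zero>\<^bsub>N\<^esub>"
    "\<And>x y. x \<in> carrier M \<Longrightarrow> y \<in> carrier M \<Longrightarrow> q (x \<oplus>\<^bsub>M\<^esub> y) = q x \<oplus>\<^bsub>N\<^esub> q y"
    "\<And>a x. a \<in> carrier A \<Longrightarrow> x \<in> carrier M \<Longrightarrow> q (a \<odot>\<^bsub>M\<^esub> x) = a \<odot>\<^bsub>N\<^esub> q x"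
  shows "right_module A N"
proof -
  interpret M: rmod A M by (rule rmodI) fact
  have N: "\<exists>x\<in>carrier M. y = q x" if "y \<in> carrier N" for y using that assms(2) by blast
  have cl: "q x \<in> carrier N" if "x \<in> carrier M" for x using that assms(2) by blast
  note q = assms(3-5)[symmetric]
  show ?thesis
  proof (rule right_moduleI)
    show "abelian_group N"
    proof (rule abelian_groupI)
      fix y assume "y \<in> carrier N"
      then obtain x where "x \<in> carrier M" "y = q x" using N by blast
      thus "\<exists>z\<in>carrier N. z \<oplus>\<^bsub>N\<^esub> y = \<zero>\<^bsub>N\<^esub>"
        by (intro bexI[of _ "q (\<ominus>\<^bsub>M\<^esub> x)"]) (simp_all add: q cl M.M.l_neg)
    qed (use cl M.M.zero_closed in \<open>auto dest!: N simp: q M.M.a_ac\<close>)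
  qed (use cl in \<open>auto dest!: N simp: q M.act_add M.add_act M.mult_act\<close>)
qed

lemma quot_module:
  assumes "right_module A M" "submod A L M"
  shows "(\<lambda>x. L +>\<^bsub>M\<^esub> x) \<in> rmod_hom A M (quot_module M L)"
    and "(\<lambda>x. L +>\<^bsub>M\<^esub> x) ` carrier M = carrier (quot_module M L)"
    and "x \<in> carrier M \<Longrightarrow> L +>\<^bsub>M\<^esub> x = \<zero>\<^bsub>quot_module M L\<^esub> \<longleftrightarrow> x \<in> L"
    and "right_module A (quot_module M L)"
proof -
  interpret M: rmod A M by (rule rmodI) fact
  note L = submodD[OF assms(2,1)]
  have Lc: "x \<in> carrier M" if "x \<in> L" for x using that L(1) by blast
  have neg: "\<ominus>\<^bsub>M\<^esub> x \<in> L" if "x \<in> L" for x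
    using L(4)[of "\<ominus> \<one>" x] M.neg_act[of \<one> x] that Lc by simp
  have "additive_subgroup L M"
    by (intro additive_subgroup.intro M.M.add.subgroupI L(1)) (use L neg in auto)
  then interpret S: abelian_subgroup L M by (rule abelian_subgroupI3[OF _ M.M.abelian_group_axioms])
  show surj: "(\<lambda>x. L +>\<^bsub>M\<^esub> x) ` carrier M = carrier (quot_module M L)"
    by (auto simp: quot_module_def A_RCOSETS_def')
  have add: "L +>\<^bsub>M\<^esub> (x \<oplus>\<^bsub>M\<^esub> y) = (L +>\<^bsub>M\<^esub> x) \<oplus>\<^bsub>quot_module M L\<^esub> (L +>\<^bsub>M\<^esub> y)"
    if "x \<in> carrier M" "y \<in> carrier M" for x y
    using S.a_rcos_sum that by (simp add: quot_module_def)
  have act: "L +>\<^bsub>M\<^esub> (a \<odot>\<^bsub>M\<^esub> x) = a \<odot>\<^bsub>quot_module M L\<^esub> (L +>\<^bsub>M\<^esub> x)"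
    if a: "a \<in> carrier A" "x \<in> carrier M" for a x
  proof -
    have 1: "\<exists>l\<in>L. h \<oplus>\<^bsub>M\<^esub> a \<odot>\<^bsub>M\<^esub> (b \<oplus>\<^bsub>M\<^esub> x) = l \<oplus>\<^bsub>M\<^esub> a \<odot>\<^bsub>M\<^esub> x" if "h \<in> L" "b \<in> L" for h b
      using that a L(3)[of h "a \<odot>\<^bsub>M\<^esub> b"] L(4)[of a b] Lc
      by (intro bexI[of _ "h \<oplus>\<^bsub>M\<^esub> a \<odot>\<^bsub>M\<^esub> b"]) (simp_all add: M.act_add M.M.a_assoc)
    have 2: "\<exists>b\<in>L. h \<oplus>\<^bsub>M\<^esub> a \<odot>\<^bsub>M\<^esub> x = h \<oplus>\<^bsub>M\<^esub> a \<odot>\<^bsub>M\<^esub> (b \<oplus>\<^bsub>M\<^esub> x)" for h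
      using a L(2) by (intro bexI[of _ "\<zero>\<^bsub>M\<^esub>"]) simp_all
    show ?thesis
    proof (intro equalityI subsetI)
      fix z assume "z \<in> L +>\<^bsub>M\<^esub> (a \<odot>\<^bsub>M\<^esub> x)"
      then obtain h where h: "h \<in> L" "z = h \<oplus>\<^bsub>M\<^esub> a \<odot>\<^bsub>M\<^esub> x" by (auto simp: a_r_coset_def')
      obtain b where "b \<in> L" "z = h \<oplus>\<^bsub>M\<^esub> a \<odot>\<^bsub>M\<^esub> (b \<oplus>\<^bsub>M\<^esub> x)" using 2[of h] h(2) by auto
      thus "z \<in> a \<odot>\<^bsub>quot_module M L\<^esub> (L +>\<^bsub>M\<^esub> x)"
        using h(1) by (auto simp: quot_module_def set_add_def' a_r_coset_def')
    next
      fix z assume "z \<in> a \<odot>\<^bsub>quot_module M L\<^esub> (L +>\<^bsub>M\<^esub> x)"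
      then obtain h b where "h \<in> L" "b \<in> L" "z = h \<oplus>\<^bsub>M\<^esub> a \<odot>\<^bsub>M\<^esub> (b \<oplus>\<^bsub>M\<^esub> x)"
        by (auto simp: quot_module_def set_add_def' a_r_coset_def')
      thus "z \<in> L +>\<^bsub>M\<^esub> (a \<odot>\<^bsub>M\<^esub> x)" using 1 by (auto simp: a_r_coset_def')
    qed
  qed
  show hom: "(\<lambda>x. L +>\<^bsub>M\<^esub> x) \<in> rmod_hom A M (quot_module M L)"
    using surj add act by (intro homI) auto
  show zero: "L +>\<^bsub>M\<^esub> x = \<zero>\<^bsub>quot_module M L\<^esub> \<longleftrightarrow> x \<in> L" if "x \<in> carrier M" for x
    using M.M.a_coset_join1[OF _ that S.a_subgroup] M.M.a_coset_join2[OF that S.a_subgroup]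
    by (auto simp: quot_module_def)
  show "right_module A (quot_module M L)"
    using zero[OF M.M.zero_closed] L(2) by (intro right_module_image[OF assms(1) surj _ add act]) simp_all
qed

lemma mod_gen_finsum:
  assumes "right_module A M" "finite J" "X \<subseteq> carrier A" "\<And>j. j \<in> J \<Longrightarrow> g j \<in> mod_gen M X"
  shows "(\<Oplus>\<^bsub>M\<^esub>j\<in>J. g j) \<in> mod_gen M X"
proof -
  interpret M: rmod A M by (rule rmodI) fact
  show ?thesis using assms(2,4)
  proof (induction J rule: finite_induct)
    case (insert j J)
    have "g \<in> insert j J \<rightarrow> carrier M" using insert assms(3) M.mod_gen_carrier by auto
    thus ?case using insert assms(3) by (simp add: M.mod_gen_add)
  qed (simp add: mod_gen.zero)
qed

lemma superfluousI:
  assumes "right_module A M" "submod A N M" "R \<subseteq> carrier A" "\<And>i. X i \<subseteq> carrier A" "X 0 = carrier A"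
    "X m \<subseteq> {\<zero>}" "\<And>i a r. a \<in> X i \<Longrightarrow> r \<in> R \<Longrightarrow> a \<otimes> r \<in> X (Suc i)" "N \<subseteq> mod_gen M R"
  shows "superfluous A N M"
proof -
  interpret M: rmod A M by (rule rmodI) fact
  show ?thesis using assms(2) M.nakayama[OF assms(3-7) _ assms(8)] by (auto simp: superfluous_def)
qed

lemma adual_right_module:
  assumes "right_module A M" shows "right_module (opp A) (adual A M)"
proof -
  interpret M: rmod A M by (rule rmodI) fact
  interpret o: kalg "opp A" by (rule kalg_opp)
  have D: "x \<in> carrier M \<Longrightarrow> g x \<in> carrier A"
    "x \<in> carrier M \<Longrightarrow> y \<in> carrier M \<Longrightarrow> g (x \<oplus>\<^bsub>M\<^esub> y) = g x \<oplus> g y"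
    "b \<in> carrier A \<Longrightarrow> x \<in> carrier M \<Longrightarrow> g (b \<odot>\<^bsub>M\<^esub> x) = g x \<otimes> b"
    if "g \<in> carrier (adual A M)" for g x y b
    using homD[of g M "regular A"] that by (simp_all add: regular_def adual_def)
  have ex: "(\<lambda>x\<in>carrier M. h x) \<in> carrier (adual A M)"
    if "\<And>x. x \<in> carrier M \<Longrightarrow> h x \<in> carrier A" "\<And>x y. x \<in> carrier M \<Longrightarrow> y \<in> carrier M \<Longrightarrow> h (x \<oplus>\<^bsub>M\<^esub> y) = h x \<oplus> h y"
      "\<And>b x. b \<in> carrier A \<Longrightarrow> x \<in> carrier M \<Longrightarrow> h (b \<odot>\<^bsub>M\<^esub> x) = h x \<otimes> b" for h
    using that by (auto simp: adual_def regular_def intro!: homI)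
  have eq: "g = h" if "g \<in> carrier (adual A M)" "h \<in> carrier (adual A M)" "\<And>x. x \<in> carrier M \<Longrightarrow> g x = h x" for g h
    using that by (auto simp: adual_def intro: extensionalityI)
  have c: "g x \<in> carrier A" if "g \<in> carrier (adual A M)" "x \<in> carrier M" for g x
    using D(1)[OF that] .
  have addc: "g \<oplus>\<^bsub>adual A M\<^esub> h \<in> carrier (adual A M)" if "g \<in> carrier (adual A M)" "h \<in> carrier (adual A M)" for g h
  proof -
    have "(\<lambda>x\<in>carrier M. g x \<oplus> h x) \<in> carrier (adual A M)"
      using D[OF that(1)] D[OF that(2)] by (intro ex) (simp_all add: a_ac l_distr)
    thus ?thesis by (simp add: adual_def)
  qed
  have zc: "\<zero>\<^bsub>adual A M\<^esub> \<in> carrier (adual A M)"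
    using ex[of "\<lambda>_. \<zero>"] by (simp add: adual_def)
  have actc: "a \<odot>\<^bsub>adual A M\<^esub> g \<in> carrier (adual A M)" if "a \<in> carrier A" "g \<in> carrier (adual A M)" for a g
  proof -
    have "(\<lambda>x\<in>carrier M. a \<otimes> g x) \<in> carrier (adual A M)"
      using D[OF that(2)] that(1) by (intro ex) (simp_all add: r_distr m_assoc)
    thus ?thesis by (simp add: adual_def)
  qed
  have ev: "(g \<oplus>\<^bsub>adual A M\<^esub> h) x = g x \<oplus> h x" "(a \<odot>\<^bsub>adual A M\<^esub> g) x = a \<otimes> g x" "\<zero>\<^bsub>adual A M\<^esub> x = \<zero>"
    if "x \<in> carrier M" for g h a x using that by (simp_all add: adual_def)
  show ?thesis
  proof (rule right_moduleI)
    show "abelian_group (adual A M)"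
    proof (rule abelian_groupI)
      fix g assume g: "g \<in> carrier (adual A M)"
      have "(\<ominus> \<one>) \<odot>\<^bsub>adual A M\<^esub> g \<oplus>\<^bsub>adual A M\<^esub> g = \<zero>\<^bsub>adual A M\<^esub>"
        using g by (intro eq[OF addc[OF actc] zc]) (simp_all add: ev c l_minus l_neg)
      thus "\<exists>h\<in>carrier (adual A M). h \<oplus>\<^bsub>adual A M\<^esub> g = \<zero>\<^bsub>adual A M\<^esub>" using actc[OF _ g] by (metis a_inv_closed one_closed)
    next
      fix x y z assume "x \<in> carrier (adual A M)" "y \<in> carrier (adual A M)" "z \<in> carrier (adual A M)"
      thus "x \<oplus>\<^bsub>adual A M\<^esub> y \<oplus>\<^bsub>adual A M\<^esub> z = x \<oplus>\<^bsub>adual A M\<^esub> (y \<oplus>\<^bsub>adual A M\<^esub> z)"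
        by - (rule eq, simp_all add: addc ev c a_assoc)
    next
      fix x y assume "x \<in> carrier (adual A M)" "y \<in> carrier (adual A M)"
      thus "x \<oplus>\<^bsub>adual A M\<^esub> y = y \<oplus>\<^bsub>adual A M\<^esub> x"
        by - (rule eq, simp_all add: addc ev c a_comm)
    next
      fix x assume "x \<in> carrier (adual A M)"
      thus "\<zero>\<^bsub>adual A M\<^esub> \<oplus>\<^bsub>adual A M\<^esub> x = x" by - (rule eq, simp_all add: addc zc ev c)
    qed (simp_all add: addc zc)
  next
    fix a x y assume "a \<in> carrier (opp A)" "x \<in> carrier (adual A M)" "y \<in> carrier (adual A M)"
    thus "a \<odot>\<^bsub>adual A M\<^esub> (x \<oplus>\<^bsub>adual A M\<^esub> y) = a \<odot>\<^bsub>adual A M\<^esub> x \<oplus>\<^bsub>adual A M\<^esub> a \<odot>\<^bsub>adual A M\<^esub> y"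
      by - (rule eq, simp_all add: addc actc ev c r_distr)
  next
    fix a b x assume "a \<in> carrier (opp A)" "b \<in> carrier (opp A)" "x \<in> carrier (adual A M)"
    thus "(a \<oplus>\<^bsub>opp A\<^esub> b) \<odot>\<^bsub>adual A M\<^esub> x = a \<odot>\<^bsub>adual A M\<^esub> x \<oplus>\<^bsub>adual A M\<^esub> b \<odot>\<^bsub>adual A M\<^esub> x"
      by - (rule eq, simp_all add: addc actc ev c l_distr)
  next
    fix a b x assume "a \<in> carrier (opp A)" "b \<in> carrier (opp A)" "x \<in> carrier (adual A M)"
    thus "(a \<otimes>\<^bsub>opp A\<^esub> b) \<odot>\<^bsub>adual A M\<^esub> x = b \<odot>\<^bsub>adual A M\<^esub> (a \<odot>\<^bsub>adual A M\<^esub> x)"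
      by - (rule eq, simp_all add: actc ev c m_assoc)
  next
    fix x assume "x \<in> carrier (adual A M)"
    thus "\<one>\<^bsub>opp A\<^esub> \<odot>\<^bsub>adual A M\<^esub> x = x" by - (rule eq, simp_all add: actc ev c)
  qed (simp add: actc)
qed

end

section \<open>The modules attached to a vertex\<close>

locale bq_vertex = bound_quiver Q I
  for Q :: "('v, 'e) pre_digraph" and I :: "(('v, 'e) qpath \<Rightarrow> 'k::field) set" +
  fixes k :: 'v
  assumes k [simp]: "k \<in> verts Q"
begin

abbreviation J :: "('v + 'e) set" where "J \<equiv> Inr ` {\<alpha> \<in> arcs Q. head Q \<alpha> = k}"
abbreviation tj :: "'v + 'e \<Rightarrow> 'v" where "tj j \<equiv> tail Q (projr j)"
abbreviation aj :: "'v + 'e \<Rightarrow> (('v, 'e) qpath \<Rightarrow> 'k) set" where "aj j \<equiv> ar (projr j)"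
abbreviation Pk :: "('k, 'v, 'e) bq_module" where "Pk \<equiv> idem_mod A (vx k)"
abbreviation M0 :: "'v + 'e \<Rightarrow> ('k, 'v, 'e) bq_module" where "M0 \<equiv> \<lambda>j. idem_mod A (vx (tj j))"
abbreviation L0 :: "('k, 'v, 'e) bq_module" where "L0 \<equiv> dsum J M0"
abbreviation PR :: "('k, 'v, 'e) bq_module" where "PR \<equiv> proj_rest Q I k"

text \<open>The differential of \<open>L_cpx\<close> with arrows addressed by \<open>projr\<close>,
  so that one index set \<open>J\<close> serves both \<open>L0\<close> and its counterpart
  \<open>Q1\<close> over the opposite algebra.\<close>

definition fk :: "('k, 'v, 'e) bq_elt \<Rightarrow> ('k, 'v, 'e) bq_elt" where
  "fk x = Fam (\<lambda>j\<in>J. Elem (aj j \<otimes>\<^bsub>A\<^esub> the_elem_of x))"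

lemma J: "finite J" "j \<in> J \<Longrightarrow> projr j \<in> arcs Q" "j \<in> J \<Longrightarrow> head Q (projr j) = k" "j \<in> J \<Longrightarrow> tj j \<in> verts Q"
  by auto

lemma aj: "j \<in> J \<Longrightarrow> aj j \<in> carrier A" "j \<in> J \<Longrightarrow> vx (tj j) \<otimes>\<^bsub>A\<^esub> aj j = aj j" "j \<in> J \<Longrightarrow> aj j \<otimes>\<^bsub>A\<^esub> vx k = aj j"
  using vx_ar ar_vx by auto

lemma L_cpx_eq: "L_cpx Q I k = two_term Pk fk L0"
proof -
  have "(\<lambda>x. Fam (\<lambda>j\<in>J. case_sum (\<lambda>i. undefined) (\<lambda>\<alpha>. Elem (ar \<alpha> \<otimes>\<^bsub>A\<^esub> the_elem_of x)) j)) = fk"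
    unfolding fk_def by (intro ext arg_cong[where f = Fam] restrict_ext) auto
  moreover have "dsum J (case_sum (\<lambda>i. undefined) (\<lambda>\<alpha>. proj_at Q I (tail Q \<alpha>))) = L0"
    by (rule dsum_cong) (auto simp: proj_at_idem)
  ultimately show ?thesis unfolding L_cpx_def proj_at_idem by simp
qed

lemma PR_eq: "PR = dsum (Inl ` (verts Q - {k})) (\<lambda>j. idem_mod A (vx (projl j)))"
  unfolding proj_rest_def by (rule dsum_cong) (auto simp: proj_at_idem)

lemma idem_k: "idem A (vx k)"
  by (rule idem_vx) simp

lemma idem_j: "j \<in> J \<Longrightarrow> idem A (vx (tj j))"
  by (rule idem_vx) auto

lemma idem_opp: "i \<in> verts Q \<Longrightarrow> idem (opp A) (vx i)"
  by (rule kalg.idemI[OF kalg_opp]) (simp_all add: vx_idem)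

lemma Pk_proj: "fg_projective A Pk"
  by (rule idem.idem_proj[OF idem_k regular_fd])

lemma M0_proj: "j \<in> J \<Longrightarrow> fg_projective A (M0 j)"
  by (rule idem.idem_proj[OF idem_j regular_fd])

lemma L0_proj: "fg_projective A L0"
  by (rule dsum_proj_mod[OF J(1) M0_proj])

lemma PR_proj: "fg_projective A PR"
  unfolding PR_eq by (rule dsum_proj_mod) (auto intro: idem.idem_proj[OF idem_vx regular_fd])

lemma M0_rm: "j \<in> J \<Longrightarrow> right_module A (M0 j)"
  using M0_proj proj_right_module by blast

lemma Pk_rm: "right_module A Pk" and L0_rm: "right_module A L0" and PR_rm: "right_module A PR"
  using Pk_proj L0_proj PR_proj proj_right_module by blast+

lemma L0_component:
  assumes "y \<in> carrier L0" "j \<in> J"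
  obtains c where "c \<in> carrier A" "vx (tj j) \<otimes>\<^bsub>A\<^esub> c = c" "component y j = Elem c"
  using idem.idem_carrierE[OF idem_j[OF assms(2)] dsum_component_closed[OF assms]] .

lemma fk_component: "j \<in> J \<Longrightarrow> component (fk x) j = Elem (aj j \<otimes>\<^bsub>A\<^esub> the_elem_of x)"
  by (simp add: fk_def)

lemma fk_hom: "fk \<in> rmod_hom A Pk L0"
proof (rule homI)
  fix x assume "x \<in> carrier Pk"
  then obtain c where c: "c \<in> carrier A" "x = Elem c" by (rule idem.idem_carrierE[OF idem_k])
  show "fk x \<in> carrier L0"
    unfolding fk_def using c aj J(4)
    by (intro dsum_carrierI) (simp add: idem.Elem_idem_iff[OF idem_j] m_assoc[symmetric])
next
  fix x y assume "x \<in> carrier Pk" "y \<in> carrier Pk"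
  then obtain c d where c: "c \<in> carrier A" "x = Elem c" "d \<in> carrier A" "y = Elem d"
    by (meson idem.idem_carrierE[OF idem_k])
  show "fk (x \<oplus>\<^bsub>Pk\<^esub> y) = fk x \<oplus>\<^bsub>L0\<^esub> fk y"
    unfolding fk_def dsum_simps(3) using c aj
    by (intro arg_cong[where f = Fam] restrict_ext) (simp add: r_distr)
next
  fix a x assume "a \<in> carrier A" "x \<in> carrier Pk"
  then obtain c where c: "c \<in> carrier A" "x = Elem c" "a \<in> carrier A" by (meson idem.idem_carrierE[OF idem_k])
  show "fk (a \<odot>\<^bsub>Pk\<^esub> x) = a \<odot>\<^bsub>L0\<^esub> fk x"
    unfolding fk_def dsum_simps(4) using c aj
    by (intro arg_cong[where f = Fam] restrict_ext) (simp add: m_assoc)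
qed

lemma cf_finsum:
  assumes "abelian_group N" "\<And>x. x \<in> carrier N \<Longrightarrow> the_elem_of x \<in> carrier A"
    "\<And>x y. x \<in> carrier N \<Longrightarrow> y \<in> carrier N \<Longrightarrow> the_elem_of (x \<oplus>\<^bsub>N\<^esub> y) = the_elem_of x \<oplus>\<^bsub>A\<^esub> the_elem_of y"
    "the_elem_of \<zero>\<^bsub>N\<^esub> = \<zero>\<^bsub>A\<^esub>" "finite S" "g \<in> S \<rightarrow> carrier N" "length (snd w) < 2"
  shows "cf w (the_elem_of (\<Oplus>\<^bsub>N\<^esub>j\<in>S. g j)) = (\<Sum>j\<in>S. cf w (the_elem_of (g j)))"
proof -
  interpret N: abelian_group N by fact
  show ?thesis using assms(5,6)
  proof (induction S rule: finite_induct)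
    case (insert j S)
    hence "(\<Oplus>\<^bsub>N\<^esub>j\<in>S. g j) \<in> carrier N" by (intro N.finsum_closed) auto
    thus ?case using insert assms(2,3,7) by (simp add: cf_add)
  qed (simp add: assms(4,7) cf_zero)
qed

text \<open>For an arrow \<alpha> ending at \<open>k\<close>, the coefficient of \<alpha> in
  \<alpha>c is the coefficient of c at the trivial path at \<open>k\<close>, so the latter vanishes.
  The coefficients at other vertices vanish because c is fixed by left multiplication with the
  vertex \<open>k\<close>.\<close>

lemma fk_kernel_rad:
  assumes "J \<noteq> {}" "c \<in> carrier A" "vx k \<otimes>\<^bsub>A\<^esub> c = c" "fk (Elem c) = \<zero>\<^bsub>L0\<^esub>"
  shows "c \<in> rad 1"
proof -
  obtain \<alpha> where \<alpha>: "\<alpha> \<in> arcs Q" "head Q \<alpha> = k" using assms(1) by auto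
  have "component (fk (Elem c)) (Inr \<alpha>) = component \<zero>\<^bsub>L0\<^esub> (Inr \<alpha>)" using assms(4) by simp
  hence "ar \<alpha> \<otimes>\<^bsub>A\<^esub> c = \<zero>\<^bsub>A\<^esub>" using \<alpha> by (simp add: fk_component dsum_simps)
  hence "cf (k, []) c = 0" using cf_arrow_left[OF assms(2) \<alpha>(1)] \<alpha>(2) by (simp add: cf_zero)
  moreover have "cf (u, []) c = cf (u, []) (vx k) * cf (u, []) c" for u
    using eps_mult[of "vx k" c u] assms(2,3) by simp
  ultimately have "cf (u, []) c = 0" for u by (metis eps_vx k mult_zero_left)
  thus ?thesis using rad_1_iff[OF assms(2)] by blast
qed

subsection \<open>The minimal presentation of the dual of the simple module\<close>

sublocale B: kalg "opp A" by (rule kalg_opp)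

abbreviation DS :: "((('v, 'e) qpath \<Rightarrow> 'k) set, 'k \<Rightarrow> 'k) module" where "DS \<equiv> kdual A (simple_at k)"
abbreviation Qk :: "('k, 'v, 'e) bq_module" where "Qk \<equiv> idem_mod (opp A) (vx k)"
abbreviation Mo :: "'v + 'e \<Rightarrow> ('k, 'v, 'e) bq_module" where "Mo \<equiv> \<lambda>j. idem_mod (opp A) (vx (tj j))"
abbreviation Q1 :: "('k, 'v, 'e) bq_module" where "Q1 \<equiv> dsum J Mo"

definition q0 :: "('k, 'v, 'e) bq_elt \<Rightarrow> 'k \<Rightarrow> 'k" where
  "q0 z = (\<lambda>x. x * cf (k, []) (the_elem_of z))"

text \<open>In terms of left modules this is the sum of the right multiplications by the arrows
  ending at \<open>k\<close>. Dualising it into the algebra gives \<open>fk\<close>.\<close>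

definition q1 :: "('k, 'v, 'e) bq_elt \<Rightarrow> ('k, 'v, 'e) bq_elt" where
  "q1 z = (\<Oplus>\<^bsub>Qk\<^esub>j\<in>J. the_elem_of (component z j) \<odot>\<^bsub>Qk\<^esub> Elem (aj j))"

lemma idem_opp_k: "idem (opp A) (vx k)"
  by (rule idem_opp) simp

lemma idem_opp_j: "j \<in> J \<Longrightarrow> idem (opp A) (vx (tj j))"
  by (rule idem_opp) auto

lemma Qk_proj: "fg_projective (opp A) Qk"
  by (rule idem.idem_proj[OF idem_opp_k regular_opp_fd[OF regular_fd]])

lemma Mo_proj: "j \<in> J \<Longrightarrow> fg_projective (opp A) (Mo j)"
  by (rule idem.idem_proj[OF idem_opp_j regular_opp_fd[OF regular_fd]])

lemma Q1_proj: "fg_projective (opp A) Q1"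
  by (rule B.dsum_proj_mod[OF J(1) Mo_proj])

lemma Mo_rm: "j \<in> J \<Longrightarrow> right_module (opp A) (Mo j)"
  using Mo_proj B.proj_right_module by blast

lemma Qk_rm: "right_module (opp A) Qk" and Q1_rm: "right_module (opp A) Q1"
  using Qk_proj Q1_proj B.proj_right_module by blast+

lemma Qk_iff: "Elem c \<in> carrier Qk \<longleftrightarrow> c \<in> carrier A \<and> c \<otimes>\<^bsub>A\<^esub> vx k = c"
  using idem.Elem_idem_iff[OF idem_opp_k] by simp

lemma Mo_iff: "j \<in> J \<Longrightarrow> Elem c \<in> carrier (Mo j) \<longleftrightarrow> c \<in> carrier A \<and> c \<otimes>\<^bsub>A\<^esub> vx (tj j) = c"
  using idem.Elem_idem_iff[OF idem_opp_j] by simp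

lemma Qk_E:
  assumes "z \<in> carrier Qk" obtains c where "c \<in> carrier A" "c \<otimes>\<^bsub>A\<^esub> vx k = c" "z = Elem c"
  using idem.idem_carrierE[OF idem_opp_k assms] by auto

lemma Q1_component:
  assumes "y \<in> carrier Q1" "j \<in> J"
  obtains c where "c \<in> carrier A" "c \<otimes>\<^bsub>A\<^esub> vx (tj j) = c" "component y j = Elem c"
  using idem.idem_carrierE[OF idem_opp_j[OF assms(2)] dsum_component_closed[OF assms]] by auto

lemma simple_act: "a \<odot>\<^bsub>simple_at k\<^esub> (c :: 'k) = c * cf (k, []) a"
  by (simp add: simple_at_def cf_def)

lemma simple_scal: "scal A (simple_at k) c x = x * (c :: 'k)"
  by (simp add: scal_def simple_act eps_smult eps_one)

lemma DS_simps:
  "\<phi> \<in> carrier DS \<longleftrightarrow> (\<forall>x. \<phi> x = x * \<phi> 1)"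
  "\<zero>\<^bsub>DS\<^esub> = (\<lambda>x. 0)" "\<phi> \<oplus>\<^bsub>DS\<^esub> \<psi> = (\<lambda>x. \<phi> x + \<psi> x)" "a \<odot>\<^bsub>DS\<^esub> \<phi> = (\<lambda>x. \<phi> (x * cf (k, []) a))"
proof -
  have c: "carrier (simple_at k :: (_, 'k) module) = UNIV" "\<And>x y. x \<oplus>\<^bsub>simple_at k\<^esub> y = x + (y :: 'k)"
    by (simp_all add: simple_at_def)
  show "\<phi> \<in> carrier DS \<longleftrightarrow> (\<forall>x. \<phi> x = x * \<phi> 1)"
  proof
    assume "\<phi> \<in> carrier DS"
    hence "\<phi> (1 * x) = x * \<phi> 1" for x by (simp add: kdual_def c simple_scal del: mult_1)
    thus "\<forall>x. \<phi> x = x * \<phi> 1" unfolding mult_1 by blast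
  next
    assume a: "\<forall>x. \<phi> x = x * \<phi> 1"
    have "\<phi> (x + y) = \<phi> x + \<phi> y" for x y by (metis a distrib_right)
    moreover have "\<phi> (x * d) = d * \<phi> x" for x d by (metis a mult.assoc mult.commute)
    ultimately show "\<phi> \<in> carrier DS" by (simp add: kdual_def c simple_scal)
  qed
  show "\<zero>\<^bsub>DS\<^esub> = (\<lambda>x. 0)" "\<phi> \<oplus>\<^bsub>DS\<^esub> \<psi> = (\<lambda>x. \<phi> x + \<psi> x)" "a \<odot>\<^bsub>DS\<^esub> \<phi> = (\<lambda>x. \<phi> (x * cf (k, []) a))"
    by (simp_all add: kdual_def c simple_act fun_eq_iff)
qed

lemma q0_surj: "q0 ` carrier Qk = carrier DS"
proof
  show "q0 ` carrier Qk \<subseteq> carrier DS" by (auto simp: DS_simps q0_def)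
  show "carrier DS \<subseteq> q0 ` carrier Qk"
  proof
    fix \<phi> assume \<phi>: "\<phi> \<in> carrier DS"
    let ?c = "(\<phi> 1 \<odot>\<^bsub>A\<^esub> \<one>\<^bsub>A\<^esub>) \<otimes>\<^bsub>A\<^esub> vx k"
    have "Elem ?c \<in> carrier Qk" unfolding Qk_iff by (simp add: m_assoc vx_idem)
    moreover have "q0 (Elem ?c) = \<phi>"
    proof (rule ext)
      fix x
      have "\<phi> x = x * \<phi> 1" using \<phi> DS_simps(1) by blast
      thus "q0 (Elem ?c) x = \<phi> x" by (simp add: q0_def eps_mult eps_smult eps_one eps_vx)
    qed
    ultimately show "\<phi> \<in> q0 ` carrier Qk" by (metis imageI)
  qed
qed

lemma q0_hom: "q0 \<in> rmod_hom (opp A) Qk DS"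
proof (rule B.homI)
  show "q0 x \<in> carrier DS" if "x \<in> carrier Qk" for x using q0_surj that by blast
qed (auto elim!: Qk_E simp: q0_def DS_simps cf_add eps_mult algebra_simps)

lemma DS_rm: "right_module (opp A) DS"
  by (rule B.right_module_image[OF Qk_rm q0_surj])
    (use B.homD[OF q0_hom] in \<open>simp_all add: q0_def DS_simps cf_zero\<close>)

text \<open>An element fixed by right multiplication with the vertex \<open>k\<close> has no
  coefficients at the other trivial paths, so the single condition at \<open>k\<close> already puts
  it into the radical.\<close>

lemma q0_kernel: "Elem c \<in> a_kernel Qk DS q0 \<longleftrightarrow> c \<in> rad 1 \<and> c \<otimes>\<^bsub>A\<^esub> vx k = c"
proof -
  have "cf (u, []) c = cf (u, []) c * cf (u, []) (vx k)" if "c \<in> carrier A" "c \<otimes>\<^bsub>A\<^esub> vx k = c" for u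
    using eps_mult[of c "vx k" u] that by simp
  hence "(\<forall>u. cf (u, []) c = 0) \<longleftrightarrow> cf (k, []) c = 0" if "c \<in> carrier A" "c \<otimes>\<^bsub>A\<^esub> vx k = c"
    using that by (metis eps_vx k mult_zero_right)
  moreover have "(\<lambda>x. x * cf (k, []) c) = (\<lambda>x. 0) \<longleftrightarrow> cf (k, []) c = 0"
    by (auto simp: fun_eq_iff intro: spec[of _ 1])
  ultimately show ?thesis using rad_1_iff[of c] rad_closed[of 1]
    by (auto simp: a_kernel_def' Qk_iff q0_def DS_simps)
qed

lemma superfluous_rad:
  assumes "right_module (opp A) M" "submod (opp A) N M" "N \<subseteq> B.mod_gen M (rad 1)"
  shows "superfluous (opp A) N M"
proof -
  obtain m where m: "rad m \<subseteq> {\<zero>\<^bsub>A\<^esub>}" by (rule rad_nilpotent)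
  have "r \<otimes>\<^bsub>A\<^esub> a \<in> rad (Suc i)" if "a \<in> rad i" "r \<in> rad 1" for a i r
    using rad_mult[OF that(2,1)] by simp
  thus ?thesis
    using rad_closed m by (intro B.superfluousI[OF assms(1,2), where X = rad and R = "rad 1" and m = m] assms(3)) (simp_all add: rad_0)
qed

lemma q0_cover: "projective_cover (opp A) Qk q0 DS"
proof -
  have "a_kernel Qk DS q0 \<subseteq> B.mod_gen Qk (rad 1)"
  proof
    fix z assume z: "z \<in> a_kernel Qk DS q0"
    then obtain c where c: "z = Elem c" by (auto simp: a_kernel_def' elim: Qk_E)
    hence c1: "c \<in> rad 1" "c \<otimes>\<^bsub>A\<^esub> vx k = c" using z q0_kernel by auto
    interpret M: rmod "opp A" Qk by (rule B.rmodI[OF Qk_rm])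
    have "c \<odot>\<^bsub>Qk\<^esub> Elem (vx k) \<in> B.mod_gen Qk (rad 1)"
      using c1 rad_closed by (intro M.mod_gen_base) (simp_all add: Qk_iff vx_idem)
    thus "z \<in> B.mod_gen Qk (rad 1)" using c1 c by simp
  qed
  thus ?thesis unfolding projective_cover_def
    using Qk_proj q0_hom q0_surj superfluous_rad[OF Qk_rm B.submod_kernel[OF q0_hom Qk_rm DS_rm]] by blast
qed

lemma aj_Qk: "j \<in> J \<Longrightarrow> Elem (aj j) \<in> carrier Qk"
  using aj by (simp add: Qk_iff)

lemma q1_hom: "q1 \<in> rmod_hom (opp A) Q1 Qk"
  unfolding q1_def
  by (intro B.dsum_out_hom[where g = "\<lambda>j z. the_elem_of z \<odot>\<^bsub>Qk\<^esub> Elem (aj j)"] J Qk_rm idem.idem_hom[OF idem_opp_j] aj_Qk)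

lemma q1_in:
  assumes "j \<in> J" "c \<in> carrier A" "c \<otimes>\<^bsub>A\<^esub> vx (tj j) = c"
  shows "q1 (dsum_in J Mo j (Elem c)) = Elem (c \<otimes>\<^bsub>A\<^esub> aj j)"
proof -
  have "q1 (dsum_in J Mo j (Elem c)) = the_elem_of (Elem c :: ('k, 'v, 'e) bq_elt) \<odot>\<^bsub>Qk\<^esub> Elem (aj j)"
    unfolding q1_def
    using assms
    by (intro B.dsum_out_in[where J = J and M = Mo and N = Qk and i = j and x = "Elem c" and
          g = "\<lambda>j z. the_elem_of z \<odot>\<^bsub>Qk\<^esub> Elem (aj j)"] J(1) Mo_rm Qk_rm idem.idem_hom[OF idem_opp_j Qk_rm aj_Qk])
      (simp_all only: Mo_iff)
  thus ?thesis by simp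
qed

lemma Qk_cf_finsum:
  assumes "g \<in> J \<rightarrow> carrier Qk" "length (snd w) < 2"
  shows "cf w (the_elem_of (\<Oplus>\<^bsub>Qk\<^esub>j\<in>J. g j)) = (\<Sum>j\<in>J. cf w (the_elem_of (g j)))"
  by (rule cf_finsum[OF B.right_module_ag[OF Qk_rm] _ _ _ J(1) assms]) (auto elim: Qk_E)

text \<open>One inclusion holds because arrows have no coefficient at a trivial path. The other is
  the generation of the radical at \<open>k\<close> by the arrows into \<open>k\<close>, through
  \<open>rad_decomp\<close> with the elements hit by \<open>q1\<close> as additive set.\<close>

lemma q1_image: "q1 ` carrier Q1 = a_kernel Qk DS q0"
proof
  show "q1 ` carrier Q1 \<subseteq> a_kernel Qk DS q0"
  proof clarify
    fix z assume z: "z \<in> carrier Q1"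
    have q: "q1 z \<in> carrier Qk" using B.homD(1)[OF q1_hom z] .
    have "cf (k, []) (the_elem_of (q1 z)) = (\<Sum>j\<in>J. cf (k, []) (the_elem_of (the_elem_of (component z j) \<odot>\<^bsub>Qk\<^esub> Elem (aj j))))"
      unfolding q1_def
    proof (rule Qk_cf_finsum)
      show "(\<lambda>j. the_elem_of (component z j) \<odot>\<^bsub>Qk\<^esub> Elem (aj j)) \<in> J \<rightarrow> carrier Qk"
        using B.homD(1)[OF idem.idem_hom[OF idem_opp_j Qk_rm aj_Qk]] dsum_component_closed[OF z] by blast
    qed simp
    also have "\<dots> = 0"
    proof (rule sum.neutral, rule ballI)
      fix j assume j: "j \<in> J"
      obtain c where c: "c \<in> carrier A" "component z j = Elem c" using Q1_component[OF z j] by metis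
      have "cf (k, []) (aj j) = 0"
        using J(2)[OF j] by (simp add: bq_path_def cf_co path_elt_closed qpath_arc) (simp add: path_elt_def)
      thus "cf (k, []) (the_elem_of (the_elem_of (component z j) \<odot>\<^bsub>Qk\<^esub> Elem (aj j))) = 0"
        using c aj(1)[OF j] by (simp add: eps_mult)
    qed
    finally show "q1 z \<in> a_kernel Qk DS q0" using q by (simp add: a_kernel_def' q0_def DS_simps)
  qed
  show "a_kernel Qk DS q0 \<subseteq> q1 ` carrier Q1"
  proof
    fix z assume z: "z \<in> a_kernel Qk DS q0"
    then obtain c where c: "z = Elem c" by (auto simp: a_kernel_def' elim: Qk_E)
    hence c1: "c \<in> rad 1" "c \<otimes>\<^bsub>A\<^esub> vx k = c" using z q0_kernel by auto
    interpret M: rmod "opp A" Qk by (rule B.rmodI[OF Qk_rm])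
    interpret N: rmod "opp A" Q1 by (rule B.rmodI[OF Q1_rm])
    note sub = B.submodD[OF B.submod_image[OF q1_hom Q1_rm Qk_rm] Qk_rm]
    let ?S = "{c. Elem c \<in> q1 ` carrier Q1}"
    have "c \<otimes>\<^bsub>A\<^esub> vx k \<in> ?S"
    proof (rule rad_decomp[OF c1(1)])
      show "\<zero>\<^bsub>A\<^esub> \<in> ?S" using sub(2) by simp
      show "x \<oplus>\<^bsub>A\<^esub> y \<in> ?S" if "x \<in> ?S" "y \<in> ?S" for x y using sub(3)[of "Elem x" "Elem y"] that by simp
      fix \<alpha> y assume \<alpha>: "\<alpha> \<in> arcs Q" "head Q \<alpha> = k" and y: "y \<in> carrier A"
      have j: "Inr \<alpha> \<in> J" using \<alpha> by simp
      \<comment> \<open>The factor y is first multiplied by the start vertex of the arrow to make it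
        an element of the summand; the product with the arrow is not affected.\<close>
      have v: "y \<otimes>\<^bsub>A\<^esub> vx (tail Q \<alpha>) \<in> carrier A" "y \<otimes>\<^bsub>A\<^esub> vx (tail Q \<alpha>) \<otimes>\<^bsub>A\<^esub> vx (tail Q \<alpha>) = y \<otimes>\<^bsub>A\<^esub> vx (tail Q \<alpha>)"
        using \<alpha> y by (simp_all add: m_assoc vx_idem)
      have "dsum_in J Mo (Inr \<alpha>) (Elem (y \<otimes>\<^bsub>A\<^esub> vx (tail Q \<alpha>))) \<in> carrier Q1"
        using v Mo_iff[OF j, of "y \<otimes>\<^bsub>A\<^esub> vx (tail Q \<alpha>)"] by (intro B.homD(1)[OF B.dsum_in_hom[OF Mo_rm j]]) simp_all
      moreover have "q1 (dsum_in J Mo (Inr \<alpha>) (Elem (y \<otimes>\<^bsub>A\<^esub> vx (tail Q \<alpha>)))) = Elem (y \<otimes>\<^bsub>A\<^esub> ar \<alpha>)"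
        using q1_in[OF j] v \<alpha> y by (simp add: m_assoc vx_ar)
      ultimately show "y \<otimes>\<^bsub>A\<^esub> ar \<alpha> \<in> ?S" by force
    qed simp
    thus "z \<in> q1 ` carrier Q1" using c1 c by simp
  qed
qed

lemma Q1_decomp: "z \<in> carrier Q1 \<Longrightarrow> z = (\<Oplus>\<^bsub>Q1\<^esub>j\<in>J. dsum_in J Mo j (component z j))"
  by (rule B.dsum_decomp[OF J(1) Mo_rm])

lemma gen_act:
  assumes "j \<in> J" "c \<in> carrier A" "c \<otimes>\<^bsub>A\<^esub> vx (tj j) = c"
  shows "dsum_in J Mo j (Elem c) = c \<odot>\<^bsub>Q1\<^esub> dsum_in J Mo j (Elem (vx (tj j)))"
  using B.homD(3)[OF B.dsum_in_hom[where M = Mo, OF Mo_rm assms(1)], where a = c and x = "Elem (vx (tj j))"] assms J(4)[OF assms(1)]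
  by (simp add: Mo_iff vx_idem)

lemma gen_closed: "j \<in> J \<Longrightarrow> dsum_in J Mo j (Elem (vx (tj j))) \<in> carrier Q1"
  by (rule B.homD(1)[OF B.dsum_in_hom[OF Mo_rm]]) (use J(4) in \<open>simp_all add: Mo_iff vx_idem\<close>)

lemma q1_cover: "projective_cover (opp A) Q1 q1 (Qk\<lparr>carrier := a_kernel Qk DS q0\<rparr>)"
proof -
  let ?K = "Qk\<lparr>carrier := a_kernel Qk DS q0\<rparr>"
  have K: "right_module (opp A) ?K"
    using B.submod_kernel[OF q0_hom Qk_rm DS_rm] by (simp add: submod_def)
  have hom: "q1 \<in> rmod_hom (opp A) Q1 ?K"
    using B.homD[OF q1_hom] q1_image by (intro B.homI) auto
  have "a_kernel Q1 ?K q1 \<subseteq> B.mod_gen Q1 (rad 1)"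
  proof
    fix z assume "z \<in> a_kernel Q1 ?K q1"
    hence z: "z \<in> carrier Q1" "q1 z = Elem \<zero>\<^bsub>A\<^esub>" by (simp_all add: a_kernel_def')
    have "dsum_in J Mo j (component z j) \<in> B.mod_gen Q1 (rad 1)" if j: "j \<in> J" for j
    proof -
      interpret N: rmod "opp A" Q1 by (rule B.rmodI[OF Q1_rm])
      obtain c where c: "c \<in> carrier A" "c \<otimes>\<^bsub>A\<^esub> vx (tj j) = c" "component z j = Elem c" by (rule Q1_component[OF z(1) j])
      let ?w = "(tj j, [projr j])"
      have "0 = cf ?w (the_elem_of (q1 z))" using z(2) by (simp add: cf_zero)
      also have "\<dots> = (\<Sum>i\<in>J. cf ?w (the_elem_of (the_elem_of (component z i) \<odot>\<^bsub>Qk\<^esub> Elem (aj i))))"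
        unfolding q1_def
      proof (rule Qk_cf_finsum)
        show "(\<lambda>j. the_elem_of (component z j) \<odot>\<^bsub>Qk\<^esub> Elem (aj j)) \<in> J \<rightarrow> carrier Qk"
          using B.homD(1)[OF idem.idem_hom[OF idem_opp_j Qk_rm aj_Qk]] dsum_component_closed[OF z(1)] by blast
      qed simp
      also have "\<dots> = (\<Sum>i\<in>J. if i = j then cf (tj j, []) c else 0)"
      proof (rule sum.cong[OF refl])
        fix i assume i: "i \<in> J"
        obtain d where d: "d \<in> carrier A" "component z i = Elem d" using Q1_component[OF z(1) i] by metis
        show "cf ?w (the_elem_of (the_elem_of (component z i) \<odot>\<^bsub>Qk\<^esub> Elem (aj i))) = (if i = j then cf (tj j, []) c else 0)"
        proof (cases "i = j")
          case True
          hence "d = c" using d(2) c(3) by simp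
          thus ?thesis using cf_arrow_right[OF d(1) J(2)[OF j] J(2)[OF i]] d(2) True by simp
        next
          case False
          hence "projr j \<noteq> projr i" using i j by auto
          thus ?thesis using cf_arrow_right[OF d(1) J(2)[OF j] J(2)[OF i]] d(2) False by simp
        qed
      qed
      also have "\<dots> = cf (tj j, []) c" using j J(1) by simp
      finally have "cf (tj j, []) c = 0" by simp
      moreover have "cf (u, []) c = cf (u, []) c * cf (u, []) (vx (tj j))" for u
        using eps_mult[of c "vx (tj j)" u] c J(4)[OF j] by simp
      ultimately have "cf (u, []) c = 0" for u by (metis eps_vx[OF J(4)[OF j]] mult_zero_right)
      hence "c \<in> rad 1" using rad_1_iff[OF c(1)] by blast
      thus ?thesis unfolding c(3) gen_act[OF j c(1,2)]
        using rad_closed by (intro N.mod_gen_base gen_closed j) auto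
    qed
    hence "(\<Oplus>\<^bsub>Q1\<^esub>j\<in>J. dsum_in J Mo j (component z j)) \<in> B.mod_gen Q1 (rad 1)"
      using rad_closed by (intro B.mod_gen_finsum Q1_rm J) auto
    thus "z \<in> B.mod_gen Q1 (rad 1)" using Q1_decomp[OF z(1)] by simp
  qed
  thus ?thesis unfolding projective_cover_def
    using Q1_proj hom q1_image superfluous_rad[OF Q1_rm B.submod_kernel[OF hom Q1_rm K]] by simp
qed

lemma DS_min_presentation: "min_presentation (opp A) Q1 q1 Qk q0 DS"
  unfolding min_presentation_def using q0_cover q1_cover by blast

subsection \<open>The transpose\<close>

text \<open>Stated for an arbitrary minimal presentation, because the definition of the transpose
  leaves open which one is used; \<open>t1\<close> and \<open>t0\<close> relate it to the explicit
  one. The conclusion identifies \<open>T\<close> with coker f by a surjection from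
  \<open>L0\<close> with kernel im f, the form in which projectives are later lifted against
  it.\<close>

lemma transpose_cover:
  fixes P1 P0 :: "('k, 'v, 'e) bq_module"
  assumes "min_presentation (opp A) P1 p1 P0 p0 DS"
  defines "T \<equiv> quot_module (adual (opp A) P1) ((\<lambda>f. \<lambda>x\<in>carrier P1. f (p1 x)) ` carrier (adual (opp A) P0))"
  shows "right_module A T"
    and "\<exists>\<rho>\<in>rmod_hom A L0 T. \<rho> ` carrier L0 = carrier T \<and>
      (\<forall>y\<in>carrier L0. \<rho> y = \<zero>\<^bsub>T\<^esub> \<longleftrightarrow> y \<in> fk ` carrier Pk)"
proof -
  have P: "right_module (opp A) P1" "right_module (opp A) P0" "p1 \<in> rmod_hom (opp A) P1 (P0\<lparr>carrier := a_kernel P0 DS p0\<rparr>)"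
    using assms(1) by (auto simp: min_presentation_def projective_cover_def dest: B.proj_right_module)
  have p1: "p1 \<in> rmod_hom (opp A) P1 P0"
    using B.homD[OF P(3)] by (intro B.homI) (auto simp: a_kernel_def')
  obtain t1 t0 where t: "t1 \<in> rmod_hom (opp A) Q1 P1" "t0 \<in> rmod_hom (opp A) Qk P0"
    "bij_betw t1 (carrier Q1) (carrier P1)" "bij_betw t0 (carrier Qk) (carrier P0)"
    "\<And>z. z \<in> carrier Q1 \<Longrightarrow> p1 (t1 z) = t0 (q1 z)"
    using B.min_presentation_unique[OF DS_min_presentation assms(1) DS_rm] by blast
  define u1 where "u1 = inv_into (carrier Q1) t1"
  define u0 where "u0 = inv_into (carrier Qk) t0"
  have u: "u1 \<in> rmod_hom (opp A) P1 Q1" "u0 \<in> rmod_hom (opp A) P0 Qk"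
    unfolding u1_def u0_def by (intro B.hom_inv t Q1_rm Qk_rm)+
  have ut: "\<And>z. z \<in> carrier Q1 \<Longrightarrow> u1 (t1 z) = z" "\<And>z. z \<in> carrier Qk \<Longrightarrow> u0 (t0 z) = z"
    "\<And>x. x \<in> carrier P1 \<Longrightarrow> t1 (u1 x) = x"
    using t(3,4) unfolding u1_def u0_def by (auto simp: bij_betw_def inv_into_f_f f_inv_into_f)
  let ?D1 = "adual (opp A) P1" and ?D0 = "adual (opp A) P0"
  let ?im = "(\<lambda>f. \<lambda>x\<in>carrier P1. f (p1 x)) ` carrier ?D0"
  have D1: "right_module A ?D1" and D0: "right_module A ?D0"
    using B.adual_right_module[OF P(1)] B.adual_right_module[OF P(2)] by simp_all
  have DI: "(\<lambda>x\<in>carrier M. g x) \<in> carrier (adual (opp A) M)"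
    if "right_module (opp A) M" "\<And>x. x \<in> carrier M \<Longrightarrow> g x \<in> carrier A"
      "\<And>x y. x \<in> carrier M \<Longrightarrow> y \<in> carrier M \<Longrightarrow> g (x \<oplus>\<^bsub>M\<^esub> y) = g x \<oplus>\<^bsub>A\<^esub> g y"
      "\<And>b x. b \<in> carrier A \<Longrightarrow> x \<in> carrier M \<Longrightarrow> g (b \<odot>\<^bsub>M\<^esub> x) = b \<otimes>\<^bsub>A\<^esub> g x"
    for M :: "('k, 'v, 'e) bq_module" and g
  proof -
    interpret M: rmod "opp A" M by (rule B.rmodI[OF that(1)])
    show ?thesis using that(2-4) M.act_closed by (auto simp: adual_def regular_def intro!: B.homI)
  qed
  have DD: "g \<in> rmod_hom (opp A) M (regular (opp A))" "x \<in> carrier M \<Longrightarrow> g x \<in> carrier A"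
      "x \<in> carrier M \<Longrightarrow> y \<in> carrier M \<Longrightarrow> g (x \<oplus>\<^bsub>M\<^esub> y) = g x \<oplus>\<^bsub>A\<^esub> g y"
      "b \<in> carrier A \<Longrightarrow> x \<in> carrier M \<Longrightarrow> g (b \<odot>\<^bsub>M\<^esub> x) = b \<otimes>\<^bsub>A\<^esub> g x"
    if "g \<in> carrier (adual (opp A) M)" for M :: "('k, 'v, 'e) bq_module" and g x y b
    using that B.homD[of g M "regular (opp A)"] by (auto simp: adual_def regular_def)
  have ev: "(g \<oplus>\<^bsub>adual (opp A) M\<^esub> h) x = g x \<oplus>\<^bsub>A\<^esub> h x" "(a \<odot>\<^bsub>adual (opp A) M\<^esub> g) x = g x \<otimes>\<^bsub>A\<^esub> a"
    if "x \<in> carrier M" for M :: "('k, 'v, 'e) bq_module" and g h a x using that by (simp_all add: adual_def)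
  have eq: "g = h" if "g \<in> carrier ?D1" "h \<in> carrier ?D1" "\<And>x. x \<in> carrier P1 \<Longrightarrow> g x = h x" for g h
    using that by (auto simp: adual_def intro: extensionalityI)
  have pc: "p1 x \<in> carrier P0" if "x \<in> carrier P1" for x using B.homD(1)[OF p1 that] .
  have imD: "(\<lambda>x\<in>carrier P1. g (p1 x)) \<in> carrier ?D1" if "g \<in> carrier ?D0" for g
    using DD(2-4)[OF that] B.homD[OF p1] by (intro DI P) simp_all
  have "(\<lambda>f. \<lambda>x\<in>carrier P1. f (p1 x)) \<in> rmod_hom A ?D0 ?D1"
  proof (rule homI)
    interpret D0: rmod A ?D0 by (rule rmodI[OF D0])
    interpret D1: rmod A ?D1 by (rule rmodI[OF D1])
    fix g h assume gh: "g \<in> carrier ?D0" "h \<in> carrier ?D0"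
    show "(\<lambda>x\<in>carrier P1. (g \<oplus>\<^bsub>?D0\<^esub> h) (p1 x)) = (\<lambda>x\<in>carrier P1. g (p1 x)) \<oplus>\<^bsub>?D1\<^esub> (\<lambda>x\<in>carrier P1. h (p1 x))"
      using gh by (intro eq) (simp_all add: imD ev pc)
  next
    interpret D0: rmod A ?D0 by (rule rmodI[OF D0])
    interpret D1: rmod A ?D1 by (rule rmodI[OF D1])
    fix a g assume g: "a \<in> carrier A" "g \<in> carrier ?D0"
    show "(\<lambda>x\<in>carrier P1. (a \<odot>\<^bsub>?D0\<^esub> g) (p1 x)) = a \<odot>\<^bsub>?D1\<^esub> (\<lambda>x\<in>carrier P1. g (p1 x))"
      using g by (intro eq) (simp_all add: imD ev pc)
  qed (rule imD)
  hence sub: "submod A ?im ?D1" by (rule submod_image[OF _ D0 D1])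
  note qm = quot_module[OF D1 sub]
  show "right_module A T" unfolding T_def by (rule qm(4))
  \<comment> \<open>The isomorphism between \<open>L0\<close> and the dual of \<open>Q1\<close>: the
    family y acts as the linear form taking z to the sum of the products of components of z and y.
    \<open>\<Psi>\<close> carries it over to \<open>P1\<close>.\<close>
  define \<Psi>' where "\<Psi>' = (\<lambda>y z. \<Oplus>\<^bsub>regular (opp A)\<^esub>j\<in>J. the_elem_of (component z j) \<odot>\<^bsub>regular (opp A)\<^esub> the_elem_of (component y j))"
  define \<Psi> where "\<Psi> = (\<lambda>y. \<lambda>x\<in>carrier P1. \<Psi>' y (u1 x))"
  have yc: "the_elem_of (component y j) \<in> carrier A" if "y \<in> carrier L0" "j \<in> J" for y j
    using L0_component[OF that] by (metis elt.sel(1))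
  have zc: "the_elem_of (component z j) \<in> carrier A" if "z \<in> carrier Q1" "j \<in> J" for z j
    using Q1_component[OF that] by (metis elt.sel(1))
  interpret Rg: rmod "opp A" "regular (opp A)" by (rule B.rmodI[OF B.regular_right_module])
  have Rc: "carrier (regular (opp A)) = carrier A" "\<And>a x. a \<odot>\<^bsub>regular (opp A)\<^esub> x = a \<otimes>\<^bsub>A\<^esub> x"
    "\<And>x y. x \<oplus>\<^bsub>regular (opp A)\<^esub> y = x \<oplus>\<^bsub>A\<^esub> y"
    by (simp_all add: regular_def)
  have g_hom: "(\<lambda>z. the_elem_of z \<odot>\<^bsub>regular (opp A)\<^esub> the_elem_of (component y j)) \<in> rmod_hom (opp A) (Mo j) (regular (opp A))"
    if "y \<in> carrier L0" "j \<in> J" for y j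
    by (rule idem.idem_hom[OF idem_opp_j[OF that(2)] Rg.right_module]) (simp add: Rc yc that)
  have \<Psi>'_hom: "\<Psi>' y \<in> rmod_hom (opp A) Q1 (regular (opp A))" if "y \<in> carrier L0" for y
    unfolding \<Psi>'_def
    by (rule B.dsum_out_hom[where g = "\<lambda>j z. the_elem_of z \<odot>\<^bsub>regular (opp A)\<^esub> the_elem_of (component y j)", OF J(1) Rg.right_module g_hom[OF that]])
  have \<Psi>'_gen: "\<Psi>' y (dsum_in J Mo j (Elem (vx (tj j)))) = the_elem_of (component y j)" if y: "y \<in> carrier L0" "j \<in> J" for y j
  proof -
    have "\<Psi>' y (dsum_in J Mo j (Elem (vx (tj j)))) =
        the_elem_of (Elem (vx (tj j)) :: ('k, 'v, 'e) bq_elt) \<odot>\<^bsub>regular (opp A)\<^esub> the_elem_of (component y j)"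
      unfolding \<Psi>'_def
      using y(2) J(4)[OF y(2)]
      by (intro B.dsum_out_in[where J = J and M = Mo and N = "regular (opp A)" and i = j and x = "Elem (vx (tj j))" and
            g = "\<lambda>j z. the_elem_of z \<odot>\<^bsub>regular (opp A)\<^esub> the_elem_of (component y j)"] J(1) Mo_rm Rg.right_module
            g_hom[OF y(1)]) (simp_all only: Mo_iff vx_idem vx_closed)
    also have "\<dots> = the_elem_of (component y j)" using L0_component[OF y] by (metis Rc(2) elt.sel(1))
    finally show ?thesis .
  qed
  \<comment> \<open>\<open>Q1\<close> is generated by the vertices placed in the single summands, so
    linear forms are compared on these generators only.\<close>
  have hom_ext: "g z = h z"
    if he: "g \<in> rmod_hom (opp A) Q1 (regular (opp A))" "h \<in> rmod_hom (opp A) Q1 (regular (opp A))" "z \<in> carrier Q1"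
      "\<And>j. j \<in> J \<Longrightarrow> g (dsum_in J Mo j (Elem (vx (tj j)))) = h (dsum_in J Mo j (Elem (vx (tj j))))" for g h z
  proof -
    have "g (dsum_in J Mo j (component z j)) = h (dsum_in J Mo j (component z j))" if j: "j \<in> J" for j
    proof -
      obtain c where c: "c \<in> carrier A" "c \<otimes>\<^bsub>A\<^esub> vx (tj j) = c" "component z j = Elem c" by (rule Q1_component[OF he(3) j])
      show ?thesis unfolding c(3) gen_act[OF j c(1,2)]
        using B.homD(3)[OF he(1) _ gen_closed[OF j], of c] B.homD(3)[OF he(2) _ gen_closed[OF j], of c] he(4)[OF j] c(1)
        by simp
    qed
    hence "(\<Oplus>\<^bsub>regular (opp A)\<^esub>j\<in>J. g (dsum_in J Mo j (component z j))) = (\<Oplus>\<^bsub>regular (opp A)\<^esub>j\<in>J. h (dsum_in J Mo j (component z j)))"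
      using B.homD(1)[OF he(2)] B.homD(1)[OF B.dsum_in_hom[OF Mo_rm]] dsum_component_closed[OF he(3)]
      by (intro Rg.M.finsum_cong') auto
    thus ?thesis
      using B.dsum_hom_eq[OF J(1) Mo_rm Rg.right_module he(1,3)] B.dsum_hom_eq[OF J(1) Mo_rm Rg.right_module he(2,3)] by simp
  qed
  have D1_hom: "g \<in> carrier ?D1 \<Longrightarrow> (\<lambda>z. g (t1 z)) \<in> rmod_hom (opp A) Q1 (regular (opp A))" for g
    using B.hom_comp'[OF t(1) DD(1)] by blast
  have \<Psi>D: "\<Psi> y \<in> carrier ?D1" if "y \<in> carrier L0" for y
    using B.homD[OF B.hom_comp'[OF u(1) \<Psi>'_hom[OF that]]] unfolding \<Psi>_def Rc opp_simps
    by (intro DI P) simp_all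
  have t1c: "z \<in> carrier Q1 \<Longrightarrow> t1 z \<in> carrier P1" for z using B.homD(1)[OF t(1)] .
  have \<Psi>t: "\<Psi> y (t1 z) = \<Psi>' y z" if "z \<in> carrier Q1" for y z using that t1c by (simp add: \<Psi>_def ut)
  have D1_eqI: "g = h" if "g \<in> carrier ?D1" "h \<in> carrier ?D1"
      "\<And>j. j \<in> J \<Longrightarrow> g (t1 (dsum_in J Mo j (Elem (vx (tj j))))) = h (t1 (dsum_in J Mo j (Elem (vx (tj j)))))" for g h
  proof (rule eq[OF that(1,2)])
    fix x assume x: "x \<in> carrier P1"
    have "u1 x \<in> carrier Q1" using B.homD(1)[OF u(1) x] .
    hence "g (t1 (u1 x)) = h (t1 (u1 x))"
      using hom_ext[OF D1_hom[OF that(1)] D1_hom[OF that(2)] _ that(3)] by blast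
    thus "g x = h x" using ut(3)[OF x] by simp
  qed
  have \<Psi>_hom: "\<Psi> \<in> rmod_hom A L0 ?D1"
  proof (rule homI)
    interpret D1: rmod A ?D1 by (rule rmodI[OF D1])
    interpret L: rmod A L0 by (rule rmodI[OF L0_rm])
    fix y w assume yw: "y \<in> carrier L0" "w \<in> carrier L0"
    show "\<Psi> (y \<oplus>\<^bsub>L0\<^esub> w) = \<Psi> y \<oplus>\<^bsub>?D1\<^esub> \<Psi> w"
    proof -
      have s: "y \<oplus>\<^bsub>L0\<^esub> w \<in> carrier L0" using yw by (rule L.M.a_closed)
      have "the_elem_of (component (y \<oplus>\<^bsub>L0\<^esub> w) j) = the_elem_of (component y j) \<oplus>\<^bsub>A\<^esub> the_elem_of (component w j)"
        if "j \<in> J" for j using that by (simp add: dsum_simps(3))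
      thus ?thesis
        using yw s by (intro D1_eqI) (simp_all add: \<Psi>D ev t1c gen_closed \<Psi>t \<Psi>'_gen)
    qed
  next
    interpret D1: rmod A ?D1 by (rule rmodI[OF D1])
    interpret L: rmod A L0 by (rule rmodI[OF L0_rm])
    fix a y assume ay: "a \<in> carrier A" "y \<in> carrier L0"
    show "\<Psi> (a \<odot>\<^bsub>L0\<^esub> y) = a \<odot>\<^bsub>?D1\<^esub> \<Psi> y"
    proof -
      have s: "a \<odot>\<^bsub>L0\<^esub> y \<in> carrier L0" using ay by (rule L.act_closed)
      have "the_elem_of (component (a \<odot>\<^bsub>L0\<^esub> y) j) = the_elem_of (component y j) \<otimes>\<^bsub>A\<^esub> a"
        if "j \<in> J" for j using that by (simp add: dsum_simps(4))
      thus ?thesis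
        using ay s by (intro D1_eqI) (simp_all add: \<Psi>D ev t1c gen_closed \<Psi>t \<Psi>'_gen)
    qed
  qed (rule \<Psi>D)
  \<comment> \<open>The inverse collects the values of a form on the generators; each value is fixed
    by its vertex because the generator is.\<close>
  have \<Psi>_surj: "\<exists>y\<in>carrier L0. \<Psi> y = g" if g: "g \<in> carrier ?D1" for g
  proof -
    let ?y = "Fam (\<lambda>j\<in>J. Elem (g (t1 (dsum_in J Mo j (Elem (vx (tj j)))))))"
    have "Elem (g (t1 (dsum_in J Mo j (Elem (vx (tj j)))))) \<in> carrier (M0 j)" if j: "j \<in> J" for j
    proof -
      have "vx (tj j) \<odot>\<^bsub>Q1\<^esub> dsum_in J Mo j (Elem (vx (tj j))) = dsum_in J Mo j (Elem (vx (tj j)))"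
        using gen_act[OF j, of "vx (tj j)"] J(4)[OF j] by (simp add: vx_idem)
      hence "vx (tj j) \<otimes>\<^bsub>A\<^esub> g (t1 (dsum_in J Mo j (Elem (vx (tj j))))) = g (t1 (dsum_in J Mo j (Elem (vx (tj j)))))"
        using B.homD(3)[OF t(1) _ gen_closed[OF j], of "vx (tj j)"] DD(4)[OF g, of "vx (tj j)" "t1 (dsum_in J Mo j (Elem (vx (tj j))))"]
          t1c[OF gen_closed[OF j]] J(4)[OF j] by simp
      thus ?thesis using DD(2)[OF g] t1c[OF gen_closed[OF j]] by (simp add: idem.Elem_idem_iff[OF idem_j[OF j]])
    qed
    hence y: "?y \<in> carrier L0" by (rule dsum_carrierI)
    have "\<Psi> ?y = g"
      by (rule D1_eqI[OF \<Psi>D[OF y] g]) (simp add: \<Psi>t gen_closed \<Psi>'_gen[OF y])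
    thus ?thesis using y by blast
  qed
  have \<Psi>_im: "\<Psi> y \<in> ?im \<longleftrightarrow> y \<in> fk ` carrier Pk" if y: "y \<in> carrier L0" for y
  proof
    assume "\<Psi> y \<in> ?im"
    then obtain h where h: "h \<in> carrier ?D0" "\<Psi> y = (\<lambda>x\<in>carrier P1. h (p1 x))" by blast
    \<comment> \<open>A form on \<open>P0\<close> is right multiplication by its value at the
      generator, so its composite with \<open>p1\<close> has the values aj c on the generators,
      which are the components of \<open>fk\<close> at c.\<close>
    let ?c = "h (t0 (Elem (vx k)))"
    have vk: "Elem (vx k) \<in> carrier Qk" by (simp add: Qk_iff vx_idem)
    have tk: "t0 (Elem (vx k)) \<in> carrier P0" using B.homD(1)[OF t(2) vk] .
    have t0e: "h (t0 (Elem c)) = c \<otimes>\<^bsub>A\<^esub> ?c" if "c \<in> carrier A" "c \<otimes>\<^bsub>A\<^esub> vx k = c" for c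
      using B.homD(3)[OF t(2) _ vk, of c] DD(4)[OF h(1) _ tk, of c] that by simp
    have c: "?c \<in> carrier A" "vx k \<otimes>\<^bsub>A\<^esub> ?c = ?c" using DD(2)[OF h(1) tk] t0e[of "vx k"] by (simp_all add: vx_idem)
    have "y = fk (Elem ?c)"
    proof (rule dsum_eqI[OF y])
      show "fk (Elem ?c) \<in> carrier L0" using c by (intro homD(1)[OF fk_hom]) (simp add: idem.Elem_idem_iff[OF idem_k])
      fix j assume j: "j \<in> J"
      have "the_elem_of (component y j) = h (p1 (t1 (dsum_in J Mo j (Elem (vx (tj j))))))"
        using \<Psi>t[OF gen_closed[OF j], of y] \<Psi>'_gen[OF y j] h(2) t1c[OF gen_closed[OF j]] by simp
      also have "\<dots> = h (t0 (Elem (aj j)))"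
        using q1_in[OF j, of "vx (tj j)"] J(4)[OF j] aj(2)[OF j] by (simp add: t(5)[OF gen_closed[OF j]] vx_idem)
      also have "\<dots> = aj j \<otimes>\<^bsub>A\<^esub> ?c" using aj[OF j] by (intro t0e)
      finally show "component y j = component (fk (Elem ?c)) j"
      proof -
        assume e: "the_elem_of (component y j) = aj j \<otimes>\<^bsub>A\<^esub> ?c"
        obtain d where "component y j = Elem d" using L0_component[OF y j] by metis
        thus ?thesis using e j by (simp add: fk_component)
      qed
    qed
    thus "y \<in> fk ` carrier Pk" using c by (auto simp: idem.Elem_idem_iff[OF idem_k])
  next
    assume "y \<in> fk ` carrier Pk"
    then obtain c where c: "c \<in> carrier A" "vx k \<otimes>\<^bsub>A\<^esub> c = c" "y = fk (Elem c)"
      by (auto elim: idem.idem_carrierE[OF idem_k])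
    let ?h = "\<lambda>x\<in>carrier P0. the_elem_of (u0 x) \<odot>\<^bsub>regular (opp A)\<^esub> c"
    have "(\<lambda>x. the_elem_of (u0 x) \<odot>\<^bsub>regular (opp A)\<^esub> c) \<in> rmod_hom (opp A) P0 (regular (opp A))"
      by (rule B.hom_comp'[OF u(2) idem.idem_hom[OF idem_opp_k Rg.right_module]]) (simp add: Rc c)
    note hh = B.homD[OF this]
    have h: "?h \<in> carrier ?D0" using hh unfolding Rc opp_simps by (intro DI P) simp_all
    have "\<Psi> y = (\<lambda>x\<in>carrier P1. ?h (p1 x))"
    proof (rule D1_eqI[OF \<Psi>D[OF y] imD[OF h]])
      fix j assume j: "j \<in> J"
      have "q1 (dsum_in J Mo j (Elem (vx (tj j)))) = Elem (aj j)"
        using q1_in[OF j, of "vx (tj j)"] J(4)[OF j] aj(2)[OF j] by (simp add: vx_idem)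
      hence "p1 (t1 (dsum_in J Mo j (Elem (vx (tj j))))) = t0 (Elem (aj j))" by (simp add: t(5)[OF gen_closed[OF j]])
      moreover have comp: "component y j = Elem (aj j \<otimes>\<^bsub>A\<^esub> c)" using c(3) j by (simp add: fk_component)
      ultimately show "\<Psi> y (t1 (dsum_in J Mo j (Elem (vx (tj j))))) =
          (\<lambda>x\<in>carrier P1. ?h (p1 x)) (t1 (dsum_in J Mo j (Elem (vx (tj j)))))"
        using j B.homD(1)[OF t(2) aj_Qk[OF j]] aj_Qk[OF j] comp
        by (simp add: \<Psi>t gen_closed \<Psi>'_gen[OF y] t1c ut(2) Rc)
    qed
    thus "\<Psi> y \<in> ?im" using h by blast
  qed
  let ?r = "\<lambda>y. ?im +>\<^bsub>?D1\<^esub> \<Psi> y"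
  have "?r \<in> rmod_hom A L0 T" unfolding T_def by (rule hom_comp'[OF \<Psi>_hom qm(1)])
  moreover have "?r ` carrier L0 = carrier T"
  proof -
    have "\<Psi> ` carrier L0 = carrier ?D1" using \<Psi>_surj homD(1)[OF \<Psi>_hom] by blast
    thus ?thesis unfolding T_def qm(2)[symmetric] by (metis image_image)
  qed
  moreover have "\<forall>y\<in>carrier L0. ?r y = \<zero>\<^bsub>T\<^esub> \<longleftrightarrow> y \<in> fk ` carrier Pk"
    using qm(3)[OF homD(1)[OF \<Psi>_hom]] \<Psi>_im unfolding T_def by simp
  ultimately show "\<exists>\<rho>\<in>rmod_hom A L0 T. \<rho> ` carrier L0 = carrier T \<and>
      (\<forall>y\<in>carrier L0. \<rho> y = \<zero>\<^bsub>T\<^esub> \<longleftrightarrow> y \<in> fk ` carrier Pk)" by blast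
qed

abbreviation NT :: "('k, 'v, 'e) bq_module" where "NT \<equiv> tau_inv A (simple_at k)"

text \<open>The choice in \<open>tau_inv\<close> needs a witness on the prescribed carrier type,
  whereas the cokernel consists of cosets. A section of the surjection from \<open>L0\<close> copies
  it into that type.\<close>

lemma tau_inv_transpose: "is_transpose (opp A) DS NT"
proof -
  let ?T = "quot_module (adual (opp A) Q1) ((\<lambda>f. \<lambda>x\<in>carrier Q1. f (q1 x)) ` carrier (adual (opp A) Qk))"
  note T = transpose_cover[OF DS_min_presentation]
  obtain \<rho> where \<rho>: "\<rho> \<in> rmod_hom A L0 ?T" "\<rho> ` carrier L0 = carrier ?T" using T(2) by blast
  define s where "s = inv_into (carrier L0) \<rho>"
  have inj: "inj_on s (carrier ?T)" unfolding s_def by (rule transport_section[OF \<rho>(2)])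
  let ?N = "transport ?T s"
  have fd: "fd_module A ?N"
    by (rule fd_image[OF proj_fd[OF L0_proj] transport_right_module[OF inj T(1)] hom_comp'[OF \<rho>(1) transport_hom[OF inj]]])
      (simp add: transport_def \<rho>(2)[symmetric] image_image)
  have "rmod_iso A ?N ?T"
    unfolding rmod_iso_def
    by (intro bexI[OF _ hom_inv[OF transport_hom[OF inj] T(1) transport_bij[OF inj]]] bij_betw_inv_into transport_bij inj)
  hence "is_transpose (opp A) DS ?N"
    unfolding is_transpose_def opp_opp using fd DS_min_presentation by blast
  thus ?thesis unfolding tau_inv_def by (rule someI)
qed

text \<open>All that is used later about the inverse translate: it is finite-dimensional and is the
  cokernel of f.\<close>

lemma tau_inv_cover:
  "fd_module A NT"
  "\<exists>\<rho>\<in>rmod_hom A L0 NT. \<rho> ` carrier L0 = carrier NT \<and> (\<forall>y\<in>carrier L0. \<rho> y = \<zero>\<^bsub>NT\<^esub> \<longleftrightarrow> y \<in> fk ` carrier Pk)"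
proof -
  obtain P1 P0 :: "('k, 'v, 'e) bq_module" and p1 p0 where fd: "fd_module A NT"
    and P: "min_presentation (opp A) P1 p1 P0 p0 DS"
    and iso: "rmod_iso A NT (quot_module (adual (opp A) P1) ((\<lambda>f. \<lambda>x\<in>carrier P1. f (p1 x)) ` carrier (adual (opp A) P0)))"
    using tau_inv_transpose unfolding is_transpose_def opp_opp by blast
  show "fd_module A NT" by (rule fd)
  let ?T = "quot_module (adual (opp A) P1) ((\<lambda>f. \<lambda>x\<in>carrier P1. f (p1 x)) ` carrier (adual (opp A) P0))"
  note T = transpose_cover[OF P]
  obtain \<rho> where \<rho>: "\<rho> \<in> rmod_hom A L0 ?T" "\<rho> ` carrier L0 = carrier ?T"
    "\<forall>y\<in>carrier L0. \<rho> y = \<zero>\<^bsub>?T\<^esub> \<longleftrightarrow> y \<in> fk ` carrier Pk"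
    using T(2) by (elim bexE conjE) (rule that)
  obtain \<theta> where \<theta>: "\<theta> \<in> rmod_hom A NT ?T" "bij_betw \<theta> (carrier NT) (carrier ?T)" using iso by (auto simp: rmod_iso_def)
  define \<eta> where "\<eta> = inv_into (carrier NT) \<theta>"
  have \<eta>: "\<eta> \<in> rmod_hom A ?T NT" "bij_betw \<eta> (carrier ?T) (carrier NT)"
    unfolding \<eta>_def using hom_inv[OF \<theta>(1) fd_right_module[OF fd] \<theta>(2)] bij_betw_inv_into[OF \<theta>(2)] by auto
  have z: "\<eta> \<zero>\<^bsub>?T\<^esub> = \<zero>\<^bsub>NT\<^esub>" by (rule hom_zero[OF \<eta>(1) right_module_ag[OF T(1)] fd_ag[OF fd]])
  have "\<eta> (\<rho> y) = \<zero>\<^bsub>NT\<^esub> \<longleftrightarrow> y \<in> fk ` carrier Pk" if y: "y \<in> carrier L0" for y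
  proof -
    have "\<eta> (\<rho> y) = \<eta> \<zero>\<^bsub>?T\<^esub> \<longleftrightarrow> \<rho> y = \<zero>\<^bsub>?T\<^esub>"
      by (rule inj_on_eq_iff[OF bij_betw_imp_inj_on[OF \<eta>(2)] homD(1)[OF \<rho>(1) y] ag_simps(2)[OF right_module_ag[OF T(1)]]])
    thus ?thesis using z bspec[OF \<rho>(3) y] by simp
  qed
  moreover have "(\<lambda>y. \<eta> (\<rho> y)) ` carrier L0 = carrier NT"
    unfolding image_image[symmetric, of \<eta> \<rho>] \<rho>(2) by (rule bij_betw_imp_surj_on[OF \<eta>(2)])
  ultimately show "\<exists>\<rho>\<in>rmod_hom A L0 NT. \<rho> ` carrier L0 = carrier NT \<and> (\<forall>y\<in>carrier L0. \<rho> y = \<zero>\<^bsub>NT\<^esub> \<longleftrightarrow> y \<in> fk ` carrier Pk)"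
    using hom_comp'[OF \<rho>(1) \<eta>(1)] by blast
qed

end

section \<open>Comparison of the complex with the module, and the two implications\<close>

context bq_vertex
begin

definition rho :: "('k, 'v, 'e) bq_elt \<Rightarrow> ('k, 'v, 'e) bq_elt" where
  "rho = (SOME \<rho>. \<rho> \<in> rmod_hom A L0 NT \<and> \<rho> ` carrier L0 = carrier NT \<and>
    (\<forall>y\<in>carrier L0. \<rho> y = \<zero>\<^bsub>NT\<^esub> \<longleftrightarrow> y \<in> fk ` carrier Pk))"

lemma rho: "rho \<in> rmod_hom A L0 NT" "rho ` carrier L0 = carrier NT"
    "y \<in> carrier L0 \<Longrightarrow> rho y = \<zero>\<^bsub>NT\<^esub> \<longleftrightarrow> y \<in> fk ` carrier Pk"
proof -
  have "\<exists>\<rho>. \<rho> \<in> rmod_hom A L0 NT \<and> \<rho> ` carrier L0 = carrier NT \<and>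
    (\<forall>y\<in>carrier L0. \<rho> y = \<zero>\<^bsub>NT\<^esub> \<longleftrightarrow> y \<in> fk ` carrier Pk)" using tau_inv_cover(2) by blast
  from someI_ex[OF this] show "rho \<in> rmod_hom A L0 NT" "rho ` carrier L0 = carrier NT"
    "y \<in> carrier L0 \<Longrightarrow> rho y = \<zero>\<^bsub>NT\<^esub> \<longleftrightarrow> y \<in> fk ` carrier Pk" unfolding rho_def by blast+
qed

abbreviation T :: "('k, 'v, 'e) bq_cpx" where "T \<equiv> T_minus Q I k"
abbreviation TB :: "('k, 'v, 'e) bq_module" where "TB \<equiv> T_BB Q I k"

lemma T_eq: "T = cpx_sum (two_term Pk fk L0) (stalk PR)"
  by (simp add: T_minus_def L_cpx_eq)

lemma TB_eq: "TB = dsum2 NT PR"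
  by (simp add: T_BB_def)

lemma ags: "abelian_group Pk" "abelian_group L0" "abelian_group PR" "abelian_group NT" "abelian_group TB"
  using right_module_ag Pk_rm L0_rm PR_rm fd_ag[OF tau_inv_cover(1)] dsum2_ag[of NT PR] by (auto simp: TB_eq)

lemma TB_fd: "fd_module A TB"
  unfolding TB_eq by (rule dsum2_fd[OF tau_inv_cover(1) proj_fd[OF PR_proj]])

lemma TB_rm: "right_module A TB"
  by (rule fd_right_module[OF TB_fd])

lemma T_cx: "cx T"
  unfolding T_eq by (intro cpx_sum_cx two_term_cx stalk_cx proj_fd Pk_proj L0_proj PR_proj fk_hom)

lemma T_obj: "obj T n = dsum2 (if n = -1 then Pk else if n = 0 then L0 else L0\<lparr>carrier := {\<zero>\<^bsub>L0\<^esub>}\<rparr>)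
    (if n = 0 then PR else PR\<lparr>carrier := {\<zero>\<^bsub>PR\<^esub>}\<rparr>)"
  by (simp add: T_eq cpx_sum_simps two_term_simps stalk_simps)

lemma T_dif: "dif T n (Two x r) = Two (if n = -1 then fk x else if n = -2 then \<zero>\<^bsub>Pk\<^esub> else \<zero>\<^bsub>L0\<^esub>) \<zero>\<^bsub>PR\<^esub>"
  by (simp add: T_eq cpx_sum_simps two_term_simps stalk_simps)

lemma T_projective: "projective_cpx A T"
  unfolding projective_cpx_def T_obj
  by (intro conjI T_cx allI dsum2_proj_mod)
    (auto intro: Pk_proj L0_proj PR_proj zero_proj[OF L0_rm] zero_proj[OF PR_rm] simp del: idem_mod_simps)

definition tq :: "int \<Rightarrow> ('k, 'v, 'e) bq_elt \<Rightarrow> ('k, 'v, 'e) bq_elt" where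
  "tq n z = (if n = 0 then Two (rho (first z)) (second z) else \<zero>\<^bsub>TB\<^esub>)"

lemma tq_cm: "cm T (stalk TB) tq"
proof (rule cmI)
  fix n
  show "tq n \<in> rmod_hom A (obj T n) (obj (stalk TB) n)"
  proof (cases "n = 0")
    case True
    have "(\<lambda>z. Two (rho (first z)) (second z)) \<in> rmod_hom A (dsum2 L0 PR) (dsum2 NT PR)"
      by (intro pair_hom hom_comp'[OF dsum2_fst rho(1)] dsum2_snd)
    thus ?thesis using True by (simp add: T_obj stalk_simps TB_eq tq_def[abs_def])
  next
    case False
    thus ?thesis using hom_const_zero[OF zero_right_module[OF TB_rm], of "obj T n"]
      by (simp add: stalk_simps tq_def[abs_def])
  qed
  fix z assume z: "z \<in> carrier (obj T n)"
  then obtain x r where xr: "z = Two x r" by (auto simp: T_obj)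
  show "tq (n + 1) (dif T n z) = dif (stalk TB) n (tq n z)"
  proof (cases "n = -1")
    case True
    hence x: "x \<in> carrier Pk" using z xr by (simp add: T_obj)
    have "rho (fk x) = \<zero>\<^bsub>NT\<^esub>" using rho(3)[OF homD(1)[OF fk_hom x]] x by blast
    thus ?thesis using True xr by (simp add: T_dif tq_def stalk_simps TB_eq)
  next
    case False
    hence "n + 1 \<noteq> 0" by simp
    thus ?thesis by (simp add: tq_def stalk_simps)
  qed
qed

lemma tq_surj: "Hsurj T (stalk TB) tq"
  unfolding Hsurj_def
proof (intro allI ballI)
  note sx = stalk_cx[OF TB_fd]
  fix n y assume y: "y \<in> cocycles (stalk TB) n"
  have diff: "y \<ominus>\<^bsub>obj (stalk TB) n\<^esub> y \<in> coboundaries (stalk TB) n"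
    using cob_zero[OF sx, of n] cocycle_closed[OF y] by (simp add: a_minus_def abelian_group.r_neg cx_ag[OF sx])
  show "\<exists>x\<in>cocycles T n. y \<ominus>\<^bsub>obj (stalk TB) n\<^esub> tq n x \<in> coboundaries (stalk TB) n"
  proof (cases "n = 0")
    case True
    obtain a r where ar: "y = Two a r" "a \<in> carrier NT" "r \<in> carrier PR"
      using cocycle_closed[OF y] True by (auto simp: stalk_simps TB_eq)
    obtain x where x: "x \<in> carrier L0" "a = rho x" using rho(2) ar(2) by blast
    have "Two x r \<in> cocycles T 0" using x ar by (simp add: cocycles_iff T_obj T_dif)
    moreover have "tq 0 (Two x r) = y" using x ar by (simp add: tq_def)
    ultimately show ?thesis using diff True by metis
  next
    case False
    hence "y = \<zero>\<^bsub>TB\<^esub>" using cocycle_closed[OF y] by (simp add: stalk_simps)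
    hence "tq n \<zero>\<^bsub>obj T n\<^esub> = y" using False by (simp add: tq_def)
    thus ?thesis using diff cob_cocycle[OF T_cx cob_zero[OF T_cx]] by metis
  qed
qed

text \<open>In degree 0 the kernel of \<open>rho\<close> consists of coboundaries anyway; the
  assumption on f is used in degree -1, where the stalk complex vanishes and the cocycles are ker
  f.\<close>

lemma tq_inj:
  assumes "\<And>x. x \<in> carrier Pk \<Longrightarrow> fk x = \<zero>\<^bsub>L0\<^esub> \<Longrightarrow> x = \<zero>\<^bsub>Pk\<^esub>"
  shows "Hinj T (stalk TB) tq"
  unfolding Hinj_def
proof (intro allI ballI impI)
  fix n z assume z: "z \<in> cocycles T n" "tq n z \<in> coboundaries (stalk TB) n"
  obtain x r where xr: "z = Two x r" using cocycle_closed[OF z(1)] by (auto simp: T_obj)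
  show "z \<in> coboundaries T n"
  proof (cases "n = 0")
    case True
    have "Two (rho x) r = Two \<zero>\<^bsub>NT\<^esub> \<zero>\<^bsub>PR\<^esub>"
      using z(2) True xr stalk_coboundaries[OF ags(5)] by (simp add: tq_def TB_eq)
    moreover have "x \<in> carrier L0" using cocycle_closed[OF z(1)] True xr by (simp add: T_obj)
    ultimately obtain w where w: "w \<in> carrier Pk" "x = fk w" "r = \<zero>\<^bsub>PR\<^esub>" using rho(3) by auto
    have "dif T (-1) (Two w \<zero>\<^bsub>PR\<^esub>) \<in> coboundaries T 0"
      using w by (intro cobI) (simp_all add: T_obj)
    thus ?thesis using w True xr by (simp add: T_dif)
  next
    case n0: False
    have "z = \<zero>\<^bsub>obj T n\<^esub>"
    proof (cases "n = -1")
      case True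
      have "x \<in> carrier Pk" "fk x = \<zero>\<^bsub>L0\<^esub>" "r = \<zero>\<^bsub>PR\<^esub>"
        using z(1) True xr by (simp_all add: cocycles_iff T_obj T_dif)
      thus ?thesis using assms[of x] True xr by (simp add: T_obj)
    next
      case False
      thus ?thesis using cocycle_closed[OF z(1)] n0 xr by (simp add: T_obj)
    qed
    thus ?thesis using cob_zero[OF T_cx] by simp
  qed
qed

lemma tq_qi:
  assumes "\<And>x. x \<in> carrier Pk \<Longrightarrow> fk x = \<zero>\<^bsub>L0\<^esub> \<Longrightarrow> x = \<zero>\<^bsub>Pk\<^esub>"
  shows "qi T (stalk TB) tq"
  using tq_cm tq_surj tq_inj[OF assms] by (simp add: quasi_iso_iff T_cx stalk_cx TB_fd)

lemma T_iso_TB: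
  assumes "\<And>x. x \<in> carrier Pk \<Longrightarrow> fk x = \<zero>\<^bsub>L0\<^esub> \<Longrightarrow> x = \<zero>\<^bsub>Pk\<^esub>"
  shows "derived_iso A T (stalk TB)"
  unfolding derived_iso_iff_qeq by (rule qeqI[OF T_cx stalk_cx[OF TB_fd] tq_qi[OF assms]])

lemma BB_of_tilting:
  assumes "tilting_module A M" "derived_iso A T (stalk M)"
  shows "BB_defined Q I k \<and> derived_iso A T (stalk TB)"
proof -
  have M: "fd_module A M" using assms(1) by (simp add: tilting_module_def)
  have "cocycles (stalk M) (-1) \<subseteq> coboundaries (stalk M) (-1)"
    by (simp add: stalk_cocycles stalk_coboundaries[OF fd_ag[OF M]] stalk_simps)
  hence H: "cocycles T (-1) \<subseteq> coboundaries T (-1)"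
    by (rule cohomology_zero_derived_iso[OF derived_iso_sym[OF assms(2)]])
  have inj: "x = \<zero>\<^bsub>Pk\<^esub>" if "x \<in> carrier Pk" "fk x = \<zero>\<^bsub>L0\<^esub>" for x
  proof -
    \<comment> \<open>An element of ker f is a cocycle in degree -1, hence a coboundary; but the
      term in degree -2 is zero.\<close>
    have "Two x \<zero>\<^bsub>PR\<^esub> \<in> cocycles T (-1)" using that by (simp add: cocycles_iff T_obj T_dif)
    hence "Two x \<zero>\<^bsub>PR\<^esub> \<in> coboundaries T (-1)" using H by blast
    then obtain w where "w \<in> carrier (obj T (-2))" "Two x \<zero>\<^bsub>PR\<^esub> = dif T (-2) w" by (auto elim: cobE)
    thus ?thesis by (auto simp: T_obj T_dif)
  qed
  note iso = T_iso_TB[OF inj]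
  obtain T' where T': "tilting_complex A T'" "derived_iso A (stalk M) T'"
    using assms(1) by (auto simp: tilting_module_def)
  have "derived_iso A (stalk TB) T'"
    using derived_iso_trans[OF derived_iso_sym[OF iso] derived_iso_trans[OF assms(2) T'(2)]] .
  hence "tilting_module A TB" using T'(1) TB_fd by (auto simp: tilting_module_def)
  \<comment> \<open>With f injective, the complex \<open>T\<close> itself is the required projective
    resolution.\<close>
  moreover have "proj_dim_le A TB 1"
    unfolding proj_dim_le_def
    using T_projective tq_qi[OF inj] by (intro exI[of _ T] exI[of _ tq]) (auto simp: T_obj)
  ultimately show ?thesis using iso by (simp add: BB_defined_def)
qed

lemma arrow_into_k:
  assumes "tilting_module A TB" shows "J \<noteq> {}"
proof
  assume J0: "J = {}"
  obtain T' where T': "tilting_complex A T'" "derived_iso A (stalk TB) T'"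
    using assms by (auto simp: tilting_module_def)
  have vk: "vx k \<in> carrier A" by simp
  \<comment> \<open>Over the empty index set the direct sum has a single element, so its quotient N
    is zero as well.\<close>
  have L0: "x = \<zero>\<^bsub>L0\<^esub>" if "x \<in> carrier L0" for x
    using that unfolding J0 by (auto simp: dsum_simps)
  have N: "y = \<zero>\<^bsub>NT\<^esub>" if "y \<in> carrier NT" for y
  proof -
    obtain x where "x \<in> carrier L0" "y = rho x" using rho(2) \<open>y \<in> carrier NT\<close> by blast
    thus ?thesis using hom_zero[OF rho(1) ags(2,4)] L0[of x] by simp
  qed
  \<comment> \<open>The component at i consists of elements starting at i. Multiplied by the vertex
    \<open>k\<close> on the right they vanish by \<open>source_vertex\<close>, as no arrow ends at
    \<open>k\<close>.\<close>
  have R: "vx k \<odot>\<^bsub>PR\<^esub> r = \<zero>\<^bsub>PR\<^esub>" if r: "r \<in> carrier PR" for r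
  proof -
    interpret PR: rmod A PR by (rule rmodI[OF PR_rm])
    show ?thesis unfolding PR_eq
    proof (rule dsum_eqI)
      show "vx k \<odot>\<^bsub>dsum (Inl ` (verts Q - {k})) (\<lambda>j :: 'v + 'e. idem_mod A (vx (projl j)))\<^esub> r
          \<in> carrier (dsum (Inl ` (verts Q - {k})) (\<lambda>j :: 'v + 'e. idem_mod A (vx (projl j))))"
        using PR.act_closed[OF vk r] unfolding PR_eq .
      show "\<zero>\<^bsub>dsum (Inl ` (verts Q - {k})) (\<lambda>j :: 'v + 'e. idem_mod A (vx (projl j)))\<^esub>
          \<in> carrier (dsum (Inl ` (verts Q - {k})) (\<lambda>j :: 'v + 'e. idem_mod A (vx (projl j))))"
        using PR.M.zero_closed unfolding PR_eq .
      fix j :: "'v + 'e" assume j: "j \<in> Inl ` (verts Q - {k})"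
      then obtain i where i: "j = Inl i" "i \<in> verts Q" "i \<noteq> k" by auto
      obtain c where c: "c \<in> carrier A" "vx i \<otimes>\<^bsub>A\<^esub> c = c" "component r j = Elem c"
        using dsum_component_closed[OF r[unfolded PR_eq] j] i by (auto elim: idem.idem_carrierE[OF idem_vx[OF i(2)]])
      have "c \<otimes>\<^bsub>A\<^esub> vx k = \<zero>\<^bsub>A\<^esub>"
        using source_vertex[OF i(2) k i(3) _ c(1)] J0 c(2) by auto
      thus "component (vx k \<odot>\<^bsub>dsum (Inl ` (verts Q - {k})) (\<lambda>j :: 'v + 'e. idem_mod A (vx (projl j)))\<^esub> r) j =
          component \<zero>\<^bsub>dsum (Inl ` (verts Q - {k})) (\<lambda>j :: 'v + 'e. idem_mod A (vx (projl j)))\<^esub> j"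
        using j c(3) by (simp add: dsum_simps)
    qed
  qed
  interpret NT: rmod A NT by (rule rmodI[OF fd_right_module[OF tau_inv_cover(1)]])
  interpret TB: rmod A TB by (rule rmodI[OF TB_rm])
  have "vx k \<odot>\<^bsub>TB\<^esub> x = \<zero>\<^bsub>TB\<^esub>" if "x \<in> carrier TB" for x
    using that R N[OF NT.act_closed[OF vk]] unfolding TB_eq by auto
  hence "vx k \<odot>\<^bsub>obj (stalk TB) n\<^esub> x \<in> coboundaries (stalk TB) n" if "x \<in> cocycles (stalk TB) n" for n x
    using that TB.act_zero[OF vk] by (auto simp: stalk_coboundaries[OF ags(5)] stalk_cocycles stalk_simps split: if_splits)
  hence "Hann (vx k) (stalk TB)" using stalk_cx[OF TB_fd] by (simp add: Hann_def)
  hence "Hann (vx k) T'" by (rule Hann_derived_iso[OF vk T'(2)])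
  moreover have "stalk Pk \<in> per A"
  proof -
    have "projective_cpx A (stalk Pk)"
      using stalk_cx[OF proj_fd[OF Pk_proj]] Pk_proj zero_proj[OF Pk_rm]
      by (auto simp: projective_cpx_def stalk_simps simp del: idem_mod_simps)
    thus ?thesis using derived_iso_refl[OF stalk_cx[OF proj_fd[OF Pk_proj]]] by (auto simp: per_def)
  qed
  ultimately have "Hann (vx k) (stalk Pk)"
    using per_Hann[OF T'(1) vk vx_idem[OF k]] by blast
  moreover have "Elem (vx k) \<in> cocycles (stalk Pk) 0"
    by (simp add: stalk_cocycles stalk_simps idem.Elem_idem_iff[OF idem_k] vx_idem)
  ultimately have "vx k \<odot>\<^bsub>obj (stalk Pk) 0\<^esub> Elem (vx k) \<in> coboundaries (stalk Pk) 0"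
    unfolding Hann_def by blast
  hence "vx k = \<zero>\<^bsub>A\<^esub>" by (simp add: stalk_coboundaries[OF ags(1)] stalk_simps vx_idem)
  thus False using eps_vx[OF k, of k] by (simp add: cf_zero)
qed

text \<open>The usual comparison of resolutions, except that L is not yet known to resolve N: lifts
  into the degree -1 term of L exist, but are unique only up to ker f. This ambiguity is the element
  \<open>\<kappa>\<close> below, and it is harmless because ker f is radical.\<close>

lemma fk_inj_of_pd:
  assumes "proj_dim_le A TB 1" "J \<noteq> {}" "x \<in> carrier Pk" "fk x = \<zero>\<^bsub>L0\<^esub>"
  shows "x = \<zero>\<^bsub>Pk\<^esub>"
proof -
  obtain P q where P: "projective_cpx A P" "\<And>i. i < -1 \<or> i > 0 \<Longrightarrow> carrier (obj P i) = {\<zero>\<^bsub>obj P i\<^esub>}"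
    "qi P (stalk TB) q" using assms(1) unfolding proj_dim_le_def by auto
  have cP: "cx P" using P(1) by (simp add: projective_cpx_def)
  have prj: "fg_projective A (obj P n)" for n using P(1) by (simp add: projective_cpx_def)
  have q: "cm P (stalk TB) q" "Hinj P (stalk TB) q" "Hsurj P (stalk TB) q"
    using P(3) by (simp_all add: quasi_iso_iff cP stalk_cx[OF TB_fd])
  let ?P0 = "obj P 0" and ?P1 = "obj P (-1)" and ?d = "dif P (-1)"
  have q0: "q 0 \<in> rmod_hom A ?P0 TB" using cm_hom[OF q(1), of 0] by (simp add: stalk_simps)
  have d: "?d \<in> rmod_hom A ?P1 ?P0" by (rule cx_hom[OF cP]) simp
  \<comment> \<open>In degree -1 the stalk complex is zero, so injectivity on cohomology makes each
    cocycle a coboundary, and the term in degree -2 is zero.\<close>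
  have d_inj: "y = \<zero>\<^bsub>?P1\<^esub>" if y: "y \<in> carrier ?P1" "?d y = \<zero>\<^bsub>?P0\<^esub>" for y
  proof -
    have yc: "y \<in> cocycles P (-1)" using y by (simp add: cocycles_iff)
    have "q (-1) y = \<zero>\<^bsub>TB\<^esub>" using cm_closed[OF q(1) y(1)] by (simp add: stalk_simps)
    hence "y \<in> coboundaries P (-1)" using q(2) yc by (simp add: Hinj_def stalk_coboundaries[OF ags(5)])
    then obtain w where "w \<in> carrier (obj P (-2))" "y = dif P (-2) w" by (auto elim: cobE)
    thus ?thesis using P(2)[of "-2"] d_zero[OF cP, of "-1" "-2"] by simp
  qed
  have q0_surj: "q 0 ` carrier ?P0 = carrier TB"
  proof
    show "q 0 ` carrier ?P0 \<subseteq> carrier TB" using homD(1)[OF q0] by blast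
    show "carrier TB \<subseteq> q 0 ` carrier ?P0"
    proof
      fix y assume y: "y \<in> carrier TB"
      hence "y \<in> cocycles (stalk TB) 0" by (simp add: stalk_cocycles stalk_simps)
      then obtain p where p: "p \<in> cocycles P 0" "y \<ominus>\<^bsub>obj (stalk TB) 0\<^esub> q 0 p \<in> coboundaries (stalk TB) 0"
        using q(3) unfolding Hsurj_def by blast
      have "y \<ominus>\<^bsub>TB\<^esub> q 0 p = \<zero>\<^bsub>TB\<^esub>" using p(2) by (simp add: stalk_coboundaries[OF ags(5)] stalk_simps)
      hence "y = q 0 p"
        using y homD(1)[OF q0 cocycle_closed[OF p(1)]] abelian_group.minus_eq_zero_iff[OF ags(5)] by blast
      thus "y \<in> q 0 ` carrier ?P0" using cocycle_closed[OF p(1)] by blast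
    qed
  qed
  have q0_ker: "p \<in> ?d ` carrier ?P1" if p: "p \<in> carrier ?P0" "q 0 p = \<zero>\<^bsub>TB\<^esub>" for p
  proof -
    have "dif P 0 p = \<zero>\<^bsub>obj P 1\<^esub>" using d_closed[OF cP p(1), of 1] P(2)[of 1] by simp
    hence "p \<in> cocycles P 0" using p(1) by (simp add: cocycles_iff)
    hence "p \<in> coboundaries P 0" using q(2) p(2) by (simp add: Hinj_def stalk_coboundaries[OF ags(5)])
    thus ?thesis by (auto elim: cobE)
  qed
  have q0_d: "q 0 (?d y) = \<zero>\<^bsub>TB\<^esub>" if "y \<in> carrier ?P1" for y
    using cm_d[OF q(1) that, of 0] by (simp add: stalk_simps)
  have rmP: "right_module A ?P0" "right_module A ?P1" using prj proj_right_module by blast+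
  note agP = right_module_ag[OF rmP(1)] right_module_ag[OF rmP(2)]
  have NTrm: "right_module A NT" by (rule fd_right_module[OF tau_inv_cover(1)])
  \<comment> \<open>\<open>a0\<close> lifts the inclusion of N into the module through
    \<open>q\<close>, and \<open>b0\<close> lifts the projection back to N through
    \<open>rho\<close>.\<close>
  have "(\<lambda>x. Two (rho x) \<zero>\<^bsub>PR\<^esub>) \<in> rmod_hom A L0 TB"
    unfolding TB_eq by (rule hom_comp'[OF rho(1) dsum2_inl[OF PR_rm]])
  then obtain a0 where a0: "a0 \<in> rmod_hom A L0 ?P0" "\<And>x. x \<in> carrier L0 \<Longrightarrow> q 0 (a0 x) = Two (rho x) \<zero>\<^bsub>PR\<^esub>"
    using proj_lift[OF L0_proj cx_fd[OF cP] TB_rm q0 q0_surj] by blast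
  have "(\<lambda>p. first (q 0 p)) \<in> rmod_hom A ?P0 NT"
    using hom_comp'[OF q0[unfolded TB_eq] dsum2_fst] .
  then obtain b0 where b0: "b0 \<in> rmod_hom A ?P0 L0" "\<And>p. p \<in> carrier ?P0 \<Longrightarrow> rho (b0 p) = first (q 0 p)"
    using proj_lift[OF prj proj_fd[OF L0_proj] NTrm rho(1,2)] by blast
  have fz: "fk \<zero>\<^bsub>Pk\<^esub> = \<zero>\<^bsub>L0\<^esub>" by (rule hom_zero[OF fk_hom ags(1,2)])
  have rf: "rho (fk x) = \<zero>\<^bsub>NT\<^esub>" if "x \<in> carrier Pk" for x using rho(3)[OF homD(1)[OF fk_hom that]] that by blast
  \<comment> \<open>On its image \<open>D\<close> the injective differential has a linear inverse
    \<open>di\<close>. The degree -1 part of the first comparison map is \<open>di\<close> after a0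
    f, so it visibly vanishes on ker f.\<close>
  define D where "D = ?P0\<lparr>carrier := ?d ` carrier ?P1\<rparr>"
  have D_hom: "?d \<in> rmod_hom A ?P1 D" using homD[OF d] unfolding D_def by (intro homI) auto
  have D_bij: "bij_betw ?d (carrier ?P1) (carrier D)"
    using kernel_iff_inj[OF d agP(2,1) d_inj] by (simp add: D_def bij_betw_def)
  define di where "di = inv_into (carrier ?P1) ?d"
  have di: "di \<in> rmod_hom A D ?P1" unfolding di_def by (rule hom_inv[OF D_hom rmP(2) D_bij])
  have d_di: "?d (di p) = p" if "p \<in> ?d ` carrier ?P1" for p unfolding di_def by (rule f_inv_into_f[OF that])
  have a0f: "a0 (fk x) \<in> ?d ` carrier ?P1" if "x \<in> carrier Pk" for x
    using q0_ker[OF homD(1)[OF a0(1)]] a0(2) homD(1)[OF fk_hom that] rf[OF that] by (simp add: TB_eq)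
  have "(\<lambda>x. a0 (fk x)) \<in> rmod_hom A Pk D"
    using homD[OF hom_comp'[OF fk_hom a0(1)]] a0f unfolding D_def by (intro homI) (simp_all del: idem_mod_simps)
  note a1 = hom_comp'[OF this di]
  \<comment> \<open>\<open>F\<close> is im f, equal to the kernel of \<open>rho\<close>: maps into
    \<open>L0\<close> that die in N land in it and lift through f, which yields \<open>b1\<close>
    and the homotopy \<open>s\<close>.\<close>
  define F where "F = L0\<lparr>carrier := fk ` carrier Pk\<rparr>"
  have F_rm: "right_module A F" using submod_image[OF fk_hom Pk_rm L0_rm] by (simp add: submod_def F_def)
  have F_hom: "fk \<in> rmod_hom A Pk F" using homD[OF fk_hom] unfolding F_def by (intro homI) (simp_all del: idem_mod_simps)
  have F_surj: "fk ` carrier Pk = carrier F" by (simp add: F_def)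
  have toF: "g \<in> rmod_hom A M F" if "g \<in> rmod_hom A M L0" "\<And>x. x \<in> carrier M \<Longrightarrow> rho (g x) = \<zero>\<^bsub>NT\<^esub>"
    for M :: "('k, 'v, 'e) bq_module" and g
    using homD[OF that(1)] rho(3)[OF homD(1)[OF that(1)]] that(2) unfolding F_def by (intro homI) simp_all
  have "(\<lambda>y. b0 (?d y)) \<in> rmod_hom A ?P1 F"
    using b0(2) homD(1)[OF d] q0_d by (intro toF hom_comp'[OF d b0(1)]) (simp add: TB_eq)
  then obtain b1 where b1: "b1 \<in> rmod_hom A ?P1 Pk" "\<And>y. y \<in> carrier ?P1 \<Longrightarrow> fk (b1 y) = b0 (?d y)"
    using proj_lift[OF prj proj_fd[OF Pk_proj] F_rm F_hom F_surj] by blast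
  define ba where "ba = (\<lambda>x. b0 (a0 x))"
  have ba: "ba \<in> rmod_hom A L0 L0" unfolding ba_def by (rule hom_comp'[OF a0(1) b0(1)])
  have rba: "rho (ba x) = rho x" if "x \<in> carrier L0" for x
    using b0(2)[OF homD(1)[OF a0(1) that]] a0(2)[OF that] by (simp add: ba_def)
  \<comment> \<open>\<open>ba\<close> and the identity induce the same map on N, so their difference
    takes values in im f.\<close>
  have "(\<lambda>x. ba x \<ominus>\<^bsub>L0\<^esub> x) \<in> rmod_hom A L0 F"
  proof (rule toF)
    show "(\<lambda>x. ba x \<ominus>\<^bsub>L0\<^esub> x) \<in> rmod_hom A L0 L0" by (intro hom_diff ba hom_id L0_rm)
    fix x assume x: "x \<in> carrier L0"
    show "rho (ba x \<ominus>\<^bsub>L0\<^esub> x) = \<zero>\<^bsub>NT\<^esub>"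
      using hom_minus[OF rho(1) ags(2,4) homD(1)[OF ba x] x] rba[OF x] homD(1)[OF rho(1) x]
        abelian_group.minus_eq_zero_iff[OF ags(4)] by simp
  qed
  then obtain s where s: "s \<in> rmod_hom A L0 Pk" "\<And>x. x \<in> carrier L0 \<Longrightarrow> fk (s x) = ba x \<ominus>\<^bsub>L0\<^esub> x"
    using proj_lift[OF L0_proj proj_fd[OF Pk_proj] F_rm F_hom F_surj] by blast
  define g where "g = (\<lambda>x. b1 (di (a0 (fk x))))"
  have g: "g \<in> rmod_hom A Pk Pk" unfolding g_def by (rule hom_comp'[OF a1 b1(1)])
  have fg: "fk (g x) = ba (fk x)" if "x \<in> carrier Pk" for x
    using b1(2)[OF homD(1)[OF a1 that]] d_di[OF a0f[OF that]] by (simp add: g_def ba_def)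
  let ?e = "Elem (vx k) :: ('k, 'v, 'e) bq_elt"
  have e: "?e \<in> carrier Pk" by (simp add: idem.Elem_idem_iff[OF idem_k] vx_idem)
  have fe: "fk ?e \<in> carrier L0" by (rule homD(1)[OF fk_hom e])
  \<comment> \<open>The defect of \<open>s\<close> as a homotopy in degree -1, evaluated at the
    generator. Composing with f gives (ba - 1) f - f s f = 0, so it lies in ker f.\<close>
  define \<kappa> where "\<kappa> = (g ?e \<ominus>\<^bsub>Pk\<^esub> ?e) \<ominus>\<^bsub>Pk\<^esub> s (fk ?e)"
  have ge: "g ?e \<in> carrier Pk" "s (fk ?e) \<in> carrier Pk" using homD(1)[OF g e] homD(1)[OF s(1) fe] by blast+
  have \<kappa>c: "\<kappa> \<in> carrier Pk" unfolding \<kappa>_def using ge e by (intro abelian_group.minus_closed[OF ags(1)])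
  have bfe: "ba (fk ?e) \<in> carrier L0" by (rule homD(1)[OF ba fe])
  have "fk \<kappa> = (fk (g ?e) \<ominus>\<^bsub>L0\<^esub> fk ?e) \<ominus>\<^bsub>L0\<^esub> fk (s (fk ?e))"
    unfolding \<kappa>_def
    using hom_minus[OF fk_hom ags(1,2) abelian_group.minus_closed[OF ags(1) ge(1) e] ge(2)] hom_minus[OF fk_hom ags(1,2) ge(1) e]
    by simp
  also have "\<dots> = \<zero>\<^bsub>L0\<^esub>"
    unfolding fg[OF e] s(2)[OF fe] using abelian_group.minus_closed[OF ags(2) bfe fe] abelian_group.minus_eq_zero_iff[OF ags(2)] by blast
  finally have f\<kappa>: "fk \<kappa> = \<zero>\<^bsub>L0\<^esub>" .
  obtain c where c: "c \<in> carrier A" "vx k \<otimes>\<^bsub>A\<^esub> c = c" "\<kappa> = Elem c" using \<kappa>c by (rule idem.idem_carrierE[OF idem_k])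
  have c_rad: "c \<in> rad 1" using fk_kernel_rad[OF assms(2) c(1,2)] f\<kappa> c(3) by simp
  obtain c' where c': "c' \<in> carrier A" "vx k \<otimes>\<^bsub>A\<^esub> c' = c'" "s (fk ?e) = Elem c'" using ge(2) by (rule idem.idem_carrierE[OF idem_k])
  \<comment> \<open>The components of f at the generator are the arrows, so by linearity the value
    of \<open>s\<close> there is a sum of products h a with a an arrow, and these have no
    coefficient at a trivial path.\<close>
  have "cf (u, []) c' = 0" for u
  proof -
    have comp: "component (fk ?e) j = Elem (aj j)" if "j \<in> J" for j
      using aj[OF that] that by (simp add: fk_component)
    have "cf (u, []) (the_elem_of (s (fk ?e))) = cf (u, []) (the_elem_of (\<Oplus>\<^bsub>Pk\<^esub>j\<in>J. s (dsum_in J M0 j (component (fk ?e) j))))"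
      using dsum_hom_eq[OF J(1) M0_rm Pk_rm s(1) fe] by simp
    also have "\<dots> = (\<Sum>j\<in>J. cf (u, []) (the_elem_of (s (dsum_in J M0 j (component (fk ?e) j)))))"
    proof (rule cf_finsum[OF ags(1) _ _ _ J(1)])
      show "(\<lambda>j. s (dsum_in J M0 j (component (fk ?e) j))) \<in> J \<rightarrow> carrier Pk"
        using homD(1)[OF s(1)] homD(1)[OF dsum_in_hom[where M = M0, OF M0_rm]] dsum_component_closed[OF fe] by blast
      show "\<And>x. x \<in> carrier Pk \<Longrightarrow> the_elem_of x \<in> carrier A"
        by (erule idem.idem_carrierE[OF idem_k]) simp
    qed simp_all
    also have "\<dots> = 0"
    proof (rule sum.neutral, rule ballI)
      fix j assume j: "j \<in> J"
      let ?v = "Elem (vx (tj j)) :: ('k, 'v, 'e) bq_elt"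
      have v: "?v \<in> carrier (M0 j)" using J(4)[OF j] by (simp only: idem.Elem_idem_iff[OF idem_j[OF j]] vx_idem vx_closed simp_thms)
      have w: "dsum_in J M0 j ?v \<in> carrier L0" by (rule homD(1)[OF dsum_in_hom[where M = M0, OF M0_rm j] v])
      have "Elem (aj j) = aj j \<odot>\<^bsub>M0 j\<^esub> ?v" using aj[OF j] by simp
      hence "s (dsum_in J M0 j (component (fk ?e) j)) = aj j \<odot>\<^bsub>Pk\<^esub> s (dsum_in J M0 j ?v)"
        using homD(3)[OF dsum_in_hom[where M = M0, OF M0_rm j] aj(1)[OF j] v] homD(3)[OF s(1) aj(1)[OF j] w] comp[OF j] by simp
      moreover obtain h where "h \<in> carrier A" "s (dsum_in J M0 j ?v) = Elem h"
        using homD(1)[OF s(1) w] by (auto elim: idem.idem_carrierE[OF idem_k])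
      moreover have "cf (u, []) (aj j) = 0"
        using J(2)[OF j] by (simp add: bq_path_def cf_co path_elt_closed qpath_arc) (simp add: path_elt_def)
      ultimately show "cf (u, []) (the_elem_of (s (dsum_in J M0 j (component (fk ?e) j)))) = 0"
        using aj(1)[OF j] by (simp add: eps_mult)
    qed
    finally show ?thesis using c'(3) by simp
  qed
  hence c'_rad: "c' \<in> rad 1" using rad_1_iff[OF c'(1)] by blast
  define r where "r = c \<oplus>\<^bsub>A\<^esub> c'"
  have r: "r \<in> rad 1" "r \<in> carrier A"
    using rad_1_iff c_rad c'_rad c(1) c'(1) by (simp_all add: r_def cf_add)
  have "g ?e = (\<kappa> \<oplus>\<^bsub>Pk\<^esub> s (fk ?e)) \<oplus>\<^bsub>Pk\<^esub> ?e"
    unfolding \<kappa>_def using ge e ags(1) by (simp add: ag_diff ag_ac del: idem_mod_simps)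
  hence g_e: "g ?e = Elem (r \<oplus>\<^bsub>A\<^esub> vx k)" using c(3) c'(3) by (simp add: r_def)
  obtain y where y: "y \<in> carrier A" "vx k \<otimes>\<^bsub>A\<^esub> y = y" "x = Elem y" using assms(3) by (rule idem.idem_carrierE[OF idem_k])
  \<comment> \<open>Here f x = 0 already kills a0 f, and injectivity of the differential transfers
    this to \<open>di\<close>; so g vanishes on ker f.\<close>
  have "g x = \<zero>\<^bsub>Pk\<^esub>"
  proof -
    have az: "a0 \<zero>\<^bsub>L0\<^esub> = \<zero>\<^bsub>?P0\<^esub>" by (rule hom_zero[OF a0(1) ags(2) agP(1)])
    have dz: "?d \<zero>\<^bsub>?P1\<^esub> = \<zero>\<^bsub>?P0\<^esub>" by (rule hom_zero[OF d agP(2,1)])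
    have "?d (di (a0 (fk x))) = \<zero>\<^bsub>?P0\<^esub>" using d_di[OF a0f[OF assms(3)]] assms(4) az by simp
    hence "di (a0 (fk x)) = \<zero>\<^bsub>?P1\<^esub>" by (rule d_inj[OF homD(1)[OF a1 assms(3)]])
    thus ?thesis using hom_zero[OF b1(1) agP(2) ags(1)] by (simp add: g_def)
  qed
  moreover have "g x = Elem ((r \<oplus>\<^bsub>A\<^esub> vx k) \<otimes>\<^bsub>A\<^esub> y)"
    using idem.idem_hom_eq[OF idem_k g y(1,2)] g_e y(3) by simp
  ultimately have "r \<otimes>\<^bsub>A\<^esub> y \<oplus>\<^bsub>A\<^esub> y = \<zero>\<^bsub>A\<^esub>" using r y by (simp add: l_distr)
  hence "y = \<ominus>\<^bsub>A\<^esub> (r \<otimes>\<^bsub>A\<^esub> y)" using r y by (metis a_comm m_closed minus_equality)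
  hence yy: "y = (\<ominus>\<^bsub>A\<^esub> r) \<otimes>\<^bsub>A\<^esub> y" using r y by (simp add: l_minus)
  have "\<ominus>\<^bsub>A\<^esub> r = (\<ominus>\<^bsub>A\<^esub> \<one>\<^bsub>A\<^esub>) \<otimes>\<^bsub>A\<^esub> r" using r by (simp add: l_minus)
  hence nr: "\<ominus>\<^bsub>A\<^esub> r \<in> rad 1" using rad_ideal(2)[OF r(1)] by simp
  \<comment> \<open>Each use of y = -r y raises the radical depth of y by one.\<close>
  have "y \<in> rad n" for n
  proof (induction n)
    case (Suc n)
    thus ?case using rad_mult[OF nr Suc] yy by simp
  qed (simp add: rad_0 y)
  moreover obtain m where "rad m \<subseteq> {\<zero>\<^bsub>A\<^esub>}" by (rule rad_nilpotent)
  ultimately have "y = \<zero>\<^bsub>A\<^esub>" by blast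
  thus ?thesis using y(3) by simp
qed

lemma tilting_of_BB:
  assumes "BB_defined Q I k"
  shows "tilting_complex A T \<and> derived_iso A (stalk TB) T"
proof -
  have a: "tilting_module A TB" "proj_dim_le A TB 1" using assms by (simp_all add: BB_defined_def)
  have iso: "derived_iso A T (stalk TB)"
    by (rule T_iso_TB) (rule fk_inj_of_pd[OF a(2) arrow_into_k[OF a(1)]])
  obtain T' where T': "tilting_complex A T'" "derived_iso A (stalk TB) T'"
    using a(1) by (auto simp: tilting_module_def)
  have "tilting_complex A T"
    by (rule tilting_complex_transfer[OF T'(1) derived_iso_sym[OF derived_iso_trans[OF iso T'(2)]] T_projective])
  thus ?thesis using derived_iso_sym[OF iso] by blast
qed

end

theorem proposition2p8:
  fixes Q :: "('v, 'e) pre_digraph"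
    and I :: "(('v, 'e) qpath \<Rightarrow> 'k::field) set"
    and k :: 'v
  assumes "fin_digraph Q"
    and "admissible Q I"
    and "k \<in> verts Q"
    and "\<And>\<alpha>. \<alpha> \<in> arcs Q \<Longrightarrow> \<not> (tail Q \<alpha> = k \<and> head Q \<alpha> = k)"
  shows "(BB_defined Q I k \<longrightarrow>
        tilting_complex (bq_algebra Q I) (T_minus Q I k) \<and>
        derived_iso (bq_algebra Q I) (stalk (T_BB Q I k)) (T_minus Q I k)) \<and>
      ((\<exists>M. tilting_module (bq_algebra Q I) M \<and>
          derived_iso (bq_algebra Q I) (T_minus Q I k) (stalk M)) \<longrightarrow>
        BB_defined Q I k \<and>
        derived_iso (bq_algebra Q I) (T_minus Q I k) (stalk (T_BB Q I k)))"
proof -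
  interpret bq_vertex Q I k
    by (intro bq_vertex.intro bound_quiver.intro bound_quiver_axioms.intro bq_vertex_axioms.intro assms(1-3))
  show ?thesis using tilting_of_BB BB_of_tilting by blast
qed

end
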